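(* For every section $\Phi\in\mathcal S$ of $\mathcal F=E\times_K F$ and every connection $A\in\mathcal A$ on $E$, $$\mathcal{YMH}_c(A,\Phi)=\|\Lambda F_A+\mu(\Phi)-c\|_{L^2}^2+2\|\overline{\partial}_A\Phi\|_{L^2}^2+4\|F_A^{0,2}\|_{L^2}^2+2\int_X\langle\Lambda F_A,c\rangle\,\omega^{[n]}-\int_X B(F_A,F_A)\wedge\omega^{[n-2]}+2\int_X\Phi^*\omega_F^A\wedge\omega^{[n-1]}.$$
   Context: Everything is smooth. $K$ is a compact connected Lie group with Lie algebra $\mathfrak k$, equipped with an $\mathrm{Ad}$-invariant inner product, used to identify $\mathfrak k\simeq\mathfrak k^*$; $c\in\mathfrak k$ is a central element. $(F,\omega_F)$ is a symplectic manifold with a symplectic left action of $K$, with a $K$-invariant almost complex structure $I_F$ such that $\omega_F(\cdot,I_F\cdot)$ is a Riemannian metric, and with a moment map $\mu:F\to\mathfrak k^*$: $d\langle\mu,s\rangle=\iota_{\mathcal X_s}\omega_F$ for $s\in\mathfrak k$ (where $\mathcal X_s(x)=\frac{d}{dt}|_{t=0}e^{ts}x$), and $\langle\mu(hx),\mathrm{Ad}(h)v\rangle=\langle\mu(x),v\rangle$ for $h\in K$. $X$ is a compact connected Kähler manifold of complex dimension $n$ with Kähler form $\omega$ (metric $\omega(\cdot,I_X\cdot)$); $\omega^{[k]}=\omega^k/k!$ (zero for $k<0$); $\Lambda$ is the adjoint of wedging with $\omega$. All $L^2$ norms use the volume form $\omega^{[n]}$. $E\to X$ is a principal $K$-bundle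 (right action), $\pi_F:\mathcal F=E\times_KF\to X$, $\mathcal A$ is the space of connections on $E$, $\mathcal S=\Gamma(\mathcal F)$, $T\mathcal F_v=\ker d\pi_F$ (with the metric and complex structure induced from $F$). A connection $A$ gives a projection $\alpha:T\mathcal F\to T\mathcal F_v$; put $d_A\Phi=\alpha\circ d\Phi\in\Omega^1(\Phi^*T\mathcal F_v)$, and let $\overline\partial_A\Phi$ be its $(0,1)$-part. $F_A\in\Omega^2(E\times_{\mathrm{Ad}}\mathfrak k)$ is the curvature, and $F_A^{0,2}$ its $(0,2)$-part in $\Omega^2(E\times_{\mathrm{Ad}}(\mathfrak k\otimes\mathbb C))$. $B$ combines the wedge product of forms with the inner product of $\mathfrak k$, so $B(F_A,F_A)\in\Omega^4(X)$. The Yang--Mills--Higgs functional is $$\mathcal{YMH}_c(A,\Phi)=\|F_A\|_{L^2}^2+\|d_A\Phi\|_{L^2}^2+\|c-\mu(\Phi)\|_{L^2}^2.$$ The form $\omega_F^A\in\Omega^2(\mathcal F)$ (the image under the Chern--Weil homomorphism of $A$ of the equivariantly closed form $\omega_F-\mu$) is $\omega_F^A=\alpha^*\omega_F-\langle\pi_F^*F_A,\mu\rangle$, where $\omega_F$ is regarded, by $K$-invariance, as a fibrewise form on $T\mathcal F_v$. *)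

theory Defs
  imports "HOL-Analysis.Analysis" "HOL-Algebra.Group" "HOL-Combinatorics.Permutations"
begin

section \<open>Smooth manifolds\<close>

text \<open>Only used on open sets of finite-dimensional spaces, where continuity of all iterated
  directional derivatives gives the usual notion. The model spaces of manifolds are
  finite-dimensional normed spaces and not of class euclidean_space, since the latter excludes
  dimension 0 (a trivial structure group, or a point as fibre).\<close>

primrec Ck_on :: "nat \<Rightarrow> 'v::real_normed_vector set \<Rightarrow> ('v \<Rightarrow> 'w::real_normed_vector) \<Rightarrow> bool" where
  "Ck_on 0 S f \<longleftrightarrow> continuous_on S f"
| "Ck_on (Suc k) S f \<longleftrightarrow>
     (\<forall>x\<in>S. f differentiable (at x)) \<and> (\<forall>v. Ck_on k S (\<lambda>x. frechet_derivative f (at x) v))"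

definition smooth_on :: "'v::real_normed_vector set \<Rightarrow> ('v \<Rightarrow> 'w::real_normed_vector) \<Rightarrow> bool" where
  "smooth_on S f \<longleftrightarrow> (\<forall>k. Ck_on k S f)"

text \<open>A chart is a pair of its domain and its coordinate map.\<close>

record ('a, 'v) mfd =
  pts :: "'a set"
  atlas :: "('a set \<times> ('a \<Rightarrow> 'v)) set"

definition cinv :: "'a set \<times> ('a \<Rightarrow> 'v) \<Rightarrow> 'v \<Rightarrow> 'a" where
  "cinv c = inv_into (fst c) (snd c)"

definition mtop :: "('a, 'v::real_normed_vector, 'z) mfd_scheme \<Rightarrow> 'a topology" where
  "mtop M = topology (\<lambda>W. W \<subseteq> pts M \<and> (\<forall>c\<in>atlas M. open (snd c ` (W \<inter> fst c))))"

definition is_manifold :: "('a, 'v::real_normed_vector, 'z) mfd_scheme \<Rightarrow> bool" where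
  "is_manifold M \<longleftrightarrow>
     (\<exists>B :: 'v set. finite B \<and> span B = UNIV) \<and>
     (\<forall>c\<in>atlas M. fst c \<subseteq> pts M \<and> inj_on (snd c) (fst c) \<and> open (snd c ` fst c)) \<and>
     pts M = (\<Union>c\<in>atlas M. fst c) \<and>
     (\<forall>c\<in>atlas M. \<forall>d\<in>atlas M. open (snd c ` (fst c \<inter> fst d)) \<and>
        smooth_on (snd c ` (fst c \<inter> fst d)) (snd d \<circ> cinv c)) \<and>
     Hausdorff_space (mtop M) \<and> second_countable (mtop M)"

definition smooth_map ::
  "('a, 'v::real_normed_vector, 'y) mfd_scheme \<Rightarrow> ('b, 'w::real_normed_vector, 'z) mfd_scheme
     \<Rightarrow> ('a \<Rightarrow> 'b) \<Rightarrow> bool" where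
  "smooth_map M N f \<longleftrightarrow> f ` pts M \<subseteq> pts N \<and>
     (\<forall>c\<in>atlas M. \<forall>d\<in>atlas N. open (snd c ` (fst c \<inter> f -` fst d)) \<and>
        smooth_on (snd c ` (fst c \<inter> f -` fst d)) (snd d \<circ> f \<circ> cinv c))"

definition diffeo ::
  "('a, 'v::real_normed_vector, 'y) mfd_scheme \<Rightarrow> ('b, 'w::real_normed_vector, 'z) mfd_scheme
     \<Rightarrow> ('a \<Rightarrow> 'b) \<Rightarrow> bool" where
  "diffeo M N f \<longleftrightarrow> bij_betw f (pts M) (pts N) \<and> smooth_map M N f \<and>
     smooth_map N M (inv_into (pts M) f)"

definition vec_mfd :: "('v, 'v) mfd" where
  "vec_mfd = \<lparr>pts = UNIV, atlas = {(UNIV, \<lambda>v. v)}\<rparr>"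

definition mprod :: "('a, 'v, 'y) mfd_scheme \<Rightarrow> ('b, 'w, 'z) mfd_scheme \<Rightarrow> ('a \<times> 'b, 'v \<times> 'w) mfd" where
  "mprod M N = \<lparr>pts = pts M \<times> pts N,
     atlas = (\<lambda>(c, d). (fst c \<times> fst d, \<lambda>(p, q). (snd c p, snd d q))) ` (atlas M \<times> atlas N)\<rparr>"

definition open_sub :: "('a, 'v, 'z) mfd_scheme \<Rightarrow> 'a set \<Rightarrow> ('a, 'v) mfd" where
  "open_sub M U = \<lparr>pts = U, atlas = (\<lambda>c. (fst c \<inter> U, snd c)) ` atlas M\<rparr>"

subsection \<open>Tangent vectors\<close>

text \<open>The tangent space of M at p is the model space of M: a tangent vector is given by its
  coordinates in a chart around p that is chosen once and for all. The differential of a map,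
  and the passage from another chart c to the chosen one, are the corresponding Jacobians.\<close>

definition chart_at :: "('a, 'v, 'z) mfd_scheme \<Rightarrow> 'a \<Rightarrow> 'a set \<times> ('a \<Rightarrow> 'v)" where
  "chart_at M p = (SOME c. c \<in> atlas M \<and> p \<in> fst c)"

definition tmap ::
  "('a, 'v::real_normed_vector, 'y) mfd_scheme \<Rightarrow> ('b, 'w::real_normed_vector, 'z) mfd_scheme
     \<Rightarrow> ('a \<Rightarrow> 'b) \<Rightarrow> 'a \<Rightarrow> 'v \<Rightarrow> 'w" where
  "tmap M N f p = frechet_derivative (snd (chart_at N (f p)) \<circ> f \<circ> cinv (chart_at M p))
                    (at (snd (chart_at M p) p))"

definition from_chart ::
  "('a, 'v::real_normed_vector, 'z) mfd_scheme \<Rightarrow> 'a set \<times> ('a \<Rightarrow> 'v) \<Rightarrow> 'a \<Rightarrow> 'v \<Rightarrow> 'v" where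
  "from_chart M c p = frechet_derivative (snd (chart_at M p) \<circ> cinv c) (at (snd c p))"

definition to_chart ::
  "('a, 'v::real_normed_vector, 'z) mfd_scheme \<Rightarrow> 'a set \<times> ('a \<Rightarrow> 'v) \<Rightarrow> 'a \<Rightarrow> 'v \<Rightarrow> 'v" where
  "to_chart M c p = frechet_derivative (snd c \<circ> cinv (chart_at M p)) (at (snd (chart_at M p) p))"

section \<open>Differential forms\<close>

text \<open>A (vector-valued) k-form at a point takes a list of k tangent vectors; on lists of any
  other length it is 0, so that alternating k-forms are determined by their values.\<close>

definition alt_form :: "nat \<Rightarrow> ('v::real_vector list \<Rightarrow> 'w::real_vector) \<Rightarrow> bool" where
  "alt_form k \<eta> \<longleftrightarrow>
     (\<forall>vs. length vs \<noteq> k \<longrightarrow> \<eta> vs = 0) \<and>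
     (\<forall>vs i. length vs = k \<and> i < k \<longrightarrow> linear (\<lambda>v. \<eta> (vs[i := v]))) \<and>
     (\<forall>vs i j. length vs = k \<and> i < j \<and> j < k \<and> vs ! i = vs ! j \<longrightarrow> \<eta> vs = 0)"

text \<open>The wedge product with respect to a bilinear pairing m of the values.\<close>

definition wedge ::
  "('a \<Rightarrow> 'b \<Rightarrow> 'c::real_vector) \<Rightarrow> nat \<Rightarrow> nat \<Rightarrow> ('v list \<Rightarrow> 'a) \<Rightarrow> ('v list \<Rightarrow> 'b) \<Rightarrow> 'v list \<Rightarrow> 'c" where
  "wedge m p q \<alpha> \<beta> vs =
     (if length vs = p + q
      then (1 / (fact p * fact q)) *\<^sub>R
             (\<Sum>\<sigma> | \<sigma> permutes {..<p + q}.
                of_int (sign \<sigma>) *\<^sub>R m (\<alpha> (map (\<lambda>i. vs ! \<sigma> i) [0..<p]))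
                                     (\<beta> (map (\<lambda>i. vs ! \<sigma> i) [p..<p + q])))
      else 0)"

primrec wpow :: "('v list \<Rightarrow> real) \<Rightarrow> nat \<Rightarrow> 'v list \<Rightarrow> real" where
  "wpow \<omega> 0 = (\<lambda>vs. if vs = [] then 1 else 0)"
| "wpow \<omega> (Suc k) = wedge (*) 2 (2 * k) \<omega> (wpow \<omega> k)"

text \<open>The pullback of a k-linear field by the inverse of a chart.\<close>

definition loc ::
  "('a, 'v::real_normed_vector, 'z) mfd_scheme \<Rightarrow> 'a set \<times> ('a \<Rightarrow> 'v)
     \<Rightarrow> ('a \<Rightarrow> 'v list \<Rightarrow> 'w) \<Rightarrow> 'v \<Rightarrow> 'v list \<Rightarrow> 'w" where
  "loc M c \<eta> y vs = \<eta> (cinv c y) (map (from_chart M c (cinv c y)) vs)"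

definition smooth_tensor ::
  "('a, 'v::real_normed_vector, 'z) mfd_scheme \<Rightarrow> nat
     \<Rightarrow> ('a \<Rightarrow> 'v list \<Rightarrow> 'w::real_normed_vector) \<Rightarrow> bool" where
  "smooth_tensor M k \<eta> \<longleftrightarrow>
     (\<forall>c\<in>atlas M. \<forall>vs. length vs = k \<longrightarrow> smooth_on (snd c ` fst c) (\<lambda>y. loc M c \<eta> y vs))"

definition diff_form ::
  "('a, 'v::real_normed_vector, 'z) mfd_scheme \<Rightarrow> nat
     \<Rightarrow> ('a \<Rightarrow> 'v list \<Rightarrow> 'w::real_normed_vector) \<Rightarrow> bool" where
  "diff_form M k \<eta> \<longleftrightarrow> (\<forall>p\<in>pts M. alt_form k (\<eta> p)) \<and> smooth_tensor M k \<eta>"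

definition ext_d ::
  "('a, 'v::real_normed_vector, 'z) mfd_scheme \<Rightarrow> nat
     \<Rightarrow> ('a \<Rightarrow> 'v list \<Rightarrow> 'w::real_normed_vector) \<Rightarrow> 'a \<Rightarrow> 'v list \<Rightarrow> 'w" where
  "ext_d M k \<eta> p vs =
     (if length vs = Suc k
      then \<Sum>i\<le>k. (-1) ^ i *\<^sub>R
             frechet_derivative (\<lambda>y. loc M (chart_at M p) \<eta> y (take i vs @ drop (Suc i) vs))
               (at (snd (chart_at M p) p)) (vs ! i)
      else 0)"

definition closed_form ::
  "('a, 'v::real_normed_vector, 'z) mfd_scheme \<Rightarrow> nat
     \<Rightarrow> ('a \<Rightarrow> 'v list \<Rightarrow> 'w::real_normed_vector) \<Rightarrow> bool" where
  "closed_form M k \<eta> \<longleftrightarrow> (\<forall>p\<in>pts M. \<forall>vs. ext_d M k \<eta> p vs = 0)"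

definition pullback ::
  "('a, 'v::real_normed_vector, 'y) mfd_scheme \<Rightarrow> ('b, 'w::real_normed_vector, 'z) mfd_scheme
     \<Rightarrow> ('a \<Rightarrow> 'b) \<Rightarrow> ('b \<Rightarrow> 'w list \<Rightarrow> 'u) \<Rightarrow> 'a \<Rightarrow> 'v list \<Rightarrow> 'u" where
  "pullback M N f \<eta> p vs = \<eta> (f p) (map (tmap M N f p) vs)"

subsection \<open>Integration of top-degree forms\<close>

definition partition_of_unity ::
  "('a, 'v::real_normed_vector, 'z) mfd_scheme \<Rightarrow> (('a \<Rightarrow> real) \<times> ('a set \<times> ('a \<Rightarrow> 'v))) set \<Rightarrow> bool" where
  "partition_of_unity M P \<longleftrightarrow> finite P \<and>
     (\<forall>(\<rho>, c)\<in>P. c \<in> atlas M \<and> smooth_map M vec_mfd \<rho> \<and> (\<forall>p\<in>pts M. 0 \<le> \<rho> p) \<and>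
        (mtop M) closure_of {p \<in> pts M. \<rho> p \<noteq> 0} \<subseteq> fst c) \<and>
     (\<forall>p\<in>pts M. (\<Sum>(\<rho>, c)\<in>P. \<rho> p) = 1)"

definition model_basis :: "'v::real_vector list" where
  "model_basis = (SOME bs. distinct bs \<and> independent (set bs) \<and> span (set bs) = UNIV)"

text \<open>The integral of a top-degree form over a compact manifold oriented by the nowhere vanishing
  top-degree form vol. With linear coordinates for the basis bs on the model space, a form
  f dy1 ... dyN in a chart contributes the Lebesgue integral of f, with the sign of that chart
  relative to the orientation. The result does not depend on the choices of basis and partition.\<close>

definition form_integral ::
  "('a, 'v::real_normed_vector, 'z) mfd_scheme \<Rightarrow> ('a \<Rightarrow> 'v list \<Rightarrow> real)
     \<Rightarrow> ('a \<Rightarrow> 'v list \<Rightarrow> real) \<Rightarrow> real" where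
  "form_integral M vol \<eta> =
     (let P = (SOME P. partition_of_unity M P); bs = (model_basis :: 'v list) in
      \<Sum>(\<rho>, c)\<in>P. LINT t|PiM {..<length bs} (\<lambda>_. lborel).
        (let y = (\<Sum>i<length bs. t i *\<^sub>R bs ! i) in
         if y \<in> snd c ` fst c
         then \<rho> (cinv c y) * loc M c \<eta> y bs * sgn (loc M c vol y bs) else 0))"

section \<open>Metrics and almost complex structures\<close>

definition inner_product :: "('v::real_vector \<Rightarrow> 'v \<Rightarrow> real) \<Rightarrow> bool" where
  "inner_product g \<longleftrightarrow> bilinear g \<and> (\<forall>u v. g u v = g v u) \<and> (\<forall>u. u \<noteq> 0 \<longrightarrow> 0 < g u u)"

definition riemannian ::
  "('a, 'v::real_normed_vector, 'z) mfd_scheme \<Rightarrow> ('a \<Rightarrow> 'v list \<Rightarrow> real) \<Rightarrow> bool" where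
  "riemannian M g \<longleftrightarrow> (\<forall>p\<in>pts M. inner_product (\<lambda>u v. g p [u, v])) \<and> smooth_tensor M 2 g"

definition assoc_metric ::
  "('a \<Rightarrow> 'v list \<Rightarrow> real) \<Rightarrow> ('a \<Rightarrow> 'v \<Rightarrow> 'v) \<Rightarrow> 'a \<Rightarrow> 'v list \<Rightarrow> real" where
  "assoc_metric \<omega> I p vs = \<omega> p [vs ! 0, I p (vs ! 1)]"

definition almost_complex ::
  "('a, 'v::real_normed_vector, 'z) mfd_scheme \<Rightarrow> ('a \<Rightarrow> 'v \<Rightarrow> 'v) \<Rightarrow> bool" where
  "almost_complex M I \<longleftrightarrow>
     (\<forall>p\<in>pts M. linear (I p) \<and> (\<forall>v. I p (I p v) = - v)) \<and>
     (\<forall>c\<in>atlas M. \<forall>v. smooth_on (snd c ` fst c)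
        (\<lambda>y. to_chart M c (cinv c y) (I (cinv c y) (from_chart M c (cinv c y) v))))"

definition symplectic_form ::
  "('a, 'v::real_normed_vector, 'z) mfd_scheme \<Rightarrow> ('a \<Rightarrow> 'v list \<Rightarrow> real) \<Rightarrow> bool" where
  "symplectic_form M \<omega> \<longleftrightarrow> diff_form M 2 \<omega> \<and> closed_form M 2 \<omega> \<and>
     (\<forall>p\<in>pts M. \<forall>u. (\<forall>v. \<omega> p [u, v] = 0) \<longrightarrow> u = 0)"

subsection \<open>Kaehler manifolds\<close>

text \<open>The atlas of a complex manifold consists of holomorphic charts; cstr is the multiplication
  by the imaginary unit on the model space. Since the tangent space at p is identified with the
  model space by means of a holomorphic chart, cstr also is the almost complex structure of the
  manifold at every p.\<close>

record ('a, 'v) kaehler = "('a, 'v) mfd" +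
  cstr :: "'v \<Rightarrow> 'v"
  kform :: "'a \<Rightarrow> 'v list \<Rightarrow> real"

definition cdim :: "('a, 'v::real_normed_vector, 'z) kaehler_scheme \<Rightarrow> nat" where
  "cdim X = dim (UNIV :: 'v set) div 2"

definition complex_manifold :: "nat \<Rightarrow> ('a, 'v::real_normed_vector, 'z) kaehler_scheme \<Rightarrow> bool" where
  "complex_manifold n X \<longleftrightarrow> is_manifold X \<and> dim (UNIV :: 'v set) = 2 * n \<and>
     linear (cstr X) \<and> (\<forall>v. cstr X (cstr X v) = - v) \<and>
     (\<forall>c\<in>atlas X. \<forall>d\<in>atlas X. \<forall>p\<in>fst c \<inter> fst d. \<forall>v.
        frechet_derivative (snd d \<circ> cinv c) (at (snd c p)) (cstr X v) =
        cstr X (frechet_derivative (snd d \<circ> cinv c) (at (snd c p)) v))"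

definition kaehler_manifold :: "nat \<Rightarrow> ('a, 'v::real_normed_vector, 'z) kaehler_scheme \<Rightarrow> bool" where
  "kaehler_manifold n X \<longleftrightarrow> complex_manifold n X \<and>
     diff_form X 2 (kform X) \<and> closed_form X 2 (kform X) \<and>
     riemannian X (assoc_metric (kform X) (\<lambda>_. cstr X))"

definition kmetric :: "('a, 'v, 'z) kaehler_scheme \<Rightarrow> 'a \<Rightarrow> 'v \<Rightarrow> 'v \<Rightarrow> real" where
  "kmetric X x u v = assoc_metric (kform X) (\<lambda>_. cstr X) x [u, v]"

definition kpow :: "('a, 'v, 'z) kaehler_scheme \<Rightarrow> int \<Rightarrow> 'a \<Rightarrow> 'v list \<Rightarrow> real" where
  "kpow X k x vs = (if k < 0 then 0 else wpow (kform X x) (nat k) vs / fact (nat k))"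

definition top_integral ::
  "('a, 'v::real_normed_vector, 'z) kaehler_scheme \<Rightarrow> ('a \<Rightarrow> 'v list \<Rightarrow> real) \<Rightarrow> real" where
  "top_integral X \<eta> = form_integral X (kpow X (int (cdim X))) \<eta>"

definition fun_integral ::
  "('a, 'v::real_normed_vector, 'z) kaehler_scheme \<Rightarrow> ('a \<Rightarrow> real) \<Rightarrow> real" where
  "fun_integral X f = top_integral X (\<lambda>x vs. f x * kpow X (int (cdim X)) x vs)"

text \<open>The product of k-forms for which the wedge products of an orthonormal coframe form an
  orthonormal basis; m is the inner product of the values.\<close>

definition onb :: "('a, 'v::real_normed_vector, 'z) kaehler_scheme \<Rightarrow> 'a \<Rightarrow> 'v list" where
  "onb X x = (SOME bs. length bs = dim (UNIV :: 'v set) \<and>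
     (\<forall>i<length bs. \<forall>j<length bs. kmetric X x (bs ! i) (bs ! j) = (if i = j then 1 else 0)))"

definition form_inner ::
  "('a, 'v::real_normed_vector, 'z) kaehler_scheme \<Rightarrow> 'a \<Rightarrow> ('w \<Rightarrow> 'w \<Rightarrow> real) \<Rightarrow> nat
     \<Rightarrow> ('v list \<Rightarrow> 'w) \<Rightarrow> ('v list \<Rightarrow> 'w) \<Rightarrow> real" where
  "form_inner X x m k \<eta> \<zeta> =
     (\<Sum>is | length is = k \<and> sorted_wrt (<) is \<and> set is \<subseteq> {..<length (onb X x)}.
        m (\<eta> (map ((!) (onb X x)) is)) (\<zeta> (map ((!) (onb X x)) is)))"

definition L2sq ::
  "('a, 'v::real_normed_vector, 'z) kaehler_scheme \<Rightarrow> ('a \<Rightarrow> 'w \<Rightarrow> 'w \<Rightarrow> real) \<Rightarrow> nat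
     \<Rightarrow> ('a \<Rightarrow> 'v list \<Rightarrow> 'w) \<Rightarrow> real" where
  "L2sq X m k \<eta> = fun_integral X (\<lambda>x. form_inner X x (m x) k (\<eta> x) (\<eta> x))"

text \<open>The adjoint of wedging with the Kaehler form, mapping (k+2)-forms to k-forms.\<close>

definition Lambda ::
  "('a, 'v::real_normed_vector, 'z) kaehler_scheme \<Rightarrow> ('w::real_vector \<Rightarrow> 'w \<Rightarrow> real) \<Rightarrow> nat
     \<Rightarrow> 'a \<Rightarrow> ('v list \<Rightarrow> 'w) \<Rightarrow> 'v list \<Rightarrow> 'w" where
  "Lambda X m k x \<eta> = (THE \<xi>. alt_form k \<xi> \<and>
     (\<forall>\<zeta>. alt_form k \<zeta> \<longrightarrow>
        form_inner X x m k \<xi> \<zeta> = form_inner X x m (k + 2) \<eta> (wedge (*\<^sub>R) 2 k (kform X x) \<zeta>)))"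

text \<open>The (0,2)-part of a 2-form: the complex bilinear extension is precomposed with the
  projections to the eigenspace of the almost complex structure for the eigenvalue -i. Elements
  of a complexified space are pairs of real and imaginary part.\<close>

definition cplx_ext2 :: "('v list \<Rightarrow> 'w::real_vector) \<Rightarrow> 'v \<times> 'v \<Rightarrow> 'v \<times> 'v \<Rightarrow> 'w \<times> 'w" where
  "cplx_ext2 \<eta> u v = (\<eta> [fst u, fst v] - \<eta> [snd u, snd v], \<eta> [fst u, snd v] + \<eta> [snd u, fst v])"

definition proj01 :: "('v::real_vector \<Rightarrow> 'v) \<Rightarrow> 'v \<Rightarrow> 'v \<times> 'v" where
  "proj01 J u = ((1/2) *\<^sub>R u, (1/2) *\<^sub>R J u)"

definition part02 ::
  "('v::real_vector \<Rightarrow> 'v) \<Rightarrow> ('v list \<Rightarrow> 'w::real_vector) \<Rightarrow> 'v list \<Rightarrow> 'w \<times> 'w" where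
  "part02 J \<eta> vs =
     (if length vs = 2 then cplx_ext2 \<eta> (proj01 J (vs ! 0)) (proj01 J (vs ! 1)) else 0)"

definition cplx_inner :: "('w \<Rightarrow> 'w \<Rightarrow> real) \<Rightarrow> 'w \<times> 'w \<Rightarrow> 'w \<times> 'w \<Rightarrow> real" where
  "cplx_inner m a b = m (fst a) (fst b) + m (snd a) (snd b)"

text \<open>The (0,1)-part of a 1-form with values in a space with complex structure I.\<close>

definition part01 ::
  "('v \<Rightarrow> 'v) \<Rightarrow> ('w::real_vector \<Rightarrow> 'w) \<Rightarrow> ('v list \<Rightarrow> 'w) \<Rightarrow> 'v list \<Rightarrow> 'w" where
  "part01 J I \<eta> vs = (1/2) *\<^sub>R (\<eta> vs + I (\<eta> (map J vs)))"

section \<open>Lie groups\<close>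

text \<open>The Lie algebra is the tangent space at the unit; ip is an inner product on it.\<close>

record ('k, 'l) lie = "('k, 'l) mfd" +
  grp :: "'k monoid"
  ip :: "'l \<Rightarrow> 'l \<Rightarrow> real"

abbreviation gmul :: "('k, 'l, 'z) lie_scheme \<Rightarrow> 'k \<Rightarrow> 'k \<Rightarrow> 'k" where
  "gmul K g h \<equiv> g \<otimes>\<^bsub>grp K\<^esub> h"

abbreviation gone :: "('k, 'l, 'z) lie_scheme \<Rightarrow> 'k" where
  "gone K \<equiv> \<one>\<^bsub>grp K\<^esub>"

abbreviation ginv :: "('k, 'l, 'z) lie_scheme \<Rightarrow> 'k \<Rightarrow> 'k" where
  "ginv K h \<equiv> inv\<^bsub>grp K\<^esub> h"

definition lie_group :: "('k, 'l::real_normed_vector, 'z) lie_scheme \<Rightarrow> bool" where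
  "lie_group K \<longleftrightarrow> is_manifold K \<and> group (grp K) \<and> carrier (grp K) = pts K \<and>
     smooth_map (mprod K K) K (\<lambda>(g, h). gmul K g h) \<and> smooth_map K K (ginv K)"

definition Ad :: "('k, 'l::real_normed_vector, 'z) lie_scheme \<Rightarrow> 'k \<Rightarrow> 'l \<Rightarrow> 'l" where
  "Ad K h = tmap K K (\<lambda>g. gmul K (gmul K h g) (ginv K h)) (gone K)"

definition bracket :: "('k, 'l::real_normed_vector, 'z) lie_scheme \<Rightarrow> 'l \<Rightarrow> 'l \<Rightarrow> 'l" where
  "bracket K s t = tmap K vec_mfd (\<lambda>h. Ad K h t) (gone K) s"

definition central :: "('k, 'l::real_normed_vector, 'z) lie_scheme \<Rightarrow> 'l \<Rightarrow> bool" where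
  "central K c \<longleftrightarrow> (\<forall>s. bracket K s c = 0)"

definition Ad_invariant_inner :: "('k, 'l::real_normed_vector, 'z) lie_scheme \<Rightarrow> bool" where
  "Ad_invariant_inner K \<longleftrightarrow> inner_product (ip K) \<and>
     (\<forall>h\<in>pts K. \<forall>s t. ip K (Ad K h s) (Ad K h t) = ip K s t)"

definition one_param_subgroup ::
  "('k, 'l::real_normed_vector, 'z) lie_scheme \<Rightarrow> 'l \<Rightarrow> (real \<Rightarrow> 'k) \<Rightarrow> bool" where
  "one_param_subgroup K s \<gamma> \<longleftrightarrow> smooth_map vec_mfd K \<gamma> \<and>
     (\<forall>a b. \<gamma> (a + b) = gmul K (\<gamma> a) (\<gamma> b)) \<and> tmap vec_mfd K \<gamma> 0 1 = s"

definition lie_exp :: "('k, 'l::real_normed_vector, 'z) lie_scheme \<Rightarrow> 'l \<Rightarrow> 'k" where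
  "lie_exp K s = (THE \<gamma>. one_param_subgroup K s \<gamma>) 1"

section \<open>Hamiltonian spaces\<close>

text \<open>The moment map mom takes values in the Lie algebra, identified with its dual by ip.\<close>

record ('k, 'l, 'f, 'w) hspace = "('f, 'w) mfd" +
  act :: "'k \<Rightarrow> 'f \<Rightarrow> 'f"
  symp :: "'f \<Rightarrow> 'w list \<Rightarrow> real"
  acs :: "'f \<Rightarrow> 'w \<Rightarrow> 'w"
  mom :: "'f \<Rightarrow> 'l"

definition fund_field ::
  "('k, 'l::real_normed_vector, 'y) lie_scheme \<Rightarrow> ('k, 'l, 'f, 'w::real_normed_vector, 'z) hspace_scheme
     \<Rightarrow> 'l \<Rightarrow> 'f \<Rightarrow> 'w" where
  "fund_field K F s x = tmap vec_mfd F (\<lambda>t. act F (lie_exp K (t *\<^sub>R s)) x) (0::real) 1"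

definition smooth_left_action ::
  "('k, 'l::real_normed_vector, 'y) lie_scheme \<Rightarrow> ('k, 'l, 'f, 'w::real_normed_vector, 'z) hspace_scheme
     \<Rightarrow> bool" where
  "smooth_left_action K F \<longleftrightarrow> smooth_map (mprod K F) F (\<lambda>(h, x). act F h x) \<and>
     (\<forall>x\<in>pts F. act F (gone K) x = x) \<and>
     (\<forall>g\<in>pts K. \<forall>h\<in>pts K. \<forall>x\<in>pts F. act F (gmul K g h) x = act F g (act F h x))"

definition moment_map ::
  "('k, 'l::real_normed_vector, 'y) lie_scheme \<Rightarrow> ('k, 'l, 'f, 'w::real_normed_vector, 'z) hspace_scheme
     \<Rightarrow> bool" where
  "moment_map K F \<longleftrightarrow> smooth_map F vec_mfd (mom F) \<and>
     (\<forall>s. \<forall>x\<in>pts F. \<forall>u.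
        tmap F vec_mfd (\<lambda>x. ip K (mom F x) s) x u = symp F x [fund_field K F s x, u]) \<and>
     (\<forall>h\<in>pts K. \<forall>x\<in>pts F. \<forall>v. ip K (mom F (act F h x)) (Ad K h v) = ip K (mom F x) v)"

definition hamiltonian_space ::
  "('k, 'l::real_normed_vector, 'y) lie_scheme \<Rightarrow> ('k, 'l, 'f, 'w::real_normed_vector, 'z) hspace_scheme
     \<Rightarrow> bool" where
  "hamiltonian_space K F \<longleftrightarrow> is_manifold F \<and> symplectic_form F (symp F) \<and>
     smooth_left_action K F \<and>
     (\<forall>h\<in>pts K. \<forall>x\<in>pts F. \<forall>vs. pullback F F (act F h) (symp F) x vs = symp F x vs) \<and>
     almost_complex F (acs F) \<and>
     (\<forall>h\<in>pts K. \<forall>x\<in>pts F. \<forall>u.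
        tmap F F (act F h) x (acs F x u) = acs F (act F h x) (tmap F F (act F h) x u)) \<and>
     riemannian F (assoc_metric (symp F) (acs F)) \<and>
     moment_map K F"

section \<open>Principal bundles and connections\<close>

record ('k, 'x, 'e, 'b) pbundle = "('e, 'b) mfd" +
  proj :: "'e \<Rightarrow> 'x"
  ract :: "'e \<Rightarrow> 'k \<Rightarrow> 'e"

definition local_triv ::
  "('k, 'l::real_normed_vector, 'y1) lie_scheme \<Rightarrow> ('x, 'v::real_normed_vector, 'y2) mfd_scheme
     \<Rightarrow> ('k, 'x, 'e, 'b::real_normed_vector, 'y3) pbundle_scheme
     \<Rightarrow> 'x set \<Rightarrow> ('x \<times> 'k \<Rightarrow> 'e) \<Rightarrow> bool" where
  "local_triv K X E U \<tau> \<longleftrightarrow> openin (mtop X) U \<and>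
     diffeo (mprod (open_sub X U) K) (open_sub E {e \<in> pts E. proj E e \<in> U}) \<tau> \<and>
     (\<forall>x\<in>U. \<forall>h\<in>pts K. proj E (\<tau> (x, h)) = x \<and>
        (\<forall>k\<in>pts K. \<tau> (x, gmul K h k) = ract E (\<tau> (x, h)) k))"

definition principal_bundle ::
  "('k, 'l::real_normed_vector, 'y1) lie_scheme \<Rightarrow> ('x, 'v::real_normed_vector, 'y2) mfd_scheme
     \<Rightarrow> ('k, 'x, 'e, 'b::real_normed_vector, 'y3) pbundle_scheme \<Rightarrow> bool" where
  "principal_bundle K X E \<longleftrightarrow> is_manifold E \<and> smooth_map E X (proj E) \<and>
     smooth_map (mprod E K) E (\<lambda>(e, h). ract E e h) \<and>
     (\<forall>e\<in>pts E. ract E e (gone K) = e) \<and>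
     (\<forall>e\<in>pts E. \<forall>g\<in>pts K. \<forall>h\<in>pts K. ract E e (gmul K g h) = ract E (ract E e g) h) \<and>
     (\<forall>x\<in>pts X. \<exists>U \<tau>. x \<in> U \<and> local_triv K X E U \<tau>)"

definition connection ::
  "('k, 'l::real_normed_vector, 'y1) lie_scheme
     \<Rightarrow> ('k, 'x, 'e, 'b::real_normed_vector, 'y2) pbundle_scheme \<Rightarrow> ('e \<Rightarrow> 'b list \<Rightarrow> 'l) \<Rightarrow> bool" where
  "connection K E A \<longleftrightarrow> diff_form E 1 A \<and>
     (\<forall>e\<in>pts E. \<forall>s. A e [tmap K E (ract E e) (gone K) s] = s) \<and>
     (\<forall>e\<in>pts E. \<forall>h\<in>pts K. \<forall>w.
        A (ract E e h) [tmap E E (\<lambda>e'. ract E e' h) e w] = Ad K (ginv K h) (A e [w]))"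

text \<open>Forms on X with values in the adjoint bundle are written in components with respect to a
  frame, that is a point e of the fibre of E: the curvature at x in the directions u, v is the
  class of (e, s), where s is the exterior derivative of the connection form at e on the
  horizontal lifts of u and v. Components for different frames are related by Ad.\<close>

definition hlift ::
  "('x, 'v::real_normed_vector, 'y1) mfd_scheme \<Rightarrow> ('k, 'x, 'e, 'b::real_normed_vector, 'y2) pbundle_scheme
     \<Rightarrow> ('e \<Rightarrow> 'b list \<Rightarrow> 'l::zero) \<Rightarrow> 'e \<Rightarrow> 'v \<Rightarrow> 'b" where
  "hlift X E A e u = (THE w. A e [w] = 0 \<and> tmap E X (proj E) e w = u)"

definition curv ::
  "('x, 'v::real_normed_vector, 'y1) mfd_scheme \<Rightarrow> ('k, 'x, 'e, 'b::real_normed_vector, 'y2) pbundle_scheme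
     \<Rightarrow> ('e \<Rightarrow> 'b list \<Rightarrow> 'l::real_normed_vector) \<Rightarrow> 'e \<Rightarrow> 'v list \<Rightarrow> 'l" where
  "curv X E A e vs = ext_d E 1 A e (map (hlift X E A e) vs)"

definition frame :: "('k, 'x, 'e, 'b, 'z) pbundle_scheme \<Rightarrow> 'x \<Rightarrow> 'e" where
  "frame E x = (SOME e. e \<in> pts E \<and> proj E e = x)"

definition curvature ::
  "('x, 'v::real_normed_vector, 'y1) mfd_scheme \<Rightarrow> ('k, 'x, 'e, 'b::real_normed_vector, 'y2) pbundle_scheme
     \<Rightarrow> ('e \<Rightarrow> 'b list \<Rightarrow> 'l::real_normed_vector) \<Rightarrow> 'x \<Rightarrow> 'v list \<Rightarrow> 'l" where
  "curvature X E A x = curv X E A (frame E x)"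

section \<open>The associated bundle\<close>

text \<open>Points of the associated bundle are the orbits of K on E x F.\<close>

definition orb ::
  "('k, 'l, 'y1) lie_scheme \<Rightarrow> ('k, 'l, 'f, 'w, 'y2) hspace_scheme
     \<Rightarrow> ('k, 'x, 'e, 'b, 'y3) pbundle_scheme \<Rightarrow> 'e \<Rightarrow> 'f \<Rightarrow> ('e \<times> 'f) set" where
  "orb K F E e f = {(ract E e h, act F (ginv K h) f) | h. h \<in> pts K}"

definition aproj :: "('k, 'x, 'e, 'b, 'z) pbundle_scheme \<Rightarrow> ('e \<times> 'f) set \<Rightarrow> 'x" where
  "aproj E y = the_elem ((\<lambda>(e, f). proj E e) ` y)"

definition fcomp :: "('e \<times> 'f) set \<Rightarrow> 'e \<Rightarrow> 'f" where
  "fcomp y e = (THE f. (e, f) \<in> y)"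

text \<open>The charts come from the local trivialisations that send (x, f) to the class of
  (tau (x, 1), f), composed with charts of X and F.\<close>

definition assoc ::
  "('k, 'l::real_normed_vector, 'y1) lie_scheme \<Rightarrow> ('k, 'l, 'f, 'w::real_normed_vector, 'y2) hspace_scheme
     \<Rightarrow> ('x, 'v::real_normed_vector, 'y3) mfd_scheme \<Rightarrow> ('k, 'x, 'e, 'b::real_normed_vector, 'y4) pbundle_scheme
     \<Rightarrow> (('e \<times> 'f) set, 'v \<times> 'w) mfd" where
  "assoc K F X E = \<lparr>pts = {orb K F E e f | e f. e \<in> pts E \<and> f \<in> pts F},
     atlas = {({orb K F E (\<tau> (x, gone K)) f | x f. x \<in> U \<inter> fst c \<and> f \<in> fst d},
               \<lambda>y. (snd c (aproj E y), snd d (fcomp y (\<tau> (aproj E y, gone K)))))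
              | U \<tau> c d. local_triv K X E U \<tau> \<and> c \<in> atlas X \<and> d \<in> atlas F}\<rparr>"

definition smooth_section ::
  "('k, 'l::real_normed_vector, 'y1) lie_scheme \<Rightarrow> ('k, 'l, 'f, 'w::real_normed_vector, 'y2) hspace_scheme
     \<Rightarrow> ('x, 'v::real_normed_vector, 'y3) mfd_scheme \<Rightarrow> ('k, 'x, 'e, 'b::real_normed_vector, 'y4) pbundle_scheme
     \<Rightarrow> ('x \<Rightarrow> ('e \<times> 'f) set) \<Rightarrow> bool" where
  "smooth_section K F X E \<Phi> \<longleftrightarrow>
     smooth_map X (assoc K F X E) \<Phi> \<and> (\<forall>x\<in>pts X. aproj E (\<Phi> x) = x)"

subsection \<open>The vertical tangent bundle\<close>

text \<open>For y the class of (e, f), the inclusion of F as fibre through y by means of the frame e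
  identifies the tangent space of F at f with the vertical tangent space at y. The structures on
  F are transported to the latter; by K-invariance the representative does not matter.\<close>

definition vert ::
  "('k, 'l::real_normed_vector, 'y1) lie_scheme \<Rightarrow> ('k, 'l, 'f, 'w::real_normed_vector, 'y2) hspace_scheme
     \<Rightarrow> ('x, 'v::real_normed_vector, 'y3) mfd_scheme \<Rightarrow> ('k, 'x, 'e, 'b::real_normed_vector, 'y4) pbundle_scheme
     \<Rightarrow> ('e \<times> 'f) set \<Rightarrow> ('v \<times> 'w) set" where
  "vert K F X E y = {u. tmap (assoc K F X E) X (aproj E) y u = 0}"

definition rep :: "('e \<times> 'f) set \<Rightarrow> 'e \<times> 'f" where
  "rep y = (SOME z. z \<in> y)"

definition fibre_iso ::
  "('k, 'l::real_normed_vector, 'y1) lie_scheme \<Rightarrow> ('k, 'l, 'f, 'w::real_normed_vector, 'y2) hspace_scheme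
     \<Rightarrow> ('x, 'v::real_normed_vector, 'y3) mfd_scheme \<Rightarrow> ('k, 'x, 'e, 'b::real_normed_vector, 'y4) pbundle_scheme
     \<Rightarrow> ('e \<times> 'f) set \<Rightarrow> 'w \<Rightarrow> 'v \<times> 'w" where
  "fibre_iso K F X E y = tmap F (assoc K F X E) (orb K F E (fst (rep y))) (snd (rep y))"

definition fibre_iso_inv ::
  "('k, 'l::real_normed_vector, 'y1) lie_scheme \<Rightarrow> ('k, 'l, 'f, 'w::real_normed_vector, 'y2) hspace_scheme
     \<Rightarrow> ('x, 'v::real_normed_vector, 'y3) mfd_scheme \<Rightarrow> ('k, 'x, 'e, 'b::real_normed_vector, 'y4) pbundle_scheme
     \<Rightarrow> ('e \<times> 'f) set \<Rightarrow> 'v \<times> 'w \<Rightarrow> 'w" where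
  "fibre_iso_inv K F X E y u = (THE a. fibre_iso K F X E y a = u)"

definition vert_acs ::
  "('k, 'l::real_normed_vector, 'y1) lie_scheme \<Rightarrow> ('k, 'l, 'f, 'w::real_normed_vector, 'y2) hspace_scheme
     \<Rightarrow> ('x, 'v::real_normed_vector, 'y3) mfd_scheme \<Rightarrow> ('k, 'x, 'e, 'b::real_normed_vector, 'y4) pbundle_scheme
     \<Rightarrow> ('e \<times> 'f) set \<Rightarrow> 'v \<times> 'w \<Rightarrow> 'v \<times> 'w" where
  "vert_acs K F X E y u =
     fibre_iso K F X E y (acs F (snd (rep y)) (fibre_iso_inv K F X E y u))"

definition vert_symp ::
  "('k, 'l::real_normed_vector, 'y1) lie_scheme \<Rightarrow> ('k, 'l, 'f, 'w::real_normed_vector, 'y2) hspace_scheme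
     \<Rightarrow> ('x, 'v::real_normed_vector, 'y3) mfd_scheme \<Rightarrow> ('k, 'x, 'e, 'b::real_normed_vector, 'y4) pbundle_scheme
     \<Rightarrow> ('e \<times> 'f) set \<Rightarrow> ('v \<times> 'w) list \<Rightarrow> real" where
  "vert_symp K F X E y us = symp F (snd (rep y)) (map (fibre_iso_inv K F X E y) us)"

definition vert_metric ::
  "('k, 'l::real_normed_vector, 'y1) lie_scheme \<Rightarrow> ('k, 'l, 'f, 'w::real_normed_vector, 'y2) hspace_scheme
     \<Rightarrow> ('x, 'v::real_normed_vector, 'y3) mfd_scheme \<Rightarrow> ('k, 'x, 'e, 'b::real_normed_vector, 'y4) pbundle_scheme
     \<Rightarrow> ('e \<times> 'f) set \<Rightarrow> 'v \<times> 'w \<Rightarrow> 'v \<times> 'w \<Rightarrow> real" where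
  "vert_metric K F X E y u u' = assoc_metric (symp F) (acs F) (snd (rep y))
     [fibre_iso_inv K F X E y u, fibre_iso_inv K F X E y u']"

definition hor ::
  "('k, 'l::real_normed_vector, 'y1) lie_scheme \<Rightarrow> ('k, 'l, 'f, 'w::real_normed_vector, 'y2) hspace_scheme
     \<Rightarrow> ('x, 'v::real_normed_vector, 'y3) mfd_scheme \<Rightarrow> ('k, 'x, 'e, 'b::real_normed_vector, 'y4) pbundle_scheme
     \<Rightarrow> ('e \<Rightarrow> 'b list \<Rightarrow> 'l) \<Rightarrow> ('e \<times> 'f) set \<Rightarrow> ('v \<times> 'w) set" where
  "hor K F X E A y =
     {tmap E (assoc K F X E) (\<lambda>e'. orb K F E e' f) e w | e f w. (e, f) \<in> y \<and> A e [w] = 0}"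

definition valpha ::
  "('k, 'l::real_normed_vector, 'y1) lie_scheme \<Rightarrow> ('k, 'l, 'f, 'w::real_normed_vector, 'y2) hspace_scheme
     \<Rightarrow> ('x, 'v::real_normed_vector, 'y3) mfd_scheme \<Rightarrow> ('k, 'x, 'e, 'b::real_normed_vector, 'y4) pbundle_scheme
     \<Rightarrow> ('e \<Rightarrow> 'b list \<Rightarrow> 'l) \<Rightarrow> ('e \<times> 'f) set \<Rightarrow> 'v \<times> 'w \<Rightarrow> 'v \<times> 'w" where
  "valpha K F X E A y u = (THE u'. u' \<in> vert K F X E y \<and> u - u' \<in> hor K F X E A y)"

definition cov_d ::
  "('k, 'l::real_normed_vector, 'y1) lie_scheme \<Rightarrow> ('k, 'l, 'f, 'w::real_normed_vector, 'y2) hspace_scheme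
     \<Rightarrow> ('x, 'v::real_normed_vector, 'y3) mfd_scheme \<Rightarrow> ('k, 'x, 'e, 'b::real_normed_vector, 'y4) pbundle_scheme
     \<Rightarrow> ('e \<Rightarrow> 'b list \<Rightarrow> 'l) \<Rightarrow> ('x \<Rightarrow> ('e \<times> 'f) set) \<Rightarrow> 'x \<Rightarrow> 'v list \<Rightarrow> 'v \<times> 'w" where
  "cov_d K F X E A \<Phi> x vs =
     (if length vs = 1 then valpha K F X E A (\<Phi> x) (tmap X (assoc K F X E) \<Phi> x (vs ! 0)) else 0)"

definition dbar ::
  "('k, 'l::real_normed_vector, 'y1) lie_scheme \<Rightarrow> ('k, 'l, 'f, 'w::real_normed_vector, 'y2) hspace_scheme
     \<Rightarrow> ('x, 'v::real_normed_vector, 'y3) kaehler_scheme \<Rightarrow> ('k, 'x, 'e, 'b::real_normed_vector, 'y4) pbundle_scheme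
     \<Rightarrow> ('e \<Rightarrow> 'b list \<Rightarrow> 'l) \<Rightarrow> ('x \<Rightarrow> ('e \<times> 'f) set) \<Rightarrow> 'x \<Rightarrow> 'v list \<Rightarrow> 'v \<times> 'w" where
  "dbar K F X E A \<Phi> x = part01 (cstr X) (vert_acs K F X E (\<Phi> x)) (cov_d K F X E A \<Phi> x)"

subsection \<open>The moment map of a section and the Chern-Weil form\<close>

text \<open>The section of the adjoint bundle induced by a section and the moment map, in components
  with respect to the same frames as the curvature.\<close>

definition mom_section ::
  "('k, 'l, 'f, 'w, 'y1) hspace_scheme \<Rightarrow> ('k, 'x, 'e, 'b, 'y2) pbundle_scheme
     \<Rightarrow> ('x \<Rightarrow> ('e \<times> 'f) set) \<Rightarrow> 'x \<Rightarrow> 'l" where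
  "mom_section F E \<Phi> x = mom F (fcomp (\<Phi> x) (frame E x))"

definition chern_weil_form ::
  "('k, 'l::real_normed_vector, 'y1) lie_scheme \<Rightarrow> ('k, 'l, 'f, 'w::real_normed_vector, 'y2) hspace_scheme
     \<Rightarrow> ('x, 'v::real_normed_vector, 'y3) mfd_scheme \<Rightarrow> ('k, 'x, 'e, 'b::real_normed_vector, 'y4) pbundle_scheme
     \<Rightarrow> ('e \<Rightarrow> 'b list \<Rightarrow> 'l) \<Rightarrow> ('e \<times> 'f) set \<Rightarrow> ('v \<times> 'w) list \<Rightarrow> real" where
  "chern_weil_form K F X E A y us =
     vert_symp K F X E y (map (valpha K F X E A y) us)
     - ip K (curv X E A (fst (rep y)) (map (tmap (assoc K F X E) X (aproj E) y) us))
            (mom F (snd (rep y)))"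

section \<open>The Yang-Mills-Higgs functional\<close>

definition YMH ::
  "('k, 'l::real_normed_vector, 'y1) lie_scheme \<Rightarrow> 'l \<Rightarrow> ('k, 'l, 'f, 'w::real_normed_vector, 'y2) hspace_scheme
     \<Rightarrow> ('x, 'v::real_normed_vector, 'y3) kaehler_scheme \<Rightarrow> ('k, 'x, 'e, 'b::real_normed_vector, 'y4) pbundle_scheme
     \<Rightarrow> ('e \<Rightarrow> 'b list \<Rightarrow> 'l) \<Rightarrow> ('x \<Rightarrow> ('e \<times> 'f) set) \<Rightarrow> real" where
  "YMH K c F X E A \<Phi> =
     L2sq X (\<lambda>_. ip K) 2 (curvature X E A)
     + L2sq X (\<lambda>x. vert_metric K F X E (\<Phi> x)) 1 (cov_d K F X E A \<Phi>)
     + L2sq X (\<lambda>_. ip K) 0 (\<lambda>x _. c - mom_section F E \<Phi> x)"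

end

theory Submission
  imports Defs "HOL-Real_Asymp.Real_Asymp"
begin

text \<open>The integrands of both sides agree at every point. In a frame of the bundle and an orthonormal
  basis of the tangent space, let \<open>R\<close> be the curvature, \<open>m\<close> the value of the moment map and \<open>C\<close> the
  half sum of the products of \<open>R(e\<^sub>i, e\<^sub>j)\<close> and \<open>R(J e\<^sub>i, J e\<^sub>j)\<close>. Contracting forms of degree above
  the dimension, which vanish, shows that a 2-form \<open>\<eta>\<close> times \<open>\<omega>\<^sup>[\<^sup>n\<^sup>-\<^sup>1\<^sup>]\<close> is \<open>\<Lambda>\<eta>\<close> times the volume form, and
  that \<open>B(R, R)\<close> times \<open>\<omega>\<^sup>[\<^sup>n\<^sup>-\<^sup>2\<^sup>]\<close> is \<open>\<bar>\<Lambda>R\<bar>\<^sup>2 - C\<close> times the volume form. Rotating the basis by the complex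
  structure gives \<open>4 \<bar>R\<^sup>0\<^sup>,\<^sup>2\<bar>\<^sup>2 = \<bar>R\<bar>\<^sup>2 - C\<close>, and twice the square norm of the (0,1)-part of the covariant
  derivative is the square norm of the latter minus twice \<open>\<Lambda>\<close> of the pulled back symplectic form.
  Expanding \<open>\<bar>\<Lambda>R + m - c\<bar>\<^sup>2\<close>, all terms cancel; the frame is irrelevant for \<open>c\<close> because \<open>K\<close> is connected
  and \<open>c\<close> is central.

  The identity of the integrals follows by linearity, which is not automatic: the integrands have to
  be continuous in charts, and a partition of unity has to exist, since the integral is defined by
  a choice of one.\<close>

section \<open>Finite-dimensional normed spaces\<close>

text \<open>The definitions make pointwise choices without any regularity: the frame of
  \<open>E\<close> over a point, the representative of an orbit, the orthonormal basis behind
  \<open>form_inner\<close>, and the chart in which tangent vectors are written. Continuity of an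
  integrand cannot be read off from them. Each quantity is therefore rewritten, by invariance under
  the group and under change of orthonormal basis, through a local section of \<open>E\<close>, a
  Gram-Schmidt basis computed in a chart of \<open>X\<close>, and charts of \<open>E\<close> and
  \<open>F\<close> held fixed near a point. The pointwise identities and the continuity both rest on
  these rewritten values. In the algebra of forms, divided powers with integer exponent are used
  because their contraction rule carries no coefficient; the formulas then also cover
  \<open>n = 0\<close> and \<open>n = 1\<close>. The cancellation hinges on the pairing of the
  contracted curvature with the moment map. It arises twice: as cross term of the expanded square,
  and from the curvature part of the Chern-Weil form.\<close>

definition is_basis :: "'v::real_normed_vector set \<Rightarrow> bool" where
  "is_basis B \<longleftrightarrow> finite B \<and> independent B \<and> span B = UNIV"

lemma basis_exists_of_span:
  fixes B :: "'v::real_normed_vector set"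
  assumes "finite B" "span B = UNIV"
  shows "\<exists>B' :: 'v set. is_basis B'"
proof -
  obtain B' where B': "B' \<subseteq> B" "independent B'" "span B' = span B"
    using maximal_independent_subset[of B] by (metis span_superset span_mono span_span subset_antisym order_trans)
  then show ?thesis using assms finite_subset unfolding is_basis_def by blast
qed

text \<open>Equivalence of norms in finite dimension, by induction on the basis: the coefficients
  with respect to \<open>B\<close> are controlled by the norm, so limits of combinations of
  \<open>B\<close> stay in its span and \<open>b\<close> has positive distance from it.\<close>

lemma independent_coefficient_bound:
  fixes B :: "'v::real_normed_vector set"
  assumes "finite B" "independent B"
  shows "\<exists>C\<ge>0. \<forall>t. \<forall>b\<in>B. \<bar>t b\<bar> \<le> C * norm (\<Sum>b\<in>B. t b *\<^sub>R b)"
  using assms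
proof (induction B rule: finite_induct)
  case empty
  then show ?case by (auto intro: exI[of _ 0])
next
  case (insert b B)
  have indB: "independent B" and bn: "b \<notin> span B"
    using insert.prems insert.hyps by (auto simp: independent_insert)
  obtain C where C: "C \<ge> 0" "\<And>t a. a \<in> B \<Longrightarrow> \<bar>t a\<bar> \<le> C * norm (\<Sum>a\<in>B. t a *\<^sub>R a)"
    using insert.IH[OF indB] by blast
  have "\<exists>d>0. \<forall>t. d \<le> norm (b + (\<Sum>a\<in>B. t a *\<^sub>R a))"
  proof (rule ccontr)
    assume "\<not> ?thesis"
    then have "\<forall>n::nat. \<exists>t. norm (b + (\<Sum>a\<in>B. t a *\<^sub>R a)) < 1 / real (Suc n)"
      by (metis not_le of_nat_0_less_iff zero_less_Suc zero_less_divide_1_iff)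
    then obtain t where t: "\<And>n::nat. norm (b + (\<Sum>a\<in>B. t n a *\<^sub>R a)) < 1 / real (Suc n)"
      by metis
    have lim0: "(\<lambda>n. b + (\<Sum>a\<in>B. t n a *\<^sub>R a)) \<longlonglongrightarrow> 0"
      by (rule Lim_null_comparison[where g = "\<lambda>n. 1 / real (Suc n)"])
         (use t in \<open>auto intro!: always_eventually less_imp_le simp del: of_nat_Suc\<close>, real_asymp)
    have "Cauchy (\<lambda>n. t n a)" if a: "a \<in> B" for a
    proof (rule metric_CauchyI)
      fix e :: real assume e: "0 < e"
      have "Cauchy (\<lambda>n. b + (\<Sum>a\<in>B. t n a *\<^sub>R a))"
        using lim0 LIMSEQ_imp_Cauchy by blast
      \<comment> \<open>Dividing by \<open>C + 1\<close> instead of \<open>C\<close> covers the case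
        \<open>C = 0\<close>.\<close>
      then obtain M where M: "\<And>m n. m \<ge> M \<Longrightarrow> n \<ge> M \<Longrightarrow>
         dist (b + (\<Sum>a\<in>B. t m a *\<^sub>R a)) (b + (\<Sum>a\<in>B. t n a *\<^sub>R a)) < e / (C + 1)"
        using metric_CauchyD[of _ "e / (C + 1)"] C(1) e by fastforce
      have "dist (t m a) (t n a) < e" if "m \<ge> M" "n \<ge> M" for m n
      proof -
        have "\<bar>t m a - t n a\<bar> \<le> C * norm (\<Sum>a\<in>B. (t m a - t n a) *\<^sub>R a)"
          using C(2)[OF a, of "\<lambda>a. t m a - t n a"] .
        also have "(\<Sum>a\<in>B. (t m a - t n a) *\<^sub>R a) = (b + (\<Sum>a\<in>B. t m a *\<^sub>R a)) - (b + (\<Sum>a\<in>B. t n a *\<^sub>R a))"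
          by (simp add: scaleR_diff_left sum_subtractf)
        also have "C * norm \<dots> \<le> C * (e / (C + 1))"
          using M[OF that] C(1) by (intro mult_left_mono) (auto simp: dist_norm)
        also have "\<dots> < e" using C(1) e by (simp add: field_simps)
        finally show ?thesis by (simp add: dist_real_def)
      qed
      then show "\<exists>M. \<forall>m\<ge>M. \<forall>n\<ge>M. dist (t m a) (t n a) < e" by blast
    qed
    then have "\<forall>a\<in>B. \<exists>l. (\<lambda>n. t n a) \<longlonglongrightarrow> l"
      using Cauchy_convergent convergent_def by blast
    then obtain l where l: "\<And>a. a \<in> B \<Longrightarrow> (\<lambda>n. t n a) \<longlonglongrightarrow> l a" by metis
    have "(\<lambda>n. b + (\<Sum>a\<in>B. t n a *\<^sub>R a)) \<longlonglongrightarrow> b + (\<Sum>a\<in>B. l a *\<^sub>R a)"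
      by (intro tendsto_intros l)
    then have "b + (\<Sum>a\<in>B. l a *\<^sub>R a) = 0" using lim0 LIMSEQ_unique by blast
    then have "b = - (\<Sum>a\<in>B. l a *\<^sub>R a)" by (simp add: eq_neg_iff_add_eq_0)
    moreover have "- (\<Sum>a\<in>B. l a *\<^sub>R a) \<in> span B" by (intro span_neg span_sum span_scale span_base)
    ultimately show False using bn by simp
  qed
  then obtain d where d: "d > 0" "\<And>t. d \<le> norm (b + (\<Sum>a\<in>B. t a *\<^sub>R a))" by blast
  \<comment> \<open>The first entry bounds the coefficient of \<open>b\<close> through its distance
    \<open>d\<close> from the span of \<open>B\<close>; the second bounds the other coefficients
    after the term of \<open>b\<close> has been subtracted.\<close>
  define D where "D = max (1 / d) (C * (1 + norm b / d))"
  have "\<bar>t x\<bar> \<le> D * norm (\<Sum>a\<in>insert b B. t a *\<^sub>R a)" if x: "x \<in> insert b B" for t x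
  proof -
    let ?w = "\<Sum>a\<in>B. t a *\<^sub>R a" and ?s = "\<Sum>a\<in>insert b B. t a *\<^sub>R a"
    have s: "?s = t b *\<^sub>R b + ?w" using insert.hyps by simp
    have tb: "\<bar>t b\<bar> * d \<le> norm ?s"
    proof (cases "t b = 0")
      case False
      have "d \<le> norm (b + (\<Sum>a\<in>B. (t a / t b) *\<^sub>R a))" by (rule d(2))
      also have "b + (\<Sum>a\<in>B. (t a / t b) *\<^sub>R a) = (1 / t b) *\<^sub>R ?s"
        using False by (simp add: s scaleR_add_right scaleR_sum_right)
      finally have "d \<le> norm ?s / \<bar>t b\<bar>" by simp
      then show ?thesis using False by (simp add: field_simps)
    qed simp
    then have tb': "\<bar>t b\<bar> \<le> norm ?s / d" using d(1) by (simp add: field_simps)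
    show ?thesis
    proof (cases "x = b")
      case True
      have "(1 / d) * norm ?s \<le> D * norm ?s" unfolding D_def by (intro mult_right_mono) auto
      then show ?thesis using tb' True by simp
    next
      case False
      then have "\<bar>t x\<bar> \<le> C * norm ?w" using C(2) x by blast
      also have "norm ?w \<le> norm ?s + \<bar>t b\<bar> * norm b"
        using norm_triangle_ineq4[of ?s "t b *\<^sub>R b"] by (simp add: s)
      also have "\<bar>t b\<bar> * norm b \<le> norm ?s / d * norm b"
        using tb' by (intro mult_right_mono) auto
      finally have "\<bar>t x\<bar> \<le> C * (norm ?s + norm ?s / d * norm b)"
        using C(1) by (simp add: mult_left_mono)
      also have "\<dots> = C * (1 + norm b / d) * norm ?s" by (simp add: algebra_simps)
      also have "\<dots> \<le> D * norm ?s" unfolding D_def by (intro mult_right_mono) auto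
      finally show ?thesis .
    qed
  qed
  moreover have "D \<ge> 0" unfolding D_def using d(1) by (simp add: le_max_iff_disj)
  ultimately show ?case by blast
qed

lemma basis_expansion:
  assumes "is_basis B"
  shows "(\<Sum>b\<in>B. representation B v b *\<^sub>R b) = v"
  using assms by (intro real_vector.sum_representation_eq) (auto simp: is_basis_def)

lemma bounded_linear_representation:
  assumes B: "is_basis B" and b: "b \<in> B"
  shows "bounded_linear (\<lambda>v. representation B v b)"
proof -
  obtain C where C: "\<And>t a. a \<in> B \<Longrightarrow> \<bar>t a\<bar> \<le> C * norm (\<Sum>a\<in>B. t a *\<^sub>R a)"
    using independent_coefficient_bound[of B] B unfolding is_basis_def by blast
  show ?thesis
  proof (rule bounded_linear_intro[where K = C])
    show "representation B (x + y) b = representation B x b + representation B y b" for x y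
      using B by (simp add: is_basis_def real_vector.representation_add)
    show "representation B (r *\<^sub>R x) b = r *\<^sub>R representation B x b" for r x
      using B by (simp add: is_basis_def real_vector.representation_scale)
    show "norm (representation B x b) \<le> norm x * C" for x
      using C[OF b, of "representation B x"] basis_expansion[OF B, of x] by (simp add: mult.commute)
  qed
qed

lemma linear_basis_expansion:
  assumes B: "is_basis B" and L: "linear L"
  shows "L v = (\<Sum>b\<in>B. representation B v b *\<^sub>R L b)"
proof -
  have "L v = L (\<Sum>b\<in>B. representation B v b *\<^sub>R b)" by (simp add: basis_expansion[OF B])
  then show ?thesis by (simp add: linear_sum[OF L] linear_scale[OF L])
qed

lemma linear_imp_bounded_linear:
  fixes L :: "'v::real_normed_vector \<Rightarrow> 'w::real_normed_vector"
  assumes B: "is_basis (B :: 'v set)" and L: "linear L"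
  shows "bounded_linear L"
proof -
  have "bounded_linear (\<lambda>v. \<Sum>b\<in>B. representation B v b *\<^sub>R L b)"
    by (intro bounded_linear_sum bounded_linear_scaleR_const bounded_linear_representation[OF B])
  then show ?thesis by (simp add: linear_basis_expansion[OF B L, symmetric])
qed

text \<open>Expanding the argument in a basis turns continuity at each fixed vector into continuity
  along a varying vector. Tensors evaluated on moving frames are treated this way.\<close>

lemma continuous_on_linear_apply:
  fixes L :: "'a::topological_space \<Rightarrow> 'v::real_normed_vector \<Rightarrow> 'w::real_normed_vector"
  assumes B: "is_basis (B :: 'v set)" and L: "\<And>y. y \<in> S \<Longrightarrow> linear (L y)"
    and c: "\<And>v. continuous_on S (\<lambda>y. L y v)" and w: "continuous_on S w"
  shows "continuous_on S (\<lambda>y. L y (w y))"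
proof -
  have "continuous_on S (\<lambda>y. \<Sum>b\<in>B. representation B (w y) b *\<^sub>R L y b)"
    by (intro continuous_intros c bounded_linear.continuous_on[OF bounded_linear_representation[OF B]] w) 
  then show ?thesis
    by (rule continuous_on_eq) (simp add: linear_basis_expansion[OF B L, symmetric])
qed

lemma is_basis_Times:
  assumes "is_basis (B :: 'v::real_normed_vector set)" "is_basis (C :: 'w::real_normed_vector set)"
  shows "\<exists>D :: ('v \<times> 'w) set. is_basis D"
proof (rule basis_exists_of_span)
  let ?D = "(\<lambda>b. (b, 0)) ` B \<union> (\<lambda>c. (0, c)) ` C"
  show "finite ?D" using assms by (auto simp: is_basis_def)
  have "(v, w) \<in> span ?D" for v w
  proof -
    have "(v, w) = (\<Sum>b\<in>B. representation B v b *\<^sub>R (b, 0::'w)) + (\<Sum>c\<in>C. representation C w c *\<^sub>R (0::'v, c))"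
      using basis_expansion[OF assms(1), of v] basis_expansion[OF assms(2), of w]
      by (simp add: prod_eq_iff fst_sum snd_sum)
    also have "\<dots> \<in> span ?D"
      by (intro span_add span_sum span_scale span_base) auto
    finally show ?thesis .
  qed
  then show "span ?D = UNIV" by auto
qed

lemma is_basis_real: "is_basis {1::real}"
  by (auto simp: is_basis_def span_singleton)

section \<open>Calculus of continuously differentiable maps\<close>

lemma frechet_derivative_eqI: "(f has_derivative D) (at x) \<Longrightarrow> frechet_derivative f (at x) = D"
  using frechet_derivative_at by metis

lemma frechet_derivative_cong_open:
  assumes "open S" "x \<in> S" "\<And>y. y \<in> S \<Longrightarrow> f y = g y" "f differentiable (at x)"
  shows "frechet_derivative f (at x) = frechet_derivative g (at x)"
proof -
  obtain D where D: "(f has_derivative D) (at x)" using assms(4) differentiable_def by blast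
  have "(g has_derivative D) (at x)"
    using has_derivative_transform_within_open[OF D assms(1,2)] assms(3) by auto
  then show ?thesis using D frechet_derivative_eqI by metis
qed

lemma differentiable_cong_open:
  assumes "open S" "x \<in> S" "\<And>y. y \<in> S \<Longrightarrow> f y = g y" "f differentiable (at x)"
  shows "g differentiable (at x)"
  using assms has_derivative_transform_within_open unfolding differentiable_def by metis

lemma Ck_on_cong:
  assumes "open S" "\<And>x. x \<in> S \<Longrightarrow> f x = g x" "Ck_on k S f"
  shows "Ck_on k S g"
  using assms(2,3)
proof (induction k arbitrary: f g)
  case 0
  then show ?case using continuous_on_cong by force
next
  case (Suc k)
  have d: "f differentiable (at x)" if "x \<in> S" for x using Suc.prems that by simp
  have e: "frechet_derivative f (at x) v = frechet_derivative g (at x) v" if "x \<in> S" for x v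
    using frechet_derivative_cong_open[OF assms(1) that Suc.prems(1) d[OF that]] by simp
  show ?case
    using Suc.IH[OF e] Suc.prems differentiable_cong_open[OF assms(1) _ Suc.prems(1) d] by auto
qed

lemma Ck_on_mono: "Ck_on k S f \<Longrightarrow> T \<subseteq> S \<Longrightarrow> Ck_on k T f"
  by (induction k arbitrary: f) (auto intro: continuous_on_subset)

lemma Ck_on_SucD: "Ck_on (Suc k) S f \<Longrightarrow> Ck_on k S f"
proof (induction k arbitrary: f)
  case 0
  then show ?case
    by (auto intro!: continuous_at_imp_continuous_on differentiable_imp_continuous_within)
next
  case (Suc k)
  then show ?case by (metis Ck_on.simps(2))
qed

lemma Ck_on_imp_continuous_on: "Ck_on k S f \<Longrightarrow> continuous_on S f"
  by (induction k) (auto dest: Ck_on_SucD simp del: Ck_on.simps(2))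

lemma Ck_on_local:
  assumes "\<And>x. x \<in> S \<Longrightarrow> \<exists>U. open U \<and> x \<in> U \<and> Ck_on k U f"
  shows "Ck_on k S f"
  using assms
proof (induction k arbitrary: f)
  case 0
  then show ?case
    by (auto intro!: continuous_at_imp_continuous_on) (metis continuous_on_eq_continuous_at)
next
  case (Suc k)
  have "f differentiable (at x)" if "x \<in> S" for x using Suc.prems[OF that] by auto
  moreover have "Ck_on k S (\<lambda>x. frechet_derivative f (at x) v)" for v
    by (rule Suc.IH) (use Suc.prems in fastforce)
  ultimately show ?case by simp
qed

lemma Ck_on_const [simp]: "Ck_on k S (\<lambda>x. a)"
  by (induction k arbitrary: a) auto

text \<open>An explicit derivative \<open>D\<close> may replace the operator
  \<open>frechet_derivative\<close>, so that the closure properties below follow from the usual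
  differentiation rules.\<close>

lemma Ck_on_SucI:
  assumes "open S" "\<And>x. x \<in> S \<Longrightarrow> (f has_derivative D x) (at x)" "\<And>v. Ck_on k S (\<lambda>x. D x v)"
  shows "Ck_on (Suc k) S f"
proof -
  have "Ck_on k S (\<lambda>x. frechet_derivative f (at x) v)" for v
    by (rule Ck_on_cong[OF assms(1) _ assms(3)[of v]]) (simp add: frechet_derivative_eqI[OF assms(2)])
  then show ?thesis using assms(2) by (auto simp: differentiable_def)
qed

lemma Ck_on_SucE:
  assumes "Ck_on (Suc k) S f" "x \<in> S"
  shows "(f has_derivative frechet_derivative f (at x)) (at x)"
  using assms frechet_derivative_works by auto

lemma Ck_on_linear:
  assumes "bounded_linear L" "open S"
  shows "Ck_on k S L"
proof (cases k)
  case 0 then show ?thesis using assms by (simp add: linear_continuous_on)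
next
  case (Suc j)
  have "Ck_on (Suc j) S L"
    by (rule Ck_on_SucI[where D = "\<lambda>_. L"]) (use assms in \<open>auto intro: bounded_linear_imp_has_derivative\<close>)
  then show ?thesis using Suc by simp
qed

lemma Ck_on_linear_comp:
  assumes "bounded_linear L" "open S" "Ck_on k S f"
  shows "Ck_on k S (\<lambda>x. L (f x))"
  using assms(3)
proof (induction k arbitrary: f)
  case 0
  then show ?case using assms bounded_linear.continuous_on by auto
next
  case (Suc k)
  show ?case
    by (rule Ck_on_SucI[OF assms(2), where D = "\<lambda>x v. L (frechet_derivative f (at x) v)"])
       (use Suc Ck_on_SucE[OF Suc.prems] in \<open>auto intro!: bounded_linear.has_derivative[OF assms(1)]\<close>)
qed

lemma Ck_on_add:
  assumes "open S" "Ck_on k S f" "Ck_on k S g"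
  shows "Ck_on k S (\<lambda>x. f x + g x)"
  using assms(2,3)
proof (induction k arbitrary: f g)
  case 0
  then show ?case by (auto intro: continuous_on_add)
next
  case (Suc k)
  show ?case
    by (rule Ck_on_SucI[OF assms(1), where D = "\<lambda>x v. frechet_derivative f (at x) v + frechet_derivative g (at x) v"])
       (use Suc Ck_on_SucE[OF Suc.prems(1)] Ck_on_SucE[OF Suc.prems(2)] in \<open>auto intro!: has_derivative_add\<close>)
qed

lemma Ck_on_sum:
  assumes "open S" "\<And>i. i \<in> I \<Longrightarrow> Ck_on k S (f i)"
  shows "Ck_on k S (\<lambda>x. \<Sum>i\<in>I. f i x)"
  using assms(2) by (induction I rule: infinite_finite_induct) (auto intro: Ck_on_add[OF assms(1)])

lemma Ck_on_bilinear:
  assumes bb: "bounded_bilinear m" and "open S" "Ck_on k S f" "Ck_on k S g"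
  shows "Ck_on k S (\<lambda>x. m (f x) (g x))"
  using assms(3,4)
proof (induction k arbitrary: f g)
  case 0
  then show ?case using bounded_bilinear.continuous_on[OF bb] by auto
next
  case (Suc k)
  show ?case
  proof (rule Ck_on_SucI[OF assms(2), where D = "\<lambda>x v. m (f x) (frechet_derivative g (at x) v) + m (frechet_derivative f (at x) v) (g x)"])
    show "((\<lambda>x. m (f x) (g x)) has_derivative
         (\<lambda>v. m (f x) (frechet_derivative g (at x) v) + m (frechet_derivative f (at x) v) (g x))) (at x)" if "x \<in> S" for x
      by (rule bounded_bilinear.FDERIV[OF bb Ck_on_SucE[OF Suc.prems(1) that] Ck_on_SucE[OF Suc.prems(2) that]])
    show "Ck_on k S (\<lambda>x. m (f x) (frechet_derivative g (at x) v) + m (frechet_derivative f (at x) v) (g x))" for v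
      using Suc Ck_on_SucD[OF Suc.prems(1)] Ck_on_SucD[OF Suc.prems(2)] by (intro Ck_on_add assms) auto
  qed
qed

text \<open>The derivative of \<open>f\<close> is applied to a direction that varies with
  \<open>x\<close>, so the chain rule does not directly produce a composition of the same kind.
  Expanding the direction in a basis of the middle space gives a sum of products to which the
  induction hypothesis applies.\<close>

lemma Ck_on_comp:
  fixes g :: "'u::real_normed_vector \<Rightarrow> 'v::real_normed_vector" and f :: "'v \<Rightarrow> 'w::real_normed_vector"
  assumes B: "is_basis (B :: 'v set)" and "open S" "open T" "Ck_on k T f" "Ck_on k S g" "g ` S \<subseteq> T"
  shows "Ck_on k S (\<lambda>x. f (g x))"
  using assms(4-6)
proof (induction k arbitrary: f g)
  case 0
  then show ?case by (auto intro: continuous_on_compose2)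
next
  case (Suc k)
  have df: "(f has_derivative frechet_derivative f (at (g x))) (at (g x))" if "x \<in> S" for x
    using Ck_on_SucE[OF Suc.prems(1)] Suc.prems(3) that by auto
  have dg: "(g has_derivative frechet_derivative g (at x)) (at x)" if "x \<in> S" for x
    by (rule Ck_on_SucE[OF Suc.prems(2) that])
  show ?case
  proof (rule Ck_on_SucI[OF assms(2), where D = "\<lambda>x v. frechet_derivative f (at (g x)) (frechet_derivative g (at x) v)"])
    show "((\<lambda>x. f (g x)) has_derivative (\<lambda>v. frechet_derivative f (at (g x)) (frechet_derivative g (at x) v))) (at x)"
      if "x \<in> S" for x
      by (rule has_derivative_compose[OF dg[OF that] df[OF that]])
    show "Ck_on k S (\<lambda>x. frechet_derivative f (at (g x)) (frechet_derivative g (at x) v))" for v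
    proof (rule Ck_on_cong[OF assms(2)])
      show "Ck_on k S (\<lambda>x. \<Sum>b\<in>B. representation B (frechet_derivative g (at x) v) b *\<^sub>R frechet_derivative f (at (g x)) b)"
      proof (rule Ck_on_sum[OF assms(2)])
        fix b assume b: "b \<in> B"
        have 1: "Ck_on k T (\<lambda>z. frechet_derivative f (at z) b)"
          and 2: "Ck_on k S (\<lambda>x. frechet_derivative g (at x) v)" using Suc.prems by simp_all
        show "Ck_on k S (\<lambda>x. representation B (frechet_derivative g (at x) v) b *\<^sub>R frechet_derivative f (at (g x)) b)"
          by (rule Ck_on_bilinear[OF bounded_bilinear_scaleR assms(2)
              Ck_on_linear_comp[OF bounded_linear_representation[OF B b] assms(2) 2]
              Suc.IH[OF 1 Ck_on_SucD[OF Suc.prems(2)] Suc.prems(3)]])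
      qed
      show "(\<Sum>b\<in>B. representation B (frechet_derivative g (at x) v) b *\<^sub>R frechet_derivative f (at (g x)) b)
         = frechet_derivative f (at (g x)) (frechet_derivative g (at x) v)" if "x \<in> S" for x
        by (rule linear_basis_expansion[OF B has_derivative_linear[OF df[OF that]], symmetric])
    qed
  qed
qed

lemma Ck_on_Pair:
  assumes "open S" "Ck_on k S f" "Ck_on k S g"
  shows "Ck_on k S (\<lambda>x. (f x, g x))"
proof -
  have "Ck_on k S (\<lambda>x. (f x, 0) + (0, g x))"
    by (intro Ck_on_add assms Ck_on_linear_comp[where L = "\<lambda>x. (x, 0)"] Ck_on_linear_comp[where L = "\<lambda>x. (0, x)"])
       (auto intro!: bounded_linear_Pair bounded_linear_ident bounded_linear_zero)
  then show ?thesis by simp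
qed

lemma Ck_on_real:
  assumes "open S" "\<And>x. x \<in> S \<Longrightarrow> (f has_real_derivative f' x) (at x)" "Ck_on k S f'"
  shows "Ck_on (Suc k) S f"
  by (rule Ck_on_SucI[where D = "\<lambda>x v. f' x * v"])
     (use assms in \<open>auto simp: has_field_derivative_def intro!: Ck_on_bilinear[OF bounded_bilinear_mult]\<close>)

lemma smooth_on_cong: "open S \<Longrightarrow> (\<And>x. x \<in> S \<Longrightarrow> f x = g x) \<Longrightarrow> smooth_on S f \<Longrightarrow> smooth_on S g"
  unfolding smooth_on_def using Ck_on_cong by blast

lemma smooth_on_mono: "smooth_on S f \<Longrightarrow> T \<subseteq> S \<Longrightarrow> smooth_on T f"
  unfolding smooth_on_def using Ck_on_mono by blast

lemma smooth_on_local: "(\<And>x. x \<in> S \<Longrightarrow> \<exists>U. open U \<and> x \<in> U \<and> smooth_on U f) \<Longrightarrow> smooth_on S f"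
  unfolding smooth_on_def by (meson Ck_on_local)

lemma smooth_on_comp:
  fixes g :: "'u::real_normed_vector \<Rightarrow> 'v::real_normed_vector" and f :: "'v \<Rightarrow> 'w::real_normed_vector"
  assumes "is_basis (B :: 'v set)" "open S" "open T" "smooth_on T f" "smooth_on S g" "g ` S \<subseteq> T"
  shows "smooth_on S (\<lambda>x. f (g x))"
  using assms Ck_on_comp unfolding smooth_on_def by blast

lemma smooth_on_has_derivative:
  assumes "smooth_on S f" "x \<in> S"
  shows "(f has_derivative frechet_derivative f (at x)) (at x)"
  using assms Ck_on_SucE unfolding smooth_on_def by blast

lemma smooth_on_derivative: "smooth_on S f \<Longrightarrow> smooth_on S (\<lambda>x. frechet_derivative f (at x) v)"
  unfolding smooth_on_def using Ck_on.simps(2) by blast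

lemma smooth_on_continuous: "smooth_on S f \<Longrightarrow> continuous_on S f"
  unfolding smooth_on_def using Ck_on_imp_continuous_on by blast

lemma smooth_on_Pair: "open S \<Longrightarrow> smooth_on S f \<Longrightarrow> smooth_on S g \<Longrightarrow> smooth_on S (\<lambda>x. (f x, g x))"
  unfolding smooth_on_def using Ck_on_Pair by blast

lemma smooth_on_linear: "bounded_linear L \<Longrightarrow> open S \<Longrightarrow> smooth_on S L"
  unfolding smooth_on_def using Ck_on_linear by blast

lemma smooth_on_linear_comp: "bounded_linear L \<Longrightarrow> open S \<Longrightarrow> smooth_on S f \<Longrightarrow> smooth_on S (\<lambda>x. L (f x))"
  unfolding smooth_on_def using Ck_on_linear_comp by blast

lemma smooth_on_const [simp]: "smooth_on S (\<lambda>x. a)"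
  unfolding smooth_on_def by simp

lemma smooth_on_id: "open S \<Longrightarrow> smooth_on S (\<lambda>x. x)"
  by (rule smooth_on_linear[OF bounded_linear_ident])

lemma smooth_on_fst: "open S \<Longrightarrow> smooth_on S f \<Longrightarrow> smooth_on S (\<lambda>x. fst (f x))"
  by (rule smooth_on_linear_comp[OF bounded_linear_fst])

lemma smooth_on_snd: "open S \<Longrightarrow> smooth_on S f \<Longrightarrow> smooth_on S (\<lambda>x. snd (f x))"
  by (rule smooth_on_linear_comp[OF bounded_linear_snd])

lemma smooth_on_add: "open S \<Longrightarrow> smooth_on S f \<Longrightarrow> smooth_on S g \<Longrightarrow> smooth_on S (\<lambda>x. f x + g x)"
  unfolding smooth_on_def using Ck_on_add by blast

lemma smooth_on_sum: "open S \<Longrightarrow> (\<And>i. i \<in> I \<Longrightarrow> smooth_on S (f i)) \<Longrightarrow> smooth_on S (\<lambda>x. \<Sum>i\<in>I. f i x)"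
  by (simp add: smooth_on_def Ck_on_sum)

lemma smooth_on_mult:
  fixes f g :: "_ \<Rightarrow> real"
  shows "open S \<Longrightarrow> smooth_on S f \<Longrightarrow> smooth_on S g \<Longrightarrow> smooth_on S (\<lambda>x. f x * g x)"
  by (simp add: smooth_on_def Ck_on_bilinear[OF bounded_bilinear_mult])

lemma smooth_on_diff: "open S \<Longrightarrow> smooth_on S f \<Longrightarrow> smooth_on S g \<Longrightarrow> smooth_on S (\<lambda>x. f x - g x)"
  using smooth_on_add[of S f "\<lambda>x. - g x"] smooth_on_linear_comp[of uminus S g]
  by (simp add: bounded_linear_minus[OF bounded_linear_ident])

subsection \<open>Symmetry of second derivatives\<close>

text \<open>The classical proof of Schwarz's theorem: the mean value theorem is applied to the
  second difference, first along \<open>u\<close> and then along \<open>v\<close>.\<close>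

lemma second_difference_mvt:
  fixes f :: "'v::real_normed_vector \<Rightarrow> real"
  assumes f: "Ck_on 2 S f" and t: "0 < t"
    and S: "\<And>a b. 0 \<le> a \<Longrightarrow> a \<le> t \<Longrightarrow> 0 \<le> b \<Longrightarrow> b \<le> t \<Longrightarrow> x + a *\<^sub>R u + b *\<^sub>R v \<in> S"
  shows "\<exists>a b. 0 \<le> a \<and> a \<le> t \<and> 0 \<le> b \<and> b \<le> t \<and>
    f (x + t *\<^sub>R u + t *\<^sub>R v) - f (x + t *\<^sub>R u) - f (x + t *\<^sub>R v) + f x =
    t * t * frechet_derivative (\<lambda>y. frechet_derivative f (at y) u) (at (x + a *\<^sub>R u + b *\<^sub>R v)) v"
proof -
  have f2: "Ck_on (Suc (Suc 0)) S f" using f by (simp add: numeral_2_eq_2)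
  have f1: "Ck_on (Suc 0) S (\<lambda>y. frechet_derivative f (at y) u)" using f2 by (subst (asm) Ck_on.simps) blast
  have df: "((\<lambda>s. f (z + s *\<^sub>R w)) has_real_derivative frechet_derivative f (at (z + s *\<^sub>R w)) w) (at s)"
    if "z + s *\<^sub>R w \<in> S" for z s w
  proof -
    have D: "(f has_derivative frechet_derivative f (at (z + s *\<^sub>R w))) (at (z + s *\<^sub>R w))"
      by (rule Ck_on_SucE[OF f2 that])
    have "((\<lambda>s. f (z + s *\<^sub>R w)) has_derivative (\<lambda>h. frechet_derivative f (at (z + s *\<^sub>R w)) (h *\<^sub>R w))) (at s)"
      by (rule has_derivative_compose[where f = "\<lambda>s. z + s *\<^sub>R w" and g = f, OF _ D]) (auto intro!: derivative_eq_intros)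
    then show ?thesis
      by (simp add: has_field_derivative_def linear_scale[OF has_derivative_linear[OF D]] mult.commute[of _ "frechet_derivative _ _ _"])
  qed
  have df1: "((\<lambda>s. frechet_derivative f (at (z + s *\<^sub>R v)) u) has_real_derivative
       frechet_derivative (\<lambda>y. frechet_derivative f (at y) u) (at (z + s *\<^sub>R v)) v) (at s)"
    if "z + s *\<^sub>R v \<in> S" for z s
  proof -
    have D: "((\<lambda>y. frechet_derivative f (at y) u) has_derivative
       frechet_derivative (\<lambda>y. frechet_derivative f (at y) u) (at (z + s *\<^sub>R v))) (at (z + s *\<^sub>R v))"
      by (rule Ck_on_SucE[OF f1 that])
    have "((\<lambda>s. frechet_derivative f (at (z + s *\<^sub>R v)) u) has_derivative
       (\<lambda>h. frechet_derivative (\<lambda>y. frechet_derivative f (at y) u) (at (z + s *\<^sub>R v)) (h *\<^sub>R v))) (at s)"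
      by (rule has_derivative_compose[where f = "\<lambda>s. z + s *\<^sub>R v" and g = "\<lambda>y. frechet_derivative f (at y) u", OF _ D]) (auto intro!: derivative_eq_intros)
    then show ?thesis
      by (simp add: has_field_derivative_def linear_scale[OF has_derivative_linear[OF D]] mult.commute[of _ "frechet_derivative _ _ _"])
  qed
  have "\<exists>a. 0 < a \<and> a < t \<and> (f (x + t *\<^sub>R u + t *\<^sub>R v) - f (x + t *\<^sub>R u)) - (f (x + 0 *\<^sub>R u + t *\<^sub>R v) - f (x + 0 *\<^sub>R u)) =
     (t - 0) * (frechet_derivative f (at (x + a *\<^sub>R u + t *\<^sub>R v)) u - frechet_derivative f (at (x + a *\<^sub>R u)) u)"
  proof (rule MVT2[OF t])
    fix s assume s: "0 \<le> s" "s \<le> t"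
    have 1: "x + t *\<^sub>R v + s *\<^sub>R u \<in> S" using S[of s t] s t by (simp add: algebra_simps)
    have 2: "x + s *\<^sub>R u \<in> S" using S[of s 0] s t by simp
    show "((\<lambda>s. f (x + s *\<^sub>R u + t *\<^sub>R v) - f (x + s *\<^sub>R u)) has_real_derivative
        frechet_derivative f (at (x + s *\<^sub>R u + t *\<^sub>R v)) u - frechet_derivative f (at (x + s *\<^sub>R u)) u) (at s)"
      using DERIV_diff[OF df[OF 1] df[OF 2]] by (simp add: algebra_simps)
  qed
  then obtain a where a: "0 < a" "a < t" "f (x + t *\<^sub>R u + t *\<^sub>R v) - f (x + t *\<^sub>R u) - f (x + t *\<^sub>R v) + f x =
     t * (frechet_derivative f (at (x + a *\<^sub>R u + t *\<^sub>R v)) u - frechet_derivative f (at (x + a *\<^sub>R u)) u)" by auto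
  have "\<exists>b. 0 < b \<and> b < t \<and> frechet_derivative f (at (x + a *\<^sub>R u + t *\<^sub>R v)) u - frechet_derivative f (at (x + a *\<^sub>R u + 0 *\<^sub>R v)) u
     = (t - 0) * frechet_derivative (\<lambda>y. frechet_derivative f (at y) u) (at (x + a *\<^sub>R u + b *\<^sub>R v)) v"
    by (rule MVT2[OF t]) (use a S in \<open>auto intro!: df1\<close>)
  then obtain b where b: "0 < b" "b < t" "frechet_derivative f (at (x + a *\<^sub>R u + t *\<^sub>R v)) u - frechet_derivative f (at (x + a *\<^sub>R u)) u
     = t * frechet_derivative (\<lambda>y. frechet_derivative f (at y) u) (at (x + a *\<^sub>R u + b *\<^sub>R v)) v" by auto
  show ?thesis using a b by (intro exI[of _ a] exI[of _ b]) simp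
qed

text \<open>The second difference is symmetric in \<open>u\<close> and \<open>v\<close>, so at each
  scale both mixed derivatives take a common value at points close to \<open>x\<close>; continuity
  carries the equality to \<open>x\<close>.\<close>

lemma second_derivative_symmetric_real:
  fixes f :: "'v::real_normed_vector \<Rightarrow> real"
  assumes S: "open S" "x \<in> S" and f: "Ck_on 2 S f"
  shows "frechet_derivative (\<lambda>y. frechet_derivative f (at y) u) (at x) v =
         frechet_derivative (\<lambda>y. frechet_derivative f (at y) v) (at x) u"
proof -
  let ?F = "\<lambda>u v y. frechet_derivative (\<lambda>y. frechet_derivative f (at y) u) (at y) v"
  have c: "continuous_on S (?F u v)" for u v
    using f by (simp add: numeral_2_eq_2)
  then have cx: "isCont (?F u v) x" for u v
    using S continuous_on_eq_continuous_at by blast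
  define p where "p = (\<lambda>(a::real) b. x + a *\<^sub>R u + b *\<^sub>R v)"
  obtain r where r: "r > 0" "ball x r \<subseteq> S" using S openE by blast
  \<comment> \<open>Points \<open>p a b\<close> with parameters below \<open>q\<close> lie in the
    ball of radius \<open>r\<close>; the summand 1 keeps the denominator positive when both
    directions vanish.\<close>
  define q where "q = r / (norm u + norm v + 1)"
  have nn: "norm u + norm v + 1 > 0" by (smt (verit) norm_ge_zero)
  have q: "q > 0" unfolding q_def using r nn by simp
  have near: "norm (p a b - x) \<le> t * (norm u + norm v)" if "0 \<le> a" "a \<le> t" "0 \<le> b" "b \<le> t" for a b t
  proof -
    have "norm (p a b - x) \<le> norm (a *\<^sub>R u) + norm (b *\<^sub>R v)" unfolding p_def
      using norm_triangle_ineq[of "a *\<^sub>R u" "b *\<^sub>R v"] by (simp add: algebra_simps)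
    also have "\<dots> \<le> t * norm u + t * norm v" using that by (auto intro!: add_mono mult_right_mono)
    finally show ?thesis by (simp add: algebra_simps)
  qed
  \<comment> \<open>The shift by 2 keeps \<open>t n\<close> strictly below \<open>q\<close> also at
    \<open>n = 0\<close>.\<close>
  define t where "t = (\<lambda>n. q / real (n + 2))"
  have t: "0 < t n" "t n < q" for n unfolding t_def using q by (auto simp: field_simps add_pos_nonneg)
  have inS: "p a b \<in> S" if "0 \<le> a" "a \<le> t n" "0 \<le> b" "b \<le> t n" for a b n
  proof -
    have "norm (p a b - x) \<le> t n * (norm u + norm v)" by (rule near[OF that])
    also have "\<dots> \<le> t n * (norm u + norm v + 1)" using t[of n] by (intro mult_left_mono) auto
    also have "\<dots> < q * (norm u + norm v + 1)" using t nn by (intro mult_strict_right_mono) auto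
    also have "\<dots> = r" unfolding q_def using nn by simp
    finally show ?thesis using r by (auto simp: dist_norm norm_minus_commute)
  qed
  have "\<exists>a b a' b'. 0 \<le> a \<and> a \<le> t n \<and> 0 \<le> b \<and> b \<le> t n \<and> 0 \<le> a' \<and> a' \<le> t n \<and> 0 \<le> b' \<and> b' \<le> t n \<and>
      ?F u v (p a b) = ?F v u (p a' b')" for n
  proof -
    obtain a b where ab: "0 \<le> a" "a \<le> t n" "0 \<le> b" "b \<le> t n"
      "f (x + t n *\<^sub>R u + t n *\<^sub>R v) - f (x + t n *\<^sub>R u) - f (x + t n *\<^sub>R v) + f x = t n * t n * ?F u v (p a b)"
      using second_difference_mvt[OF f t(1)[of n], of x u v] inS[of _ n] unfolding p_def by blast
    have "\<exists>b' a'. 0 \<le> b' \<and> b' \<le> t n \<and> 0 \<le> a' \<and> a' \<le> t n \<and>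
      f (x + t n *\<^sub>R v + t n *\<^sub>R u) - f (x + t n *\<^sub>R v) - f (x + t n *\<^sub>R u) + f x =
      t n * t n * ?F v u (x + b' *\<^sub>R v + a' *\<^sub>R u)"
      by (rule second_difference_mvt[OF f t(1)[of n]])
         (use inS[of _ n] in \<open>simp add: p_def add.assoc add.commute[of "_ *\<^sub>R v"]\<close>)
    then obtain b' a' where ab': "0 \<le> b'" "b' \<le> t n" "0 \<le> a'" "a' \<le> t n"
      "f (x + t n *\<^sub>R v + t n *\<^sub>R u) - f (x + t n *\<^sub>R v) - f (x + t n *\<^sub>R u) + f x =
      t n * t n * ?F v u (x + b' *\<^sub>R v + a' *\<^sub>R u)" by blast
    have e: "x + b' *\<^sub>R v + a' *\<^sub>R u = p a' b'" "x + t n *\<^sub>R v + t n *\<^sub>R u = x + t n *\<^sub>R u + t n *\<^sub>R v"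
      by (auto simp: p_def algebra_simps)
    have "t n * t n * ?F u v (p a b) = t n * t n * ?F v u (p a' b')"
      using ab(5) ab'(5) unfolding e by linarith
    then have "?F u v (p a b) = ?F v u (p a' b')" using t(1)[of n] by simp
    then show ?thesis using ab ab' by blast
  qed
  then obtain a b a' b' where ab: "\<And>n. 0 \<le> a n" "\<And>n. a n \<le> t n" "\<And>n. 0 \<le> b n" "\<And>n. b n \<le> t n"
      "\<And>n. 0 \<le> a' n" "\<And>n. a' n \<le> t n" "\<And>n. 0 \<le> b' n" "\<And>n. b' n \<le> t n"
     and eq: "\<And>n. ?F u v (p (a n) (b n)) = ?F v u (p (a' n) (b' n))"
    by metis
  have t0: "t \<longlonglongrightarrow> 0" unfolding t_def by real_asymp
  have lim: "(\<lambda>n. p (a n) (b n)) \<longlonglongrightarrow> x" if "\<And>n. 0 \<le> a n" "\<And>n. a n \<le> t n" "\<And>n. 0 \<le> b n" "\<And>n. b n \<le> t n" for a b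
  proof -
    have "(\<lambda>n. p (a n) (b n) - x) \<longlonglongrightarrow> 0"
    proof (rule Lim_null_comparison[where g = "\<lambda>n. t n * (norm u + norm v)"])
      show "\<forall>\<^sub>F n in sequentially. norm (p (a n) (b n) - x) \<le> t n * (norm u + norm v)"
        by (rule always_eventually, rule allI, rule near[OF that])
      show "(\<lambda>n. t n * (norm u + norm v)) \<longlonglongrightarrow> 0" using tendsto_mult_left_zero[OF t0] .
    qed
    then show ?thesis by (rule LIM_zero_cancel)
  qed
  have "(\<lambda>n. ?F u v (p (a n) (b n))) \<longlonglongrightarrow> ?F u v x"
    by (rule isCont_tendsto_compose[OF cx lim]) (fact ab)+
  moreover have "(\<lambda>n. ?F v u (p (a' n) (b' n))) \<longlonglongrightarrow> ?F v u x"
    by (rule isCont_tendsto_compose[OF cx lim]) (fact ab)+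
  ultimately show ?thesis unfolding eq by (rule LIMSEQ_unique)
qed

text \<open>Coordinates with respect to \<open>B\<close> reduce this to real-valued
  functions.\<close>

lemma second_derivative_symmetric:
  fixes f :: "'v::real_normed_vector \<Rightarrow> 'w::real_normed_vector"
  assumes B: "is_basis (B :: 'w set)" and S: "open S" "x \<in> S" and f: "Ck_on 2 S f"
  shows "frechet_derivative (\<lambda>y. frechet_derivative f (at y) u) (at x) v =
         frechet_derivative (\<lambda>y. frechet_derivative f (at y) v) (at x) u"
proof -
  let ?F = "\<lambda>u v. frechet_derivative (\<lambda>y. frechet_derivative f (at y) u) (at x) v"
  have "representation B (?F u v) b = representation B (?F v u) b" if b: "b \<in> B" for b
  proof -
    let ?r = "\<lambda>v. representation B v b"
    have bl: "bounded_linear ?r" by (rule bounded_linear_representation[OF B b])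
    have f2: "Ck_on (Suc (Suc 0)) S f" using f by (simp add: numeral_2_eq_2)
    have f1: "Ck_on (Suc 0) S (\<lambda>y. frechet_derivative f (at y) u)" for u using f2 by (subst (asm) Ck_on.simps) blast
    have 1: "frechet_derivative (\<lambda>y. ?r (f y)) (at y) u = ?r (frechet_derivative f (at y) u)" if "y \<in> S" for y u
      using frechet_derivative_eqI[OF bounded_linear.has_derivative[OF bl Ck_on_SucE[OF f2 that]]] by metis
    have 2: "frechet_derivative (\<lambda>y. frechet_derivative (\<lambda>y. ?r (f y)) (at y) u) (at x) v = ?r (?F u v)" for u v
    proof -
      have "((\<lambda>y. ?r (frechet_derivative f (at y) u)) has_derivative (\<lambda>v. ?r (?F u v))) (at x)"
        by (rule bounded_linear.has_derivative[OF bl Ck_on_SucE[OF f1 S(2)]])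
      then have "((\<lambda>y. frechet_derivative (\<lambda>y. ?r (f y)) (at y) u) has_derivative (\<lambda>v. ?r (?F u v))) (at x)"
        using has_derivative_transform_within_open[OF _ S] 1 by force
      then show ?thesis using frechet_derivative_eqI by metis
    qed
    show ?thesis
      using second_derivative_symmetric_real[OF S Ck_on_linear_comp[OF bl S(1) f], of u v] unfolding 2 .
  qed
  then have e: "(\<Sum>b\<in>B. representation B (?F u v) b *\<^sub>R b) = (\<Sum>b\<in>B. representation B (?F v u) b *\<^sub>R b)"
    by (intro sum.cong) simp_all
  have "?F u v = (\<Sum>b\<in>B. representation B (?F u v) b *\<^sub>R b)" by (rule basis_expansion[OF B, symmetric])
  also note e
  also have "(\<Sum>b\<in>B. representation B (?F v u) b *\<^sub>R b) = ?F v u" by (rule basis_expansion[OF B])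
  finally show ?thesis .
qed

subsection \<open>A smooth cut-off function\<close>

text \<open>For \<open>k = 0\<close> this is the standard smooth function that is flat at 0. The
  negative powers are included so that the family is closed under differentiation up to linear
  combinations.\<close>

definition flat :: "nat \<Rightarrow> real \<Rightarrow> real" where
  "flat k x = (if x > 0 then exp (- 1 / x) / x ^ k else 0)"

lemma flat_tendsto_0: "((\<lambda>x. exp (- 1 / x) / x ^ k) \<longlongrightarrow> (0::real)) (at_right 0)"
proof -
  have "((\<lambda>x::real. inverse x ^ k / exp (inverse x)) \<longlongrightarrow> 0) (at_right 0)"
    by (rule filterlim_compose[OF tendsto_power_div_exp_0 filterlim_inverse_at_top_right])
  moreover have "inverse x ^ k / exp (inverse x) = exp (- 1 / x) / x ^ k" for x :: real
    by (simp add: exp_minus divide_inverse power_inverse)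
  ultimately show ?thesis by simp
qed

lemma flat_tendsto: "(flat k \<longlongrightarrow> 0) (at 0)"
proof -
  have "(flat k \<longlongrightarrow> 0) (at_right 0)"
  proof (rule Lim_transform_eventually[OF flat_tendsto_0[of k]])
    show "\<forall>\<^sub>F x in at_right 0. exp (- 1 / x) / x ^ k = flat k x"
      unfolding eventually_at_right_field by (rule exI[of _ 1]) (simp add: flat_def)
  qed
  moreover have "(flat k \<longlongrightarrow> 0) (at_left 0)"
  proof (rule Lim_transform_eventually[OF tendsto_const])
    show "\<forall>\<^sub>F x in at_left 0. 0 = flat k x"
      unfolding eventually_at_left_field by (rule exI[of _ "-1"]) (simp add: flat_def)
  qed
  ultimately show ?thesis using filterlim_split_at by blast
qed

text \<open>At 0 the difference quotient of \<open>flat k\<close> is \<open>flat (Suc k)\<close>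
  itself, which tends to 0; elsewhere the quotient rule applies.\<close>

lemma flat_has_derivative: "(flat k has_real_derivative flat (k + 2) x - k * flat (k + 1) x) (at x)"
proof -
  consider "x > 0" | "x = 0" | "x < 0" by linarith
  then show ?thesis
  proof cases
    case 1
    have "((\<lambda>x. exp (- 1 / x) / x ^ k) has_real_derivative
       ((exp (- 1 / x) * (1 / x ^ 2)) * x ^ k - exp (- 1 / x) * (k * x ^ (k - 1))) / (x ^ k * x ^ k)) (at x)"
      using 1 by (auto intro!: derivative_eq_intros simp: power2_eq_square divide_simps)
    moreover have "((exp (- 1 / x) * (1 / x ^ 2)) * x ^ k - exp (- 1 / x) * (k * x ^ (k - 1))) / (x ^ k * x ^ k)
       = flat (k + 2) x - k * flat (k + 1) x"
      using 1 by (cases k) (simp_all add: flat_def field_simps power2_eq_square)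
    ultimately have "((\<lambda>x. exp (- 1 / x) / x ^ k) has_real_derivative flat (k + 2) x - k * flat (k + 1) x) (at x)"
      by simp
    then have d: "((\<lambda>x. exp (- 1 / x) / x ^ k) has_derivative (\<lambda>h. (flat (k + 2) x - k * flat (k + 1) x) * h)) (at x)"
      by (simp add: has_field_derivative_def)
    have "(flat k has_derivative (\<lambda>h. (flat (k + 2) x - k * flat (k + 1) x) * h)) (at x)"
      by (rule has_derivative_transform_within_open[OF d, of "{0<..}"]) (use 1 in \<open>auto simp: flat_def\<close>)
    then show ?thesis by (simp add: has_field_derivative_def)
  next
    case 2
    have "((\<lambda>h. (flat k (0 + h) - flat k 0) / h) \<longlongrightarrow> 0) (at 0)"
    proof (rule Lim_transform_eventually[OF flat_tendsto[of "Suc k"]])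
      show "\<forall>\<^sub>F x in at 0. flat (Suc k) x = (flat k (0 + x) - flat k 0) / x"
        unfolding eventually_at by (rule exI[of _ 1]) (simp add: flat_def)
    qed
    then show ?thesis using 2 by (simp add: DERIV_def flat_def)
  next
    case 3
    have d: "((\<lambda>x. 0) has_derivative (\<lambda>h. (flat (k + 2) x - k * flat (k + 1) x) * h)) (at x)"
      using 3 by (simp add: flat_def)
    have "(flat k has_derivative (\<lambda>h. (flat (k + 2) x - k * flat (k + 1) x) * h)) (at x)"
      by (rule has_derivative_transform_within_open[OF d, of "{..<0}"]) (use 3 in \<open>auto simp: flat_def\<close>)
    then show ?thesis by (simp add: has_field_derivative_def)
  qed
qed

lemma Ck_on_flat: "Ck_on j UNIV (flat k)"
proof (induction j arbitrary: k)
  case 0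
  have "isCont (flat k) x" for x using flat_has_derivative DERIV_isCont by blast
  then show ?case by (simp add: continuous_at_imp_continuous_on)
next
  case (Suc j)
  have "Ck_on j UNIV (\<lambda>x. flat (k + 2) x + (- real k) *\<^sub>R flat (k + 1) x)"
    by (intro Ck_on_add Ck_on_linear_comp[OF bounded_linear_scaleR_right] Suc) auto
  then show ?case by (intro Ck_on_real[OF _ flat_has_derivative]) auto
qed

lemma smooth_on_flat: "smooth_on UNIV (flat k)"
  by (simp add: smooth_on_def Ck_on_flat)

lemma smooth_on_inverse: "smooth_on {0<..} (inverse :: real \<Rightarrow> real)"
proof -
  have "Ck_on k {0<..} (inverse :: real \<Rightarrow> real)" for k
  proof (induction k)
    case (Suc k)
    have "Ck_on k {0<..} (\<lambda>x::real. - (inverse x * inverse x))"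
      by (intro Ck_on_linear_comp[where L = uminus] Ck_on_bilinear[OF bounded_bilinear_mult] Suc bounded_linear_minus bounded_linear_ident) auto
    then show ?case by (intro Ck_on_real) (auto intro!: derivative_eq_intros)
  qed (auto intro!: continuous_intros)
  then show ?thesis by (simp add: smooth_on_def)
qed

section \<open>Charts, smooth maps and their differentials\<close>

text \<open>The atlas of the associated bundle is not known to satisfy the topological axioms of a
  manifold; the following part of the axioms suffices for calculus.\<close>

definition charted :: "('a, 'v::real_normed_vector, 'z) mfd_scheme \<Rightarrow> bool" where
  "charted M \<longleftrightarrow>
     (\<exists>B :: 'v set. is_basis B) \<and>
     (\<forall>c\<in>atlas M. fst c \<subseteq> pts M \<and> inj_on (snd c) (fst c) \<and> open (snd c ` fst c)) \<and>
     pts M = (\<Union>c\<in>atlas M. fst c) \<and>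
     (\<forall>c\<in>atlas M. \<forall>d\<in>atlas M. open (snd c ` (fst c \<inter> fst d)) \<and>
        smooth_on (snd c ` (fst c \<inter> fst d)) (snd d \<circ> cinv c))"

lemma is_manifold_charted: "is_manifold M \<Longrightarrow> charted M"
  unfolding is_manifold_def charted_def using basis_exists_of_span by auto

lemma charted_basis:
  fixes M :: "('a, 'v::real_normed_vector, 'z) mfd_scheme"
  assumes "charted M" obtains B :: "'v set" where "is_basis B"
  using assms unfolding charted_def by blast

lemma cinv_snd [simp]: "inj_on (snd c) (fst c) \<Longrightarrow> p \<in> fst c \<Longrightarrow> cinv c (snd c p) = p"
  by (simp add: cinv_def)

lemma cinv_in: "y \<in> snd c ` fst c \<Longrightarrow> cinv c y \<in> fst c"
  by (simp add: cinv_def inv_into_into)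

lemma snd_cinv: "y \<in> snd c ` fst c \<Longrightarrow> snd c (cinv c y) = y"
  by (simp add: cinv_def f_inv_into_f)

section \<open>The topology defined by the charts\<close>

context
  fixes M :: "('a, 'v::real_normed_vector, 'z) mfd_scheme"
  assumes M: "charted M"
begin

lemma chart_inj: "c \<in> atlas M \<Longrightarrow> inj_on (snd c) (fst c)"
  and chart_sub: "c \<in> atlas M \<Longrightarrow> fst c \<subseteq> pts M"
  and chart_image_open: "c \<in> atlas M \<Longrightarrow> open (snd c ` fst c)"
  and overlap_open: "c \<in> atlas M \<Longrightarrow> d \<in> atlas M \<Longrightarrow> open (snd c ` (fst c \<inter> fst d))"
  and transition_smooth: "c \<in> atlas M \<Longrightarrow> d \<in> atlas M \<Longrightarrow> smooth_on (snd c ` (fst c \<inter> fst d)) (snd d \<circ> cinv c)"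
  and pts_charts: "pts M = (\<Union>c\<in>atlas M. fst c)"
  using M unfolding charted_def by auto

lemma chart_at_props: assumes "p \<in> pts M" shows "chart_at M p \<in> atlas M" "p \<in> fst (chart_at M p)"
proof -
  have "\<exists>c. c \<in> atlas M \<and> p \<in> fst c" using assms pts_charts by blast
  then have "chart_at M p \<in> atlas M \<and> p \<in> fst (chart_at M p)" unfolding chart_at_def by (rule someI_ex)
  then show "chart_at M p \<in> atlas M" "p \<in> fst (chart_at M p)" by auto
qed

lemma istopology_mtop: "istopology (\<lambda>W. W \<subseteq> pts M \<and> (\<forall>c\<in>atlas M. open (snd c ` (W \<inter> fst c))))"
  unfolding istopology_def
proof (intro conjI allI impI ballI)
  fix S T c assume S: "S \<subseteq> pts M \<and> (\<forall>c\<in>atlas M. open (snd c ` (S \<inter> fst c)))"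
    and T: "T \<subseteq> pts M \<and> (\<forall>c\<in>atlas M. open (snd c ` (T \<inter> fst c)))" and c: "c \<in> atlas M"
  have "snd c ` (S \<inter> T \<inter> fst c) = snd c ` (S \<inter> fst c) \<inter> snd c ` (T \<inter> fst c)"
    using chart_inj[OF c] by (auto simp: inj_on_def)
  then show "open (snd c ` (S \<inter> T \<inter> fst c))" using S T c by auto
next
  fix \<K> c assume K: "\<forall>K\<in>\<K>. K \<subseteq> pts M \<and> (\<forall>c\<in>atlas M. open (snd c ` (K \<inter> fst c)))" and c: "c \<in> atlas M"
  have "snd c ` (\<Union>\<K> \<inter> fst c) = (\<Union>K\<in>\<K>. snd c ` (K \<inter> fst c))" by auto
  then show "open (snd c ` (\<Union>\<K> \<inter> fst c))" using K c by auto
qed auto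

lemma openin_mtop: "openin (mtop M) W \<longleftrightarrow> W \<subseteq> pts M \<and> (\<forall>c\<in>atlas M. open (snd c ` (W \<inter> fst c)))"
  unfolding mtop_def by (subst topology_inverse'[OF istopology_mtop]) simp

lemma openin_pts: "openin (mtop M) (pts M)"
  unfolding openin_mtop using chart_sub chart_image_open by (metis Int_absorb1 order_refl)

lemma topspace_mtop: "topspace (mtop M) = pts M"
  using openin_pts openin_mtop by (metis openin_subset openin_topspace subset_antisym)

lemma openin_chart: assumes c: "c \<in> atlas M" and V: "open V" shows "openin (mtop M) {p \<in> fst c. snd c p \<in> V}"
  unfolding openin_mtop
proof (intro conjI ballI)
  show "{p \<in> fst c. snd c p \<in> V} \<subseteq> pts M" using chart_sub[OF c] by auto
  fix d assume d: "d \<in> atlas M"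
  have "continuous_on (snd d ` (fst d \<inter> fst c)) (snd c \<circ> cinv d)"
    using transition_smooth[OF d c] smooth_on_continuous by blast
  then have "open (snd d ` (fst d \<inter> fst c) \<inter> (snd c \<circ> cinv d) -` V)"
    using continuous_open_preimage[OF _ overlap_open[OF d c] V] by blast
  also have "snd d ` (fst d \<inter> fst c) \<inter> (snd c \<circ> cinv d) -` V = snd d ` ({p \<in> fst c. snd c p \<in> V} \<inter> fst d)"
    using chart_inj[OF d] by auto
  finally show "open (snd d ` ({p \<in> fst c. snd c p \<in> V} \<inter> fst d))" .
qed

lemma openin_chart_dom: "c \<in> atlas M \<Longrightarrow> openin (mtop M) (fst c)"
  using openin_chart[of c UNIV] by simp

text \<open>The topology asks for openness in every chart. One chart around each point suffices,
  because transition maps are continuous.\<close>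

lemma openin_mtopI:
  assumes "\<And>p. p \<in> W \<Longrightarrow> \<exists>c V. c \<in> atlas M \<and> p \<in> fst c \<and> open V \<and> snd c p \<in> V \<and> V \<subseteq> snd c ` fst c \<and> cinv c ` V \<subseteq> W"
  shows "openin (mtop M) W"
proof (subst openin_subopen, intro ballI)
  fix p assume p: "p \<in> W"
  then obtain c V where c: "c \<in> atlas M" "p \<in> fst c" "open V" "snd c p \<in> V" "V \<subseteq> snd c ` fst c" "cinv c ` V \<subseteq> W"
    using assms[OF p] by blast
  have "{p \<in> fst c. snd c p \<in> V} \<subseteq> W"
  proof
    fix q assume "q \<in> {p \<in> fst c. snd c p \<in> V}"
    then have "q \<in> fst c" "cinv c (snd c q) \<in> W" using c(6) by blast+
    then show "q \<in> W" using chart_inj[OF c(1)] by simp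
  qed
  then show "\<exists>T. openin (mtop M) T \<and> p \<in> T \<and> T \<subseteq> W"
    using openin_chart[OF c(1,3)] c by blast
qed

end

text \<open>The pointwise version of \<open>smooth_map\<close>, meant for local objects such as
  sections over a trivialising set. The neighbourhood \<open>V\<close>, mapped into the domain of
  \<open>d\<close>, carries the continuity that \<open>smooth_map\<close> expresses by openness of
  preimages.\<close>

definition smooth_at :: "('a, 'v::real_normed_vector, 'y) mfd_scheme \<Rightarrow> ('b, 'w::real_normed_vector, 'z) mfd_scheme
     \<Rightarrow> ('a \<Rightarrow> 'b) \<Rightarrow> 'a \<Rightarrow> bool" where
  "smooth_at M N f p \<longleftrightarrow> (\<forall>c\<in>atlas M. \<forall>d\<in>atlas N. p \<in> fst c \<longrightarrow> f p \<in> fst d \<longrightarrow>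
     (\<exists>V. open V \<and> snd c p \<in> V \<and> V \<subseteq> snd c ` fst c \<and> (\<forall>y\<in>V. f (cinv c y) \<in> fst d) \<and>
        smooth_on V (\<lambda>y. snd d (f (cinv c y)))))"

lemma smooth_atD:
  assumes "smooth_at M N f p" "c \<in> atlas M" "d \<in> atlas N" "p \<in> fst c" "f p \<in> fst d"
  shows "\<exists>V. open V \<and> snd c p \<in> V \<and> V \<subseteq> snd c ` fst c \<and> (\<forall>y\<in>V. f (cinv c y) \<in> fst d) \<and>
        smooth_on V (\<lambda>y. snd d (f (cinv c y)))"
  using assms unfolding smooth_at_def by blast

lemma smooth_map_smooth_at:
  assumes f: "smooth_map M N f" and inj: "\<And>c. c \<in> atlas M \<Longrightarrow> inj_on (snd c) (fst c)"
  shows "smooth_at M N f p"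
  unfolding smooth_at_def
proof (intro ballI impI)
  fix c d assume c: "c \<in> atlas M" and d: "d \<in> atlas N" and p: "p \<in> fst c" "f p \<in> fst d"
  let ?V = "snd c ` (fst c \<inter> f -` fst d)"
  have "open ?V" "smooth_on ?V (\<lambda>y. snd d (f (cinv c y)))"
    using f c d unfolding smooth_map_def by (auto simp: comp_def)
  moreover have "f (cinv c y) \<in> fst d" if "y \<in> ?V" for y using that inj[OF c] by auto
  ultimately show "\<exists>V. open V \<and> snd c p \<in> V \<and> V \<subseteq> snd c ` fst c \<and> (\<forall>y\<in>V. f (cinv c y) \<in> fst d) \<and>
        smooth_on V (\<lambda>y. snd d (f (cinv c y)))"
    using p by (intro exI[of _ ?V]) auto
qed

lemma smooth_at_comp:
  fixes N :: "('b, 'w::real_normed_vector, 'z) mfd_scheme"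
  assumes M: "charted M" and N: "charted N" and f: "smooth_at M N f p" and g: "smooth_at N P g (f p)" and fp: "f p \<in> pts N"
  shows "smooth_at M P (\<lambda>x. g (f x)) p"
  unfolding smooth_at_def
proof (intro ballI impI)
  fix c e assume c: "c \<in> atlas M" and e: "e \<in> atlas P" and p: "p \<in> fst c" "g (f p) \<in> fst e"
  define d where "d = chart_at N (f p)"
  have d: "d \<in> atlas N" "f p \<in> fst d" using chart_at_props[OF N fp] by (auto simp: d_def)
  obtain B :: "'w set" where B: "is_basis B" using charted_basis[OF N] .
  obtain V1 where V1: "open V1" "snd c p \<in> V1" "V1 \<subseteq> snd c ` fst c" "\<And>y. y \<in> V1 \<Longrightarrow> f (cinv c y) \<in> fst d"
    "smooth_on V1 (\<lambda>y. snd d (f (cinv c y)))"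
    using smooth_atD[OF f c d(1) p(1) d(2)] by (elim exE conjE) (rule that, auto)
  obtain V2 where V2: "open V2" "snd d (f p) \<in> V2" "V2 \<subseteq> snd d ` fst d" "\<And>y. y \<in> V2 \<Longrightarrow> g (cinv d y) \<in> fst e"
    "smooth_on V2 (\<lambda>y. snd e (g (cinv d y)))"
    using smooth_atD[OF g d(1) e d(2) p(2)] by (elim exE conjE) (rule that, auto)
  define V where "V = V1 \<inter> (\<lambda>y. snd d (f (cinv c y))) -` V2"
  have oV: "open V" unfolding V_def
    using continuous_open_preimage[OF smooth_on_continuous[OF V1(5)] V1(1) V2(1)] .
  have ci: "cinv c (snd c p) = p" using chart_inj[OF M c] p by simp
  have k: "cinv d (snd d (f (cinv c y))) = f (cinv c y)" if "y \<in> V" for y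
    using V1(4) that chart_inj[OF N d(1)] by (auto simp: V_def)
  have "smooth_on V (\<lambda>y. snd e (g (cinv d (snd d (f (cinv c y))))))"
    by (rule smooth_on_comp[OF B oV V2(1) V2(5) smooth_on_mono[OF V1(5)]]) (auto simp: V_def)
  then have "smooth_on V (\<lambda>y. snd e (g (f (cinv c y))))"
    by (rule smooth_on_cong[OF oV, rotated]) (simp add: k)
  moreover have "snd c p \<in> V" using V1(2) V2(2) by (simp add: V_def ci)
  moreover have "g (f (cinv c y)) \<in> fst e" if "y \<in> V" for y
    using V2(4) k[OF that] that by (metis (no_types, lifting) IntE V_def vimageE)
  ultimately show "\<exists>V. open V \<and> snd c p \<in> V \<and> V \<subseteq> snd c ` fst c \<and> (\<forall>y\<in>V. g (f (cinv c y)) \<in> fst e) \<and>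
        smooth_on V (\<lambda>y. snd e (g (f (cinv c y))))"
    using oV V1(3) by (intro exI[of _ V]) (auto simp: V_def)
qed

lemma smooth_at_cong:
  assumes M: "charted M" and W: "openin (mtop M) W" "p \<in> W" and eq: "\<And>x. x \<in> W \<Longrightarrow> f x = g x"
    and f: "smooth_at M N f p"
  shows "smooth_at M N g p"
  unfolding smooth_at_def
proof (intro ballI impI)
  fix c d assume c: "c \<in> atlas M" and d: "d \<in> atlas N" and p: "p \<in> fst c" "g p \<in> fst d"
  have fp: "f p \<in> fst d" using p eq W by simp
  obtain V where V: "open V" "snd c p \<in> V" "V \<subseteq> snd c ` fst c" "\<And>y. y \<in> V \<Longrightarrow> f (cinv c y) \<in> fst d"
    "smooth_on V (\<lambda>y. snd d (f (cinv c y)))"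
    using smooth_atD[OF f c d p(1) fp] by (elim exE conjE) (rule that, auto)
  define V' where "V' = V \<inter> snd c ` (W \<inter> fst c)"
  have oV: "open V'" using V(1) W(1) c openin_mtop[OF M] by (auto simp: V'_def)
  have e: "f (cinv c y) = g (cinv c y)" if "y \<in> V'" for y
    using that eq chart_inj[OF M c] by (auto simp: V'_def)
  have "smooth_on V' (\<lambda>y. snd d (g (cinv c y)))"
    by (rule smooth_on_cong[OF oV _ smooth_on_mono[OF V(5)]]) (auto simp: e, auto simp: V'_def)
  moreover have "g (cinv c y) \<in> fst d" if "y \<in> V'" for y
    using V(4)[of y] that e[OF that] by (simp add: V'_def)
  ultimately show "\<exists>V. open V \<and> snd c p \<in> V \<and> V \<subseteq> snd c ` fst c \<and> (\<forall>y\<in>V. g (cinv c y) \<in> fst d) \<and>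
        smooth_on V (\<lambda>y. snd d (g (cinv c y)))"
    using oV V(2,3) W p by (intro exI[of _ V']) (auto simp: V'_def)
qed

subsection \<open>Vector spaces and products\<close>

lemma vec_mfd_simps [simp]: "pts vec_mfd = UNIV" "atlas vec_mfd = {(UNIV, \<lambda>v. v)}"
  by (auto simp: vec_mfd_def)

lemma cinv_vec [simp]: "cinv (UNIV, \<lambda>v. v) y = y"
  by (simp add: cinv_def inv_into_def)

lemma chart_at_vec [simp]: "chart_at vec_mfd y = (UNIV, \<lambda>v. v)"
  unfolding chart_at_def by (rule some_equality) auto

lemma charted_vec: assumes "is_basis (B :: 'v::real_normed_vector set)" shows "charted (vec_mfd :: ('v, 'v) mfd)"
  unfolding charted_def using assms
  by (auto simp: comp_def intro!: smooth_on_id)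

lemma smooth_at_vecI:
  assumes "open V" "y \<in> V" "smooth_on V f" shows "smooth_at vec_mfd vec_mfd f y"
  unfolding smooth_at_def using assms by (auto intro: exI[of _ V])

lemma smooth_at_chart:
  assumes M: "charted M" and c: "c \<in> atlas M" "p \<in> fst c" shows "smooth_at M vec_mfd (snd c) p"
  unfolding smooth_at_def
proof (intro ballI impI)
  fix c' d assume c': "c' \<in> atlas M" and d: "d \<in> atlas vec_mfd" and p: "p \<in> fst c'" "snd c p \<in> fst d"
  have "d = (UNIV, \<lambda>v. v)" using d by simp
  then show "\<exists>V. open V \<and> snd c' p \<in> V \<and> V \<subseteq> snd c' ` fst c' \<and> (\<forall>y\<in>V. snd c (cinv c' y) \<in> fst d) \<and>
        smooth_on V (\<lambda>y. snd d (snd c (cinv c' y)))"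
    using overlap_open[OF M c' c(1)] transition_smooth[OF M c' c(1)] p c
    by (intro exI[of _ "snd c' ` (fst c' \<inter> fst c)"]) (auto simp: comp_def)
qed

lemma smooth_at_cinv:
  assumes M: "charted M" and c: "c \<in> atlas M" "y \<in> snd c ` fst c" shows "smooth_at vec_mfd M (cinv c) y"
  unfolding smooth_at_def
proof (intro ballI impI)
  fix e d assume e: "e \<in> atlas vec_mfd" and d: "d \<in> atlas M" and y: "y \<in> fst e" "cinv c y \<in> fst d"
  have "e = (UNIV, \<lambda>v. v)" using e by simp
  moreover have "y \<in> snd c ` (fst c \<inter> fst d)"
    using y(2) cinv_in[OF c(2)] snd_cinv[OF c(2)] by (intro image_eqI[of _ _ "cinv c y"]) auto
  ultimately show "\<exists>V. open V \<and> snd e y \<in> V \<and> V \<subseteq> snd e ` fst e \<and> (\<forall>y\<in>V. cinv c (cinv e y) \<in> fst d) \<and>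
        smooth_on V (\<lambda>y. snd d (cinv c (cinv e y)))"
    using overlap_open[OF M c(1) d] transition_smooth[OF M c(1) d] chart_inj[OF M c(1)]
    by (intro exI[of _ "snd c ` (fst c \<inter> fst d)"]) (auto simp: comp_def)
qed

text \<open>One pair of charts is enough: near \<open>p\<close> the map is the composition of the
  chart \<open>c\<close>, its coordinate expression and the inverse of \<open>d\<close>, each of
  which is smooth with respect to all charts.\<close>

lemma smooth_atI_charts:
  fixes M :: "('a, 'v::real_normed_vector, 'y) mfd_scheme" and N :: "('b, 'w::real_normed_vector, 'z) mfd_scheme"
  assumes M: "charted M" and N: "charted N" and c: "c \<in> atlas M" "p \<in> fst c" and d: "d \<in> atlas N"
    and V: "open V" "snd c p \<in> V" "V \<subseteq> snd c ` fst c" "\<And>y. y \<in> V \<Longrightarrow> f (cinv c y) \<in> fst d"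
    "smooth_on V (\<lambda>y. snd d (f (cinv c y)))"
  shows "smooth_at M N f p"
proof -
  obtain B :: "'v set" where B: "is_basis B" using charted_basis[OF M] .
  obtain C :: "'w set" where C: "is_basis C" using charted_basis[OF N] .
  note vB = charted_vec[OF B] and vC = charted_vec[OF C]
  have fp: "f p \<in> fst d" using V(2,4) c chart_inj[OF M c(1)] by force
  have 1: "smooth_at M vec_mfd (\<lambda>x. snd d (f (cinv c (snd c x)))) p"
    using smooth_at_comp[OF M vB smooth_at_chart[OF M c] smooth_at_vecI[OF V(1,2,5)]] by simp
  have "smooth_at M N (\<lambda>x. cinv d (snd d (f (cinv c (snd c x))))) p"
    by (rule smooth_at_comp[OF M vC 1 smooth_at_cinv[OF N d]])
       (use fp c chart_inj[OF M c(1)] in auto)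
  then show ?thesis
    by (rule smooth_at_cong[OF M openin_chart[OF M c(1) V(1)], rotated 2])
       (use c V chart_inj[OF M c(1)] chart_inj[OF N d] in \<open>auto\<close>, metis cinv_snd)
qed

definition pch :: "'a set \<times> ('a \<Rightarrow> 'v) \<Rightarrow> 'b set \<times> ('b \<Rightarrow> 'w) \<Rightarrow> ('a \<times> 'b) set \<times> ('a \<times> 'b \<Rightarrow> 'v \<times> 'w)" where
  "pch c d = (fst c \<times> fst d, \<lambda>(p, q). (snd c p, snd d q))"

lemma pch_simps [simp]: "fst (pch c d) = fst c \<times> fst d" "snd (pch c d) (p, q) = (snd c p, snd d q)"
  by (auto simp: pch_def)

lemma pch_image: "snd (pch c d) ` (A \<times> B) = snd c ` A \<times> snd d ` B"
  by (force simp: pch_def)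

lemma pts_mprod: "pts (mprod M N) = pts M \<times> pts N"
  by (simp add: mprod_def)

lemma atlas_mprod: "a \<in> atlas (mprod M N) \<longleftrightarrow> (\<exists>c\<in>atlas M. \<exists>d\<in>atlas N. a = pch c d)"
proof -
  have "atlas (mprod M N) = (\<lambda>(c, d). pch c d) ` (atlas M \<times> atlas N)" by (simp add: mprod_def pch_def)
  then show ?thesis by (simp only: image_iff split_paired_Bex_Sigma prod.case)
qed

lemmas mprod_simps = pts_mprod atlas_mprod

lemma pch_inj: "inj_on (snd c) (fst c) \<Longrightarrow> inj_on (snd d) (fst d) \<Longrightarrow> inj_on (snd (pch c d)) (fst (pch c d))"
  by (auto simp: inj_on_def)

lemma cinv_pch:
  assumes "inj_on (snd c) (fst c)" "inj_on (snd d) (fst d)" "y \<in> snd c ` fst c" "z \<in> snd d ` fst d"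
  shows "cinv (pch c d) (y, z) = (cinv c y, cinv d z)"
  using cinv_snd[OF pch_inj[OF assms(1,2)], of "(cinv c y, cinv d z)"] assms
  by (simp add: cinv_in snd_cinv)

lemma charted_mprod:
  fixes M :: "('a, 'v::real_normed_vector, 'y) mfd_scheme" and N :: "('b, 'w::real_normed_vector, 'z) mfd_scheme"
  assumes M: "charted M" and N: "charted N"
  shows "charted (mprod M N)"
  unfolding charted_def
proof (intro conjI)
  obtain B :: "'v set" where B: "is_basis B" using charted_basis[OF M] .
  obtain C :: "'w set" where C: "is_basis C" using charted_basis[OF N] .
  show "\<exists>B :: ('v \<times> 'w) set. is_basis B" by (rule is_basis_Times[OF B C])
  show "\<forall>c\<in>atlas (mprod M N). fst c \<subseteq> pts (mprod M N) \<and> inj_on (snd c) (fst c) \<and> open (snd c ` fst c)"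
  proof
    fix a assume "a \<in> atlas (mprod M N)"
    then obtain c d where cd: "c \<in> atlas M" "d \<in> atlas N" "a = pch c d" by (auto simp: atlas_mprod)
    show "fst a \<subseteq> pts (mprod M N) \<and> inj_on (snd a) (fst a) \<and> open (snd a ` fst a)"
      unfolding cd(3)
    proof (intro conjI)
      show "fst (pch c d) \<subseteq> pts (mprod M N)" using chart_sub[OF M cd(1)] chart_sub[OF N cd(2)] by (auto simp: pts_mprod)
      show "inj_on (snd (pch c d)) (fst (pch c d))" by (rule pch_inj[OF chart_inj[OF M cd(1)] chart_inj[OF N cd(2)]])
      show "open (snd (pch c d) ` fst (pch c d))"
        unfolding pch_simps(1) pch_image by (rule open_Times[OF chart_image_open[OF M cd(1)] chart_image_open[OF N cd(2)]])
    qed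
  qed
  show "pts (mprod M N) = (\<Union>c\<in>atlas (mprod M N). fst c)"
  proof (intro equalityI subsetI)
    fix z assume "z \<in> pts (mprod M N)"
    then obtain c d where "c \<in> atlas M" "d \<in> atlas N" "z \<in> fst (pch c d)"
      unfolding pts_mprod pts_charts[OF M] pts_charts[OF N] pch_simps(1) by blast
    moreover have "pch c d \<in> atlas (mprod M N)" unfolding atlas_mprod using calculation by blast
    ultimately show "z \<in> (\<Union>c\<in>atlas (mprod M N). fst c)" by blast
  next
    fix z assume "z \<in> (\<Union>c\<in>atlas (mprod M N). fst c)"
    then obtain a where a: "a \<in> atlas (mprod M N)" "z \<in> fst a" by blast
    from a(1) obtain c d where "c \<in> atlas M" "d \<in> atlas N" "a = pch c d" unfolding atlas_mprod by blast
    with a(2) have "c \<in> atlas M" "d \<in> atlas N" "z \<in> fst (pch c d)" by simp_all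
    then show "z \<in> pts (mprod M N)" using chart_sub[OF M] chart_sub[OF N] unfolding pts_mprod pch_simps(1) by blast
  qed
  show "\<forall>a\<in>atlas (mprod M N). \<forall>b\<in>atlas (mprod M N). open (snd a ` (fst a \<inter> fst b)) \<and>
        smooth_on (snd a ` (fst a \<inter> fst b)) (snd b \<circ> cinv a)"
  proof (intro ballI)
    fix a b assume "a \<in> atlas (mprod M N)" "b \<in> atlas (mprod M N)"
    then obtain c d c' d' where cd: "a = pch c d" "b = pch c' d'" "c \<in> atlas M" "d \<in> atlas N" "c' \<in> atlas M" "d' \<in> atlas N"
      by (auto simp: mprod_simps)
    let ?S = "snd c ` (fst c \<inter> fst c')" and ?T = "snd d ` (fst d \<inter> fst d')"
    have im: "snd a ` (fst a \<inter> fst b) = ?S \<times> ?T"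
      unfolding cd by (simp add: Times_Int_Times pch_image)
    have o: "open ?S" "open ?T" using overlap_open[OF M cd(3,5)] overlap_open[OF N cd(4,6)] by auto
    then have oo: "open (?S \<times> ?T)" by (rule open_Times)
    have s1: "smooth_on (?S \<times> ?T) (\<lambda>z. (snd c' \<circ> cinv c) (fst z))"
      by (rule smooth_on_comp[OF B oo o(1) transition_smooth[OF M cd(3,5)] smooth_on_fst[OF oo smooth_on_id[OF oo]]]) auto
    have s2: "smooth_on (?S \<times> ?T) (\<lambda>z. (snd d' \<circ> cinv d) (snd z))"
      by (rule smooth_on_comp[OF C oo o(2) transition_smooth[OF N cd(4,6)] smooth_on_snd[OF oo smooth_on_id[OF oo]]]) auto
    have "smooth_on (?S \<times> ?T) (snd b \<circ> cinv a)"
    proof (rule smooth_on_cong[OF oo _ smooth_on_Pair[OF oo s1 s2]])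
      fix z assume "z \<in> ?S \<times> ?T"
      then show "((snd c' \<circ> cinv c) (fst z), (snd d' \<circ> cinv d) (snd z)) = (snd b \<circ> cinv a) z"
        using cinv_pch[OF chart_inj[OF M cd(3)] chart_inj[OF N cd(4)], of "fst z" "snd z"] unfolding cd by force
    qed
    then show "open (snd a ` (fst a \<inter> fst b)) \<and> smooth_on (snd a ` (fst a \<inter> fst b)) (snd b \<circ> cinv a)"
      unfolding im using oo by simp
  qed
qed

lemma smooth_at_pair:
  assumes f: "smooth_at Q M f z" and g: "smooth_at Q N g z"
  shows "smooth_at Q (mprod M N) (\<lambda>z. (f z, g z)) z"
  unfolding smooth_at_def
proof (intro ballI impI)
  fix c b assume c: "c \<in> atlas Q" and b: "b \<in> atlas (mprod M N)" and p: "z \<in> fst c" "(f z, g z) \<in> fst b"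
  obtain d e where de: "b = pch d e" "d \<in> atlas M" "e \<in> atlas N" using b by (auto simp: mprod_simps)
  have fz: "f z \<in> fst d" "g z \<in> fst e" using p de by auto
  obtain V1 where V1: "open V1" "snd c z \<in> V1" "V1 \<subseteq> snd c ` fst c" "\<And>y. y \<in> V1 \<Longrightarrow> f (cinv c y) \<in> fst d"
    "smooth_on V1 (\<lambda>y. snd d (f (cinv c y)))"
    using smooth_atD[OF f c de(2) p(1) fz(1)] by (elim exE conjE) (rule that, auto)
  obtain V2 where V2: "open V2" "snd c z \<in> V2" "V2 \<subseteq> snd c ` fst c" "\<And>y. y \<in> V2 \<Longrightarrow> g (cinv c y) \<in> fst e"
    "smooth_on V2 (\<lambda>y. snd e (g (cinv c y)))"
    using smooth_atD[OF g c de(3) p(1) fz(2)] by (elim exE conjE) (rule that, auto)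
  have o: "open (V1 \<inter> V2)" using V1 V2 by auto
  have "smooth_on (V1 \<inter> V2) (\<lambda>y. (snd d (f (cinv c y)), snd e (g (cinv c y))))"
    by (intro smooth_on_Pair o smooth_on_mono[OF V1(5)] smooth_on_mono[OF V2(5)]) auto
  then show "\<exists>V. open V \<and> snd c z \<in> V \<and> V \<subseteq> snd c ` fst c \<and> (\<forall>y\<in>V. (f (cinv c y), g (cinv c y)) \<in> fst b) \<and>
        smooth_on V (\<lambda>y. snd b (f (cinv c y), g (cinv c y)))"
    using V1 V2 o by (intro exI[of _ "V1 \<inter> V2"]) (auto simp: de)
qed

lemma smooth_at_id:
  assumes M: "charted M" and p: "p \<in> pts M" shows "smooth_at M M (\<lambda>x. x) p"
  using chart_at_props[OF M p] chart_image_open[OF M] chart_inj[OF M]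
  by (intro smooth_atI_charts[OF M M, where c = "chart_at M p" and d = "chart_at M p" and V = "snd (chart_at M p) ` fst (chart_at M p)"])
     (auto intro: smooth_on_cong[OF _ _ smooth_on_id])

lemma smooth_at_const: "smooth_at M N (\<lambda>x. a) p" if M: "charted M"
  unfolding smooth_at_def using chart_image_open[OF M] by (auto intro!: exI[of _ "snd _ ` fst _"])

lemma smooth_at_fst:
  assumes M: "charted M" and N: "charted N" and pq: "p \<in> pts M" "q \<in> pts N"
  shows "smooth_at (mprod M N) M fst (p, q)"
proof -
  let ?c = "chart_at M p" and ?d = "chart_at N q"
  note c = chart_at_props[OF M pq(1)] and d = chart_at_props[OF N pq(2)]
  let ?V = "snd ?c ` fst ?c \<times> snd ?d ` fst ?d"
  have o: "open ?V" using chart_image_open[OF M c(1)] chart_image_open[OF N d(1)] by (rule open_Times)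
  have k: "fst (cinv (pch ?c ?d) y) = cinv ?c (fst y)" if "y \<in> ?V" for y
    using cinv_pch[OF chart_inj[OF M c(1)] chart_inj[OF N d(1)], of "fst y" "snd y"] that by force
  show ?thesis
  proof (rule smooth_atI_charts[OF charted_mprod[OF M N] M _ _ c(1) o])
    show "pch ?c ?d \<in> atlas (mprod M N)" unfolding atlas_mprod using c d by blast
    show "(p, q) \<in> fst (pch ?c ?d)" "snd (pch ?c ?d) (p, q) \<in> ?V" "?V \<subseteq> snd (pch ?c ?d) ` fst (pch ?c ?d)"
      using c d by (auto simp: pch_image)
    show "fst (cinv (pch ?c ?d) y) \<in> fst ?c" if "y \<in> ?V" for y
      using that unfolding k[OF that] by (auto intro: cinv_in)
    show "smooth_on ?V (\<lambda>y. snd ?c (fst (cinv (pch ?c ?d) y)))"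
      by (rule smooth_on_cong[OF o _ smooth_on_fst[OF o smooth_on_id[OF o]]]) (auto simp: k snd_cinv)
  qed
qed

lemma smooth_at_snd:
  assumes M: "charted M" and N: "charted N" and pq: "p \<in> pts M" "q \<in> pts N"
  shows "smooth_at (mprod M N) N snd (p, q)"
proof -
  let ?c = "chart_at M p" and ?d = "chart_at N q"
  note c = chart_at_props[OF M pq(1)] and d = chart_at_props[OF N pq(2)]
  let ?V = "snd ?c ` fst ?c \<times> snd ?d ` fst ?d"
  have o: "open ?V" using chart_image_open[OF M c(1)] chart_image_open[OF N d(1)] by (rule open_Times)
  have k: "snd (cinv (pch ?c ?d) y) = cinv ?d (snd y)" if "y \<in> ?V" for y
    using cinv_pch[OF chart_inj[OF M c(1)] chart_inj[OF N d(1)], of "fst y" "snd y"] that by force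
  show ?thesis
  proof (rule smooth_atI_charts[OF charted_mprod[OF M N] N _ _ d(1) o])
    show "pch ?c ?d \<in> atlas (mprod M N)" unfolding atlas_mprod using c d by blast
    show "(p, q) \<in> fst (pch ?c ?d)" "snd (pch ?c ?d) (p, q) \<in> ?V" "?V \<subseteq> snd (pch ?c ?d) ` fst (pch ?c ?d)"
      using c d by (auto simp: pch_image)
    show "snd (cinv (pch ?c ?d) y) \<in> fst ?d" if "y \<in> ?V" for y
      using that unfolding k[OF that] by (auto intro: cinv_in)
    show "smooth_on ?V (\<lambda>y. snd ?d (snd (cinv (pch ?c ?d) y)))"
      by (rule smooth_on_cong[OF o _ smooth_on_snd[OF o smooth_on_id[OF o]]]) (auto simp: k snd_cinv)
  qed
qed

lemma smooth_at_two:
  assumes Q: "charted Q" and M: "charted M" and N: "charted N"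
    and F: "smooth_at (mprod M N) P (\<lambda>(p, q). F p q) (f z, g z)"
    and f: "smooth_at Q M f z" "f z \<in> pts M" and g: "smooth_at Q N g z" "g z \<in> pts N"
  shows "smooth_at Q P (\<lambda>z. F (f z) (g z)) z"
  using smooth_at_comp[OF Q charted_mprod[OF M N] smooth_at_pair[OF f(1) g(1)] F] f g by (simp add: mprod_simps)

text \<open>Restricting the domain of a chart does not affect smoothness at a point. This passes
  from the open submanifolds, between which a trivialisation is a diffeomorphism, to the ambient
  manifolds.\<close>

lemma smooth_at_subcharts:
  assumes f: "smooth_at M' N' f p" and inj: "\<And>c. c \<in> atlas M \<Longrightarrow> inj_on (snd c) (fst c)"
    and M: "\<And>c. c \<in> atlas M \<Longrightarrow> p \<in> fst c \<Longrightarrow> \<exists>c'\<in>atlas M'. p \<in> fst c' \<and> fst c' \<subseteq> fst c \<and> snd c' = snd c"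
    and N: "\<And>d. d \<in> atlas N \<Longrightarrow> f p \<in> fst d \<Longrightarrow> \<exists>d'\<in>atlas N'. f p \<in> fst d' \<and> fst d' \<subseteq> fst d \<and> snd d' = snd d"
  shows "smooth_at M N f p"
  unfolding smooth_at_def
proof (intro ballI impI)
  fix c d assume c: "c \<in> atlas M" and d: "d \<in> atlas N" and p: "p \<in> fst c" "f p \<in> fst d"
  obtain c' where c': "c' \<in> atlas M'" "p \<in> fst c'" "fst c' \<subseteq> fst c" "snd c' = snd c" using M[OF c p(1)] by blast
  obtain d' where d': "d' \<in> atlas N'" "f p \<in> fst d'" "fst d' \<subseteq> fst d" "snd d' = snd d" using N[OF d p(2)] by blast
  obtain V where V: "open V" "snd c' p \<in> V" "V \<subseteq> snd c' ` fst c'" "\<And>y. y \<in> V \<Longrightarrow> f (cinv c' y) \<in> fst d'"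
    "smooth_on V (\<lambda>y. snd d' (f (cinv c' y)))"
    using smooth_atD[OF f c'(1) d'(1) c'(2) d'(2)] by (elim exE conjE) (rule that, auto)
  have k: "cinv c' y = cinv c y" if y: "y \<in> V" for y
  proof -
    obtain q where q: "q \<in> fst c'" "y = snd c q" using V(3) c'(4) y by auto
    have "inj_on (snd c') (fst c')" using inj[OF c] c'(3,4) by (metis inj_on_subset)
    then show ?thesis using cinv_snd[of c' q] cinv_snd[OF inj[OF c], of q] q c' by auto
  qed
  have "smooth_on V (\<lambda>y. snd d (f (cinv c y)))"
    by (rule smooth_on_cong[OF V(1) _ V(5)]) (simp add: k d')
  then show "\<exists>V. open V \<and> snd c p \<in> V \<and> V \<subseteq> snd c ` fst c \<and> (\<forall>y\<in>V. f (cinv c y) \<in> fst d) \<and>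
        smooth_on V (\<lambda>y. snd d (f (cinv c y)))"
    using V c' d' k by (intro exI[of _ V]) fastforce
qed

lemma openin_smooth_preimage:
  assumes M: "charted M" and N: "charted N" and W: "openin (mtop N) W"
    and f: "\<And>p. p \<in> pts M \<Longrightarrow> smooth_at M N f p" "f ` pts M \<subseteq> pts N"
  shows "openin (mtop M) {p \<in> pts M. f p \<in> W}"
proof (rule openin_mtopI[OF M])
  fix p assume p: "p \<in> {p \<in> pts M. f p \<in> W}"
  define c d where "c = chart_at M p" and "d = chart_at N (f p)"
  have c: "c \<in> atlas M" "p \<in> fst c" using chart_at_props[OF M] p by (auto simp: c_def)
  have "f p \<in> pts N" using f(2) p by auto
  then have d: "d \<in> atlas N" "f p \<in> fst d" using chart_at_props[OF N] by (auto simp: d_def)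
  have fp: "smooth_at M N f p" using f p by simp
  obtain V where V: "open V" "snd c p \<in> V" "V \<subseteq> snd c ` fst c" "\<And>y. y \<in> V \<Longrightarrow> f (cinv c y) \<in> fst d"
    "smooth_on V (\<lambda>y. snd d (f (cinv c y)))"
    using smooth_atD[OF fp c(1) d(1) c(2) d(2)] by (elim exE conjE) (rule that, auto)
  let ?O = "snd d ` (W \<inter> fst d)"
  have oO: "open ?O" using W d openin_mtop[OF N] by auto
  define V' where "V' = V \<inter> (\<lambda>y. snd d (f (cinv c y))) -` ?O"
  have "open V'" unfolding V'_def
    using continuous_open_preimage[OF smooth_on_continuous[OF V(5)] V(1) oO] .
  moreover have "snd c p \<in> V'" using V(2) p d c chart_inj[OF M c(1)] by (auto simp: V'_def)
  moreover have "cinv c y \<in> {p \<in> pts M. f p \<in> W}" if y: "y \<in> V'" for y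
  proof -
    obtain q where q: "q \<in> W" "q \<in> fst d" "snd d (f (cinv c y)) = snd d q" using y by (auto simp: V'_def)
    have "f (cinv c y) \<in> fst d" using V(4) y by (simp add: V'_def)
    then have "f (cinv c y) = q" using chart_inj[OF N d(1)] q inj_onD by metis
    moreover have "cinv c y \<in> pts M" using chart_sub[OF M c(1)] cinv_in V(3) y by (metis IntE V'_def subsetD)
    ultimately show ?thesis using q by simp
  qed
  ultimately show "\<exists>c V. c \<in> atlas M \<and> p \<in> fst c \<and> open V \<and> snd c p \<in> V \<and> V \<subseteq> snd c ` fst c \<and> cinv c ` V \<subseteq> {p \<in> pts M. f p \<in> W}"
    using c V(3) by (intro exI[of _ c] exI[of _ V']) (auto simp: V'_def)
qed

section \<open>Differentials of maps and the chain rule\<close>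

definition has_diff :: "'a set \<times> ('a \<Rightarrow> 'v::real_normed_vector) \<Rightarrow> 'b set \<times> ('b \<Rightarrow> 'w::real_normed_vector)
    \<Rightarrow> ('a \<Rightarrow> 'b) \<Rightarrow> 'a \<Rightarrow> ('v \<Rightarrow> 'w) \<Rightarrow> bool" where
  "has_diff c d f p L \<longleftrightarrow> p \<in> fst c \<and> f p \<in> fst d \<and>
     ((\<lambda>y. snd d (f (cinv c y))) has_derivative L) (at (snd c p)) \<and>
     (\<forall>\<^sub>F y in nhds (snd c p). f (cinv c y) \<in> fst d)"

lemma smooth_at_has_diff:
  assumes f: "smooth_at M N f p" and c: "c \<in> atlas M" "p \<in> fst c" and d: "d \<in> atlas N" "f p \<in> fst d"
  shows "has_diff c d f p (frechet_derivative (\<lambda>y. snd d (f (cinv c y))) (at (snd c p)))"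
proof -
  obtain V where V: "open V" "snd c p \<in> V" "\<And>y. y \<in> V \<Longrightarrow> f (cinv c y) \<in> fst d"
    "smooth_on V (\<lambda>y. snd d (f (cinv c y)))"
    using smooth_atD[OF f c(1) d(1) c(2) d(2)] by (elim exE conjE) (rule that, auto)
  show ?thesis unfolding has_diff_def
    using c d smooth_on_has_derivative[OF V(4,2)] V(1-3) by (auto simp: eventually_nhds)
qed

text \<open>Outside the domain of \<open>d\<close> the value of \<open>snd d\<close> is arbitrary.
  The eventual membership contained in \<open>has_diff\<close> ensures that \<open>cinv d\<close>
  undoes \<open>snd d\<close> near the point, so the derivative of the composed coordinate
  expressions is the right one.\<close>

lemma has_diff_comp:
  assumes f: "has_diff c d f p L" and g: "has_diff d e g (f p) L'"
    and c: "inj_on (snd c) (fst c)" and d: "inj_on (snd d) (fst d)"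
  shows "has_diff c e (\<lambda>x. g (f x)) p (\<lambda>u. L' (L u))"
proof -
  let ?f = "\<lambda>y. snd d (f (cinv c y))" and ?g = "\<lambda>z. snd e (g (cinv d z))" and ?y = "snd c p"
  have fy: "?f ?y = snd d (f p)" using f c by (simp add: has_diff_def)
  have Df: "(?f has_derivative L) (at ?y)" using f by (simp add: has_diff_def)
  have Dg: "(?g has_derivative L') (at (?f ?y))" unfolding fy using g by (simp add: has_diff_def)
  have ev: "\<forall>\<^sub>F y in nhds ?y. f (cinv c y) \<in> fst d" using f by (simp add: has_diff_def)
  have D: "((\<lambda>y. ?g (?f y)) has_derivative (\<lambda>u. L' (L u))) (at ?y)"
    by (rule has_derivative_compose[OF Df Dg])
  have e1: "\<forall>\<^sub>F y in nhds ?y. ?g (?f y) = snd e (g (f (cinv c y)))"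
    using ev by eventually_elim (simp add: d)
  have "((\<lambda>y. snd e (g (f (cinv c y)))) has_derivative (\<lambda>u. L' (L u))) (at ?y)"
    by (rule has_derivative_transform_eventually[OF D])
       (use e1 eventually_nhds_x_imp_x[OF e1] in \<open>auto simp: eventually_at_filter elim: eventually_mono\<close>)
  moreover have "\<forall>\<^sub>F y in nhds ?y. g (f (cinv c y)) \<in> fst e"
  proof -
    have "isCont h y \<Longrightarrow> filterlim h (nhds (h y)) (nhds y)" for h :: "'b \<Rightarrow> 'd" and y
      by (simp add: isCont_def tendsto_at_iff_tendsto_nhds)
    from this[OF has_derivative_continuous[OF Df]]
    have "filterlim ?f (nhds (snd d (f p))) (nhds ?y)"
      unfolding fy .
    moreover have "\<forall>\<^sub>F z in nhds (snd d (f p)). g (cinv d z) \<in> fst e" using g by (simp add: has_diff_def)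
    ultimately have "\<forall>\<^sub>F y in nhds ?y. g (cinv d (?f y)) \<in> fst e" using eventually_compose_filterlim by blast
    with ev show ?thesis by eventually_elim (simp add: d)
  qed
  ultimately show ?thesis using f g unfolding has_diff_def by simp
qed

lemma tmap_eqI: "has_diff (chart_at M p) (chart_at N (f p)) f p L \<Longrightarrow> tmap M N f p = L"
  unfolding tmap_def has_diff_def comp_def by (metis frechet_derivative_eqI)

lemma tmap_has_diff:
  assumes M: "charted M" and N: "charted N" and f: "smooth_at M N f p" and p: "p \<in> pts M" "f p \<in> pts N"
  shows "has_diff (chart_at M p) (chart_at N (f p)) f p (tmap M N f p)"
  using smooth_at_has_diff[OF f chart_at_props[OF M p(1)] chart_at_props[OF N p(2)]]
  by (simp add: tmap_def comp_def)

lemma tmap_linear: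
  assumes "charted M" "charted N" "smooth_at M N f p" "p \<in> pts M" "f p \<in> pts N"
  shows "linear (tmap M N f p)"
  using tmap_has_diff[OF assms] has_derivative_linear unfolding has_diff_def by blast

lemma tmap_comp:
  assumes M: "charted M" and N: "charted N" and P: "charted P" and f: "smooth_at M N f p" and g: "smooth_at N P g (f p)"
    and p: "p \<in> pts M" "f p \<in> pts N" "g (f p) \<in> pts P"
  shows "tmap M P (\<lambda>x. g (f x)) p u = tmap N P g (f p) (tmap M N f p u)"
  using tmap_eqI[OF has_diff_comp[OF tmap_has_diff[OF M N f p(1,2)] tmap_has_diff[OF N P g p(2,3)]
     chart_inj[OF M chart_at_props(1)[OF M p(1)]] chart_inj[OF N chart_at_props(1)[OF N p(2)]]]]
  by simp

lemma has_diff_cong: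
  assumes M: "charted M" and W: "openin (mtop M) W" "p \<in> W" "\<And>x. x \<in> W \<Longrightarrow> f x = g x"
    and f: "has_diff c d f p L" and c: "c \<in> atlas M"
  shows "has_diff c d g p L"
proof -
  have p: "p \<in> fst c" using f by (simp add: has_diff_def)
  have "open (snd c ` (W \<inter> fst c))" "snd c p \<in> snd c ` (W \<inter> fst c)"
    using W c p openin_mtop[OF M] by auto
  then have "\<forall>\<^sub>F y in nhds (snd c p). y \<in> snd c ` (W \<inter> fst c)" by (rule eventually_nhds_in_open)
  then have ev: "\<forall>\<^sub>F y in nhds (snd c p). f (cinv c y) = g (cinv c y)"
    by eventually_elim (use W(3) chart_inj[OF M c] in auto)
  have fc: "f (cinv c (snd c p)) = g (cinv c (snd c p))" using W p chart_inj[OF M c] by simp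
  have "((\<lambda>y. snd d (g (cinv c y))) has_derivative L) (at (snd c p))"
  proof (rule has_derivative_transform_eventually)
    show "((\<lambda>y. snd d (f (cinv c y))) has_derivative L) (at (snd c p))" using f by (simp add: has_diff_def)
    show "\<forall>\<^sub>F y in at (snd c p). snd d (f (cinv c y)) = snd d (g (cinv c y))"
      using ev by (auto simp: eventually_at_filter elim: eventually_mono)
  qed (auto simp: fc)
  moreover have "\<forall>\<^sub>F y in nhds (snd c p). g (cinv c y) \<in> fst d"
    using f ev unfolding has_diff_def by (auto elim: eventually_elim2)
  ultimately show ?thesis using f W unfolding has_diff_def by auto
qed

lemma tmap_cong:
  assumes M: "charted M" and N: "charted N" and W: "openin (mtop M) W" "p \<in> W" "\<And>x. x \<in> W \<Longrightarrow> f x = g x"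
    and f: "smooth_at M N f p" and p: "p \<in> pts M" "f p \<in> pts N"
  shows "tmap M N f p = tmap M N g p"
proof -
  have "f p = g p" using W by simp
  then have "tmap M N g p = tmap M N f p"
    using has_diff_cong[OF M W tmap_has_diff[OF M N f p] chart_at_props(1)[OF M p(1)]] by (intro tmap_eqI) simp
  then show ?thesis by simp
qed

lemma tmap_id:
  assumes M: "charted M" and p: "p \<in> pts M" shows "tmap M M (\<lambda>x. x) p u = u"
proof -
  let ?c = "chart_at M p"
  note c = chart_at_props[OF M p]
  have "((\<lambda>y. snd ?c (cinv ?c y)) has_derivative (\<lambda>u. u)) (at (snd ?c p))"
    by (rule has_derivative_transform_within_open[OF _ chart_image_open[OF M c(1)], of "\<lambda>u. u"])
       (use c in \<open>auto simp: snd_cinv\<close>)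
  then show ?thesis unfolding tmap_def comp_def using frechet_derivative_eqI by metis
qed

lemma tmap_const: "tmap M N (\<lambda>x. a) p u = 0"
  by (simp add: tmap_def comp_def)

lemma has_diff_pair:
  assumes f: "has_diff c d f p L" and g: "has_diff c e g p L'"
  shows "has_diff c (pch d e) (\<lambda>x. (f x, g x)) p (\<lambda>u. (L u, L' u))"
  using assms unfolding has_diff_def by (auto intro!: has_derivative_Pair eventually_conj)

lemma tmap_two_aux:
  assumes Q: "charted Q" and M: "charted M" and N: "charted N"
    and L: "has_diff (pch (chart_at M (f z)) (chart_at N (g z))) (chart_at P (F (f z) (g z))) (\<lambda>(p, q). F p q) (f z, g z) L"
    and f: "smooth_at Q M f z" "f z \<in> pts M" and g: "smooth_at Q N g z" "g z \<in> pts N" and z: "z \<in> pts Q"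
  shows "tmap Q P (\<lambda>z. F (f z) (g z)) z u = L (tmap Q M f z u, tmap Q N g z u)"
proof -
  note d = chart_at_props[OF M f(2)] and e = chart_at_props[OF N g(2)] and c = chart_at_props[OF Q z]
  have "has_diff (chart_at Q z) (pch (chart_at M (f z)) (chart_at N (g z))) (\<lambda>x. (f x, g x)) z (\<lambda>u. (tmap Q M f z u, tmap Q N g z u))"
    by (rule has_diff_pair[OF tmap_has_diff[OF Q M f(1) z f(2)] tmap_has_diff[OF Q N g(1) z g(2)]])
  from has_diff_comp[OF this L chart_inj[OF Q c(1)] pch_inj[OF chart_inj[OF M d(1)] chart_inj[OF N e(1)]]]
  have "has_diff (chart_at Q z) (chart_at P (F (f z) (g z))) (\<lambda>x. F (f x) (g x)) z (\<lambda>u. L (tmap Q M f z u, tmap Q N g z u))"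
    by simp
  from tmap_eqI[OF this] show ?thesis by simp
qed

text \<open>The differential of \<open>F\<close> on the product, in the product of the chosen
  charts, is one linear map \<open>L\<close>. Each partial differential is \<open>L\<close> on one
  factor, obtained by taking a constant for the other argument.\<close>

lemma tmap_two:
  assumes Q: "charted Q" and M: "charted M" and N: "charted N" and P: "charted P"
    and F: "smooth_at (mprod M N) P (\<lambda>(p, q). F p q) (f z, g z)"
    and f: "smooth_at Q M f z" "f z \<in> pts M" and g: "smooth_at Q N g z" "g z \<in> pts N"
    and z: "z \<in> pts Q" and Fz: "F (f z) (g z) \<in> pts P"
  shows "tmap Q P (\<lambda>z. F (f z) (g z)) z u =
    tmap M P (\<lambda>x. F x (g z)) (f z) (tmap Q M f z u) + tmap N P (\<lambda>y. F (f z) y) (g z) (tmap Q N g z u)"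
proof -
  let ?d = "chart_at M (f z)" and ?e = "chart_at N (g z)" and ?h = "chart_at P (F (f z) (g z))"
  note d = chart_at_props[OF M f(2)] and e = chart_at_props[OF N g(2)] and h = chart_at_props[OF P Fz]
  have de: "pch ?d ?e \<in> atlas (mprod M N)" unfolding atlas_mprod using d e by blast
  obtain L where L: "has_diff (pch ?d ?e) ?h (\<lambda>(p, q). F p q) (f z, g z) L"
    using smooth_at_has_diff[OF F de _ h(1)] d e h by auto
  have lin: "linear L" using L unfolding has_diff_def by (auto intro: has_derivative_linear)
  have 1: "tmap Q P (\<lambda>z. F (f z) (g z)) z u = L (tmap Q M f z u, tmap Q N g z u)"
    by (rule tmap_two_aux[OF Q M N L f g z])
  have 2: "tmap M P (\<lambda>x. F x (g z)) (f z) v = L (v, 0)" for v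
    using tmap_two_aux[where Q = M and f = "\<lambda>x. x" and g = "\<lambda>_. g z" and z = "f z" and F = F and L = L and P = P,
       OF M M N L smooth_at_id[OF M f(2)] f(2) smooth_at_const[OF M] g(2) f(2)]
    by (simp add: tmap_id[OF M f(2)] tmap_const)
  have 3: "tmap N P (\<lambda>y. F (f z) y) (g z) v = L (0, v)" for v
    using tmap_two_aux[where Q = N and g = "\<lambda>x. x" and f = "\<lambda>_. f z" and z = "g z" and F = F and L = L and P = P,
       OF N M N L smooth_at_const[OF N] f(2) smooth_at_id[OF N g(2)] g(2) g(2)]
    by (simp add: tmap_id[OF N g(2)] tmap_const)
  show ?thesis unfolding 1 2 3 linear_add[OF lin, symmetric] by simp
qed

subsection \<open>Differentials in arbitrary charts\<close>

lemma tmap_vec: "tmap vec_mfd vec_mfd f y = frechet_derivative f (at y)"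
  by (simp add: tmap_def comp_def)

lemma from_chart_tmap: "cinv c (snd c p) = p \<Longrightarrow> from_chart M c p = tmap vec_mfd M (cinv c) (snd c p)"
  by (simp add: tmap_def from_chart_def comp_def)

lemma to_chart_tmap: "to_chart M c p = tmap M vec_mfd (snd c) p"
  by (simp add: tmap_def to_chart_def comp_def)

lemma to_from_chart:
  fixes M :: "('a, 'v::real_normed_vector, 'z) mfd_scheme"
  assumes M: "charted M" and c: "c \<in> atlas M" "p \<in> fst c"
  shows "to_chart M c p (from_chart M c p u) = u"
proof -
  obtain B :: "'v set" where B: "is_basis B" using charted_basis[OF M] .
  note vB = charted_vec[OF B]
  have k: "cinv c (snd c p) = p" and pp: "p \<in> pts M" using c chart_inj[OF M c(1)] chart_sub[OF M c(1)] by auto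
  have s1: "smooth_at M vec_mfd (snd c) (cinv c (snd c p))" and s2: "smooth_at vec_mfd M (cinv c) (snd c p)"
    using smooth_at_chart[OF M c] smooth_at_cinv[OF M c(1)] c by (auto simp: k)
  have "((\<lambda>y. snd c (cinv c y)) has_derivative (\<lambda>u. u)) (at (snd c p))"
    by (rule has_derivative_transform_within_open[OF _ chart_image_open[OF M c(1)], of "\<lambda>u. u"])
       (use c in \<open>auto simp: snd_cinv\<close>)
  then have "tmap vec_mfd vec_mfd (\<lambda>y. snd c (cinv c y)) (snd c p) u = u"
    unfolding tmap_vec using frechet_derivative_eqI by metis
  moreover have "tmap vec_mfd vec_mfd (\<lambda>y. snd c (cinv c y)) (snd c p) u = to_chart M c p (from_chart M c p u)"
    using tmap_comp[OF vB M vB s2 s1, of u] k pp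
    unfolding from_chart_tmap[of c p M, OF k] to_chart_tmap by simp
  ultimately show ?thesis by simp
qed

lemma from_chart_linear:
  fixes M :: "('a, 'v::real_normed_vector, 'z) mfd_scheme"
  assumes M: "charted M" and c: "c \<in> atlas M" "p \<in> fst c"
  shows "linear (from_chart M c p)"
proof -
  obtain B :: "'v set" where B: "is_basis B" using charted_basis[OF M] .
  have k: "cinv c (snd c p) = p" and pp: "p \<in> pts M" using c chart_inj[OF M c(1)] chart_sub[OF M c(1)] by auto
  show ?thesis unfolding from_chart_tmap[of c p M, OF k]
    by (rule tmap_linear[OF charted_vec[OF B] M smooth_at_cinv[OF M c(1)]]) (use c k pp in auto)
qed

text \<open>The chart \<open>chart_at\<close> may jump from point to point, so the values of
  \<open>tmap\<close> need not vary continuously. In a fixed chart \<open>d\<close> the coordinate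
  derivative does, and \<open>from_chart\<close> absorbs the jumps.\<close>

lemma tmap_vec_chart:
  fixes N :: "('b, 'w::real_normed_vector, 'z) mfd_scheme" and s :: "'v::real_normed_vector \<Rightarrow> 'b"
  assumes N: "charted N" and B: "is_basis (B :: 'v set)" and s: "smooth_at vec_mfd N s y" and d: "d \<in> atlas N" "s y \<in> fst d"
  shows "tmap vec_mfd N s y u = from_chart N d (s y) (frechet_derivative (\<lambda>y. snd d (s y)) (at y) u)"
proof -
  obtain C :: "'w set" where C: "is_basis C" using charted_basis[OF N] .
  have k: "cinv d (snd d (s y)) = s y" and sp: "s y \<in> pts N" using d chart_inj[OF N d(1)] chart_sub[OF N d(1)] by auto
  obtain V where V: "open V" "y \<in> V" "\<And>y. y \<in> V \<Longrightarrow> s y \<in> fst d" "smooth_on V (\<lambda>y. snd d (s y))"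
    using smooth_atD[OF s, of "(UNIV, \<lambda>v. v)" d] d by auto
  note vB = charted_vec[OF B] and vC = charted_vec[OF C]
  have s1: "smooth_at vec_mfd vec_mfd (\<lambda>y. snd d (s y)) y" by (rule smooth_at_vecI[OF V(1,2,4)])
  have s2: "smooth_at vec_mfd N (cinv d) (snd d (s y))" using smooth_at_cinv[OF N d(1)] d by auto
  have oV: "openin (mtop vec_mfd) V" unfolding openin_mtop[OF vB] using V by simp
  have 1: "tmap vec_mfd N s y = tmap vec_mfd N (\<lambda>y. cinv d (snd d (s y))) y"
    by (rule tmap_cong[OF vB N oV V(2) _ s]) (use V(3) sp chart_inj[OF N d(1)] in auto)
  have "tmap vec_mfd N (\<lambda>y. cinv d (snd d (s y))) y u = tmap vec_mfd N (cinv d) (snd d (s y)) (tmap vec_mfd vec_mfd (\<lambda>y. snd d (s y)) y u)"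
    by (rule tmap_comp[OF vB vC N s1 s2]) (use k sp in auto)
  then show ?thesis unfolding 1 from_chart_tmap[of d "s y" N, OF k] tmap_vec .
qed

lemma tmap_from_chart:
  fixes M :: "('a, 'v::real_normed_vector, 'y) mfd_scheme" and N :: "('b, 'w::real_normed_vector, 'z) mfd_scheme"
  assumes M: "charted M" and N: "charted N" and f: "smooth_at M N f p" and c: "c \<in> atlas M" "p \<in> fst c" and fp: "f p \<in> pts N"
  shows "tmap M N f p (from_chart M c p u) = tmap vec_mfd N (\<lambda>y. f (cinv c y)) (snd c p) u"
proof -
  obtain B :: "'v set" where B: "is_basis B" using charted_basis[OF M] .
  have k: "cinv c (snd c p) = p" and pp: "p \<in> pts M" using c chart_inj[OF M c(1)] chart_sub[OF M c(1)] by auto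
  have s2: "smooth_at vec_mfd M (cinv c) (snd c p)" using smooth_at_cinv[OF M c(1)] c by auto
  show ?thesis unfolding from_chart_tmap[of c p M, OF k]
    using tmap_comp[OF charted_vec[OF B] M N s2, of f u] f k pp fp by simp
qed

section \<open>The shuffle product of forms\<close>

text \<open>Peeling off the first argument by the antiderivation rule gives the wedge product a
  definition by recursion on the argument list, which makes it associative by a one-line induction.\<close>

definition contr :: "'v \<Rightarrow> ('v list \<Rightarrow> 'w) \<Rightarrow> 'v list \<Rightarrow> 'w" where
  "contr v \<alpha> = (\<lambda>vs. \<alpha> (v # vs))"

text \<open>Contraction in the last slot is needed because the sum over permutations is peeled at
  its last index, whereas \<open>shuf\<close> peels the first argument.\<close>

definition rcontr :: "'v \<Rightarrow> ('v list \<Rightarrow> 'w) \<Rightarrow> 'v list \<Rightarrow> 'w" where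
  "rcontr v \<alpha> = (\<lambda>vs. \<alpha> (vs @ [v]))"

text \<open>The sign that a contraction picks up when passing the form. It is read off from the
  length of the argument list, so the degree is not a parameter.\<close>

definition gsign :: "('v list \<Rightarrow> 'w::real_vector) \<Rightarrow> 'v list \<Rightarrow> 'w" where
  "gsign \<alpha> = (\<lambda>vs. (-1) ^ length vs *\<^sub>R \<alpha> vs)"

fun shuf :: "('a::real_vector \<Rightarrow> 'b::real_vector \<Rightarrow> 'c::real_vector) \<Rightarrow> ('v list \<Rightarrow> 'a) \<Rightarrow> ('v list \<Rightarrow> 'b) \<Rightarrow> 'v list \<Rightarrow> 'c" where
  "shuf m \<alpha> \<beta> [] = m (\<alpha> []) (\<beta> [])"
| "shuf m \<alpha> \<beta> (v # vs) = shuf m (contr v \<alpha>) \<beta> vs + shuf m (gsign \<alpha>) (contr v \<beta>) vs"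

lemma contr_simps [simp]:
  "contr v (\<lambda>x. \<alpha> x + \<beta> x) = (\<lambda>x. contr v \<alpha> x + contr v \<beta> x)"
  "contr v (\<lambda>x. r *\<^sub>R \<alpha> x) = (\<lambda>x. r *\<^sub>R contr v \<alpha> x)"
  "contr v (\<lambda>x. - \<alpha> x) = (\<lambda>x. - contr v \<alpha> x)"
  "contr v (gsign \<alpha>) = (\<lambda>x. - gsign (contr v \<alpha>) x)"
  "contr v (\<lambda>x. 0) = (\<lambda>x. 0)"
  by (auto simp: contr_def gsign_def)

lemma gsign_simps [simp]:
  "gsign (\<lambda>x. \<alpha> x + \<beta> x) = (\<lambda>x. gsign \<alpha> x + gsign \<beta> x)"
  "gsign (\<lambda>x. r *\<^sub>R \<alpha> x) = (\<lambda>x. r *\<^sub>R gsign \<alpha> x)"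
  "gsign (\<lambda>x. - \<alpha> x) = (\<lambda>x. - gsign \<alpha> x)"
  "gsign (gsign \<alpha>) = \<alpha>"
  "gsign (\<lambda>x. 0) = (\<lambda>x. 0)"
  by (auto simp: gsign_def scaleR_add_right power_add[symmetric] mult_2[symmetric])

lemma rcontr_contr: "rcontr w (contr v \<alpha>) = contr v (rcontr w \<alpha>)"
  by (simp add: contr_def rcontr_def)

lemma rcontr_gsign: "rcontr v (gsign \<alpha>) = (\<lambda>x. - gsign (rcontr v \<alpha>) x)"
  by (simp add: rcontr_def gsign_def)

context
  fixes m :: "'a::real_vector \<Rightarrow> 'b::real_vector \<Rightarrow> 'c::real_vector"
  assumes m: "bilinear m"
begin

lemma shuf_add_left: "shuf m (\<lambda>x. \<alpha> x + \<alpha>' x) \<beta> vs = shuf m \<alpha> \<beta> vs + shuf m \<alpha>' \<beta> vs"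
  by (induction vs arbitrary: \<alpha> \<alpha>' \<beta>) (auto simp: bilinear_ladd[OF m])

lemma shuf_add_right: "shuf m \<alpha> (\<lambda>x. \<beta> x + \<beta>' x) vs = shuf m \<alpha> \<beta> vs + shuf m \<alpha> \<beta>' vs"
  by (induction vs arbitrary: \<alpha> \<beta> \<beta>') (auto simp: bilinear_radd[OF m])

lemma shuf_scale_left: "shuf m (\<lambda>x. r *\<^sub>R \<alpha> x) \<beta> vs = r *\<^sub>R shuf m \<alpha> \<beta> vs"
  by (induction vs arbitrary: \<alpha> \<beta>) (auto simp: bilinear_lmul[OF m] scaleR_add_right)

lemma shuf_scale_right: "shuf m \<alpha> (\<lambda>x. r *\<^sub>R \<beta> x) vs = r *\<^sub>R shuf m \<alpha> \<beta> vs"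
  by (induction vs arbitrary: \<alpha> \<beta>) (auto simp: bilinear_rmul[OF m] scaleR_add_right)

lemma shuf_minus_left: "shuf m (\<lambda>x. - \<alpha> x) \<beta> vs = - shuf m \<alpha> \<beta> vs"
  using shuf_scale_left[of "-1"] by simp

lemma shuf_minus_right: "shuf m \<alpha> (\<lambda>x. - \<beta> x) vs = - shuf m \<alpha> \<beta> vs"
  using shuf_scale_right[of _ "-1"] by simp

lemma shuf_zero_left: "shuf m (\<lambda>x. 0) \<beta> vs = 0"
  using shuf_scale_left[of 0 "\<lambda>x. 0"] by simp

lemma shuf_zero_right: "shuf m \<alpha> (\<lambda>x. 0) vs = 0"
  using shuf_scale_right[of \<alpha> 0 "\<lambda>x. 0"] by simp

lemmas shuf_simps = shuf_add_left shuf_add_right shuf_scale_left shuf_scale_right shuf_minus_left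
  shuf_minus_right shuf_zero_left shuf_zero_right

lemma shuf_sum_left: "shuf m (\<lambda>x. \<Sum>i\<in>I. \<alpha> i x) \<beta> vs = (\<Sum>i\<in>I. shuf m (\<alpha> i) \<beta> vs)"
  by (induction I rule: infinite_finite_induct) (auto simp: shuf_simps)

lemma shuf_sum_right: "shuf m \<alpha> (\<lambda>x. \<Sum>i\<in>I. \<beta> i x) vs = (\<Sum>i\<in>I. shuf m \<alpha> (\<beta> i) vs)"
  by (induction I rule: infinite_finite_induct) (auto simp: shuf_simps)

lemma contr_shuf: "contr v (shuf m \<alpha> \<beta>) = (\<lambda>x. shuf m (contr v \<alpha>) \<beta> x + shuf m (gsign \<alpha>) (contr v \<beta>) x)"
  by (rule ext) (simp add: contr_def)

lemma gsign_shuf: "gsign (shuf m \<alpha> \<beta>) vs = shuf m (gsign \<alpha>) (gsign \<beta>) vs"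
proof (induction vs arbitrary: \<alpha> \<beta>)
  case (Cons v vs)
  have "gsign (shuf m \<alpha> \<beta>) (v # vs) = contr v (gsign (shuf m \<alpha> \<beta>)) vs" by (simp add: contr_def)
  also have "\<dots> = - gsign (shuf m (contr v \<alpha>) \<beta>) vs - gsign (shuf m (gsign \<alpha>) (contr v \<beta>)) vs"
    by (simp add: contr_shuf)
  finally show ?case by (simp add: Cons.IH shuf_simps)
qed (simp add: gsign_def)

text \<open>Peeling at the other end: the last argument reaches the left factor only by passing the
  right one, so the sign now falls on the right factor.\<close>

lemma shuf_snoc: "shuf m \<alpha> \<beta> (vs @ [v]) = shuf m \<alpha> (rcontr v \<beta>) vs + shuf m (rcontr v \<alpha>) (gsign \<beta>) vs"
proof (induction vs arbitrary: \<alpha> \<beta>)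
  case Nil
  then show ?case by (simp add: contr_def rcontr_def gsign_def)
next
  case (Cons u vs)
  then show ?case by (simp add: rcontr_contr rcontr_gsign shuf_simps)
qed

lemma shuf_deg0_right: "(\<And>vs. vs \<noteq> [] \<Longrightarrow> \<beta> vs = 0) \<Longrightarrow> shuf m \<alpha> \<beta> vs = m (\<alpha> vs) (\<beta> [])"
proof (induction vs arbitrary: \<alpha>)
  case (Cons v vs)
  have "contr v \<beta> = (\<lambda>x. 0)" using Cons.prems by (auto simp: contr_def)
  then show ?case using Cons by (simp add: shuf_simps contr_def)
qed simp

lemma shuf_deg0_left: "(\<And>vs. vs \<noteq> [] \<Longrightarrow> \<alpha> vs = 0) \<Longrightarrow> shuf m \<alpha> \<beta> vs = m (\<alpha> []) (\<beta> vs)"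
proof (induction vs arbitrary: \<beta>)
  case (Cons v vs)
  have "contr v \<alpha> = (\<lambda>x. 0)" using Cons.prems by (auto simp: contr_def)
  moreover have "gsign \<alpha> ws = \<alpha> ws" for ws using Cons.prems by (cases "ws = []") (simp_all add: gsign_def)
  then have "gsign \<alpha> = \<alpha>" by blast
  ultimately show ?case using Cons.IH[of "contr v \<beta>"] Cons.prems by (simp add: shuf_simps) (simp add: contr_def)
qed simp

end

definition deg :: "nat \<Rightarrow> ('v list \<Rightarrow> 'w::zero) \<Rightarrow> bool" where
  "deg k \<alpha> \<longleftrightarrow> (\<forall>vs. length vs \<noteq> k \<longrightarrow> \<alpha> vs = 0)"

lemma deg_gsign: "deg k \<alpha> \<Longrightarrow> gsign \<alpha> = (\<lambda>x. (-1) ^ k *\<^sub>R \<alpha> x)"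
  unfolding deg_def gsign_def by (metis scaleR_zero_right)

lemma deg_contr: "deg (Suc k) \<alpha> \<Longrightarrow> deg k (contr v \<alpha>)"
  by (auto simp: deg_def contr_def)

lemma deg_rcontr: "deg (Suc k) \<alpha> \<Longrightarrow> deg k (rcontr v \<alpha>)"
  by (auto simp: deg_def rcontr_def)

lemma deg_contr0: "deg 0 \<alpha> \<Longrightarrow> contr v \<alpha> = (\<lambda>x. 0)"
  by (auto simp: deg_def contr_def)

lemma deg_gsign': "deg k \<alpha> \<Longrightarrow> deg k (gsign \<alpha>)"
  by (auto simp: deg_def gsign_def)

lemma deg_shuf:
  fixes \<alpha> :: "'v list \<Rightarrow> 'a::real_vector" and \<beta> :: "'v list \<Rightarrow> 'b::real_vector" and m :: "'a \<Rightarrow> 'b \<Rightarrow> 'c::real_vector"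
  assumes m: "bilinear m" and "deg p \<alpha>" "deg q \<beta>" shows "deg (p + q) (shuf m \<alpha> \<beta>)"
  unfolding deg_def[of "p + q"]
proof (intro allI impI)
  fix vs :: "'v list" assume "length vs \<noteq> p + q"
  with assms(2,3) show "shuf m \<alpha> \<beta> vs = 0"
  proof (induction vs arbitrary: p q \<alpha> \<beta>)
    case Nil
    then have "\<alpha> [] = 0 \<or> \<beta> [] = 0" by (auto simp: deg_def)
    then show ?case using bilinear_lzero[OF m] bilinear_rzero[OF m] by auto
  next
    case (Cons v vs)
    have "shuf m (contr v \<alpha>) \<beta> vs = 0"
    proof (cases p)
      case 0 then show ?thesis using Cons.prems deg_contr0[of \<alpha>] by (simp add: shuf_zero_left[OF m])
    next
      case (Suc p') then show ?thesis using Cons.IH[of p' "contr v \<alpha>" q \<beta>] Cons.prems by (simp add: deg_contr)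
    qed
    moreover have "shuf m (gsign \<alpha>) (contr v \<beta>) vs = 0"
    proof (cases q)
      case 0 then show ?thesis using Cons.prems deg_contr0[of \<beta>] by (simp add: shuf_zero_right[OF m])
    next
      case (Suc q') then show ?thesis using Cons.IH[of p "gsign \<alpha>" q' "contr v \<beta>"] Cons.prems by (simp add: deg_contr deg_gsign')
    qed
    ultimately show ?case by simp
  qed
qed

subsection \<open>Alternating forms\<close>

text \<open>Alternation by adjacent swaps and without a fixed degree: in this form it passes to
  contractions and to \<open>gsign\<close> with no index arithmetic.\<close>

definition asym_form :: "('v list \<Rightarrow> 'w::ab_group_add) \<Rightarrow> bool" where
  "asym_form \<alpha> \<longleftrightarrow> (\<forall>xs u v ys. \<alpha> (xs @ u # v # ys) = - \<alpha> (xs @ v # u # ys))"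

definition mlin :: "('v::real_vector list \<Rightarrow> 'w::real_vector) \<Rightarrow> bool" where
  "mlin \<alpha> \<longleftrightarrow> (\<forall>xs ys. linear (\<lambda>v. \<alpha> (xs @ v # ys)))"

lemma alt_form_mlin:
  assumes "alt_form k \<alpha>" shows "mlin \<alpha>"
  unfolding mlin_def
proof (intro allI)
  fix xs ys
  show "linear (\<lambda>v. \<alpha> (xs @ v # ys))"
  proof (cases "length xs + Suc (length ys) = k")
    case True
    then have k: "length (xs @ 0 # ys) = k \<and> length xs < k" by auto
    have "\<forall>vs i. length vs = k \<and> i < k \<longrightarrow> linear (\<lambda>v. \<alpha> (vs[i := v]))"
      using assms unfolding alt_form_def by blast
    from this[rule_format, OF k] show ?thesis by simp
  next
    case False
    then have "(\<lambda>v. \<alpha> (xs @ v # ys)) = (\<lambda>v. 0)" using assms unfolding alt_form_def by auto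
    then show ?thesis by (simp add: linear_zero)
  qed
qed

text \<open>Polarisation: the form vanishes when the two adjacent arguments are both the sum of
  \<open>u\<close> and \<open>v\<close>.\<close>

lemma alt_form_asym:
  assumes "alt_form k \<alpha>" shows "asym_form \<alpha>"
  unfolding asym_form_def
proof (intro allI)
  fix xs u v ys
  have m: "linear (\<lambda>v. \<alpha> (xs @ v # ys))" for xs ys using alt_form_mlin[OF assms] by (simp add: mlin_def)
  have l1: "\<alpha> (xs @ (a + b) # zs) = \<alpha> (xs @ a # zs) + \<alpha> (xs @ b # zs)" for a b zs
    using linear_add[OF m] by simp
  have l2: "\<alpha> (xs @ c # (a + b) # zs) = \<alpha> (xs @ c # a # zs) + \<alpha> (xs @ c # b # zs)" for a b c zs
    using linear_add[OF m[of "xs @ [c]"], of a b] by simp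
  have z: "\<alpha> (xs @ w # w # ys) = 0" for w
  proof (cases "length (xs @ w # w # ys) = k")
    case True
    have *: "\<forall>vs i j. length vs = k \<and> i < j \<and> j < k \<and> vs ! i = vs ! j \<longrightarrow> \<alpha> vs = 0"
      using assms unfolding alt_form_def by blast
    show ?thesis
      by (rule *[rule_format, of _ "length xs" "Suc (length xs)"]) (use True in \<open>auto simp: nth_append\<close>)
  next
    case False then show ?thesis using assms unfolding alt_form_def by blast
  qed
  have "\<alpha> (xs @ (u + v) # (u + v) # ys) = \<alpha> (xs @ u # v # ys) + \<alpha> (xs @ v # u # ys)"
    unfolding l1 l2 by (simp add: z)
  then have "\<alpha> (xs @ u # v # ys) + \<alpha> (xs @ v # u # ys) = 0" unfolding z by (rule sym)
  then show "\<alpha> (xs @ u # v # ys) = - \<alpha> (xs @ v # u # ys)" by (rule iffD2[OF eq_neg_iff_add_eq_0])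
qed

lemma alt_form_deg: "alt_form k \<alpha> \<Longrightarrow> deg k \<alpha>"
  by (simp add: alt_form_def deg_def)

lemma asymD: "asym_form \<alpha> \<Longrightarrow> \<alpha> (xs @ u # v # ys) = - \<alpha> (xs @ v # u # ys)"
  unfolding asym_form_def by blast

lemma asym_contr: assumes a: "asym_form \<alpha>" shows "asym_form (contr v \<alpha>)"
  unfolding asym_form_def contr_def
proof (intro allI)
  fix xs u w ys
  show "\<alpha> (v # xs @ u # w # ys) = - \<alpha> (v # xs @ w # u # ys)" using asymD[OF a, of "v # xs" u w ys] by simp
qed

lemma asym_rcontr: assumes a: "asym_form \<alpha>" shows "asym_form (rcontr v \<alpha>)"
  unfolding asym_form_def rcontr_def
proof (intro allI)
  fix xs u w ys
  show "\<alpha> ((xs @ u # w # ys) @ [v]) = - \<alpha> ((xs @ w # u # ys) @ [v])" using asymD[OF a, of xs u w "ys @ [v]"] by simp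
qed

lemma asym_gsign: assumes a: "asym_form \<alpha>" shows "asym_form (gsign \<alpha>)"
  unfolding asym_form_def gsign_def
proof (intro allI)
  fix xs u w ys
  show "(- 1) ^ length (xs @ u # w # ys) *\<^sub>R \<alpha> (xs @ u # w # ys) = - ((- 1) ^ length (xs @ w # u # ys) *\<^sub>R \<alpha> (xs @ w # u # ys))"
    using asymD[OF a, of xs u w ys] by simp
qed

lemma mlinD: "mlin \<alpha> \<Longrightarrow> linear (\<lambda>v. \<alpha> (xs @ v # ys))"
  by (simp add: mlin_def)

lemma mlin_contr: assumes a: "mlin \<alpha>" shows "mlin (contr v \<alpha>)"
  unfolding mlin_def contr_def
proof (intro allI)
  fix xs ys
  show "linear (\<lambda>w. \<alpha> (v # xs @ w # ys))" using mlinD[OF a, of "v # xs" ys] by simp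
qed

lemma mlin_gsign: "mlin \<alpha> \<Longrightarrow> mlin (gsign \<alpha>)"
  unfolding mlin_def gsign_def by (simp add: linear_compose_scale_right linear_compose_neg)

lemma asym_contr2: assumes a: "asym_form \<alpha>" shows "contr u (contr v \<alpha>) = (\<lambda>x. - contr v (contr u \<alpha>) x)"
  unfolding contr_def
proof (rule ext)
  fix x
  show "\<alpha> (v # u # x) = - \<alpha> (u # v # x)" using asymD[OF a, of "[]" v u x] by simp
qed

text \<open>For the first two arguments, peeling both gives four terms: those with both contractions
  on one factor change sign because contractions anticommute, and the two mixed terms are exchanged
  with opposite signs by \<open>gsign\<close>.\<close>

lemma asym_shuf:
  assumes m: "bilinear m" and "asym_form \<alpha>" "asym_form \<beta>" shows "asym_form (shuf m \<alpha> \<beta>)"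
proof -
  have "shuf m \<alpha> \<beta> (xs @ u # v # ys) = - shuf m \<alpha> \<beta> (xs @ v # u # ys)" for xs u v ys
    using assms(2,3)
  proof (induction xs arbitrary: \<alpha> \<beta>)
    case Nil
    then show ?case
      by (simp add: shuf_simps[OF m] asym_contr2[of \<alpha> u v] asym_contr2[of \<beta> u v])
  next
    case (Cons x xs)
    then show ?case by (simp add: asym_contr asym_gsign)
  qed
  then show ?thesis unfolding asym_form_def by blast
qed

lemma mlin_shuf:
  assumes m: "bilinear m" and "mlin \<alpha>" "mlin \<beta>" shows "mlin (shuf m \<alpha> \<beta>)"
proof -
  have c: "contr (u + v) \<alpha> = (\<lambda>x. contr u \<alpha> x + contr v \<alpha> x)" "contr (r *\<^sub>R u) \<alpha> = (\<lambda>x. r *\<^sub>R contr u \<alpha> x)"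
    if "mlin \<alpha>" for u v r and \<alpha> :: "'d list \<Rightarrow> 'w::real_vector"
    using linear_add[OF mlinD[OF that, of "[]"]] linear_scale[OF mlinD[OF that, of "[]"]] by (simp_all add: contr_def)
  have "linear (\<lambda>v. shuf m \<alpha> \<beta> (xs @ v # ys))" for xs ys
    using assms(2,3)
  proof (induction xs arbitrary: \<alpha> \<beta>)
    case Nil
    then show ?case by (intro linearI) (simp_all add: shuf_simps[OF m] c scaleR_add_right)
  next
    case (Cons x xs)
    then show ?case by (simp add: mlin_contr mlin_gsign linear_compose_add)
  qed
  then show ?thesis unfolding mlin_def by blast
qed

lemma asym_move: "asym_form \<alpha> \<Longrightarrow> \<alpha> (xs @ v # ys) = (-1) ^ length ys *\<^sub>R \<alpha> (xs @ ys @ [v])"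
  for \<alpha> :: "'v list \<Rightarrow> 'w::real_vector"
proof (induction ys arbitrary: xs)
  case (Cons y ys)
  have "\<alpha> (xs @ v # y # ys) = - \<alpha> ((xs @ [y]) @ v # ys)"
    using asymD[OF Cons.prems, of xs v y ys] by simp
  then show ?case using Cons.IH[OF Cons.prems, of "xs @ [y]"] by simp
qed simp

subsection \<open>The wedge product as a shuffle product\<close>

definition altsum :: "('v list \<Rightarrow> 'w::real_vector) \<Rightarrow> nat \<Rightarrow> 'v list \<Rightarrow> 'w" where
  "altsum T n ws = (\<Sum>\<sigma> | \<sigma> permutes {..<n}. of_int (sign \<sigma>) *\<^sub>R T (map (\<lambda>i. ws ! \<sigma> i) [0..<n]))"

text \<open>Each permutation of \<open>n + 1\<close> indices is uniquely a transposition of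
  \<open>n\<close> with some \<open>b\<close> after a permutation of the first \<open>n\<close>. For
  \<open>b = n\<close> the sign is kept; otherwise it changes, and \<open>v\<close> takes the place
  of argument \<open>b\<close>, which becomes the last one.\<close>

lemma altsum_Suc:
  assumes n: "length vs = n"
  shows "altsum T (Suc n) (vs @ [v]) = altsum (\<lambda>xs. T (xs @ [v])) n vs - (\<Sum>b<n. altsum (\<lambda>xs. T (xs @ [vs ! b])) n (vs[b := v]))"
proof -
  let ?ws = "vs @ [v]"
  let ?f = "\<lambda>\<sigma>. of_int (sign \<sigma>) *\<^sub>R T (map (\<lambda>i. ?ws ! \<sigma> i) [0..<Suc n])"
  have inner: "?f (Transposition.transpose n b \<circ> q) = (if b = n then 1 else - 1) *\<^sub>R
      (of_int (sign q) *\<^sub>R T (map (\<lambda>i. (if b = n then vs else vs[b := v]) ! q i) [0..<n] @ [?ws ! b]))"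
    if q: "q permutes {..<n}" and b: "b \<le> n" for b q
  proof -
    have s: "sign (Transposition.transpose n b \<circ> q) = (if b = n then 1 else - 1) * sign q"
      using q by (subst sign_compose) (auto simp: sign_swap_id permutation_swap_id intro: permutes_imp_permutation[of "{..<n}"])
    have qn: "q n = n" using q by (simp add: permutes_not_in)
    have "?ws ! Transposition.transpose n b (q i) = (if b = n then vs else vs[b := v]) ! q i" if i: "i < n" for i
    proof -
      have "q i < n" using permutes_in_image[OF q, of i] i by simp
      then show ?thesis using b n by (auto simp: Transposition.transpose_def nth_append nth_list_update)
    qed
    then have mp: "map (\<lambda>i. ?ws ! (Transposition.transpose n b \<circ> q) i) [0..<Suc n] = map (\<lambda>i. (if b = n then vs else vs[b := v]) ! q i) [0..<n] @ [?ws ! b]"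
      by (simp add: qn)
    show ?thesis unfolding s mp by (cases "b = n") simp_all
  qed
  have "altsum T (Suc n) ?ws = (\<Sum>\<sigma> | \<sigma> permutes insert n {..<n}. ?f \<sigma>)"
    by (simp add: altsum_def lessThan_Suc)
  also have "\<dots> = (\<Sum>b\<in>insert n {..<n}. \<Sum>q | q permutes {..<n}. ?f (Transposition.transpose n b \<circ> q))"
    by (rule sum_over_permutations_insert) auto
  also have "\<dots> = (\<Sum>b\<in>insert n {..<n}. (if b = n then 1 else - 1) *\<^sub>R altsum (\<lambda>xs. T (xs @ [?ws ! b])) n (if b = n then vs else vs[b := v]))"
    unfolding altsum_def scaleR_sum_right by (intro sum.cong refl inner) auto
  also have "\<dots> = altsum (\<lambda>xs. T (xs @ [v])) n vs + (\<Sum>b<n. - altsum (\<lambda>xs. T (xs @ [vs ! b])) n (vs[b := v]))"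
    using n by (subst sum.insert) (auto simp: nth_append intro!: sum.cong)
  finally show ?thesis by (simp add: sum_negf)
qed

context
  fixes m :: "'a::real_vector \<Rightarrow> 'b::real_vector \<Rightarrow> 'c::real_vector"
  assumes m: "bilinear m"
begin

text \<open>A counting identity: in every shuffle, each of the \<open>q\<close> arguments given to
  the right factor can be moved into its last slot, so each term is met \<open>q\<close> times. The
  power of -1 is the sign of moving argument \<open>i\<close> to the end.\<close>

lemma shuf_peel:
  assumes "asym_form \<beta>" "deg q \<beta>"
  shows "(\<Sum>i<length w. (-1) ^ (length w - 1 - i) *\<^sub>R shuf m \<alpha> (rcontr (w ! i) \<beta>) (take i w @ drop (Suc i) w)) = real q *\<^sub>R shuf m \<alpha> \<beta> w"
  using assms
proof (induction w arbitrary: \<alpha> \<beta> q rule: rev_induct)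
  case Nil
  then show ?case by (cases q) (auto simp: deg_def bilinear_rzero[OF m])
next
  case (snoc x w)
  let ?n = "length w" and ?d = "\<lambda>i. take i w @ drop (Suc i) w"
  \<comment> \<open>For \<open>q = 0\<close> the contraction is zero, so the truncated degree
    \<open>q - 1\<close> is still correct.\<close>
  have dx: "deg (q - 1) (rcontr x \<beta>)"
  proof (cases q)
    case 0 then show ?thesis using snoc.prems by (auto simp: deg_def rcontr_def)
  qed (use snoc.prems deg_rcontr in auto)
  have rr: "rcontr x (rcontr u \<beta>) = (\<lambda>y. - rcontr u (rcontr x \<beta>) y)" for u
  proof
    fix y show "rcontr x (rcontr u \<beta>) y = - rcontr u (rcontr x \<beta>) y"
      using asymD[OF snoc.prems(1), of y x u "[]"] by (simp add: rcontr_def)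
  qed
  have gr: "gsign (rcontr u \<beta>) = (\<lambda>y. - rcontr u (gsign \<beta>) y)" for u
    by (simp add: rcontr_gsign)
  have tm: "(-1) ^ (?n - i) *\<^sub>R shuf m \<alpha> (rcontr (w ! i) \<beta>) (?d i @ [x]) =
     (-1) ^ (?n - 1 - i) *\<^sub>R shuf m \<alpha> (rcontr (w ! i) (rcontr x \<beta>)) (?d i) +
     (-1) ^ (?n - 1 - i) *\<^sub>R shuf m (rcontr x \<alpha>) (rcontr (w ! i) (gsign \<beta>)) (?d i)" if i: "i < ?n" for i
  proof -
    have "?n - i = Suc (?n - 1 - i)" using i by simp
    then show ?thesis unfolding shuf_snoc[OF m] rr gr by (simp add: shuf_simps[OF m] scaleR_add_right scaleR_diff_right)
  qed
  have "(\<Sum>i<length (w @ [x]). (-1) ^ (length (w @ [x]) - 1 - i) *\<^sub>R shuf m \<alpha> (rcontr ((w @ [x]) ! i) \<beta>) (take i (w @ [x]) @ drop (Suc i) (w @ [x])))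
      = (\<Sum>i<?n. (-1) ^ (?n - i) *\<^sub>R shuf m \<alpha> (rcontr (w ! i) \<beta>) (?d i @ [x])) + shuf m \<alpha> (rcontr x \<beta>) w"
    by (simp add: nth_append)
  also have "(\<Sum>i<?n. (-1) ^ (?n - i) *\<^sub>R shuf m \<alpha> (rcontr (w ! i) \<beta>) (?d i @ [x])) =
     real (q - 1) *\<^sub>R shuf m \<alpha> (rcontr x \<beta>) w + real q *\<^sub>R shuf m (rcontr x \<alpha>) (gsign \<beta>) w"
    unfolding snoc.IH[OF asym_rcontr[OF snoc.prems(1)] dx, symmetric]
      snoc.IH[OF asym_gsign[OF snoc.prems(1)] deg_gsign'[OF snoc.prems(2)], symmetric]
      sum.distrib[symmetric] by (intro sum.cong refl tm) simp
  also have "real (q - 1) *\<^sub>R shuf m \<alpha> (rcontr x \<beta>) w + real q *\<^sub>R shuf m (rcontr x \<alpha>) (gsign \<beta>) w + shuf m \<alpha> (rcontr x \<beta>) w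
      = real q *\<^sub>R shuf m \<alpha> \<beta> (w @ [x])"
  proof (cases q)
    case 0
    then have "rcontr x \<beta> = (\<lambda>y. 0)" using snoc.prems by (auto simp: deg_def rcontr_def)
    then show ?thesis using 0 by (simp add: shuf_simps[OF m])
  next
    case (Suc q')
    then show ?thesis unfolding shuf_snoc[OF m] by (simp add: algebra_simps)
  qed
  finally show ?case .
qed

text \<open>The peeling identity in the shape produced by \<open>altsum_Suc\<close>, where argument
  \<open>i\<close> is replaced by \<open>v\<close> instead of deleted; moving \<open>v\<close> to
  the end accounts for the signs.\<close>

lemma shuf_peel_swap:
  assumes a: "asym_form \<alpha>" and b: "asym_form \<beta>" "deg q \<beta>"
  shows "shuf m \<alpha> (rcontr v \<beta>) vs - (\<Sum>i<length vs. shuf m \<alpha> (rcontr (vs ! i) \<beta>) (vs[i := v])) = real q *\<^sub>R shuf m \<alpha> \<beta> (vs @ [v])"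
proof -
  let ?n = "length vs"
  have "(-1) ^ (?n - i) *\<^sub>R shuf m \<alpha> (rcontr (vs ! i) \<beta>) (take i vs @ drop (Suc i) vs @ [v])
      = - shuf m \<alpha> (rcontr (vs ! i) \<beta>) (vs[i := v])" if i: "i < ?n" for i
  proof -
    have "?n - i = Suc (?n - Suc i)" using i by simp
    then show ?thesis
      unfolding upd_conv_take_nth_drop[OF i] asym_move[OF asym_shuf[OF m a asym_rcontr[OF b(1)]], where xs = "take i vs" and v = v and ys = "drop (Suc i) vs"]
      by simp
  qed
  then show ?thesis
    using shuf_peel[OF b, of "vs @ [v]" \<alpha>] by (simp add: nth_append sum_negf)
qed

end

lemma bilinear_scaleR: "bilinear (*\<^sub>R)"
  by (auto simp: bilinear_def linear_iff algebra_simps)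

lemma bilinear_times: "bilinear ((*) :: real \<Rightarrow> real \<Rightarrow> real)"
  by (auto simp: bilinear_def linear_iff algebra_simps)

definition unit_form :: "'v list \<Rightarrow> real" where
  "unit_form vs = (if vs = [] then 1 else 0)"

lemma unit_form_props: "deg 0 unit_form" "asym_form unit_form"
  by (auto simp: deg_def asym_form_def unit_form_def)

text \<open>With \<open>unit_form\<close> as left factor the shuffle product is the right factor
  itself, so the peeling identity supplies the factor \<open>Suc q\<close> of the induction
  step.\<close>

lemma altsum_alternating:
  fixes \<beta> :: "'v list \<Rightarrow> 'w::real_vector"
  assumes "asym_form \<beta>" "deg q \<beta>" "length vs = q"
  shows "altsum \<beta> q vs = fact q *\<^sub>R \<beta> vs"
  using assms
proof (induction q arbitrary: \<beta> vs)
  case 0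
  then show ?case by (simp add: altsum_def)
next
  case (Suc q)
  obtain us v where us: "vs = us @ [v]" "length us = q" using Suc.prems(3) by (metis length_Suc_conv_rev)
  have IH: "altsum (\<lambda>xs. \<beta> (xs @ [w])) q zs = fact q *\<^sub>R rcontr w \<beta> zs" if "length zs = q" for w zs
    using Suc.IH[OF asym_rcontr[OF Suc.prems(1)] deg_rcontr[OF Suc.prems(2)] that] by (simp add: rcontr_def)
  have u: "shuf (*\<^sub>R) unit_form \<gamma> zs = \<gamma> zs" for \<gamma> :: "'v list \<Rightarrow> 'w" and zs
    using shuf_deg0_left[OF bilinear_scaleR, of unit_form \<gamma>] by (simp add: unit_form_def)
  have "altsum \<beta> (Suc q) vs = fact q *\<^sub>R (rcontr v \<beta> us - (\<Sum>i<q. rcontr (us ! i) \<beta> (us[i := v])))"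
    unfolding us(1) altsum_Suc[OF us(2)] using us(2) by (simp add: IH scaleR_sum_right scaleR_diff_right)
  also have "\<dots> = fact q *\<^sub>R (real (Suc q) *\<^sub>R \<beta> vs)"
    using shuf_peel_swap[OF bilinear_scaleR unit_form_props(2) Suc.prems(1,2), of v us] us by (simp only: u)
  finally show ?case by (simp add: mult.commute)
qed

text \<open>Induction on the degree of the right factor: each step removes its last slot by the
  peeling identity and contributes one factor of \<open>fact q\<close>. At degree 0 the left factor
  alone is antisymmetrised, which gives \<open>fact p\<close>.\<close>

lemma altsum_shuf:
  assumes m: "bilinear m" and a: "asym_form \<alpha>" "deg p \<alpha>" and "asym_form \<beta>" "deg q \<beta>" "length vs = p + q"
  shows "altsum (\<lambda>xs. m (\<alpha> (take p xs)) (\<beta> (drop p xs))) (p + q) vs = (fact p * fact q) *\<^sub>R shuf m \<alpha> \<beta> vs"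
  using assms(4-)
proof (induction q arbitrary: \<beta> vs)
  case 0
  have lin: "linear (\<lambda>x. m x (\<beta> []))" using m by (simp add: bilinear_def)
  have "altsum (\<lambda>xs. m (\<alpha> (take p xs)) (\<beta> (drop p xs))) (p + 0) vs = m (altsum \<alpha> p vs) (\<beta> [])"
    unfolding altsum_def linear_sum[OF lin] by (intro sum.cong) (auto simp: bilinear_lmul[OF m])
  also have "\<dots> = fact p *\<^sub>R m (\<alpha> vs) (\<beta> [])"
    using altsum_alternating[OF a] 0 by (simp add: bilinear_lmul[OF m])
  also have "m (\<alpha> vs) (\<beta> []) = shuf m \<alpha> \<beta> vs"
    using shuf_deg0_right[OF m, of \<beta>] 0 by (simp add: deg_def)
  finally show ?case by simp
next
  case (Suc q)
  let ?n = "p + q"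
  obtain us v where us: "vs = us @ [v]" "length us = ?n" using Suc.prems(3) by (metis length_Suc_conv_rev add_Suc_right)
  have IH: "altsum (\<lambda>xs. m (\<alpha> (take p (xs @ [w]))) (\<beta> (drop p (xs @ [w])))) ?n zs = (fact p * fact q) *\<^sub>R shuf m \<alpha> (rcontr w \<beta>) zs"
    if z: "length zs = ?n" for w zs
  proof -
    have "altsum (\<lambda>xs. m (\<alpha> (take p (xs @ [w]))) (\<beta> (drop p (xs @ [w])))) ?n zs =
        altsum (\<lambda>xs. m (\<alpha> (take p xs)) (rcontr w \<beta> (drop p xs))) ?n zs"
      unfolding altsum_def by (intro sum.cong) (auto simp: rcontr_def)
    then show ?thesis
      using Suc.IH[OF asym_rcontr[OF Suc.prems(1)] deg_rcontr[OF Suc.prems(2)] z] by simp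
  qed
  have "altsum (\<lambda>xs. m (\<alpha> (take p xs)) (\<beta> (drop p xs))) (Suc ?n) vs =
     (fact p * fact q) *\<^sub>R (shuf m \<alpha> (rcontr v \<beta>) us - (\<Sum>i<?n. shuf m \<alpha> (rcontr (us ! i) \<beta>) (us[i := v])))"
    unfolding us(1) altsum_Suc[OF us(2)] using us(2) by (simp only: IH length_list_update scaleR_sum_right scaleR_diff_right)
  also have "\<dots> = (fact p * fact q) *\<^sub>R (real (Suc q) *\<^sub>R shuf m \<alpha> \<beta> vs)"
    using shuf_peel_swap[OF m a(1) Suc.prems(1,2), of v us] us by simp
  finally show ?case by (simp add: mult.commute mult.left_commute)
qed

text \<open>The factorials of the antisymmetrised product cancel the normalisation of
  \<open>wedge\<close>. Computations with wedge products can henceforth be carried out with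
  \<open>shuf\<close>.\<close>

lemma wedge_eq_shuf:
  assumes m: "bilinear m" and a: "asym_form \<alpha>" "deg p \<alpha>" and b: "asym_form \<beta>" "deg q \<beta>"
  shows "wedge m p q \<alpha> \<beta> = shuf m \<alpha> \<beta>"
proof
  fix vs
  show "wedge m p q \<alpha> \<beta> vs = shuf m \<alpha> \<beta> vs"
  proof (cases "length vs = p + q")
    case True
    have "map f [0..<p] = take p (map f [0..<p + q])" "map f [p..<p + q] = drop p (map f [0..<p + q])" for f :: "nat \<Rightarrow> 'd"
      by (auto simp: take_map drop_map)
    then have "(\<Sum>\<sigma> | \<sigma> permutes {..<p + q}. of_int (sign \<sigma>) *\<^sub>R m (\<alpha> (map (\<lambda>i. vs ! \<sigma> i) [0..<p])) (\<beta> (map (\<lambda>i. vs ! \<sigma> i) [p..<p + q])))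
        = altsum (\<lambda>xs. m (\<alpha> (take p xs)) (\<beta> (drop p xs))) (p + q) vs"
      unfolding altsum_def by (intro sum.cong refl) metis
    then show ?thesis using True altsum_shuf[OF m a b True] by (simp add: wedge_def)
  next
    case False
    then show ?thesis using deg_shuf[OF m a(2) b(2)] by (simp add: wedge_def deg_def)
  qed
qed

abbreviation rsh :: "('v list \<Rightarrow> real) \<Rightarrow> ('v list \<Rightarrow> real) \<Rightarrow> 'v list \<Rightarrow> real" where
  "rsh \<equiv> shuf (*)"

lemmas rsh_simps = shuf_simps[OF bilinear_times]
lemma rsh_mult_left: "rsh (\<lambda>x. r * \<alpha> x) \<beta> vs = r * rsh \<alpha> \<beta> vs"
  using shuf_scale_left[OF bilinear_times, of r \<alpha> \<beta> vs] by simp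

lemma rsh_mult_right: "rsh \<alpha> (\<lambda>x. r * \<beta> x) vs = r * rsh \<alpha> \<beta> vs"
  using shuf_scale_right[OF bilinear_times, of \<alpha> r \<beta> vs] by simp

lemmas contr_rsh = contr_shuf[OF bilinear_times]

lemma gsign_rsh: "gsign (rsh \<alpha> \<beta>) = rsh (gsign \<alpha>) (gsign \<beta>)"
  by (rule ext) (rule gsign_shuf[OF bilinear_times])

lemma rsh_assoc: "rsh (rsh \<alpha> \<beta>) \<gamma> = rsh \<alpha> (rsh \<beta> \<gamma>)"
proof
  fix vs show "rsh (rsh \<alpha> \<beta>) \<gamma> vs = rsh \<alpha> (rsh \<beta> \<gamma>) vs"
    by (induction vs arbitrary: \<alpha> \<beta> \<gamma>) (simp_all add: contr_rsh rsh_simps gsign_rsh)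
qed

text \<open>A contraction reverses the parity of a form, so the even and the odd case have to be
  proved by a common induction.\<close>

lemma rsh_commute_aux:
  "(gsign \<alpha> = \<alpha> \<longrightarrow> rsh \<alpha> \<beta> vs = rsh \<beta> \<alpha> vs) \<and> (gsign \<alpha> = (\<lambda>x. - \<alpha> x) \<longrightarrow> rsh \<alpha> \<beta> vs = rsh (gsign \<beta>) \<alpha> vs)"
proof (induction vs arbitrary: \<alpha> \<beta>)
  case Nil
  then show ?case by (simp add: gsign_def)
next
  case (Cons v vs)
  have g: "gsign (contr v \<alpha>) = (\<lambda>x. - contr v (gsign \<alpha>) x)" by simp
  show ?case
  proof (intro conjI impI)
    assume a: "gsign \<alpha> = \<alpha>"
    have "gsign (contr v \<alpha>) = (\<lambda>x. - contr v \<alpha> x)" unfolding g a ..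
    then have 1: "rsh (contr v \<alpha>) \<beta> vs = rsh (gsign \<beta>) (contr v \<alpha>) vs"
      using Cons.IH[of "contr v \<alpha>" \<beta>] by blast
    have 2: "rsh \<alpha> (contr v \<beta>) vs = rsh (contr v \<beta>) \<alpha> vs" using Cons.IH[of \<alpha> "contr v \<beta>"] a by blast
    show "rsh \<alpha> \<beta> (v # vs) = rsh \<beta> \<alpha> (v # vs)"
      unfolding shuf.simps a 1 2 by (rule add.commute)
  next
    assume a: "gsign \<alpha> = (\<lambda>x. - \<alpha> x)"
    have "gsign (contr v \<alpha>) = contr v \<alpha>" unfolding g a by simp
    then have 1: "rsh (contr v \<alpha>) \<beta> vs = rsh \<beta> (contr v \<alpha>) vs"
      using Cons.IH[of "contr v \<alpha>" \<beta>] by blast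
    have 2: "rsh \<alpha> (contr v \<beta>) vs = rsh (gsign (contr v \<beta>)) \<alpha> vs" using Cons.IH[of \<alpha> "contr v \<beta>"] a by blast
    have "rsh \<alpha> \<beta> (v # vs) = rsh \<beta> (contr v \<alpha>) vs - rsh (gsign (contr v \<beta>)) \<alpha> vs"
      unfolding shuf.simps a shuf_minus_left[OF bilinear_times] 1 2 by simp
    moreover have "rsh (gsign \<beta>) \<alpha> (v # vs) = rsh \<beta> (contr v \<alpha>) vs - rsh (gsign (contr v \<beta>)) \<alpha> vs"
      by (simp add: rsh_simps)
    ultimately show "rsh \<alpha> \<beta> (v # vs) = rsh (gsign \<beta>) \<alpha> (v # vs)" by simp
  qed
qed

lemma rsh_even_commute: "gsign \<alpha> = \<alpha> \<Longrightarrow> rsh \<alpha> \<beta> = rsh \<beta> \<alpha>"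
  using rsh_commute_aux by blast

text \<open>Expanding all arguments in the basis leaves only values on more than
  \<open>card B\<close> basis vectors. One of them is repeated, and swaps bring its two occurrences
  side by side.\<close>

lemma top_form_zero:
  fixes \<gamma> :: "'v::real_normed_vector list \<Rightarrow> 'w::real_vector"
  assumes B: "is_basis (B :: 'v set)" and \<gamma>: "mlin \<gamma>" "asym_form \<gamma>" and vs: "length vs > card B"
  shows "\<gamma> vs = 0"
proof -
  have rep: "\<gamma> (xs @ u # ys @ u # zs) = 0" for xs ys zs :: "'v list" and u
  proof -
    have z: "\<gamma> (xs @ u # u # zs) = 0" for xs zs
      using asymD[OF \<gamma>(2), of xs u u zs] by (metis eq_neg_iff_add_eq_0 scaleR_2 scaleR_eq_0_iff zero_neq_numeral)
    show ?thesis
    proof (induction ys arbitrary: xs)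
      case Nil then show ?case by (simp add: z)
    next
      case (Cons y ys)
      have "\<gamma> (xs @ u # (y # ys) @ u # zs) = - \<gamma> ((xs @ [y]) @ u # ys @ u # zs)"
        using asymD[OF \<gamma>(2), of xs u y "ys @ u # zs"] by simp
      then show ?case unfolding Cons by simp
    qed
  qed
  have fB: "finite B" using B by (simp add: is_basis_def)
  have "\<gamma> (xs @ ys) = 0" if "set xs \<subseteq> B" "length (xs @ ys) > card B" for xs ys :: "'v list"
    using that
  proof (induction ys arbitrary: xs)
    case Nil
    have "\<not> distinct xs" using Nil fB by (metis append_Nil2 card_mono distinct_card not_le)
    then obtain as bs cs u where "xs = as @ [u] @ bs @ [u] @ cs" using not_distinct_decomp by blast
    then show ?case using rep[of as u bs cs] by simp
  next
    case (Cons y ys)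
    have "\<gamma> (xs @ y # ys) = (\<Sum>b\<in>B. representation B y b *\<^sub>R \<gamma> ((xs @ [b]) @ ys))"
      using linear_basis_expansion[OF B mlinD[OF \<gamma>(1), of xs ys], of y] by simp
    also have "\<dots> = 0" using Cons.IH[of "xs @ [_]"] Cons.prems by (intro sum.neutral) auto
    finally show ?case .
  qed
  from this[of "[]" vs] show ?thesis using vs by simp
qed

section \<open>Divided powers of a 2-form and their contractions\<close>

definition ipow :: "('v list \<Rightarrow> real) \<Rightarrow> int \<Rightarrow> 'v list \<Rightarrow> real" where
  "ipow \<omega> k vs = (if k < 0 then 0 else wpow \<omega> (nat k) vs / fact (nat k))"

lemma mlin_zero: "mlin (\<lambda>vs. 0)"
  by (simp add: mlin_def linear_zero)

lemma asym_scale: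
  fixes \<alpha> :: "'v list \<Rightarrow> 'w::real_vector"
  assumes "asym_form \<alpha>" shows "asym_form (\<lambda>x. r *\<^sub>R \<alpha> x)"
  unfolding asym_form_def
proof (intro allI)
  fix xs u v ys show "r *\<^sub>R \<alpha> (xs @ u # v # ys) = - (r *\<^sub>R \<alpha> (xs @ v # u # ys))"
    using asymD[OF assms, of xs u v ys] by simp
qed

lemma mlin_scale: "mlin \<alpha> \<Longrightarrow> mlin (\<lambda>x. r *\<^sub>R \<alpha> x)"
  unfolding mlin_def by (simp add: linear_compose_scale_right)

lemma deg_scale: fixes \<alpha> :: "'v list \<Rightarrow> 'w::real_vector" shows "deg k \<alpha> \<Longrightarrow> deg k (\<lambda>x. r *\<^sub>R \<alpha> x)"
  unfolding deg_def by simp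

context
  fixes \<omega> :: "'v::real_vector list \<Rightarrow> real"
  assumes \<omega>: "alt_form 2 \<omega>"
begin

lemma even_2form: "gsign \<omega> = \<omega>"
  using deg_gsign[OF alt_form_deg[OF \<omega>]] by simp

lemma wpow_props: "deg (2 * k) (wpow \<omega> k)" "asym_form (wpow \<omega> k)" "mlin (wpow \<omega> k)"
  and wpow_Suc_rsh: "wpow \<omega> (Suc k) = rsh \<omega> (wpow \<omega> k)"
proof -
  note a = alt_form_asym[OF \<omega>] and l = alt_form_mlin[OF \<omega>] and d = alt_form_deg[OF \<omega>]
  have *: "deg (2 * k) (wpow \<omega> k) \<and> asym_form (wpow \<omega> k) \<and> mlin (wpow \<omega> k)" for k
  proof (induction k)
    case 0
    then show ?case by (auto simp: deg_def asym_form_def mlin_def linear_zero)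
  next
    case (Suc k)
    have e: "wpow \<omega> (Suc k) = rsh \<omega> (wpow \<omega> k)"
      using wedge_eq_shuf[OF bilinear_times a d] Suc by simp
    show ?case unfolding e
      using deg_shuf[OF bilinear_times d, of "2 * k" "wpow \<omega> k"] asym_shuf[OF bilinear_times a] mlin_shuf[OF bilinear_times l] Suc by simp
  qed
  show "deg (2 * k) (wpow \<omega> k)" "asym_form (wpow \<omega> k)" "mlin (wpow \<omega> k)" using * by auto
  show "wpow \<omega> (Suc k) = rsh \<omega> (wpow \<omega> k)"
    using wedge_eq_shuf[OF bilinear_times a d] *[of k] by simp
qed

text \<open>Contraction is an antiderivation; since the 2-form is even, it commutes with all forms
  and the resulting terms are equal.\<close>

lemma contr_wpow: "contr v (wpow \<omega> (Suc k)) = (\<lambda>x. real (Suc k) *\<^sub>R rsh (contr v \<omega>) (wpow \<omega> k) x)"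
proof (induction k)
  case 0
  have "contr v (wpow \<omega> 0) = (\<lambda>x. 0)" by (auto simp: contr_def)
  then show ?case unfolding wpow_Suc_rsh[of 0] contr_rsh by (simp add: rsh_simps)
next
  case (Suc k)
  have "rsh \<omega> (rsh (contr v \<omega>) (wpow \<omega> k)) = rsh (contr v \<omega>) (wpow \<omega> (Suc k))"
    unfolding wpow_Suc_rsh[of k] rsh_assoc[symmetric] rsh_even_commute[OF even_2form, of "contr v \<omega>"] ..
  then show ?case
    unfolding wpow_Suc_rsh[of "Suc k"] contr_rsh[of v \<omega>] even_2form Suc by (simp add: rsh_simps rsh_mult_right algebra_simps del: wpow.simps)
qed

lemma ipow_alt: "ipow \<omega> k = (\<lambda>x. (if k < 0 then 0 else 1 / fact (nat k)) *\<^sub>R wpow \<omega> (nat k) x)"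
  by (auto simp: ipow_def)

lemma ipow_props: "deg (nat (2 * k)) (ipow \<omega> k)" "asym_form (ipow \<omega> k)" "mlin (ipow \<omega> k)"
proof -
  have "nat (2 * k) = 2 * nat k" by simp
  then show "deg (nat (2 * k)) (ipow \<omega> k)" "asym_form (ipow \<omega> k)" "mlin (ipow \<omega> k)"
    unfolding ipow_alt using wpow_props[of "nat k"] by (simp_all only: deg_scale asym_scale mlin_scale)
qed

text \<open>Dividing by the factorial absorbs the coefficient of \<open>contr_wpow\<close>. The rule
  also holds for exponents at most 0, where both sides vanish; this is the reason for integer
  exponents.\<close>

lemma contr_ipow: "contr v (ipow \<omega> k) = rsh (contr v \<omega>) (ipow \<omega> (k - 1))"
proof
  fix x
  consider "k < 0" | "k = 0" | "k > 0" by linarith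
  then show "contr v (ipow \<omega> k) x = rsh (contr v \<omega>) (ipow \<omega> (k - 1)) x"
  proof cases
    case 1
    then have "ipow \<omega> k = (\<lambda>x. 0)" "ipow \<omega> (k - 1) = (\<lambda>x. 0)" by (auto simp: ipow_def)
    then show ?thesis by (simp add: rsh_simps)
  next
    case 2
    then have "contr v (ipow \<omega> k) = (\<lambda>x. 0)" "ipow \<omega> (k - 1) = (\<lambda>x. 0)" by (auto simp: ipow_def contr_def)
    then show ?thesis by (simp add: rsh_simps)
  next
    case 3
    define j where "j = nat k - 1"
    have n: "nat k = Suc j" "nat (k - 1) = j" using 3 by (auto simp: j_def)
    have 1: "ipow \<omega> k = (\<lambda>x. (1 / fact (Suc j)) *\<^sub>R wpow \<omega> (Suc j) x)"
      using 3 by (simp add: ipow_alt n del: wpow.simps fact_Suc)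
    have 2: "ipow \<omega> (k - 1) = (\<lambda>x. (1 / fact j) *\<^sub>R wpow \<omega> j x)"
      using 3 by (simp add: ipow_alt n)
    have e: "(1 / fact (Suc j)) * (real (Suc j) * t) = (1 / fact j) * t" for t :: real
      by (simp add: field_simps del: of_nat_Suc)
    show ?thesis unfolding 1 2 contr_simps(2) contr_wpow shuf_scale_right[OF bilinear_times] by (simp only: real_scaleR_def e)
  qed
qed

end

section \<open>Orthonormal bases\<close>

definition orthonormal :: "('v \<Rightarrow> 'v \<Rightarrow> real) \<Rightarrow> nat \<Rightarrow> (nat \<Rightarrow> 'v) \<Rightarrow> bool" where
  "orthonormal g N e \<longleftrightarrow> (\<forall>i<N. \<forall>j<N. g (e i) (e j) = (if i = j then 1 else 0))"

lemma inner_product_bilinear: "inner_product g \<Longrightarrow> bilinear g"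
  and inner_product_sym: "inner_product g \<Longrightarrow> g u v = g v u"
  and inner_product_pos: "inner_product g \<Longrightarrow> u \<noteq> 0 \<Longrightarrow> 0 < g u u"
  by (auto simp: inner_product_def)

lemma bilinear_sum_left: "bilinear h \<Longrightarrow> h (\<Sum>i\<in>I. f i) v = (\<Sum>i\<in>I. h (f i) v)"
  and bilinear_sum_right: "bilinear h \<Longrightarrow> h u (\<Sum>i\<in>I. f i) = (\<Sum>i\<in>I. h u (f i))"
  using linear_sum[of "\<lambda>x. h x v" f I] linear_sum[of "h u" f I] by (auto simp: bilinear_def)

text \<open>Gram-Schmidt with a parameter. It yields continuous local frames for a varying metric
  and, over a one-point parameter set, the existence of an orthonormal basis.\<close>

lemma continuous_gram_schmidt:
  fixes g :: "'y::topological_space \<Rightarrow> 'v::real_normed_vector \<Rightarrow> 'v \<Rightarrow> real"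
  assumes B: "is_basis (B :: 'v set)"
    and g: "\<And>y. y \<in> S \<Longrightarrow> inner_product (g y)" and c: "\<And>u v. continuous_on S (\<lambda>y. g y u v)"
  shows "\<exists>e. (\<forall>i. continuous_on S (\<lambda>y. e y i)) \<and> (\<forall>y\<in>S. orthonormal (g y) (card B) (e y))"
proof -
  note bil = inner_product_bilinear[OF g]
  have lin: "linear (g y u)" "linear (\<lambda>u. g y u v)" if "y \<in> S" for y u v
    using bil[OF that] by (auto simp: bilinear_def)
  have cg: "continuous_on S (\<lambda>y. g y (a y) (b y))" if "continuous_on S a" "continuous_on S b" for a b
  proof -
    have 1: "continuous_on S (\<lambda>y. g y (a y) v)" for v
    proof (rule continuous_on_linear_apply[OF B, where L = "\<lambda>y u. g y u v" and w = a])
      show "linear (\<lambda>u. g y u v)" if "y \<in> S" for y by (rule lin(2)[OF that])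
    qed (rule c that)+
    show ?thesis
    proof (rule continuous_on_linear_apply[OF B, where L = "\<lambda>y. g y (a y)" and w = b])
      show "linear (g y (a y))" if "y \<in> S" for y by (rule lin(1)[OF that])
    qed (rule 1 that)+
  qed
  obtain bs where bs: "set bs = B" "distinct bs" "length bs = card B"
    using B finite_distinct_list[of B] distinct_card unfolding is_basis_def by metis
  \<comment> \<open>The span condition is carried along because it makes the next vector
    \<open>w\<close> nonzero: \<open>b\<close> lies outside the span of its predecessors.\<close>
  have "\<exists>e. (\<forall>i. continuous_on S (\<lambda>y. e y i)) \<and> (\<forall>y\<in>S. orthonormal (g y) k (e y) \<and> (\<forall>i<k. e y i \<in> span (set (take k bs))))"
    if "k \<le> card B" for k
    using that
  proof (induction k)
    case 0
    show ?case by (rule exI[of _ "\<lambda>_ _. 0"]) (auto simp: orthonormal_def)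
  next
    case (Suc k)
    then obtain e where e: "\<And>i. continuous_on S (\<lambda>y. e y i)" "\<And>y. y \<in> S \<Longrightarrow> orthonormal (g y) k (e y)"
      "\<And>y i. y \<in> S \<Longrightarrow> i < k \<Longrightarrow> e y i \<in> span (set (take k bs))" by auto
    define b where "b = bs ! k"
    have kl: "k < length bs" using Suc.prems bs by simp
    define w where "w = (\<lambda>y. b - (\<Sum>i<k. g y b (e y i) *\<^sub>R e y i))"
    have cw: "continuous_on S w" unfolding w_def by (intro continuous_intros cg e)
    have bn: "b \<notin> span (set (take k bs))"
    proof -
      have "b \<notin> set (take k bs)" using bs(2) kl unfolding b_def
        by (auto simp: in_set_conv_nth nth_eq_iff_index_eq)
      moreover have "set (take k bs) \<subseteq> B" "b \<in> B" using bs set_take_subset[of k bs] kl by (auto simp: b_def)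
      ultimately have "independent (insert b (set (take k bs)))" "b \<notin> set (take k bs)"
        using B independent_mono[of B "insert b (set (take k bs))"] by (auto simp: is_basis_def)
      then show ?thesis by (simp add: independent_insert)
    qed
    have w0: "w y \<noteq> 0" if "y \<in> S" for y
    proof
      assume "w y = 0"
      then have "b = (\<Sum>i<k. g y b (e y i) *\<^sub>R e y i)" by (simp add: w_def)
      moreover have "\<dots> \<in> span (set (take k bs))" by (intro span_sum span_scale e that) auto
      ultimately show False using bn by simp
    qed
    have gw: "g y (w y) (w y) > 0" if "y \<in> S" for y using inner_product_pos[OF g[OF that] w0[OF that]] .
    define f where "f = (\<lambda>y i. if i = k then (1 / sqrt (g y (w y) (w y))) *\<^sub>R w y else e y i)"
    have "continuous_on S (\<lambda>y. f y i)" for i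
    proof (cases "i = k")
      case True
      have "continuous_on S (\<lambda>y. (1 / sqrt (g y (w y) (w y))) *\<^sub>R w y)"
        by (intro continuous_intros cg cw) (use gw in force)
      then show ?thesis using True by (simp add: f_def)
    next
      case False then show ?thesis using e(1)[of i] by (simp add: f_def)
    qed
    moreover have "orthonormal (g y) (Suc k) (f y) \<and> (\<forall>i<Suc k. f y i \<in> span (set (take (Suc k) bs)))" if y: "y \<in> S" for y
    proof
      note bl = bil[OF y] and sy = inner_product_sym[OF g[OF y]]
      have we: "g y (w y) (e y j) = 0" if j: "j < k" for j
      proof -
        have "g y (w y) (e y j) = g y b (e y j) - (\<Sum>i<k. g y b (e y i) * g y (e y i) (e y j))"
          unfolding w_def by (simp add: bilinear_lsub[OF bl] bilinear_sum_left[OF bl] bilinear_lmul[OF bl])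
        also have "(\<Sum>i<k. g y b (e y i) * g y (e y i) (e y j)) = (\<Sum>i<k. if i = j then g y b (e y i) else 0)"
          by (intro sum.cong refl) (use e(2)[OF y] j in \<open>auto simp: orthonormal_def\<close>)
        also have "\<dots> = g y b (e y j)" using j by simp
        finally show ?thesis by simp
      qed
      have 1: "g y (f y k) (f y k) = 1"
        unfolding f_def using gw[OF y] by (simp add: bilinear_lmul[OF bl] bilinear_rmul[OF bl] field_simps)
      have 2: "g y (f y k) (f y j) = 0" if "j < k" for j
        unfolding f_def using we[OF that] that by (simp add: bilinear_lmul[OF bl])
      have 3: "g y (f y j) (f y k) = 0" if "j < k" for j using 2[OF that] sy by metis
      have 4: "g y (f y i) (f y j) = (if i = j then 1 else 0)" if "i < k" "j < k" for i j
        using e(2)[OF y] that by (auto simp: orthonormal_def f_def)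
      show "orthonormal (g y) (Suc k) (f y)" unfolding orthonormal_def
        using 1 2 3 4 by (auto simp: less_Suc_eq)
      have sub: "span (set (take k bs)) \<subseteq> span (set (take (Suc k) bs))"
        by (rule span_mono) (rule set_take_subset_set_take, simp)
      have "b \<in> set (take (Suc k) bs)" unfolding b_def using kl by (auto simp: take_Suc_conv_app_nth)
      then have "w y \<in> span (set (take (Suc k) bs))" unfolding w_def
        using e(3)[OF y] sub by (intro span_diff span_sum span_scale) (auto intro: span_base)
      then show "\<forall>i<Suc k. f y i \<in> span (set (take (Suc k) bs))"
        using e(3)[OF y] sub by (auto simp: f_def less_Suc_eq intro!: span_scale)
    qed
    ultimately show ?case by (intro exI[of _ f]) blast
  qed
  from this[of "card B"] show ?thesis by auto
qed

section \<open>Orthonormal expansions and basis independence of traces\<close>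

locale onb_space =
  fixes g :: "'v::real_normed_vector \<Rightarrow> 'v \<Rightarrow> real" and N :: nat
  assumes g: "inner_product g" and N: "dim (UNIV :: 'v set) = N" and fin: "\<exists>B :: 'v set. is_basis B"
begin

lemma bil: "bilinear g" by (rule inner_product_bilinear[OF g])

lemma sym: "g u v = g v u" by (rule inner_product_sym[OF g])

lemma basis_card: "is_basis (B :: 'v set) \<Longrightarrow> card B = N"
  using dim_eq_card[of B UNIV] N by (simp add: is_basis_def)

lemma orthonormal_inj: "orthonormal g N e \<Longrightarrow> inj_on e {..<N}"
  unfolding orthonormal_def by (rule inj_onI) (metis lessThan_iff zero_neq_one)

lemma coefficient:
  assumes e: "orthonormal g N e" and j: "j < N"
  shows "g (\<Sum>i<N. a i *\<^sub>R e i) (e j) = a j"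
proof -
  have "g (\<Sum>i<N. a i *\<^sub>R e i) (e j) = (\<Sum>i<N. a i * g (e i) (e j))"
    by (simp add: bilinear_sum_left[OF bil] bilinear_lmul[OF bil])
  also have "\<dots> = (\<Sum>i<N. if i = j then a i else 0)"
    by (intro sum.cong refl) (use e j in \<open>auto simp: orthonormal_def\<close>)
  also have "\<dots> = a j" using j by simp
  finally show ?thesis .
qed

lemma orthonormal_independent:
  assumes e: "orthonormal g N e" shows "independent (e ` {..<N})"
proof (rule independent_if_scalars_zero)
  fix c x assume s: "(\<Sum>v\<in>e ` {..<N}. c v *\<^sub>R v) = 0" and x: "x \<in> e ` {..<N}"
  obtain j where j: "j < N" "x = e j" using x by auto
  have "(\<Sum>i<N. c (e i) *\<^sub>R e i) = 0" using s by (simp add: sum.reindex[OF orthonormal_inj[OF e]])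
  then show "c x = 0" using coefficient[OF e j(1), of "\<lambda>i. c (e i)"] j by (simp add: bilinear_lzero[OF bil])
qed simp

text \<open>Orthonormal vectors are independent, and as many as the dimension span: a vector outside
  their span would enlarge them to an independent set that is too big.\<close>

lemma expand:
  assumes e: "orthonormal g N e"
  shows "(\<Sum>i<N. g u (e i) *\<^sub>R e i) = u"
proof -
  obtain B :: "'v set" where B: "is_basis B" using fin by blast
  have u: "u \<in> span (e ` {..<N})"
  proof (rule ccontr)
    assume u: "u \<notin> span (e ` {..<N})"
    have un: "u \<notin> e ` {..<N}" using u span_base[of u "e ` {..<N}"] by metis
    have "independent (insert u (e ` {..<N}))"
      using u un orthonormal_independent[OF e] by (simp add: independent_insert)
    then have "card (insert u (e ` {..<N})) \<le> card B"
      using independent_span_bound[of B "insert u (e ` {..<N})"] B by (simp add: is_basis_def)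
    moreover have "card (insert u (e ` {..<N})) = Suc N"
      using un card_image[OF orthonormal_inj[OF e]] by simp
    ultimately show False using basis_card[OF B] by simp
  qed
  have "u \<in> range (\<lambda>a. \<Sum>v\<in>e ` {..<N}. a v *\<^sub>R v)" using u by (subst (asm) span_finite) simp_all
  then obtain a where "u = (\<Sum>v\<in>e ` {..<N}. a v *\<^sub>R v)" by (rule rangeE)
  then have ua: "u = (\<Sum>i<N. a (e i) *\<^sub>R e i)" by (simp add: sum.reindex[OF orthonormal_inj[OF e]])
  have "g u (e j) = a (e j)" if "j < N" for j
    by (subst ua) (rule coefficient[OF e that, of "\<lambda>i. a (e i)"])
  then have "(\<Sum>i<N. g u (e i) *\<^sub>R e i) = (\<Sum>i<N. a (e i) *\<^sub>R e i)" by (intro sum.cong refl) simp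
  then show ?thesis unfolding ua[symmetric] .
qed

lemma parseval:
  assumes e: "orthonormal g N e"
  shows "(\<Sum>i<N. g u (e i) * g v (e i)) = g u v"
proof -
  have "g u v = g u (\<Sum>i<N. g v (e i) *\<^sub>R e i)" by (simp add: expand[OF e])
  then show ?thesis by (simp add: bilinear_sum_right[OF bil] bilinear_rmul[OF bil] mult.commute)
qed

lemma bilinear_expand:
  assumes h: "bilinear h" and e: "orthonormal g N e"
  shows "h u v = (\<Sum>i<N. \<Sum>j<N. (g u (e i) * g v (e j)) *\<^sub>R h (e i) (e j))"
proof -
  have "h u v = h (\<Sum>i<N. g u (e i) *\<^sub>R e i) (\<Sum>j<N. g v (e j) *\<^sub>R e j)" by (simp add: expand[OF e])
  then show ?thesis
    by (simp add: bilinear_sum_right[OF h] bilinear_sum_left[OF h] bilinear_rmul[OF h] bilinear_lmul[OF h] mult.commute scaleR_sum_right)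
       (rule sum.swap)
qed

text \<open>Expanding the basis \<open>f\<close> in \<open>e\<close> produces products of
  coefficients whose sum over \<open>f\<close> collapses by Parseval. Taking for \<open>f\<close>
  the basis rotated by the complex structure gives the rotations used later.\<close>

lemma trace_invariant:
  fixes h :: "'v \<Rightarrow> 'v \<Rightarrow> 'w::real_vector"
  assumes h: "bilinear h" and e: "orthonormal g N e" and f: "orthonormal g N f"
  shows "(\<Sum>i<N. h (f i) (f i)) = (\<Sum>i<N. h (e i) (e i))"
proof -
  have "(\<Sum>k<N. h (f k) (f k)) = (\<Sum>k<N. \<Sum>i<N. \<Sum>j<N. (g (f k) (e i) * g (f k) (e j)) *\<^sub>R h (e i) (e j))"
    by (intro sum.cong refl bilinear_expand[OF h e])
  also have "\<dots> = (\<Sum>i<N. \<Sum>k<N. \<Sum>j<N. (g (f k) (e i) * g (f k) (e j)) *\<^sub>R h (e i) (e j))" by (rule sum.swap)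
  also have "\<dots> = (\<Sum>i<N. \<Sum>j<N. \<Sum>k<N. (g (f k) (e i) * g (f k) (e j)) *\<^sub>R h (e i) (e j))"
    by (intro sum.cong refl sum.swap)
  also have "\<dots> = (\<Sum>i<N. \<Sum>j<N. g (e i) (e j) *\<^sub>R h (e i) (e j))"
  proof (intro sum.cong refl)
    fix i j
    have "(\<Sum>k<N. g (f k) (e i) * g (f k) (e j)) = (\<Sum>k<N. g (e i) (f k) * g (e j) (f k))"
      by (intro sum.cong refl arg_cong2[where f = "(*)"] sym)
    then show "(\<Sum>k<N. (g (f k) (e i) * g (f k) (e j)) *\<^sub>R h (e i) (e j)) = g (e i) (e j) *\<^sub>R h (e i) (e j)"
      unfolding scaleR_sum_left[symmetric] parseval[OF f] by simp
  qed
  also have "\<dots> = (\<Sum>i<N. \<Sum>j<N. if i = j then h (e i) (e j) else 0)"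
    by (intro sum.cong refl) (use e in \<open>auto simp: orthonormal_def\<close>)
  also have "\<dots> = (\<Sum>i<N. h (e i) (e i))" by (intro sum.cong refl) simp
  finally show ?thesis .
qed

end

lemma bilinear_pair: "bilinear (\<lambda>u v. \<alpha> [u, v])" if "mlin \<alpha>"
  unfolding bilinear_def
proof (intro conjI allI)
  show "linear (\<lambda>v. \<alpha> [u, v])" for u using mlinD[OF that, of "[u]" "[]"] by simp
  show "linear (\<lambda>u. \<alpha> [u, v])" for v using mlinD[OF that, of "[]" "[v]"] by simp
qed

lemma asym_pair: "asym_form \<alpha> \<Longrightarrow> \<alpha> [u, v] = - \<alpha> [v, u]"
  using asymD[of \<alpha> "[]" u v "[]"] by simp

lemma deg2_eqI: "deg 2 \<alpha> \<Longrightarrow> deg 2 \<beta> \<Longrightarrow> (\<And>u v. \<alpha> [u, v] = \<beta> [u, v]) \<Longrightarrow> \<alpha> = \<beta>"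
proof
  fix vs assume d: "deg 2 \<alpha>" "deg 2 \<beta>" and e: "\<And>u v. \<alpha> [u, v] = \<beta> [u, v]"
  show "\<alpha> vs = \<beta> vs"
  proof (cases "length vs = 2")
    case True
    then obtain u v where "vs = [u, v]" by (auto simp: numeral_2_eq_2 length_Suc_conv)
    then show ?thesis using e by simp
  qed (use d in \<open>simp add: deg_def\<close>)
qed

section \<open>Hermitian linear algebra\<close>

locale hermitian =
  fixes \<omega> :: "'v::real_normed_vector list \<Rightarrow> real" and J :: "'v \<Rightarrow> 'v" and n :: nat
  assumes \<omega>: "alt_form 2 \<omega>" and J: "linear J" "\<And>v. J (J v) = - v"
    and inner: "inner_product (\<lambda>u v. \<omega> [u, J v])"
    and dim2n: "dim (UNIV :: 'v set) = 2 * n" and fin': "\<exists>B :: 'v set. is_basis B"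
begin

sublocale onb_space "\<lambda>u v. \<omega> [u, J v]" "2 * n"
  by unfold_locales (rule inner dim2n fin')+

abbreviation g :: "'v \<Rightarrow> 'v \<Rightarrow> real" where "g u v \<equiv> \<omega> [u, J v]"

lemmas \<omega>_mlin = alt_form_mlin[OF \<omega>] and \<omega>_asym = alt_form_asym[OF \<omega>] and \<omega>_deg = alt_form_deg[OF \<omega>]

lemma \<omega>_bil: "bilinear (\<lambda>u v. \<omega> [u, v])" by (rule bilinear_pair[OF \<omega>_mlin])

text \<open>The symmetry of the metric built from the form and \<open>J\<close> is equivalent to
  invariance of the form under \<open>J\<close>; hence \<open>J\<close> is also an isometry.\<close>

lemma \<omega>_J: "\<omega> [J u, J v] = \<omega> [u, v]"
proof -
  have "\<omega> [u, J (J v)] = \<omega> [J v, J u]" by (rule sym)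
  then show ?thesis using asym_pair[OF \<omega>_asym, of "J v" "J u"] by (simp add: J bilinear_rneg[OF \<omega>_bil])
qed

lemma g_J: "g (J u) (J v) = g u v" using \<omega>_J[of u "J v"] by simp

lemma orthonormal_J: "orthonormal g (2 * n) e \<Longrightarrow> orthonormal g (2 * n) (\<lambda>i. J (e i))"
  by (simp add: orthonormal_def g_J)

text \<open>A form of degree above the dimension vanishes; contracting this vanishing form with \<open>v\<close>
  moves the contraction from the power of \<open>\<omega>\<close> to the other factors.\<close>

lemma one_form_wedge:
  assumes \<alpha>: "deg 1 \<alpha>" "asym_form \<alpha>" "mlin \<alpha>"
  shows "rsh \<alpha> (rsh (contr v \<omega>) (ipow \<omega> (int n - 1))) = (\<lambda>x. \<alpha> [v] * ipow \<omega> (int n) x)"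
proof
  fix x
  obtain B :: "'v set" where B: "is_basis B" using fin by blast
  have d: "deg (1 + 2 * n) (rsh \<alpha> (ipow \<omega> (int n)))"
    using deg_shuf[OF bilinear_times \<alpha>(1) ipow_props(1)[OF \<omega>, of "int n"]] by (simp add: nat_mult_distrib)
  have "rsh \<alpha> (ipow \<omega> (int n)) (v # x) = 0"
  proof (cases "length (v # x) = 1 + 2 * n")
    case True
    show ?thesis
      by (rule top_form_zero[OF B mlin_shuf[OF bilinear_times \<alpha>(3) ipow_props(3)[OF \<omega>]]
            asym_shuf[OF bilinear_times \<alpha>(2) ipow_props(2)[OF \<omega>]]]) (use True basis_card[OF B] in simp)
  qed (use d in \<open>unfold deg_def, blast\<close>)
  moreover have "gsign \<alpha> = (\<lambda>x. - \<alpha> x)" using deg_gsign[OF \<alpha>(1)] by simp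
  moreover have "rsh (contr v \<alpha>) (ipow \<omega> (int n)) x = \<alpha> [v] * ipow \<omega> (int n) x"
    using shuf_deg0_left[OF bilinear_times, of "contr v \<alpha>" "ipow \<omega> (int n)" x] \<alpha>(1) by (simp add: contr_def deg_def)
  ultimately show "rsh \<alpha> (rsh (contr v \<omega>) (ipow \<omega> (int n - 1))) x = \<alpha> [v] * ipow \<omega> (int n) x"
    by (simp add: contr_ipow[OF \<omega>] rsh_simps)
qed

text \<open>The vanishing form here is the product of \<eta>, the contraction of \<omega> with
  \<open>a\<close>, and the divided power of exponent \<open>n - 1\<close>; its degree is
  \<open>2 * n + 1\<close>. Contraction with \<open>v\<close> gives three terms, of which
  \<open>one_form_wedge\<close> evaluates the first.\<close>

lemma two_form_wedge_aux:
  assumes \<eta>: "deg 2 \<eta>" "asym_form \<eta>" "mlin \<eta>"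
  shows "rsh \<eta> (rsh (contr a \<omega>) (rsh (contr v \<omega>) (ipow \<omega> (int n - 2)))) x =
     \<eta> [v, a] * ipow \<omega> (int n) x + \<omega> [a, v] * rsh \<eta> (ipow \<omega> (int n - 1)) x"
proof -
  obtain B :: "'v set" where B: "is_basis B" using fin by blast
  let ?\<alpha> = "contr a \<omega>" and ?W = "ipow \<omega> (int n - 1)"
  have \<alpha>: "deg 1 ?\<alpha>" "asym_form ?\<alpha>" "mlin ?\<alpha>"
    using deg_contr[of 1 \<omega> a] \<omega>_deg asym_contr[OF \<omega>_asym] mlin_contr[OF \<omega>_mlin] by (simp_all add: numeral_2_eq_2)
  have gs: "gsign ?\<alpha> = (\<lambda>x. - ?\<alpha> x)" using deg_gsign[OF \<alpha>(1)] by simp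
  have ge: "gsign \<eta> = \<eta>" using deg_gsign[OF \<eta>(1)] by simp
  have "rsh \<eta> (rsh ?\<alpha> ?W) (v # x) = 0"
  \<comment> \<open>For \<open>n = 0\<close> the power has exponent -1 and is zero, while the degree
    \<open>2 * n - 2\<close> of the other case would be truncated.\<close>
  proof (cases "n = 0")
    case True
    then have W0: "?W = (\<lambda>x. 0)" by (auto simp: ipow_def)
    have "rsh ?\<alpha> ?W = (\<lambda>x. 0)" unfolding W0 by (rule ext) (rule shuf_zero_right[OF bilinear_times])
    then show ?thesis by (simp add: rsh_simps del: shuf.simps)
  next
    case False
    have "nat (2 * (int n - 1)) = 2 * n - 2" by simp
    with ipow_props(1)[OF \<omega>, of "int n - 1"] have "deg (2 * n - 2) ?W" by simp
    then have d: "deg (2 + (1 + (2 * n - 2))) (rsh \<eta> (rsh ?\<alpha> ?W))"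
      by (intro deg_shuf bilinear_times \<eta> \<alpha>)
    show ?thesis
    proof (cases "length (v # x) = 2 + (1 + (2 * n - 2))")
      case True
      show ?thesis
        by (rule top_form_zero[OF B mlin_shuf[OF bilinear_times \<eta>(3) mlin_shuf[OF bilinear_times \<alpha>(3) ipow_props(3)[OF \<omega>]]]
            asym_shuf[OF bilinear_times \<eta>(2) asym_shuf[OF bilinear_times \<alpha>(2) ipow_props(2)[OF \<omega>]]]]) (use True False basis_card[OF B] in simp)
    qed (use d in \<open>unfold deg_def, blast\<close>)
  qed
  then have 1: "rsh (contr v \<eta>) (rsh ?\<alpha> ?W) x + rsh \<eta> (\<lambda>x. rsh (contr v ?\<alpha>) ?W x - rsh ?\<alpha> (rsh (contr v \<omega>) (ipow \<omega> (int n - 2))) x) x = 0"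
    by (simp add: contr_rsh ge gs contr_ipow[OF \<omega>] rsh_simps)
  have 2: "rsh (contr v ?\<alpha>) ?W y = \<omega> [a, v] * ?W y" for y
    using shuf_deg0_left[OF bilinear_times, of "contr v ?\<alpha>" ?W y] \<omega>_deg by (simp add: contr_def deg_def)
  have 3: "rsh (contr v \<eta>) (rsh ?\<alpha> ?W) x = \<eta> [v, a] * ipow \<omega> (int n) x"
    using one_form_wedge[of "contr v \<eta>" a] deg_contr[of 1 \<eta> v] \<eta> asym_contr[OF \<eta>(2)] mlin_contr[OF \<eta>(3)]
    by (simp add: numeral_2_eq_2) (simp add: contr_def)
  have 4: "rsh \<eta> (\<lambda>x. \<omega> [a, v] * ?W x - rsh ?\<alpha> (rsh (contr v \<omega>) (ipow \<omega> (int n - 2))) x) x =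
     \<omega> [a, v] * rsh \<eta> ?W x - rsh \<eta> (rsh ?\<alpha> (rsh (contr v \<omega>) (ipow \<omega> (int n - 2)))) x"
    using shuf_add_right[OF bilinear_times, of \<eta> "\<lambda>x. \<omega> [a, v] * ?W x" "\<lambda>x. - rsh ?\<alpha> (rsh (contr v \<omega>) (ipow \<omega> (int n - 2))) x" x]
    by (simp add: rsh_mult_right rsh_simps del: shuf.simps)
  from 1 show ?thesis unfolding 2 3 4 by simp
qed

text \<open>The metric dual of \<open>e\<close>. Writing it as a contraction of \<omega> with
  \<open>- J e\<close> makes the contraction identities applicable to a coframe.\<close>

definition cof :: "'v \<Rightarrow> 'v list \<Rightarrow> real" where
  "cof e = contr (- J e) \<omega>"

lemma cof_apply: "cof e [u] = g u e"
  using asym_pair[OF \<omega>_asym, of "- J e" u] by (simp add: cof_def contr_def bilinear_rneg[OF \<omega>_bil])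

lemma cof_props: "deg 1 (cof e)" "asym_form (cof e)" "mlin (cof e)"
  unfolding cof_def using deg_contr[of 1 \<omega>] \<omega>_deg asym_contr[OF \<omega>_asym] mlin_contr[OF \<omega>_mlin] by (simp_all add: numeral_2_eq_2)

text \<open>This is the contraction \<Lambda> of a 2-form in the basis \<open>e\<close>; the factor
  one half compensates for summing over ordered pairs.\<close>

definition lam :: "(nat \<Rightarrow> 'v) \<Rightarrow> ('v list \<Rightarrow> real) \<Rightarrow> real" where
  "lam e \<eta> = (1 / 2) * (\<Sum>i<2 * n. \<Sum>j<2 * n. \<eta> [e i, e j] * \<omega> [e i, e j])"

lemma two_form_expand:
  assumes \<eta>: "deg 2 \<eta>" "asym_form \<eta>" "mlin \<eta>" and e: "orthonormal g (2 * n) e"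
  shows "\<eta> = (\<lambda>x. \<Sum>i<2 * n. \<Sum>j<2 * n. ((1 / 2) * \<eta> [e i, e j]) * rsh (cof (e i)) (cof (e j)) x)"
proof (rule deg2_eqI[OF \<eta>(1)])
  have d: "deg 2 (rsh (cof a) (cof b))" for a b
    using deg_shuf[OF bilinear_times cof_props(1) cof_props(1)] by (simp add: numeral_2_eq_2)
  then show "deg 2 (\<lambda>x. \<Sum>i<2 * n. \<Sum>j<2 * n. ((1 / 2) * \<eta> [e i, e j]) * rsh (cof (e i)) (cof (e j)) x)"
    unfolding deg_def by simp
  fix u v
  have c: "rsh (cof a) (cof b) [u, v] = g u a * g v b - g v a * g u b" for a b
  proof -
    have z: "cof a [] = 0" "cof b [] = 0" using cof_props(1) by (auto simp: deg_def)
    have zz: "cof a [x, y] = 0" "cof b [x, y] = 0" for x y using cof_props(1) by (auto simp: deg_def)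
    show ?thesis by (simp add: contr_def gsign_def z zz cof_apply)
  qed
  have h: "bilinear (\<lambda>u v. \<eta> [u, v])" by (rule bilinear_pair[OF \<eta>(3)])
  have 1: "\<eta> [u, v] = (\<Sum>i<2 * n. \<Sum>j<2 * n. \<eta> [e i, e j] * (g u (e i) * g v (e j)))" for u v
    using bilinear_expand[OF h e, of u v] by (simp add: mult.commute)
  have "(\<Sum>i<2 * n. \<Sum>j<2 * n. ((1 / 2) * \<eta> [e i, e j]) * rsh (cof (e i)) (cof (e j)) [u, v]) = (1 / 2) * (\<eta> [u, v] - \<eta> [v, u])"
    unfolding c 1[of u v] 1[of v u] sum_subtractf[symmetric] sum_distrib_left by (simp add: algebra_simps)
  then show "\<eta> [u, v] = (\<Sum>i<2 * n. \<Sum>j<2 * n. ((1 / 2) * \<eta> [e i, e j]) * rsh (cof (e i)) (cof (e j)) [u, v])"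
    using asym_pair[OF \<eta>(2), of u v] by simp
qed

lemma cof_J: "cof a [- J b] = \<omega> [a, b]"
  using \<omega>_J[of b a] asym_pair[OF \<omega>_asym, of a b] by (simp add: cof_apply bilinear_lneg[OF \<omega>_bil])

text \<open>By linearity it suffices to treat a product of two coframe elements. Since the second is
  a contraction of \<omega>, \<open>one_form_wedge\<close> evaluates the product as the value of
  \<omega> on the two vectors.\<close>

lemma wedge_lam:
  assumes \<eta>: "deg 2 \<eta>" "asym_form \<eta>" "mlin \<eta>" and e: "orthonormal g (2 * n) e"
  shows "rsh \<eta> (ipow \<omega> (int n - 1)) x = lam e \<eta> * ipow \<omega> (int n) x"
proof -
  have c: "rsh (rsh (cof a) (cof b)) (ipow \<omega> (int n - 1)) x = \<omega> [a, b] * ipow \<omega> (int n) x" for a b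
    unfolding rsh_assoc using one_form_wedge[OF cof_props, of a "- J b"] by (simp add: cof_def[symmetric] cof_J)
  have "rsh \<eta> (ipow \<omega> (int n - 1)) x = (\<Sum>i<2 * n. \<Sum>j<2 * n. ((1 / 2) * \<eta> [e i, e j]) * (\<omega> [e i, e j] * ipow \<omega> (int n) x))"
    by (subst two_form_expand[OF \<eta> e]) (simp only: shuf_sum_left[OF bilinear_times] rsh_mult_left c)
  then show ?thesis by (simp add: lam_def sum_distrib_left sum_distrib_right mult.assoc)
qed

text \<open>Only \<zeta> is expanded in the coframe; \<open>two_form_wedge_aux\<close> then applies
  to the contractions with \<open>- J (e i)\<close> and \<open>- J (e j)\<close>, which is how the
  rotated values of \<eta> enter.\<close>

lemma wedge_wedge:
  assumes \<eta>: "deg 2 \<eta>" "asym_form \<eta>" "mlin \<eta>" and \<zeta>: "deg 2 \<zeta>" "asym_form \<zeta>" "mlin \<zeta>" and e: "orthonormal g (2 * n) e"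
  shows "rsh (rsh \<eta> \<zeta>) (ipow \<omega> (int n - 2)) x =
     (lam e \<eta> * lam e \<zeta> - (1 / 2) * (\<Sum>i<2 * n. \<Sum>j<2 * n. \<zeta> [e i, e j] * \<eta> [J (e i), J (e j)])) * ipow \<omega> (int n) x"
proof -
  have hb: "bilinear (\<lambda>u v. \<eta> [u, v])" by (rule bilinear_pair[OF \<eta>(3)])
  have c: "rsh \<eta> (rsh (cof a) (rsh (cof b) (ipow \<omega> (int n - 2)))) x =
      (\<omega> [a, b] * lam e \<eta> - \<eta> [J a, J b]) * ipow \<omega> (int n) x" for a b
  proof -
    have "\<eta> [- J b, - J a] = - \<eta> [J a, J b]"
      using asym_pair[OF \<eta>(2), of "J b" "J a"] by (simp add: bilinear_lneg[OF hb] bilinear_rneg[OF hb])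
    moreover have "\<omega> [- J a, - J b] = \<omega> [a, b]" by (simp add: bilinear_lneg[OF \<omega>_bil] bilinear_rneg[OF \<omega>_bil] \<omega>_J)
    ultimately show ?thesis
      using two_form_wedge_aux[OF \<eta>, of "- J a" "- J b" x] wedge_lam[OF \<eta> e, of x] by (simp add: cof_def[symmetric] algebra_simps)
  qed
  have "rsh (rsh \<eta> \<zeta>) (ipow \<omega> (int n - 2)) x =
     (\<Sum>i<2 * n. \<Sum>j<2 * n. ((1 / 2) * \<zeta> [e i, e j]) * ((\<omega> [e i, e j] * lam e \<eta> - \<eta> [J (e i), J (e j)]) * ipow \<omega> (int n) x))"
  proof -
    have "rsh \<zeta> (ipow \<omega> (int n - 2)) = (\<lambda>x. \<Sum>i<2 * n. \<Sum>j<2 * n.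
        ((1 / 2) * \<zeta> [e i, e j]) * rsh (cof (e i)) (rsh (cof (e j)) (ipow \<omega> (int n - 2))) x)"
      by (rule ext, subst two_form_expand[OF \<zeta> e]) (simp only: shuf_sum_left[OF bilinear_times] rsh_mult_left rsh_assoc)
    then show ?thesis
      unfolding rsh_assoc by (simp only: shuf_sum_right[OF bilinear_times] rsh_mult_right c)
  qed
  also have "\<dots> = ((\<Sum>i<2 * n. \<Sum>j<2 * n. (1 / 2) * (\<zeta> [e i, e j] * \<omega> [e i, e j]) * lam e \<eta>) -
       (\<Sum>i<2 * n. \<Sum>j<2 * n. (1 / 2) * (\<zeta> [e i, e j] * \<eta> [J (e i), J (e j)]))) * ipow \<omega> (int n) x"
    unfolding sum_subtractf[symmetric] sum_distrib_right by (intro sum.cong refl) (simp add: algebra_simps)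
  also have "(\<Sum>i<2 * n. \<Sum>j<2 * n. (1 / 2) * (\<zeta> [e i, e j] * \<omega> [e i, e j]) * lam e \<eta>) = lam e \<eta> * lam e \<zeta>"
    by (simp add: lam_def[of e \<zeta>] sum_distrib_left sum_distrib_right mult_ac)
  finally show ?thesis by (simp add: sum_distrib_left)
qed

end

section \<open>Partitions of unity\<close>

lemma smooth_map_vecI:
  assumes M: "charted M" and f: "\<And>p. p \<in> pts M \<Longrightarrow> smooth_at M vec_mfd f p"
  shows "smooth_map M vec_mfd f"
proof -
  have "smooth_on (snd c ` fst c) (\<lambda>y. f (cinv c y))" if c: "c \<in> atlas M" for c
  proof (rule smooth_on_local)
    fix y assume "y \<in> snd c ` fst c"
    then obtain p where p: "p \<in> fst c" "y = snd c p" by auto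
    have "p \<in> pts M" using chart_sub[OF M c] p by auto
    from smooth_atD[OF f[OF this] c _ p(1), of "(UNIV, \<lambda>v. v)"]
    show "\<exists>U. open U \<and> y \<in> U \<and> smooth_on U (\<lambda>y. f (cinv c y))" using p by auto
  qed
  then show ?thesis unfolding smooth_map_def using chart_image_open[OF M] by (simp add: comp_def)
qed

lemma smooth_at_scalar:
  assumes M: "charted M" and f: "smooth_at M vec_mfd f p" and S: "open S" "f p \<in> S" and h: "smooth_on S h"
    and B: "is_basis (B :: 'w::real_normed_vector set)"
  shows "smooth_at M vec_mfd (\<lambda>x. h (f x :: 'w)) p"
  by (rule smooth_at_comp[OF M charted_vec[OF B] f smooth_at_vecI[OF S h]]) simp

lemma smooth_at_vec_iff:
  "smooth_at M vec_mfd f p \<longleftrightarrow> (\<forall>c\<in>atlas M. p \<in> fst c \<longrightarrow>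
     (\<exists>V. open V \<and> snd c p \<in> V \<and> V \<subseteq> snd c ` fst c \<and> smooth_on V (\<lambda>y. f (cinv c y))))"
  unfolding smooth_at_def by simp

lemma smooth_at_mult:
  fixes f g :: "'a \<Rightarrow> real"
  assumes f: "smooth_at M vec_mfd f p" and g: "smooth_at M vec_mfd g p"
  shows "smooth_at M vec_mfd (\<lambda>x. f x * g x) p"
  unfolding smooth_at_vec_iff
proof (intro ballI impI)
  fix c assume c: "c \<in> atlas M" "p \<in> fst c"
  obtain V where V: "open V" "snd c p \<in> V" "V \<subseteq> snd c ` fst c" "smooth_on V (\<lambda>y. f (cinv c y))"
    using f c unfolding smooth_at_vec_iff by blast
  obtain W where W: "open W" "snd c p \<in> W" "smooth_on W (\<lambda>y. g (cinv c y))"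
    using g c unfolding smooth_at_vec_iff by blast
  have "smooth_on (V \<inter> W) (\<lambda>y. f (cinv c y) * g (cinv c y))"
    using V W by (intro smooth_on_mult smooth_on_mono[OF V(4)] smooth_on_mono[OF W(3)]) auto
  then show "\<exists>V. open V \<and> snd c p \<in> V \<and> V \<subseteq> snd c ` fst c \<and> smooth_on V (\<lambda>y. f (cinv c y) * g (cinv c y))"
    using V W by (intro exI[of _ "V \<inter> W"]) auto
qed

lemma smooth_at_sum:
  fixes f :: "'i \<Rightarrow> 'a \<Rightarrow> real"
  assumes M: "charted M" and f: "\<And>i. i \<in> I \<Longrightarrow> smooth_at M vec_mfd (f i) p" and I: "finite I"
  shows "smooth_at M vec_mfd (\<lambda>x. \<Sum>i\<in>I. f i x) p"
  using I f
proof (induction I rule: finite_induct)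
  case empty
  show ?case using smooth_at_const[OF M] by simp
next
  case (insert i I)
  show ?case unfolding smooth_at_vec_iff
  proof (intro ballI impI)
    fix c assume c: "c \<in> atlas M" "p \<in> fst c"
    have "smooth_at M vec_mfd (f i) p" using insert.prems by simp
    then obtain V where V: "open V" "snd c p \<in> V" "V \<subseteq> snd c ` fst c" "smooth_on V (\<lambda>y. f i (cinv c y))"
      using c unfolding smooth_at_vec_iff by blast
    have "smooth_at M vec_mfd (\<lambda>x. \<Sum>i\<in>I. f i x) p" using insert.prems insert.IH by simp
    then obtain W where W: "open W" "snd c p \<in> W" "smooth_on W (\<lambda>y. \<Sum>i\<in>I. f i (cinv c y))"
      using c unfolding smooth_at_vec_iff by blast
    have "smooth_on (V \<inter> W) (\<lambda>y. f i (cinv c y) + (\<Sum>i\<in>I. f i (cinv c y)))"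
      using V W by (intro smooth_on_add smooth_on_mono[OF V(4)] smooth_on_mono[OF W(3)]) auto
    then show "\<exists>V. open V \<and> snd c p \<in> V \<and> V \<subseteq> snd c ` fst c \<and> smooth_on V (\<lambda>y. \<Sum>i\<in>insert i I. f i (cinv c y))"
      using V W insert.hyps by (intro exI[of _ "V \<inter> W"]) auto
  qed
qed

text \<open>The flat function applied in a chart to a squared radius minus a positive definite
  quadratic form in the coordinates. It is supported in a small neighbourhood of \<open>p\<close>
  and extends by zero.\<close>

lemma bump_exists:
  fixes M :: "('a, 'v::real_normed_vector, 'z) mfd_scheme"
  assumes M: "is_manifold M" and cpt: "compact_space (mtop M)" and p: "p \<in> pts M"
  shows "\<exists>b :: 'a \<Rightarrow> real. b p > 0 \<and> (\<forall>x. 0 \<le> b x) \<and> (\<forall>x. x \<notin> pts M \<longrightarrow> b x = 0) \<and>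
     (\<forall>x\<in>pts M. smooth_at M vec_mfd b x) \<and> (mtop M) closure_of {x \<in> pts M. b x \<noteq> 0} \<subseteq> fst (chart_at M p)"
proof -
  have cM: "charted M" by (rule is_manifold_charted[OF M])
  obtain B :: "'v set" where B: "is_basis B" using charted_basis[OF cM] .
  define c where "c = chart_at M p"
  have c: "c \<in> atlas M" "p \<in> fst c" using chart_at_props[OF cM p] by (auto simp: c_def)
  have oc: "openin (mtop M) (fst c)" by (rule openin_chart_dom[OF cM c(1)])
  have "regular_space (mtop M)"
    using M cpt compact_Hausdorff_imp_regular_space unfolding is_manifold_def by blast
  \<comment> \<open>A partition of unity restricts the closure of each support. A closed
    \<open>V\<close> between \<open>U\<close> and the chart domain, which exists by regularity,
    keeps that closure inside the domain.\<close>
  then obtain U V where UV: "openin (mtop M) U" "closedin (mtop M) V" "p \<in> U" "U \<subseteq> V" "V \<subseteq> fst c"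
    using oc c(2) unfolding neighbourhood_base_of_closedin[symmetric] neighbourhood_base_of by (metis (no_types, lifting))
  let ?O = "snd c ` (U \<inter> fst c)"
  have oO: "open ?O" using UV(1) c(1) openin_mtop[OF cM] by auto
  have "snd c p \<in> ?O" using UV c by auto
  then obtain r where r: "r > 0" "ball (snd c p) r \<subseteq> ?O" using oO openE by blast
  \<comment> \<open>If all coordinates are at most \<open>r / R\<close>, the norm is at most
    \<open>(r / R) * (R - 1)\<close>, hence below \<open>r\<close>. The summand 1 also makes
    \<open>R\<close> positive for an empty basis.\<close>
  define R where "R = (\<Sum>b\<in>B. norm b) + 1"
  have R: "R > 0" unfolding R_def by (smt (verit) norm_ge_zero sum_nonneg)
  \<comment> \<open>A sum of squared coordinates is used because the norm of the model space, or its
    square, may fail to be smooth.\<close>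
  define q where "q = (\<lambda>y. \<Sum>b\<in>B. representation B (y - snd c p) b * representation B (y - snd c p) b)"
  have sq: "smooth_on UNIV q" unfolding q_def
    by (intro smooth_on_sum smooth_on_mult smooth_on_linear_comp[OF bounded_linear_representation[OF B]]
        smooth_on_diff smooth_on_id smooth_on_const) auto
  have small: "y \<in> ?O" if y: "q y < (r / R)\<^sup>2" for y
  proof -
    have rb: "\<bar>representation B (y - snd c p) b\<bar> \<le> r / R" if b: "b \<in> B" for b
    proof -
      have "(representation B (y - snd c p) b)\<^sup>2 \<le> q y" unfolding q_def power2_eq_square
        by (rule member_le_sum[OF b]) (use B in \<open>auto simp: is_basis_def\<close>)
      then have "(representation B (y - snd c p) b)\<^sup>2 \<le> (r / R)\<^sup>2" using y by simp
      then show ?thesis using r R by (metis abs_le_square_iff abs_of_pos divide_pos_pos)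
    qed
    have "norm (y - snd c p) = norm (\<Sum>b\<in>B. representation B (y - snd c p) b *\<^sub>R b)" by (simp add: basis_expansion[OF B])
    also have "\<dots> \<le> (\<Sum>b\<in>B. (r / R) * norm b)" using mult_right_mono[OF rb norm_ge_zero] by (intro sum_norm_le) auto
    also have "\<dots> = (r / R) * (R - 1)" by (simp add: R_def sum_distrib_left)
    also have "\<dots> < r" using r R by (simp add: field_simps)
    finally show ?thesis using r by (auto simp: dist_norm norm_minus_commute)
  qed
  define b where "b = (\<lambda>x. if x \<in> fst c then flat 0 ((r / R)\<^sup>2 - q (snd c x)) else 0)"
  have q0: "q (snd c p) = 0" by (simp add: q_def real_vector.representation_zero)
  have "b p > 0" using r R c q0 by (simp add: b_def flat_def)
  moreover have nn: "0 \<le> b x" for x by (simp add: b_def flat_def)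
  moreover have "b x = 0" if "x \<notin> pts M" for x using chart_sub[OF cM c(1)] that by (auto simp: b_def)
  moreover have bU: "x \<in> U" if "b x \<noteq> 0" for x
  proof -
    have x: "x \<in> fst c" "q (snd c x) < (r / R)\<^sup>2" using that by (auto simp: b_def flat_def split: if_splits)
    from small[OF x(2)] obtain z where "z \<in> U" "z \<in> fst c" "snd c x = snd c z" by blast
    then show ?thesis using chart_inj[OF cM c(1)] x(1) by (metis inj_onD)
  qed
  then have "{x \<in> pts M. b x \<noteq> 0} \<subseteq> V" using UV by blast
  then have cl: "(mtop M) closure_of {x \<in> pts M. b x \<noteq> 0} \<subseteq> V" using UV(2) closure_of_minimal by blast
  moreover have "smooth_at M vec_mfd b x" if x: "x \<in> pts M" for x
  proof (cases "x \<in> fst c")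
    case True
    have "smooth_on UNIV (\<lambda>y. flat 0 ((r / R)\<^sup>2 - q y))"
      by (rule smooth_on_comp[OF is_basis_real _ _ smooth_on_flat]) (auto intro!: smooth_on_diff sq)
    from smooth_at_scalar[OF cM smooth_at_chart[OF cM c(1) True] _ _ this B]
    have "smooth_at M vec_mfd (\<lambda>x. flat 0 ((r / R)\<^sup>2 - q (snd c x))) x" by simp
    then show ?thesis by (rule smooth_at_cong[OF cM oc True, rotated]) (simp add: b_def)
  next
    case False
    have o: "openin (mtop M) (pts M - V)" using UV(2) topspace_mtop[OF cM] by (metis openin_diff openin_topspace)
    have z: "b y = 0" if "y \<in> pts M - V" for y using bU[of y] that UV(4) by blast
    show ?thesis
      by (rule smooth_at_cong[OF cM o _ _ smooth_at_const[OF cM]]) (use x False UV z in auto)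
  qed
  ultimately show ?thesis using UV(5) unfolding c_def by (intro exI[of _ b]) blast
qed

text \<open>Compactness leaves finitely many bump functions whose positivity sets cover the
  manifold; dividing by their positive sum gives the partition.\<close>

lemma partition_of_unity_exists:
  fixes M :: "('a, 'v::real_normed_vector, 'z) mfd_scheme"
  assumes M: "is_manifold M" and cpt: "compact_space (mtop M)"
  shows "\<exists>P. partition_of_unity M P"
proof -
  have cM: "charted M" by (rule is_manifold_charted[OF M])
  note tM = topspace_mtop[OF cM]
  have "\<forall>p\<in>pts M. \<exists>b :: 'a \<Rightarrow> real. b p > 0 \<and> (\<forall>x. 0 \<le> b x) \<and> (\<forall>x. x \<notin> pts M \<longrightarrow> b x = 0) \<and>
     (\<forall>x\<in>pts M. smooth_at M vec_mfd b x) \<and> (mtop M) closure_of {x \<in> pts M. b x \<noteq> 0} \<subseteq> fst (chart_at M p)"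
    by (intro ballI bump_exists[OF M cpt])
  from bchoice[OF this]
  obtain b :: "'a \<Rightarrow> 'a \<Rightarrow> real" where b': "\<forall>p\<in>pts M. b p p > 0 \<and> (\<forall>x. 0 \<le> b p x) \<and> (\<forall>x. x \<notin> pts M \<longrightarrow> b p x = 0) \<and>
     (\<forall>x\<in>pts M. smooth_at M vec_mfd (b p) x) \<and> (mtop M) closure_of {x \<in> pts M. b p x \<noteq> 0} \<subseteq> fst (chart_at M p)"
    by (elim exE)
  note b = b'[rule_format]
  have ob: "openin (mtop M) {x \<in> pts M. b p x \<in> {0<..}}" if p: "p \<in> pts M" for p
    by (rule openin_smooth_preimage[OF cM charted_vec[OF is_basis_real]])
       (use b[OF p] in \<open>auto simp: openin_mtop[OF charted_vec[OF is_basis_real]]\<close>)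
  have "\<exists>\<F>. finite \<F> \<and> \<F> \<subseteq> (\<lambda>p. {x \<in> pts M. b p x \<in> {0<..}}) ` pts M \<and> topspace (mtop M) \<subseteq> \<Union>\<F>"
  proof (rule compactinD)
    show "compactin (mtop M) (topspace (mtop M))" using cpt by (simp add: compact_space_def)
    show "topspace (mtop M) \<subseteq> \<Union>((\<lambda>p. {x \<in> pts M. b p x \<in> {0<..}}) ` pts M)" unfolding tM using b by auto
  qed (use ob in auto)
  then obtain \<F> where \<F>: "finite \<F>" "\<F> \<subseteq> (\<lambda>p. {x \<in> pts M. b p x \<in> {0<..}}) ` pts M" "pts M \<subseteq> \<Union>\<F>" unfolding tM by blast
  obtain S where S: "finite S" "S \<subseteq> pts M" "\<F> = (\<lambda>p. {x \<in> pts M. b p x \<in> {0<..}}) ` S"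
    using finite_subset_image[OF \<F>(1,2)] by blast
  define Q where "Q = (\<lambda>p. (b p, chart_at M p)) ` S"
  have fQ: "finite Q" using S by (simp add: Q_def)
  define T where "T = (\<lambda>x. \<Sum>z\<in>Q. fst z x)"
  have Qp: "\<exists>p\<in>pts M. z = (b p, chart_at M p)" if "z \<in> Q" for z using that S by (auto simp: Q_def)
  have nn: "0 \<le> fst z x" if "z \<in> Q" for z x using Qp[OF that] b by auto
  have T: "T x > 0" if x: "x \<in> pts M" for x
  proof -
    obtain p where p: "p \<in> S" "b p x > 0" using \<F>(3) S(3) x by auto
    have z: "(b p, chart_at M p) \<in> Q" using p by (simp add: Q_def)
    show ?thesis unfolding T_def using sum_pos2[OF fQ z, of "\<lambda>z. fst z x"] p nn by auto
  qed
  have sb: "smooth_at M vec_mfd (fst z) x" if "z \<in> Q" "x \<in> pts M" for z x using Qp[OF that(1)] b that by auto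
  have sT: "smooth_at M vec_mfd T x" if "x \<in> pts M" for x
    unfolding T_def by (rule smooth_at_sum[OF cM _ fQ]) (rule sb, auto intro: that)
  define \<rho> where "\<rho> = (\<lambda>(z :: ('a \<Rightarrow> real) \<times> 'a set \<times> ('a \<Rightarrow> 'v)) x. fst z x * inverse (T x))"
  have s\<rho>: "smooth_at M vec_mfd (\<rho> z) x" if "z \<in> Q" "x \<in> pts M" for z x
    unfolding \<rho>_def
    by (intro smooth_at_mult sb that smooth_at_scalar[OF cM sT _ _ smooth_on_inverse is_basis_real])
       (use T that in auto)
  define P where "P = (\<lambda>z. (\<rho> z, snd z)) ` Q"
  \<comment> \<open>A partition is a set of pairs, so coinciding pairs would be counted once in its
    sum. On the manifold the positive factor \<open>T\<close> can be cancelled; elsewhere all bump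
    functions are 0, so equality as functions follows.\<close>
  have inj: "inj_on (\<lambda>z. (\<rho> z, snd z)) Q"
  proof (rule inj_onI)
    fix z z' assume z: "z \<in> Q" "z' \<in> Q" and e: "(\<rho> z, snd z) = (\<rho> z', snd z')"
    have "fst z x = fst z' x" for x
    proof (cases "x \<in> pts M")
      case True
      have "\<rho> z x = \<rho> z' x" using e by simp
      then show ?thesis using T[OF True] by (simp add: \<rho>_def)
    next
      case False then show ?thesis using Qp[OF z(1)] Qp[OF z(2)] b by auto
    qed
    then show "z = z'" using e by (auto simp: prod_eq_iff)
  qed
  have "partition_of_unity M P" unfolding partition_of_unity_def
  proof (intro conjI ballI)
    show "finite P" using fQ by (simp add: P_def)
    fix x assume x: "x \<in> pts M"
    have "(\<Sum>(\<rho>, c)\<in>P. \<rho> x) = (\<Sum>z\<in>Q. \<rho> z x)" unfolding P_def by (simp add: sum.reindex[OF inj])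
    also have "\<dots> = T x * inverse (T x)" unfolding \<rho>_def T_def by (simp add: sum_distrib_right)
    finally show "(\<Sum>(\<rho>, c)\<in>P. \<rho> x) = 1" using T[OF x] by simp
  next
    fix a assume "a \<in> P"
    then obtain z where z: "z \<in> Q" "a = (\<rho> z, snd z)" by (auto simp: P_def)
    obtain p where p: "p \<in> pts M" "z = (b p, chart_at M p)" using Qp[OF z(1)] by blast
    have "smooth_map M vec_mfd (\<rho> z)" by (rule smooth_map_vecI[OF cM s\<rho>[OF z(1)]])
    moreover have "0 \<le> \<rho> z x" if "x \<in> pts M" for x using nn[OF z(1), of x] T[OF that] by (simp add: \<rho>_def)
    moreover have "{x \<in> pts M. \<rho> z x \<noteq> 0} = {x \<in> pts M. b p x \<noteq> 0}"
      using p less_imp_neq[OF T] by (auto simp: \<rho>_def)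
    then have "(mtop M) closure_of {x \<in> pts M. \<rho> z x \<noteq> 0} \<subseteq> fst (chart_at M p)" using b[OF p(1)] by simp
    ultimately show "case a of (\<rho>, c) \<Rightarrow> c \<in> atlas M \<and> smooth_map M vec_mfd \<rho> \<and> (\<forall>p\<in>pts M. 0 \<le> \<rho> p) \<and>
        (mtop M) closure_of {p \<in> pts M. \<rho> p \<noteq> 0} \<subseteq> fst c"
      using z p chart_at_props(1)[OF cM p(1)] by simp
  qed
  then show ?thesis by blast
qed

section \<open>Linearity of the integral\<close>

lemma model_basis_props:
  assumes B: "is_basis (B :: 'v::real_normed_vector set)"
  shows "distinct (model_basis :: 'v list)" "is_basis (set (model_basis :: 'v list))"
proof -
  obtain bs where "set bs = B" "distinct bs" using B finite_distinct_list[of B] unfolding is_basis_def by blast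
  then have "\<exists>bs :: 'v list. distinct bs \<and> independent (set bs) \<and> span (set bs) = UNIV"
    using B unfolding is_basis_def by blast
  then have "distinct (model_basis :: 'v list) \<and> independent (set (model_basis :: 'v list)) \<and> span (set (model_basis :: 'v list)) = UNIV"
    unfolding model_basis_def by (rule someI_ex)
  then show "distinct (model_basis :: 'v list)" "is_basis (set (model_basis :: 'v list))" by (auto simp: is_basis_def)
qed

text \<open>The coefficient bound confines the parameters with nonzero integrand to a box of finite
  measure, and on the compact set the continuous function is bounded.\<close>

lemma integrable_compact_support:
  fixes H :: "'v::{real_normed_vector, second_countable_topology} \<Rightarrow> real" and bs :: "'v list"
  assumes bs: "distinct bs" "is_basis (set bs)" and H: "continuous_on UNIV H" and K: "compact K" "\<And>y. y \<notin> K \<Longrightarrow> H y = 0"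
  shows "integrable (PiM {..<length bs} (\<lambda>_. lborel)) (\<lambda>t. H (\<Sum>i<length bs. t i *\<^sub>R bs ! i))"
proof -
  let ?N = "length bs" and ?M = "PiM {..<length bs} (\<lambda>_. lborel :: real measure)" and ?y = "\<lambda>t. \<Sum>i<length bs. t i *\<^sub>R bs ! i"
  obtain C where C: "C \<ge> 0" "\<And>t b. b \<in> set bs \<Longrightarrow> \<bar>t b\<bar> \<le> C * norm (\<Sum>b\<in>set bs. t b *\<^sub>R b)"
    using independent_coefficient_bound[of "set bs"] bs(2) unfolding is_basis_def by blast
  have coeff: "\<bar>t i\<bar> \<le> C * norm (?y t)" if i: "i < ?N" for t i
  proof -
    define idx where "idx = the_inv_into {..<?N} (\<lambda>i. bs ! i)"
    have inj: "inj_on (\<lambda>i. bs ! i) {..<?N}" using bs(1) by (simp add: inj_on_nth)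
    have idx: "idx (bs ! j) = j" if "j < ?N" for j unfolding idx_def using the_inv_into_f_f[OF inj] that by simp
    have im: "set bs = (\<lambda>i. bs ! i) ` {..<?N}" by (auto simp: set_conv_nth)
    have "(\<Sum>b\<in>set bs. t (idx b) *\<^sub>R b) = ?y t"
      unfolding im sum.reindex[OF inj] by (intro sum.cong refl) (simp add: idx)
    then show ?thesis using C(2)[of "bs ! i" "\<lambda>b. t (idx b)"] i by (simp add: idx)
  qed
  obtain R where R: "\<And>y. y \<in> K \<Longrightarrow> norm y \<le> R" using compact_imp_bounded[OF K(1)] unfolding bounded_iff by blast
  obtain D where D: "\<And>y. y \<in> K \<Longrightarrow> norm (H y) \<le> D"
    using compact_imp_bounded[OF compact_continuous_image[OF continuous_on_subset[OF H] K(1)]] unfolding bounded_iff by auto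
  let ?A = "PiE {..<?N} (\<lambda>_. {- (C * R)..C * R})"
  interpret product_sigma_finite "\<lambda>_::nat. lborel :: real measure" by unfold_locales
  have my: "?y \<in> borel_measurable ?M" by measurable
  show ?thesis
  proof (rule integrableI_bounded_set[where A = ?A and B = "max D 0"])
    show "?A \<in> sets ?M" by (rule sets_PiM_I_finite) auto
    show "(\<lambda>t. H (?y t)) \<in> borel_measurable ?M"
      by (rule measurable_compose[OF my borel_measurable_continuous_onI[OF H]])
    show "emeasure ?M ?A < \<infinity>" by (subst emeasure_PiM) (auto simp: power_eq_top_ennreal less_top[symmetric] emeasure_lborel_Icc_eq)
    show "AE t in ?M. t \<in> ?A \<longrightarrow> norm (H (?y t)) \<le> max D 0"
    proof (rule AE_I2, rule impI)
      fix t show "norm (H (?y t)) \<le> max D 0" using D[of "?y t"] K(2)[of "?y t"] by (cases "?y t \<in> K") auto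
    qed
    show "AE t in ?M. t \<notin> ?A \<longrightarrow> H (?y t) = 0"
    proof (rule AE_I2, rule impI)
      fix t assume t: "t \<in> space ?M" "t \<notin> ?A"
      then obtain i where i: "i < ?N" "\<not> (\<bar>t i\<bar> \<le> C * R)" by (auto simp: space_PiM PiE_def Pi_def)
      have "?y t \<notin> K"
      proof
        assume "?y t \<in> K"
        then have "C * norm (?y t) \<le> C * R" using R C(1) by (intro mult_left_mono) auto
        then show False using coeff[OF i(1), of t] i(2) by linarith
      qed
      then show "H (?y t) = 0" by (rule K(2))
    qed
  qed
qed

lemma wedge_map:
  "wedge m p q (\<lambda>vs. \<alpha> (map L vs)) (\<lambda>vs. \<beta> (map L vs)) vs = wedge m p q \<alpha> \<beta> (map L vs)"
proof (cases "length vs = p + q")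
  case True
  have "L (vs ! \<sigma> i) = map L vs ! \<sigma> i" if "\<sigma> permutes {..<p + q}" "i < p + q" for \<sigma> i
    using permutes_in_image[OF that(1), of i] that True by simp
  then show ?thesis using True unfolding wedge_def
    by (auto intro!: sum.cong arg_cong2[where f = m] arg_cong2[where f = scaleR] arg_cong[where f = \<alpha>] arg_cong[where f = \<beta>])
qed (simp add: wedge_def)

lemma wpow_map: "wpow (\<lambda>vs. \<omega> (map L vs)) k vs = wpow \<omega> k (map L vs)"
proof (induction k arbitrary: vs)
  case (Suc k)
  have "wpow (\<lambda>vs. \<omega> (map L vs)) k = (\<lambda>vs. wpow \<omega> k (map L vs))" using Suc by blast
  then show ?case by (simp add: wedge_map)
qed simp

lemma continuous_on_wpow:
  assumes \<omega>: "\<And>u v. continuous_on S (\<lambda>y. \<omega> y [u, v])"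
  shows "continuous_on S (\<lambda>y. wpow (\<omega> y) k vs)"
proof (induction k arbitrary: vs)
  case (Suc k)
  have "continuous_on S (\<lambda>y. \<omega> y (map f [0..<2]))" for f
    using \<omega>[of "f 0" "f 1"] by (simp add: numeral_2_eq_2)
  then show ?case unfolding wpow.simps wedge_def
    by (cases "length vs = 2 + 2 * k") (auto intro!: continuous_intros Suc simp del: upt_Suc)
qed simp

lemma kpow_ipow: "kpow X k x = ipow (kform X x) k"
  by (rule ext) (simp add: kpow_def ipow_def)

lemma loc_kpow: "loc X c (kpow X k) y vs = ipow (loc X c (kform X) y) k vs"
  by (simp add: loc_def[abs_def] kpow_ipow ipow_def wpow_map)

lemma continuous_on_loc_kpow:
  assumes X: "smooth_tensor X 2 (kform X)" and c: "c \<in> atlas X"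
  shows "continuous_on (snd c ` fst c) (\<lambda>y. loc X c (kpow X k) y vs)"
proof -
  have "continuous_on (snd c ` fst c) (\<lambda>y. loc X c (kform X) y [u, v])" for u v
    using X c by (intro smooth_on_continuous) (simp add: smooth_tensor_def)
  then have "continuous_on (snd c ` fst c) (\<lambda>y. wpow (loc X c (kform X) y) (nat k) vs)"
    by (rule continuous_on_wpow)
  then show ?thesis unfolding loc_kpow ipow_def by (cases "k < 0") (auto intro!: continuous_intros)
qed

text \<open>The regularity demanded of integrands: together with the compact supports of the
  partition it makes each local integral converge, so that integrals may be added.\<close>

definition chart_continuous :: "('a, 'v::real_normed_vector, 'z) mfd_scheme \<Rightarrow> ('a \<Rightarrow> real) \<Rightarrow> bool" where
  "chart_continuous X f \<longleftrightarrow> (\<forall>c\<in>atlas X. continuous_on (snd c ` fst c) (\<lambda>y. f (cinv c y)))"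

lemma chart_continuous_intros:
  assumes "chart_continuous X f" "chart_continuous X g"
  shows "chart_continuous X (\<lambda>x. f x + g x)" "chart_continuous X (\<lambda>x. f x - g x)" "chart_continuous X (\<lambda>x. f x * g x)"
    "chart_continuous X (\<lambda>x. a)"
  using assms unfolding chart_continuous_def by (auto intro: continuous_intros)

text \<open>For a multiple of the volume form, the orientation sign in \<open>form_integral\<close>
  turns the coordinate expression of the volume form into its absolute value.\<close>

definition local_integrand ::
  "('a, 'v::real_normed_vector, 'z) kaehler_scheme \<Rightarrow> ('a \<Rightarrow> real) \<Rightarrow> 'a set \<times> ('a \<Rightarrow> 'v) \<Rightarrow> ('a \<Rightarrow> real) \<Rightarrow> 'v \<Rightarrow> real" where
  "local_integrand X \<rho> c f y = (if y \<in> snd c ` fst c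
     then \<rho> (cinv c y) * (f (cinv c y) * \<bar>loc X c (kpow X (int (cdim X))) y model_basis\<bar>) else 0)"

lemma fun_integral_local:
  fixes X :: "('a, 'v::real_normed_vector, 'z) kaehler_scheme"
  shows
  "fun_integral X f = (\<Sum>(\<rho>, c)\<in>(SOME P. partition_of_unity X P).
     LINT t|PiM {..<length (model_basis :: 'v list)} (\<lambda>_. lborel).
       local_integrand X \<rho> c f (\<Sum>i<length (model_basis :: 'v list). t i *\<^sub>R model_basis ! i))"
proof -
  have "loc X c (\<lambda>x vs. f x * kpow X (int (cdim X)) x vs) y vs = f (cinv c y) * loc X c (kpow X (int (cdim X))) y vs"
    for c :: "'a set \<times> ('a \<Rightarrow> 'v)" and y vs by (simp add: loc_def)
  then show ?thesis
    unfolding fun_integral_def top_integral_def form_integral_def Let_def local_integrand_def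
    by (intro sum.cong refl prod.case_cong) (auto intro!: Bochner_Integration.integral_cong simp: abs_sgn mult.assoc split: prod.splits)
qed

lemma form_integral_cong:
  assumes M: "charted M" and eq: "\<And>x vs. x \<in> pts M \<Longrightarrow> \<eta> x vs = \<zeta> x vs" and P: "partition_of_unity M (SOME P. partition_of_unity M P)"
  shows "form_integral M vol \<eta> = form_integral M vol \<zeta>"
proof -
  have e: "loc M c \<eta> y vs = loc M c \<zeta> y vs" if "c \<in> atlas M" "y \<in> snd c ` fst c" for c y vs
    unfolding loc_def using eq chart_sub[OF M that(1)] cinv_in[OF that(2)] by blast
  have c: "c \<in> atlas M" if "(\<rho>, c) \<in> (SOME P. partition_of_unity M P)" for \<rho> c
    using P that unfolding partition_of_unity_def by blast
  show ?thesis unfolding form_integral_def Let_def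
    by (rule sum.cong[OF refl]) (auto intro!: Bochner_Integration.integral_cong simp: e c split: prod.splits)
qed

context
  fixes X :: "('x, 'v::{real_normed_vector, second_countable_topology}, 'z) kaehler_scheme" and n :: nat
  assumes X: "kaehler_manifold n X" and cpt: "compact_space (mtop X)"
begin

lemma X_manifold: "is_manifold X" and X_charted: "charted X" and X_kform: "smooth_tensor X 2 (kform X)" and X_cdim: "cdim X = n"
  using X unfolding kaehler_manifold_def complex_manifold_def diff_form_def cdim_def by (auto intro: is_manifold_charted)

lemma X_partition: "partition_of_unity X (SOME P. partition_of_unity X P)"
  using someI_ex[OF partition_of_unity_exists[OF X_manifold cpt]] .

text \<open>The integrand is continuous on the open chart image and zero off the compact image of
  the support. These two open sets cover the model space, so extension by zero is
  continuous.\<close>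

lemma integrable_local_integrand:
  assumes P: "(\<rho>, c) \<in> (SOME P. partition_of_unity X P)" and f: "chart_continuous X f"
  shows "integrable (PiM {..<length (model_basis :: 'v list)} (\<lambda>_. lborel))
      (\<lambda>t. local_integrand X \<rho> c f (\<Sum>i<length (model_basis :: 'v list). t i *\<^sub>R model_basis ! i))"
proof -
  obtain B :: "'v set" where B: "is_basis B" using charted_basis[OF X_charted] .
  have c: "c \<in> atlas X" and \<rho>: "smooth_map X vec_mfd \<rho>" and cl: "(mtop X) closure_of {p \<in> pts X. \<rho> p \<noteq> 0} \<subseteq> fst c"
    using X_partition P unfolding partition_of_unity_def by blast+
  let ?C = "(mtop X) closure_of {p \<in> pts X. \<rho> p \<noteq> 0}"
  let ?S = "snd c ` fst c" and ?K = "snd c ` ?C" and ?H = "local_integrand X \<rho> c f"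
  have oS: "open ?S" by (rule chart_image_open[OF X_charted c])
  have "compactin (mtop X) ?C" using closedin_compact_space[OF cpt] by simp
  moreover have "continuous_map (subtopology (mtop X) (fst c)) euclidean (snd c)"
    unfolding continuous_map_def
  proof (intro conjI allI impI)
    fix V :: "'v set" assume "openin euclidean V"
    then have "openin (mtop X) {p \<in> fst c. snd c p \<in> V}" using openin_chart[OF X_charted c] by simp
    moreover have "{x \<in> topspace (subtopology (mtop X) (fst c)). snd c x \<in> V} = {p \<in> fst c. snd c p \<in> V}"
      using chart_sub[OF X_charted c] topspace_mtop[OF X_charted] by auto
    ultimately show "openin (subtopology (mtop X) (fst c)) {x \<in> topspace (subtopology (mtop X) (fst c)). snd c x \<in> V}"
      by (auto simp: openin_subtopology)
  qed simp
  ultimately have "compactin euclidean ?K"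
    using image_compactin[of "subtopology (mtop X) (fst c)" ?C euclidean "snd c"] cl by (simp add: compactin_subtopology)
  then have K: "compact ?K" by simp
  have KS: "?K \<subseteq> ?S" using cl by blast
  have z: "?H y = 0" if "y \<notin> ?K" for y
  proof (cases "y \<in> ?S")
    case True
    then obtain p where p: "p \<in> fst c" "y = snd c p" by auto
    have px: "p \<in> pts X" using chart_sub[OF X_charted c] p by auto
    have "p \<notin> ?C" using that p by auto
    then have "\<rho> p = 0" using closure_of_subset[of "{p \<in> pts X. \<rho> p \<noteq> 0}" "mtop X"] px topspace_mtop[OF X_charted] by auto
    then show ?thesis using p chart_inj[OF X_charted c] by (simp add: local_integrand_def)
  qed (simp add: local_integrand_def)
  have "continuous_on ?S (\<lambda>y. \<rho> (cinv c y))"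
    using \<rho> c unfolding smooth_map_def by (intro smooth_on_continuous) (simp add: comp_def)
  then have "continuous_on ?S (\<lambda>y. \<rho> (cinv c y) * (f (cinv c y) * \<bar>loc X c (kpow X (int (cdim X))) y model_basis\<bar>))"
    using f c continuous_on_loc_kpow[OF X_kform c] unfolding chart_continuous_def by (intro continuous_intros) auto
  then have 1: "continuous_on ?S ?H" by (rule continuous_on_eq) (simp add: local_integrand_def)
  have 2: "continuous_on (- ?K) ?H"
    by (rule continuous_on_eq[where f = "\<lambda>_. 0"]) (use z in auto)
  have "continuous_on (?S \<union> - ?K) ?H"
    by (rule continuous_on_open_Un[OF oS _ 1 2]) (use K compact_imp_closed in blast)
  moreover have "?S \<union> - ?K = UNIV" using KS by blast
  ultimately have H: "continuous_on UNIV ?H" by simp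
  show ?thesis
    by (rule integrable_compact_support[OF model_basis_props[OF B] H K z])
qed

lemma fun_integral_add:
  assumes f: "chart_continuous X f" and g: "chart_continuous X g"
  shows "fun_integral X (\<lambda>x. f x + g x) = fun_integral X f + fun_integral X g"
proof -
  have e: "local_integrand X \<rho> c (\<lambda>x. f x + g x) y = local_integrand X \<rho> c f y + local_integrand X \<rho> c g y" for \<rho> c y
    by (simp add: local_integrand_def algebra_simps)
  show ?thesis unfolding fun_integral_local sum.distrib[symmetric]
    by (rule sum.cong[OF refl])
       (auto simp: e intro!: Bochner_Integration.integral_add integrable_local_integrand f g split: prod.splits)
qed

lemma fun_integral_scale: "fun_integral X (\<lambda>x. r * f x) = r * fun_integral X f"
proof -
  have e: "local_integrand X \<rho> c (\<lambda>x. r * f x) y = r * local_integrand X \<rho> c f y" for \<rho> c y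
    by (simp add: local_integrand_def)
  show ?thesis unfolding fun_integral_local sum_distrib_left by (rule sum.cong[OF refl]) (auto simp: e)
qed

lemma top_integral_eq_fun_integral:
  assumes "\<And>x vs. x \<in> pts X \<Longrightarrow> \<eta> x vs = f x * kpow X (int n) x vs"
  shows "top_integral X \<eta> = fun_integral X f"
  unfolding top_integral_def fun_integral_def
  by (rule form_integral_cong[OF X_charted _ X_partition]) (simp add: assms X_cdim)

lemma fun_integral_cong:
  assumes "\<And>x. x \<in> pts X \<Longrightarrow> f x = g x"
  shows "fun_integral X f = fun_integral X g"
  unfolding fun_integral_def top_integral_def
  by (rule form_integral_cong[OF X_charted _ X_partition]) (simp add: assms)

end

section \<open>Naturality of the exterior derivative of one-forms\<close>

text \<open>A product rule for a linear map that varies with the point and is known to be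
  differentiable only on fixed vectors; a basis expansion reduces it to the rule for scalar
  multiples.\<close>

lemma has_derivative_linear_apply:
  fixes \<beta> :: "'w::real_normed_vector \<Rightarrow> 'w \<Rightarrow> 'u::real_normed_vector" and f q :: "'v::real_normed_vector \<Rightarrow> 'w"
  assumes C: "is_basis (C :: 'w set)"
    and T: "open T" and V: "open V" "y \<in> V" and f: "(f has_derivative f') (at y)" "\<And>z. z \<in> V \<Longrightarrow> f z \<in> T"
    and q: "(q has_derivative q') (at y)"
    and \<beta>: "\<And>z. z \<in> T \<Longrightarrow> linear (\<beta> z)" and D\<beta>: "\<And>w. ((\<lambda>z. \<beta> z w) has_derivative D w) (at (f y))"
  shows "((\<lambda>z. \<beta> (f z) (q z)) has_derivative (\<lambda>u. \<beta> (f y) (q' u) + D (q y) (f' u))) (at y)"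
proof -
  let ?r = "representation C"
  note bl = bounded_linear_representation[OF C]
  have fy: "f y \<in> T" using f(2) V by blast
  have D: "((\<lambda>z. \<Sum>b\<in>C. ?r (q z) b *\<^sub>R \<beta> (f z) b) has_derivative
       (\<lambda>u. \<Sum>b\<in>C. ?r (q y) b *\<^sub>R D b (f' u) + ?r (q' u) b *\<^sub>R \<beta> (f y) b)) (at y)"
  proof (rule has_derivative_sum)
    fix b assume b: "b \<in> C"
    show "((\<lambda>z. ?r (q z) b *\<^sub>R \<beta> (f z) b) has_derivative (\<lambda>u. ?r (q y) b *\<^sub>R D b (f' u) + ?r (q' u) b *\<^sub>R \<beta> (f y) b)) (at y)"
      by (rule has_derivative_scaleR[OF bounded_linear.has_derivative[OF bl[OF b] q]
           has_derivative_compose[OF f(1) D\<beta>]])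
  qed
  \<comment> \<open>The derivatives \<open>D w\<close> are given separately for each
    \<open>w\<close>; their linearity in \<open>w\<close> comes from uniqueness of
    derivatives.\<close>
  have lD: "D w h = (\<Sum>b\<in>C. ?r w b *\<^sub>R D b h)" for w h
  proof -
    have "((\<lambda>z. \<Sum>b\<in>C. ?r w b *\<^sub>R \<beta> z b) has_derivative (\<lambda>h. \<Sum>b\<in>C. ?r w b *\<^sub>R D b h)) (at (f y))"
      by (intro has_derivative_sum has_derivative_scaleR_right D\<beta>)
    then have "((\<lambda>z. \<beta> z w) has_derivative (\<lambda>h. \<Sum>b\<in>C. ?r w b *\<^sub>R D b h)) (at (f y))"
      by (rule has_derivative_transform_within_open[OF _ T fy]) (rule linear_basis_expansion[OF C \<beta>, symmetric])
    from has_derivative_unique[OF D\<beta> this] show ?thesis by (rule fun_cong)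
  qed
  have 1: "(\<Sum>b\<in>C. ?r (q y) b *\<^sub>R D b (f' u) + ?r (q' u) b *\<^sub>R \<beta> (f y) b) = \<beta> (f y) (q' u) + D (q y) (f' u)" for u
    by (simp add: sum.distrib lD[of "q y"] linear_basis_expansion[OF C \<beta>[OF fy], of "q' u"])
  show ?thesis
    by (rule has_derivative_transform_within_open[OF D[unfolded 1] V])
       (rule linear_basis_expansion[OF C \<beta>[OF f(2)], symmetric])
qed

lemma ext_d_one_form:
  "ext_d M 1 \<eta> p [u, v] =
     frechet_derivative (\<lambda>y. loc M (chart_at M p) \<eta> y [v]) (at (snd (chart_at M p) p)) u -
     frechet_derivative (\<lambda>y. loc M (chart_at M p) \<eta> y [u]) (at (snd (chart_at M p) p)) v"
  by (simp add: ext_d_def)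

lemma ext_d_length: "length vs \<noteq> Suc k \<Longrightarrow> ext_d M k \<eta> p vs = 0"
  by (simp add: ext_d_def)

lemma alt_form_1_linear: "alt_form 1 \<alpha> \<Longrightarrow> linear (\<lambda>v. \<alpha> [v])"
  using alt_form_mlin[of 1 \<alpha>] mlinD[of \<alpha> "[]" "[]"] by simp

lemma loc_one_form_linear:
  assumes M: "charted M" and \<eta>: "\<And>p. p \<in> pts M \<Longrightarrow> alt_form 1 (\<eta> p)" and c: "c \<in> atlas M" and y: "y \<in> snd c ` fst c"
  shows "linear (\<lambda>w. loc M c \<eta> y [w])"
proof -
  have q: "cinv c y \<in> fst c" "cinv c y \<in> pts M" using cinv_in[OF y] chart_sub[OF M c] by auto
  show ?thesis unfolding loc_def using linear_compose[OF from_chart_linear[OF M c q(1)] alt_form_1_linear[OF \<eta>[OF q(2)]]]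
    by (simp add: comp_def)
qed

text \<open>The second derivatives of \<open>f\<close> that appear on the left-hand side cancel by their symmetry.\<close>

lemma ext_d_natural:
  fixes M :: "('a, 'v::real_normed_vector, 'y) mfd_scheme" and N :: "('b, 'w::real_normed_vector, 'z) mfd_scheme"
    and \<eta> :: "'b \<Rightarrow> 'w list \<Rightarrow> 'u::real_normed_vector"
  assumes M: "charted M" and N: "charted N" and W: "openin (mtop M) W" "p \<in> W"
    and f: "\<And>q. q \<in> W \<Longrightarrow> smooth_at M N f q" "\<And>q. q \<in> W \<Longrightarrow> f q \<in> pts N"
    and \<eta>: "\<And>q. q \<in> pts N \<Longrightarrow> alt_form 1 (\<eta> q)" "smooth_tensor N 1 \<eta>"
    and \<zeta>: "\<And>q w. q \<in> W \<Longrightarrow> \<zeta> q [w] = \<eta> (f q) [tmap M N f q w]"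
  shows "ext_d M 1 \<zeta> p [u, v] = ext_d N 1 \<eta> (f p) [tmap M N f p u, tmap M N f p v]"
proof -
  define c d where "c = chart_at M p" and "d = chart_at N (f p)"
  have pM: "p \<in> pts M" using W openin_mtop[OF M] by auto
  have c: "c \<in> atlas M" "p \<in> fst c" using chart_at_props[OF M pM] by (auto simp: c_def)
  have d: "d \<in> atlas N" "f p \<in> fst d" using chart_at_props[OF N f(2)[OF W(2)]] by (auto simp: d_def)
  obtain B :: "'v set" where B: "is_basis B" using charted_basis[OF M] .
  obtain C :: "'w set" where C: "is_basis C" using charted_basis[OF N] .
  obtain V0 where V0: "open V0" "snd c p \<in> V0" "V0 \<subseteq> snd c ` fst c" "\<And>y. y \<in> V0 \<Longrightarrow> f (cinv c y) \<in> fst d"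
    "smooth_on V0 (\<lambda>y. snd d (f (cinv c y)))"
    using smooth_atD[OF f(1)[OF W(2)] c(1) d(1) c(2) d(2)] by (elim exE conjE) (rule that, auto)
  define V where "V = V0 \<inter> snd c ` (W \<inter> fst c)"
  have oV: "open V" unfolding V_def using V0(1) W(1) c(1) openin_mtop[OF M] by auto
  have yV: "snd c p \<in> V" using V0 W c by (auto simp: V_def)
  define h where "h = (\<lambda>y. snd d (f (cinv c y)))"
  have h: "smooth_on V h" unfolding h_def by (rule smooth_on_mono[OF V0(5)]) (simp add: V_def)
  let ?T = "snd d ` fst d"
  have hT: "h y \<in> ?T" if "y \<in> V" for y using V0(4) that by (auto simp: h_def V_def)
  define Dh where "Dh = (\<lambda>y. frechet_derivative h (at y))"
  define \<beta> where "\<beta> = (\<lambda>z w. loc N d \<eta> z [w])"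
  have lin: "linear (\<beta> z)" if "z \<in> ?T" for z unfolding \<beta>_def by (rule loc_one_form_linear[OF N \<eta>(1) d(1) that])
  have s\<beta>: "smooth_on ?T (\<lambda>z. \<beta> z w)" for w using \<eta>(2) d(1) by (simp add: smooth_tensor_def \<beta>_def)
  have oT: "open ?T" by (rule chart_image_open[OF N d(1)])
  have loc\<zeta>: "loc M c \<zeta> y [w] = \<beta> (h y) (Dh y w)" if y: "y \<in> V" for y w
  proof -
    have q: "cinv c y \<in> fst c" "cinv c y \<in> W" "snd c (cinv c y) = y"
      using y chart_inj[OF M c(1)] by (auto simp: V_def)
    have fd: "f (cinv c y) \<in> fst d" using V0(4) y by (simp add: V_def)
    have "tmap M N f (cinv c y) (from_chart M c (cinv c y) w) = tmap vec_mfd N (\<lambda>y. f (cinv c y)) y w"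
      using tmap_from_chart[OF M N f(1)[OF q(2)] c(1) q(1) f(2)[OF q(2)]] q(3) by simp
    also have "\<dots> = from_chart N d (f (cinv c y)) (Dh y w)"
      unfolding Dh_def h_def
    proof (rule tmap_vec_chart[where s = "\<lambda>y. f (cinv c y)", OF N B _ d(1) fd])
      have "y \<in> snd c ` fst c" using y V0(3) by (auto simp: V_def)
      then show "smooth_at vec_mfd N (\<lambda>y. f (cinv c y)) y"
        using smooth_at_comp[OF charted_vec[OF B] M smooth_at_cinv[OF M c(1)] f(1)[OF q(2)]] chart_sub[OF M c(1)] q(1) by blast
    qed
    finally have e: "tmap M N f (cinv c y) (from_chart M c (cinv c y) w) = from_chart N d (f (cinv c y)) (Dh y w)" .
    have "cinv d (h y) = f (cinv c y)" unfolding h_def using fd chart_inj[OF N d(1)] by simp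
    then show ?thesis unfolding loc_def \<beta>_def using \<zeta>[OF q(2)] e by simp
  qed
  let ?y = "snd c p"
  have Dhy: "(h has_derivative Dh ?y) (at ?y)" unfolding Dh_def by (rule smooth_on_has_derivative[OF h yV])
  have D2: "((\<lambda>z. Dh z w) has_derivative frechet_derivative (\<lambda>z. Dh z w) (at ?y)) (at ?y)" for w
    unfolding Dh_def by (rule smooth_on_has_derivative[OF smooth_on_derivative[OF h] yV])
  have D\<beta>: "((\<lambda>z. \<beta> z w) has_derivative frechet_derivative (\<lambda>z. \<beta> z w) (at (h ?y))) (at (h ?y))" for w
    by (rule smooth_on_has_derivative[OF s\<beta> hT[OF yV]])
  have key: "frechet_derivative (\<lambda>y. loc M c \<zeta> y [w]) (at ?y) u =
      \<beta> (h ?y) (frechet_derivative (\<lambda>z. Dh z w) (at ?y) u) + frechet_derivative (\<lambda>z. \<beta> z (Dh ?y w)) (at (h ?y)) (Dh ?y u)" for w u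
  proof -
    have "((\<lambda>z. \<beta> (h z) (Dh z w)) has_derivative (\<lambda>u. \<beta> (h ?y) (frechet_derivative (\<lambda>z. Dh z w) (at ?y) u) +
        frechet_derivative (\<lambda>z. \<beta> z (Dh ?y w)) (at (h ?y)) (Dh ?y u))) (at ?y)"
      by (rule has_derivative_linear_apply[OF C oT oV yV Dhy hT D2 lin D\<beta>])
    then have "((\<lambda>y. loc M c \<zeta> y [w]) has_derivative (\<lambda>u. \<beta> (h ?y) (frechet_derivative (\<lambda>z. Dh z w) (at ?y) u) +
        frechet_derivative (\<lambda>z. \<beta> z (Dh ?y w)) (at (h ?y)) (Dh ?y u))) (at ?y)"
      by (rule has_derivative_transform_within_open[OF _ oV yV]) (simp add: loc\<zeta>)
    from frechet_derivative_eqI[OF this] show ?thesis by simp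
  qed
  have "frechet_derivative (\<lambda>z. Dh z v) (at ?y) u = frechet_derivative (\<lambda>z. Dh z u) (at ?y) v"
    unfolding Dh_def by (rule second_derivative_symmetric[OF C oV yV]) (use h in \<open>simp add: smooth_on_def\<close>)
  moreover have "Dh ?y w = tmap M N f p w" for w
    by (simp add: Dh_def h_def tmap_def comp_def c_def d_def)
  moreover have "h ?y = snd d (f p)" using chart_inj[OF M c(1)] c(2) by (simp add: h_def)
  ultimately show ?thesis
    unfolding ext_d_one_form c_def[symmetric] d_def[symmetric] key by (simp add: \<beta>_def)
qed

lemma loc_vec:
  fixes y :: "'v::real_normed_vector"
  shows "loc vec_mfd (UNIV, \<lambda>v. v) \<zeta> y vs = \<zeta> y vs"
proof -
  have "from_chart vec_mfd (UNIV, \<lambda>v. v) y u = u" for y u :: 'v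
  proof -
    have "((\<lambda>v. v) has_derivative (\<lambda>v. v)) (at y)" for y :: 'v by simp
    then show ?thesis using frechet_derivative_eqI by (simp add: from_chart_def comp_def frechet_derivative_ident)
  qed
  then show ?thesis by (simp add: loc_def map_idI)
qed

text \<open>The definition of \<open>ext_d\<close> at \<open>p\<close> uses the chart chosen for
  \<open>p\<close>. Naturality under the inverse of \<open>c\<close> shows that every chart gives
  the same formula, so one chart can be kept while the point moves.\<close>

lemma ext_d_chart:
  fixes M :: "('a, 'v::real_normed_vector, 'y) mfd_scheme" and \<eta> :: "'a \<Rightarrow> 'v list \<Rightarrow> 'u::real_normed_vector"
  assumes M: "charted M" and \<eta>: "\<And>q. q \<in> pts M \<Longrightarrow> alt_form 1 (\<eta> q)" "smooth_tensor M 1 \<eta>"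
    and c: "c \<in> atlas M" "p \<in> fst c"
  shows "ext_d M 1 \<eta> p [from_chart M c p u, from_chart M c p v] =
     frechet_derivative (\<lambda>y. loc M c \<eta> y [v]) (at (snd c p)) u - frechet_derivative (\<lambda>y. loc M c \<eta> y [u]) (at (snd c p)) v"
proof -
  obtain B :: "'v set" where B: "is_basis B" using charted_basis[OF M] .
  let ?W = "snd c ` fst c"
  have k: "cinv c (snd c p) = p" using chart_inj[OF M c(1)] c(2) by simp
  have oW: "openin (mtop vec_mfd) ?W" using chart_image_open[OF M c(1)] by (simp add: openin_mtop[OF charted_vec[OF B]])
  have "ext_d vec_mfd 1 (loc M c \<eta>) (snd c p) [u, v] =
     ext_d M 1 \<eta> (cinv c (snd c p)) [tmap vec_mfd M (cinv c) (snd c p) u, tmap vec_mfd M (cinv c) (snd c p) v]"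
  proof (rule ext_d_natural[OF charted_vec[OF B] M oW _ smooth_at_cinv[OF M c(1)] _ \<eta>])
    show "cinv c q \<in> pts M" if "q \<in> ?W" for q using cinv_in[OF that] chart_sub[OF M c(1)] by blast
    show "loc M c \<eta> q [w] = \<eta> (cinv c q) [tmap vec_mfd M (cinv c) q w]" if "q \<in> ?W" for q w
      using from_chart_tmap[of c "cinv c q" M] snd_cinv[OF that] by (simp add: loc_def)
  qed (use c in auto)
  then show ?thesis
    unfolding k from_chart_tmap[of c p M, OF k, symmetric] unfolding ext_d_one_form by (simp add: loc_vec)
qed

section \<open>Lie groups and principal bundles\<close>

locale lie_grp =
  fixes K :: "('k, 'l::real_normed_vector) lie"
  assumes lie: "lie_group K"
begin

lemma cK: "charted K" and grpK: "group (grp K)" and carrierK: "carrier (grp K) = pts K"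
  using lie unfolding lie_group_def by (auto intro: is_manifold_charted)

lemma one_in: "gone K \<in> pts K" using monoid.one_closed[OF group.is_monoid[OF grpK]] carrierK by simp
lemma mul_in: "g \<in> pts K \<Longrightarrow> h \<in> pts K \<Longrightarrow> gmul K g h \<in> pts K"
  using monoid.m_closed[OF group.is_monoid[OF grpK]] carrierK by simp
lemma inv_in: "g \<in> pts K \<Longrightarrow> ginv K g \<in> pts K" using group.inv_closed[OF grpK] carrierK by simp
lemma mul_assoc: "f \<in> pts K \<Longrightarrow> g \<in> pts K \<Longrightarrow> h \<in> pts K \<Longrightarrow> gmul K (gmul K f g) h = gmul K f (gmul K g h)"
  using monoid.m_assoc[OF group.is_monoid[OF grpK]] carrierK by simp
lemma mul_one: "g \<in> pts K \<Longrightarrow> gmul K g (gone K) = g" and one_mul: "g \<in> pts K \<Longrightarrow> gmul K (gone K) g = g"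
  using monoid.r_one[OF group.is_monoid[OF grpK]] monoid.l_one[OF group.is_monoid[OF grpK]] carrierK by auto
lemma mul_inv: "g \<in> pts K \<Longrightarrow> gmul K g (ginv K g) = gone K" and inv_mul: "g \<in> pts K \<Longrightarrow> gmul K (ginv K g) g = gone K"
  using group.r_inv[OF grpK] group.l_inv[OF grpK] carrierK by auto
lemma inv_inv: "g \<in> pts K \<Longrightarrow> ginv K (ginv K g) = g" using group.inv_inv[OF grpK] carrierK by simp
lemma inv_mul_group: "g \<in> pts K \<Longrightarrow> h \<in> pts K \<Longrightarrow> ginv K (gmul K g h) = gmul K (ginv K h) (ginv K g)"
  using group.inv_mult_group[OF grpK] carrierK by simp
lemma mul_inv_cancel: "g \<in> pts K \<Longrightarrow> h \<in> pts K \<Longrightarrow> gmul K g (gmul K (ginv K g) h) = h"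
  using mul_assoc[of g "ginv K g" h] by (simp add: inv_in mul_inv one_mul)
lemma inv_mul_cancel: "g \<in> pts K \<Longrightarrow> h \<in> pts K \<Longrightarrow> gmul K (ginv K g) (gmul K g h) = h"
  using mul_assoc[of "ginv K g" g h] by (simp add: inv_in inv_mul one_mul)

lemma smooth_mul: "g \<in> pts K \<Longrightarrow> h \<in> pts K \<Longrightarrow> smooth_at (mprod K K) K (\<lambda>(g, h). gmul K g h) (g, h)"
  using lie unfolding lie_group_def
  by (intro smooth_map_smooth_at) (auto intro: chart_inj[OF charted_mprod[OF cK cK]])

lemma smooth_inv: "smooth_at K K (ginv K) g"
  using lie unfolding lie_group_def by (intro smooth_map_smooth_at) (auto intro: chart_inj[OF cK])

lemma smooth_mul_comp:
  assumes "charted Q" "smooth_at Q K f z" "smooth_at Q K g z" "f z \<in> pts K" "g z \<in> pts K"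
  shows "smooth_at Q K (\<lambda>z. gmul K (f z) (g z)) z"
  using smooth_at_two[where F = "\<lambda>g h. gmul K g h", OF assms(1) cK cK smooth_mul assms(2,4) assms(3,5)] assms by simp

abbreviation conj :: "'k \<Rightarrow> 'k \<Rightarrow> 'k" where "conj h g \<equiv> gmul K (gmul K h g) (ginv K h)"

lemma conj_one: "h \<in> pts K \<Longrightarrow> conj h (gone K) = gone K" by (simp add: mul_one mul_inv)

lemma smooth_conj: "h \<in> pts K \<Longrightarrow> g \<in> pts K \<Longrightarrow> smooth_at K K (conj h) g"
  by (intro smooth_mul_comp cK smooth_at_const smooth_at_id) (auto simp: mul_in inv_in)

lemma Ad_linear: "h \<in> pts K \<Longrightarrow> linear (Ad K h)"
  unfolding Ad_def by (rule tmap_linear[OF cK cK smooth_conj]) (auto simp: one_in conj_one)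

lemma Ad_mul: assumes "g \<in> pts K" "h \<in> pts K" shows "Ad K (gmul K g h) s = Ad K g (Ad K h s)"
proof -
  have 1: "Ad K (gmul K g h) = tmap K K (\<lambda>k. conj g (conj h k)) (gone K)"
    unfolding Ad_def
  proof (rule tmap_cong[OF cK cK openin_pts[OF cK] one_in])
    show "conj (gmul K g h) k = conj g (conj h k)" if "k \<in> pts K" for k
      using assms that by (simp add: inv_mul_group mul_assoc mul_in inv_in)
  qed (use assms in \<open>auto simp: one_in conj_one mul_in intro: smooth_conj\<close>)
  have "tmap K K (\<lambda>k. conj g (conj h k)) (gone K) s = tmap K K (conj g) (conj h (gone K)) (tmap K K (conj h) (gone K) s)"
    by (rule tmap_comp[OF cK cK cK]) (use assms in \<open>auto simp: one_in conj_one intro: smooth_conj\<close>)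
  then show ?thesis unfolding 1 unfolding Ad_def using assms by (simp add: conj_one)
qed

lemma Ad_one: "Ad K (gone K) s = s"
proof -
  have "tmap K K (\<lambda>k. k) (gone K) = tmap K K (conj (gone K)) (gone K)"
    by (rule tmap_cong[OF cK cK openin_pts[OF cK] one_in _ smooth_at_id[OF cK one_in] one_in one_in])
       (use inv_mul[OF one_in] mul_one[OF inv_in[OF one_in]] in \<open>simp add: one_mul mul_one\<close>)
  then show ?thesis unfolding Ad_def by (metis tmap_id[OF cK one_in])
qed

lemma Ad_inv: "h \<in> pts K \<Longrightarrow> Ad K h (Ad K (ginv K h) s) = s" "h \<in> pts K \<Longrightarrow> Ad K (ginv K h) (Ad K h s) = s"
  using Ad_mul[of h "ginv K h" s] Ad_mul[of "ginv K h" h s] by (simp_all add: inv_in mul_inv inv_mul Ad_one)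

end

lemma open_sub_simps: "pts (open_sub M U) = U" "atlas (open_sub M U) = (\<lambda>c. (fst c \<inter> U, snd c)) ` atlas M"
  by (auto simp: open_sub_def)

section \<open>Principal bundles: trivialisations, fibres and tangent spaces\<close>

locale principal = lie_grp K for K :: "('k, 'l::real_normed_vector) lie" +
  fixes X :: "('x, 'v::real_normed_vector) kaehler" and E :: "('k, 'x, 'e, 'b::real_normed_vector) pbundle"
  assumes Xm: "is_manifold X" and bun: "principal_bundle K X E"
begin

lemma cX: "charted X" and cE: "charted E"
  using Xm bun unfolding principal_bundle_def by (auto intro: is_manifold_charted)

lemma proj_in: "e \<in> pts E \<Longrightarrow> proj E e \<in> pts X"
  using bun unfolding principal_bundle_def smooth_map_def by auto

lemma ract_in: "e \<in> pts E \<Longrightarrow> h \<in> pts K \<Longrightarrow> ract E e h \<in> pts E"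
  using bun unfolding principal_bundle_def smooth_map_def by (fastforce simp: pts_mprod)

lemma ract_one: "e \<in> pts E \<Longrightarrow> ract E e (gone K) = e"
  and ract_mul: "e \<in> pts E \<Longrightarrow> g \<in> pts K \<Longrightarrow> h \<in> pts K \<Longrightarrow> ract E e (gmul K g h) = ract E (ract E e g) h"
  using bun unfolding principal_bundle_def by auto

lemma smooth_proj: "smooth_at E X (proj E) e"
  using bun unfolding principal_bundle_def by (auto intro!: smooth_map_smooth_at intro: chart_inj[OF cE])

lemma smooth_ract: "smooth_at (mprod E K) E (\<lambda>(e, h). ract E e h) (e, h)"
  using bun unfolding principal_bundle_def by (auto intro!: smooth_map_smooth_at intro: chart_inj[OF charted_mprod[OF cE cK]])

lemma smooth_ract1: "e \<in> pts E \<Longrightarrow> h \<in> pts K \<Longrightarrow> smooth_at E E (\<lambda>e. ract E e h) e"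
  using smooth_at_two[where F = "\<lambda>e h. ract E e h", OF cE cE cK smooth_ract smooth_at_id[OF cE] _ smooth_at_const[OF cE]] by simp

lemma smooth_ract2: "e \<in> pts E \<Longrightarrow> h \<in> pts K \<Longrightarrow> smooth_at K E (ract E e) h"
  using smooth_at_two[where F = "\<lambda>e h. ract E e h" and f = "\<lambda>_. e" and g = "\<lambda>h. h", OF cK cE cK smooth_ract smooth_at_const[OF cK] _ smooth_at_id[OF cK]] by simp

definition triv_comp :: "'x set \<Rightarrow> ('x \<times> 'k \<Rightarrow> 'e) \<Rightarrow> 'e \<Rightarrow> 'k" where
  "triv_comp U \<tau> e = snd (inv_into (U \<times> pts K) \<tau> e)"

context
  fixes U \<tau> assumes triv: "local_triv K X E U \<tau>"
begin

lemma triv_open: "openin (mtop X) U" and triv_sub: "U \<subseteq> pts X"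
  using triv openin_mtop[OF cX] unfolding local_triv_def by auto

lemma triv_bij: "bij_betw \<tau> (U \<times> pts K) {e \<in> pts E. proj E e \<in> U}"
  using triv unfolding local_triv_def diffeo_def by (simp add: pts_mprod open_sub_simps)

lemma triv_in: "x \<in> U \<Longrightarrow> h \<in> pts K \<Longrightarrow> \<tau> (x, h) \<in> pts E"
  using bij_betwE[OF triv_bij] by auto

lemma triv_proj: "x \<in> U \<Longrightarrow> h \<in> pts K \<Longrightarrow> proj E (\<tau> (x, h)) = x"
  and triv_mul: "x \<in> U \<Longrightarrow> h \<in> pts K \<Longrightarrow> k \<in> pts K \<Longrightarrow> \<tau> (x, gmul K h k) = ract E (\<tau> (x, h)) k"
  using triv unfolding local_triv_def by auto

lemma triv_comp: assumes e: "e \<in> pts E" "proj E e \<in> U"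
  shows "triv_comp U \<tau> e \<in> pts K" "\<tau> (proj E e, triv_comp U \<tau> e) = e"
proof -
  let ?i = "inv_into (U \<times> pts K) \<tau> e"
  have "e \<in> \<tau> ` (U \<times> pts K)" using triv_bij e unfolding bij_betw_def by auto
  then have i: "?i \<in> U \<times> pts K" "\<tau> ?i = e" by (rule inv_into_into, rule f_inv_into_f)
  then obtain x h where xh: "?i = (x, h)" "x \<in> U" "h \<in> pts K" by auto
  have "proj E e = x" using i xh triv_proj by auto
  then show "triv_comp U \<tau> e \<in> pts K" "\<tau> (proj E e, triv_comp U \<tau> e) = e" using i xh by (auto simp: triv_comp_def)
qed

lemma triv_comp_triv: "x \<in> U \<Longrightarrow> h \<in> pts K \<Longrightarrow> triv_comp U \<tau> (\<tau> (x, h)) = h"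
  using inv_into_f_f[OF bij_betw_imp_inj_on[OF triv_bij], of "(x, h)"] by (simp add: triv_comp_def)

text \<open>A trivialisation is a diffeomorphism between open submanifolds; comparison of restricted
  charts makes it smooth as a map into the whole of \<open>E\<close>.\<close>

lemma smooth_triv:
  assumes xh: "x \<in> U" "h \<in> pts K" shows "smooth_at (mprod X K) E \<tau> (x, h)"
proof (rule smooth_at_subcharts)
  have sm: "smooth_map (mprod (open_sub X U) K) (open_sub E {e \<in> pts E. proj E e \<in> U}) \<tau>"
    using triv unfolding local_triv_def diffeo_def by simp
  show "smooth_at (mprod (open_sub X U) K) (open_sub E {e \<in> pts E. proj E e \<in> U}) \<tau> (x, h)"
  proof (rule smooth_map_smooth_at[OF sm])
    fix a assume "a \<in> atlas (mprod (open_sub X U) K)"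
    then obtain c d where "c \<in> atlas X" "d \<in> atlas K" "a = pch (fst c \<inter> U, snd c) d"
      unfolding atlas_mprod open_sub_simps by blast
    then show "inj_on (snd a) (fst a)"
      using pch_inj[of "(fst c \<inter> U, snd c)" d] inj_on_subset[OF chart_inj[OF cX], of c "fst c \<inter> U"] chart_inj[OF cK] by simp
  qed
  show "inj_on (snd c) (fst c)" if "c \<in> atlas (mprod X K)" for c using chart_inj[OF charted_mprod[OF cX cK] that] .
  fix a assume "a \<in> atlas (mprod X K)" "(x, h) \<in> fst a"
  then obtain c d where cd: "c \<in> atlas X" "d \<in> atlas K" "a = pch c d" "x \<in> fst c" "h \<in> fst d" unfolding atlas_mprod by auto
  have "pch (fst c \<inter> U, snd c) d \<in> atlas (mprod (open_sub X U) K)" unfolding atlas_mprod open_sub_simps using cd by blast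
  then show "\<exists>c'\<in>atlas (mprod (open_sub X U) K). (x, h) \<in> fst c' \<and> fst c' \<subseteq> fst a \<and> snd c' = snd a"
    using cd xh by (intro bexI[of _ "pch (fst c \<inter> U, snd c) d"]) (auto simp: pch_def)
next
  fix d assume d: "d \<in> atlas E" "\<tau> (x, h) \<in> fst d"
  then show "\<exists>d'\<in>atlas (open_sub E {e \<in> pts E. proj E e \<in> U}). \<tau> (x, h) \<in> fst d' \<and> fst d' \<subseteq> fst d \<and> snd d' = snd d"
    using triv_in[OF xh] triv_proj[OF xh] xh by (auto simp: open_sub_simps)
qed

lemma smooth_triv_comp:
  assumes e: "e \<in> pts E" "proj E e \<in> U" shows "smooth_at E K (triv_comp U \<tau>) e"
proof -
  let ?i = "inv_into (U \<times> pts K) \<tau>" and ?S = "{e \<in> pts E. proj E e \<in> U}"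
  have sm: "smooth_map (open_sub E ?S) (mprod (open_sub X U) K) ?i"
    using triv unfolding local_triv_def diffeo_def by (simp add: pts_mprod open_sub_simps)
  have ie: "?i e \<in> U \<times> pts K" using triv_bij e unfolding bij_betw_def by (auto intro!: inv_into_into)
  have s: "smooth_at E (mprod X K) ?i e"
  proof (rule smooth_at_subcharts)
    show "smooth_at (open_sub E ?S) (mprod (open_sub X U) K) ?i e"
    proof (rule smooth_map_smooth_at[OF sm])
      fix c assume "c \<in> atlas (open_sub E ?S)"
      then obtain c' where "c' \<in> atlas E" "c = (fst c' \<inter> ?S, snd c')" unfolding open_sub_simps by blast
      then show "inj_on (snd c) (fst c)" using inj_on_subset[OF chart_inj[OF cE], of c' "fst c' \<inter> ?S"] by simp
    qed
    show "inj_on (snd c) (fst c)" if "c \<in> atlas E" for c using chart_inj[OF cE that] .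
    fix c assume "c \<in> atlas E" "e \<in> fst c"
    then show "\<exists>c'\<in>atlas (open_sub E ?S). e \<in> fst c' \<and> fst c' \<subseteq> fst c \<and> snd c' = snd c"
      using e by (auto simp: open_sub_simps)
  next
    fix a assume "a \<in> atlas (mprod X K)" "?i e \<in> fst a"
    then obtain c d where cd: "c \<in> atlas X" "d \<in> atlas K" "a = pch c d" "?i e \<in> fst c \<times> fst d" unfolding atlas_mprod by auto
    have "pch (fst c \<inter> U, snd c) d \<in> atlas (mprod (open_sub X U) K)" unfolding atlas_mprod open_sub_simps using cd by blast
    then show "\<exists>c'\<in>atlas (mprod (open_sub X U) K). ?i e \<in> fst c' \<and> fst c' \<subseteq> fst a \<and> snd c' = snd a"
      using cd ie by (intro bexI[of _ "pch (fst c \<inter> U, snd c) d"]) (auto simp: pch_def)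
  qed
  obtain x h where xh: "?i e = (x, h)" "x \<in> U" "h \<in> pts K" using ie by auto
  have "smooth_at E K (\<lambda>e. snd (?i e)) e"
    by (rule smooth_at_comp[OF cE charted_mprod[OF cX cK] s])
       (use xh triv_sub smooth_at_snd[OF cX cK, of x h] in \<open>auto simp: pts_mprod\<close>)
  then show ?thesis by (simp add: triv_comp_def[abs_def])
qed

lemma smooth_triv_section:
  assumes "x \<in> U" "h \<in> pts K" shows "smooth_at X E (\<lambda>x. \<tau> (x, h)) x"
  using smooth_at_two[where F = "\<lambda>x h. \<tau> (x, h)" and g = "\<lambda>_. h", OF cX cX cK _ smooth_at_id[OF cX] _ smooth_at_const[OF cX]]
    smooth_triv[OF assms] assms triv_sub by auto

end

lemma triv_exists: "x \<in> pts X \<Longrightarrow> \<exists>U \<tau>. x \<in> U \<and> local_triv K X E U \<tau>"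
  using bun unfolding principal_bundle_def by blast

text \<open>Invariance of the fibres, and below transitivity and freeness on them, are not clauses
  of \<open>principal_bundle\<close>. They are read off in a trivialisation, where the action is
  right multiplication.\<close>

lemma proj_ract: assumes e: "e \<in> pts E" and h: "h \<in> pts K" shows "proj E (ract E e h) = proj E e"
proof -
  obtain U \<tau> where U: "proj E e \<in> U" "local_triv K X E U \<tau>" using triv_exists[OF proj_in[OF e]] by blast
  note t = triv_comp[OF U(2) e U(1)]
  have "ract E e h = \<tau> (proj E e, gmul K (triv_comp U \<tau> e) h)" using triv_mul[OF U(2) U(1) t(1) h] t by simp
  then show ?thesis using triv_proj[OF U(2) U(1) mul_in[OF t(1) h]] by simp
qed

lemma fibre_transitive:
  assumes e: "e \<in> pts E" "e' \<in> pts E" "proj E e = proj E e'"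
  shows "\<exists>h\<in>pts K. e' = ract E e h"
proof -
  obtain U \<tau> where U: "proj E e \<in> U" "local_triv K X E U \<tau>" using triv_exists[OF proj_in[OF e(1)]] by blast
  note t = triv_comp[OF U(2) e(1) U(1)] and t' = triv_comp[OF U(2) e(2) U(1)[unfolded e(3)]]
  let ?h = "gmul K (ginv K (triv_comp U \<tau> e)) (triv_comp U \<tau> e')"
  have "?h \<in> pts K" using t t' by (simp add: mul_in inv_in)
  moreover have "ract E e ?h = e'"
    using triv_mul[OF U(2) U(1) t(1), of ?h] t t' e(3) by (simp add: mul_in inv_in mul_inv_cancel)
  ultimately show ?thesis by metis
qed

lemma ract_free:
  assumes e: "e \<in> pts E" and h: "h \<in> pts K" "k \<in> pts K" and eq: "ract E e h = ract E e k"
  shows "h = k"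
proof -
  obtain U \<tau> where U: "proj E e \<in> U" "local_triv K X E U \<tau>" using triv_exists[OF proj_in[OF e]] by blast
  note t = triv_comp[OF U(2) e U(1)]
  let ?g = "triv_comp U \<tau> e"
  have "gmul K ?g h = gmul K ?g k"
    using triv_mul[OF U(2) U(1) t(1) h(1)] triv_mul[OF U(2) U(1) t(1) h(2)] t eq
      triv_comp_triv[OF U(2) U(1) mul_in[OF t(1) h(1)]] triv_comp_triv[OF U(2) U(1) mul_in[OF t(1) h(2)]] by simp
  then show ?thesis using inv_mul_cancel[OF t(1)] h by metis
qed

lemma frame_props: "x \<in> pts X \<Longrightarrow> frame E x \<in> pts E \<and> proj E (frame E x) = x"
proof -
  assume x: "x \<in> pts X"
  obtain U \<tau> where U: "x \<in> U" "local_triv K X E U \<tau>" using triv_exists[OF x] by blast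
  have "\<exists>e. e \<in> pts E \<and> proj E e = x" using triv_in[OF U(2,1) one_in] triv_proj[OF U(2,1) one_in] by blast
  then show ?thesis unfolding frame_def by (rule someI_ex)
qed

text \<open>Near \<open>e\<close> the total space is the image of a local section through \<open>e\<close> under the group.\<close>

lemma tangent_decomposition:
  assumes e: "e \<in> pts E"
  shows "\<exists>S T. (\<forall>w. w = S (tmap E X (proj E) e w) + tmap K E (ract E e) (gone K) (T w)) \<and>
     (\<forall>u. tmap E X (proj E) e (S u) = u)"
proof -
  obtain U \<tau> where U: "proj E e \<in> U" "local_triv K X E U \<tau>" using triv_exists[OF proj_in[OF e]] by blast
  note t = triv_comp[OF U(2) e U(1)]
  define g where "g = triv_comp U \<tau> e"
  note g = t[folded g_def]
  define \<sigma> where "\<sigma> = (\<lambda>x. \<tau> (x, g))"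
  \<comment> \<open>Near \<open>e\<close>, the group element \<open>m e'\<close> carries the section
    point over \<open>proj E e'\<close> to \<open>e'\<close>, with \<open>m e\<close> the unit.
    Differentiating this product decomposition gives the two summands.\<close>
  define m where "m = (\<lambda>e'. gmul K (ginv K g) (triv_comp U \<tau> e'))"
  have \<sigma>e: "\<sigma> (proj E e) = e" using g by (simp add: \<sigma>_def)
  have me: "m e = gone K" using g by (simp add: m_def g_def[symmetric] inv_mul)
  have s\<sigma>: "smooth_at X E \<sigma> (proj E e)" unfolding \<sigma>_def by (rule smooth_triv_section[OF U(2,1) g(1)])
  have sm: "smooth_at E K m e" unfolding m_def
    by (rule smooth_mul_comp[OF cE smooth_at_const[OF cE] smooth_triv_comp[OF U(2) e U(1)]]) (use g t in \<open>auto simp: inv_in\<close>)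
  let ?W = "{e \<in> pts E. proj E e \<in> U}"
  have oW: "openin (mtop E) ?W" by (rule openin_smooth_preimage[OF cE cX triv_open[OF U(2)] smooth_proj]) (use proj_in in auto)
  have eq: "ract E (\<sigma> (proj E e')) (m e') = e'" if e': "e' \<in> ?W" for e'
  proof -
    note t' = triv_comp[OF U(2), of e']
    have "ract E (\<tau> (proj E e', g)) (m e') = \<tau> (proj E e', gmul K g (m e'))"
      using triv_mul[OF U(2) _ g(1), of "proj E e'" "m e'"] e' t' by (simp add: m_def mul_in inv_in g)
    also have "gmul K g (m e') = triv_comp U \<tau> e'" unfolding m_def using mul_inv_cancel g t' e' by simp
    finally show ?thesis using t' e' by (simp add: \<sigma>_def)
  qed
  have s\<sigma>p: "smooth_at E E (\<lambda>e'. \<sigma> (proj E e')) e" by (rule smooth_at_comp[OF cE cX smooth_proj s\<sigma> proj_in[OF e]])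
  have "tmap E E (\<lambda>e'. ract E (\<sigma> (proj E e')) (m e')) e w =
      tmap E E (\<lambda>e'. ract E e' (m e)) (\<sigma> (proj E e)) (tmap E E (\<lambda>e'. \<sigma> (proj E e')) e w) +
      tmap K E (ract E (\<sigma> (proj E e))) (m e) (tmap E K m e w)" for w
    by (rule tmap_two[where F = "\<lambda>e h. ract E e h", OF cE cE cK cE smooth_ract s\<sigma>p _ sm])
       (use e in \<open>auto simp: \<sigma>e me one_in ract_one\<close>)
  moreover have "tmap E E (\<lambda>e'. e') e = tmap E E (\<lambda>e'. ract E (\<sigma> (proj E e')) (m e')) e"
    by (rule tmap_cong[OF cE cE oW _ _ smooth_at_id[OF cE e] e e]) (use e U eq in auto)
  moreover have "tmap E E (\<lambda>e'. e') e = tmap E E (\<lambda>e'. ract E e' (gone K)) e"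
    by (rule tmap_cong[OF cE cE openin_pts[OF cE] e _ smooth_at_id[OF cE e] e e]) (simp add: ract_one)
  moreover have "tmap E E (\<lambda>e'. \<sigma> (proj E e')) e w = tmap X E \<sigma> (proj E e) (tmap E X (proj E) e w)" for w
    by (rule tmap_comp[OF cE cX cE smooth_proj s\<sigma> e proj_in[OF e]]) (simp add: \<sigma>e e)
  ultimately have 1: "w = tmap X E \<sigma> (proj E e) (tmap E X (proj E) e w) + tmap K E (ract E e) (gone K) (tmap E K m e w)" for w
    unfolding \<sigma>e me using tmap_id[OF cE e] by metis
  have "tmap X X (\<lambda>x. x) (proj E e) = tmap X X (\<lambda>x. proj E (\<sigma> x)) (proj E e)"
    by (rule tmap_cong[OF cX cX triv_open[OF U(2)] U(1) _ smooth_at_id[OF cX proj_in[OF e]]])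
       (use triv_proj[OF U(2) _ g(1)] proj_in[OF e] in \<open>auto simp: \<sigma>_def\<close>)
  moreover have "tmap X X (\<lambda>x. proj E (\<sigma> x)) (proj E e) u = tmap E X (proj E) e (tmap X E \<sigma> (proj E e) u)" for u
    using tmap_comp[OF cX cE cX s\<sigma> smooth_proj, of u] proj_in[OF e] by (simp add: \<sigma>e e)
  ultimately have 2: "tmap E X (proj E) e (tmap X E \<sigma> (proj E e) u) = u" for u
    using tmap_id[OF cX proj_in[OF e]] by metis
  show ?thesis using 1 2 by (intro exI[of _ "tmap X E \<sigma> (proj E e)"] exI[of _ "tmap E K m e"]) blast
qed

lemma proj_linear: "e \<in> pts E \<Longrightarrow> linear (tmap E X (proj E) e)"
  by (rule tmap_linear[OF cE cX smooth_proj _ proj_in])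

lemma vertical_linear: "e \<in> pts E \<Longrightarrow> linear (tmap K E (ract E e) (gone K))"
  by (rule tmap_linear[OF cK cE smooth_ract2]) (auto simp: one_in ract_one)

lemma proj_vertical: assumes e: "e \<in> pts E" shows "tmap E X (proj E) e (tmap K E (ract E e) (gone K) s) = 0"
proof -
  have "tmap K X (\<lambda>k. proj E (ract E e k)) (gone K) s = tmap E X (proj E) (ract E e (gone K)) (tmap K E (ract E e) (gone K) s)"
    by (rule tmap_comp[OF cK cE cX smooth_ract2[OF e one_in] smooth_proj one_in]) (use e in \<open>auto simp: ract_one proj_in\<close>)
  moreover have "tmap K X (\<lambda>k. proj E e) (gone K) = tmap K X (\<lambda>k. proj E (ract E e k)) (gone K)"
    by (rule tmap_cong[OF cK cX openin_pts[OF cK] one_in _ smooth_at_const[OF cK] one_in]) (use e in \<open>auto simp: proj_ract proj_in\<close>)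
  ultimately show ?thesis using tmap_const[of K X "proj E e"] e by (metis ract_one)
qed

end

lemma alt_form_2I:
  assumes "\<And>vs. length vs \<noteq> 2 \<Longrightarrow> \<alpha> vs = 0" "bilinear (\<lambda>u v. \<alpha> [u, v])" "\<And>u. \<alpha> [u, u] = 0"
  shows "alt_form 2 \<alpha>"
  unfolding alt_form_def
proof (intro conjI allI impI)
  fix vs :: "'a list" and i :: nat assume l: "length vs = 2 \<and> i < 2"
  then obtain u v where vs: "vs = [u, v]" by (auto simp: numeral_2_eq_2 length_Suc_conv)
  have "i = 0 \<or> i = 1" using l by auto
  then show "linear (\<lambda>w. \<alpha> (vs[i := w]))" using assms(2) unfolding vs bilinear_def by auto
next
  fix vs :: "'a list" and i j :: nat assume l: "length vs = 2 \<and> i < j \<and> j < 2 \<and> vs ! i = vs ! j"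
  then obtain u v where vs: "vs = [u, v]" by (auto simp: numeral_2_eq_2 length_Suc_conv)
  have ij: "i = 0" "j = 1" using l by auto
  show "\<alpha> vs = 0" using l assms(3)[of u] unfolding vs ij by simp
qed (use assms(1) in auto)

lemma ext_d_alternating:
  fixes M :: "('a, 'v::real_normed_vector, 'y) mfd_scheme" and \<eta> :: "'a \<Rightarrow> 'v list \<Rightarrow> 'u::real_normed_vector"
  assumes M: "charted M" and \<eta>: "\<And>q. q \<in> pts M \<Longrightarrow> alt_form 1 (\<eta> q)" "smooth_tensor M 1 \<eta>" and p: "p \<in> pts M"
  shows "bilinear (\<lambda>u v. ext_d M 1 \<eta> p [u, v])" "ext_d M 1 \<eta> p [u, u] = 0"
proof -
  let ?c = "chart_at M p"
  note c = chart_at_props[OF M p]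
  let ?y = "snd ?c p" and ?S = "snd ?c ` fst ?c"
  have y: "?y \<in> ?S" using c by simp
  have D: "((\<lambda>y. loc M ?c \<eta> y [v]) has_derivative frechet_derivative (\<lambda>y. loc M ?c \<eta> y [v]) (at ?y)) (at ?y)" for v
    by (rule smooth_on_has_derivative[OF _ y]) (use \<eta>(2) c in \<open>simp add: smooth_tensor_def\<close>)
  let ?D = "\<lambda>v. frechet_derivative (\<lambda>y. loc M ?c \<eta> y [v]) (at ?y)"
  note lin = loc_one_form_linear[OF M \<eta>(1) c(1)]
  have a: "?D (v + w) = (\<lambda>u. ?D v u + ?D w u)" for v w
  proof (rule frechet_derivative_eqI)
    show "((\<lambda>y. loc M ?c \<eta> y [v + w]) has_derivative (\<lambda>u. ?D v u + ?D w u)) (at ?y)"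
      by (rule has_derivative_transform_within_open[OF has_derivative_add[OF D D] chart_image_open[OF M c(1)] y])
         (simp add: linear_add[OF lin])
  qed
  have s: "?D (r *\<^sub>R v) = (\<lambda>u. r *\<^sub>R ?D v u)" for r v
  proof (rule frechet_derivative_eqI)
    show "((\<lambda>y. loc M ?c \<eta> y [r *\<^sub>R v]) has_derivative (\<lambda>u. r *\<^sub>R ?D v u)) (at ?y)"
      by (rule has_derivative_transform_within_open[OF has_derivative_scaleR_right[OF D] chart_image_open[OF M c(1)] y])
         (simp add: linear_scale[OF lin])
  qed
  note l = has_derivative_linear[OF D]
  show "bilinear (\<lambda>u v. ext_d M 1 \<eta> p [u, v])"
    unfolding ext_d_one_form bilinear_def
    by (auto intro!: linearI simp: a s linear_add[OF l] linear_scale[OF l] scaleR_diff_right)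
  show "ext_d M 1 \<eta> p [u, u] = 0" unfolding ext_d_one_form by simp
qed

section \<open>The adjoint action on a central element of a connected group\<close>

context lie_grp
begin

text \<open>Conjugation is smooth in both variables jointly, and \<open>Ad\<close> is its partial
  derivative in the second variable at the unit; in product charts that is a derivative of the
  smooth map \<open>G\<close> in a fixed direction.\<close>

lemma smooth_Ad:
  assumes h: "h \<in> pts K" shows "smooth_at K vec_mfd (\<lambda>h. Ad K h s) h"
  unfolding smooth_at_vec_iff
proof (intro ballI impI)
  fix d assume d: "d \<in> atlas K" "h \<in> fst d"
  define c where "c = chart_at K (gone K)"
  have c: "c \<in> atlas K" "gone K \<in> fst c" using chart_at_props[OF cK one_in] by (auto simp: c_def)
  obtain L :: "'l set" where L: "is_basis L" using charted_basis[OF cK] .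
  obtain LL :: "('l \<times> 'l) set" where LL: "is_basis LL" using is_basis_Times[OF L L] by blast
  note cKK = charted_mprod[OF cK cK]
  have hh: "(h, gone K) \<in> pts (mprod K K)" using h one_in by (simp add: pts_mprod)
  have sf: "smooth_at (mprod K K) K fst (h, gone K)" and ss: "smooth_at (mprod K K) K snd (h, gone K)"
    by (rule smooth_at_fst[OF cK cK h one_in], rule smooth_at_snd[OF cK cK h one_in])
  have "smooth_at (mprod K K) K (\<lambda>z. conj (fst z) (snd z)) (h, gone K)"
    by (intro smooth_mul_comp cKK sf ss smooth_at_comp[OF cKK cK sf smooth_inv])
       (use h in \<open>auto simp: one_in mul_in inv_in\<close>)
  moreover have dc: "pch d c \<in> atlas (mprod K K)" unfolding atlas_mprod using d c by blast
  moreover have "(h, gone K) \<in> fst (pch d c)" "conj (fst (h, gone K)) (snd (h, gone K)) \<in> fst c"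
    using d c h by (auto simp: conj_one)
  ultimately obtain V where V: "open V" "snd (pch d c) (h, gone K) \<in> V" "V \<subseteq> snd (pch d c) ` fst (pch d c)"
     "smooth_on V (\<lambda>y. snd c (conj (fst (cinv (pch d c) y)) (snd (cinv (pch d c) y))))"
    using smooth_atD[of "mprod K K" K "\<lambda>z. conj (fst z) (snd z)" "(h, gone K)" "pch d c" c] c(1) by blast
  let ?z = "snd c (gone K)"
  define G where "G = (\<lambda>y. snd c (conj (fst (cinv (pch d c) y)) (snd (cinv (pch d c) y))))"
  define V' where "V' = (\<lambda>y. (y, ?z)) -` V"
  have oV': "open V'" unfolding V'_def by (rule open_vimage[OF V(1)]) (intro continuous_intros)
  have hV': "snd d h \<in> V'" using V(2) by (simp add: V'_def)
  have V'd: "y \<in> snd d ` fst d" if "y \<in> V'" for y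
  proof -
    have "(y, ?z) \<in> snd (pch d c) ` (fst d \<times> fst c)" using that V(3) by (auto simp: V'_def)
    then show ?thesis unfolding pch_image by simp
  qed
  have sm: "smooth_on V' (\<lambda>y. frechet_derivative G (at (y, ?z)) (0, s))"
    by (rule smooth_on_comp[OF LL oV' V(1) smooth_on_derivative[of V G]])
       (use V(4) oV' in \<open>auto simp: G_def V'_def intro!: smooth_on_Pair smooth_on_id\<close>)
  have "Ad K (cinv d y) s = frechet_derivative G (at (y, ?z)) (0, s)" if y: "y \<in> V'" for y
  proof -
    let ?g = "cinv d y"
    have g: "?g \<in> pts K" using cinv_in[OF V'd[OF y]] chart_sub[OF cK d(1)] by auto
    have DG: "(G has_derivative frechet_derivative G (at (y, ?z))) (at (y, ?z))"
      by (rule smooth_on_has_derivative[of V]) (use V(4) y in \<open>auto simp: G_def V'_def\<close>)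
    have D1: "((\<lambda>z. G (y, z)) has_derivative (\<lambda>s. frechet_derivative G (at (y, ?z)) (0, s))) (at ?z)"
      by (rule has_derivative_compose[where f = "\<lambda>z. (y, z)" and g = G, OF _ DG]) (auto intro!: derivative_eq_intros)
    have "((\<lambda>z. snd c (conj ?g (cinv c z))) has_derivative (\<lambda>s. frechet_derivative G (at (y, ?z)) (0, s))) (at ?z)"
    proof (rule has_derivative_transform_within_open[OF D1 chart_image_open[OF cK c(1)]])
      show "G (y, z) = snd c (conj ?g (cinv c z))" if "z \<in> snd c ` fst c" for z
        unfolding G_def cinv_pch[OF chart_inj[OF cK d(1)] chart_inj[OF cK c(1)] V'd[OF y] that] by simp
    qed (use c in simp)
    from frechet_derivative_eqI[OF this]
    show ?thesis unfolding Ad_def tmap_def comp_def conj_one[OF g] c_def[symmetric] by simp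
  qed
  then have "smooth_on V' (\<lambda>y. Ad K (cinv d y) s)" by (intro smooth_on_cong[OF oV' _ sm]) simp
  then show "\<exists>V. open V \<and> snd d h \<in> V \<and> V \<subseteq> snd d ` fst d \<and> smooth_on V (\<lambda>y. Ad K (cinv d y) s)"
    using oV' hV' V'd by blast
qed

text \<open>Vanishing brackets say that the derivative at the unit is zero. Multiplicativity of
  \<open>Ad\<close> transports this to \<open>g\<close>: the orbit map is the fixed linear map
  \<open>Ad K g\<close> after left translation by the inverse of \<open>g\<close>.\<close>

lemma Ad_derivative_zero:
  assumes c: "central K c" and g: "g \<in> pts K" shows "tmap K vec_mfd (\<lambda>h. Ad K h c) g u = 0"
proof -
  obtain L :: "'l set" where L: "is_basis L" using charted_basis[OF cK] .
  note cv = charted_vec[OF L]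
  let ?f = "\<lambda>h. Ad K h c" and ?l = "\<lambda>h. gmul K (ginv K g) h"
  have gl: "?l g = gone K" using g by (simp add: inv_mul)
  have sl: "smooth_at K K ?l g" by (intro smooth_mul_comp cK smooth_at_const smooth_at_id) (use g in \<open>auto simp: inv_in\<close>)
  have sfl: "smooth_at K vec_mfd (\<lambda>h. ?f (?l h)) g"
    by (rule smooth_at_comp[where g = ?f, OF cK cK sl]) (auto simp: gl one_in smooth_Ad)
  have sA: "smooth_at vec_mfd vec_mfd (Ad K g) x" for x
    by (rule smooth_at_vecI[of UNIV]) (auto intro: smooth_on_linear linear_imp_bounded_linear[OF L Ad_linear[OF g]])
  have 0: "tmap K vec_mfd ?f (gone K) v = 0" for v using c by (simp add: central_def bracket_def)
  have 1: "tmap K vec_mfd (\<lambda>h. ?f (?l h)) g u = 0"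
    using tmap_comp[where g = ?f and f = ?l, OF cK cK cv sl _ g] smooth_Ad[OF one_in] one_in 0 by (simp add: gl)
  have 2: "tmap K vec_mfd (\<lambda>h. Ad K g (?f (?l h))) g u = 0"
    using tmap_comp[where g = "Ad K g" and f = "\<lambda>h. ?f (?l h)", OF cK cv cv sfl sA g, of u] 1
      linear_0[OF tmap_linear[OF cv cv sA]] by simp
  have "tmap K vec_mfd ?f g = tmap K vec_mfd (\<lambda>h. Ad K g (?f (?l h))) g"
  proof (rule tmap_cong[OF cK cv openin_pts[OF cK] g _ smooth_Ad[OF g] g])
    show "Ad K h c = Ad K g (Ad K (gmul K (ginv K g) h) c)" if "h \<in> pts K" for h
      using Ad_mul[OF g, of "gmul K (ginv K g) h" c] that g by (simp add: mul_in inv_in mul_inv_cancel)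
  qed simp
  then show ?thesis using 2 by simp
qed

lemma Ad_locally_constant:
  assumes c: "central K c" and g: "g \<in> pts K"
  shows "\<exists>d V. d \<in> atlas K \<and> g \<in> fst d \<and> open V \<and> snd d g \<in> V \<and> V \<subseteq> snd d ` fst d \<and> (\<forall>y\<in>V. Ad K (cinv d y) c = Ad K g c)"
proof -
  obtain L :: "'l set" where L: "is_basis L" using charted_basis[OF cK] .
  note cv = charted_vec[OF L]
  define d where "d = chart_at K g"
  have d: "d \<in> atlas K" "g \<in> fst d" using chart_at_props[OF cK g] by (auto simp: d_def)
  obtain r where r: "r > 0" "ball (snd d g) r \<subseteq> snd d ` fst d"
    using chart_image_open[OF cK d(1)] d(2) openE by (metis imageI)
  let ?f = "\<lambda>y. Ad K (cinv d y) c"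
  have D: "(?f has_derivative (\<lambda>h. 0)) (at y)" if y: "y \<in> snd d ` fst d" for y
  proof -
    have q: "cinv d y \<in> fst d" "cinv d y \<in> pts K" "snd d (cinv d y) = y"
      using cinv_in[OF y] snd_cinv[OF y] chart_sub[OF cK d(1)] by auto
    have s: "smooth_at vec_mfd vec_mfd ?f y"
      by (rule smooth_at_comp[where g = "\<lambda>h. Ad K h c", OF cv cK smooth_at_cinv[OF cK d(1) y] smooth_Ad[OF q(2)] q(2)])
    have "frechet_derivative ?f (at y) u = 0" for u
      using tmap_from_chart[OF cK cv smooth_Ad[OF q(2)] d(1) q(1), of c u] Ad_derivative_zero[OF c q(2)] q(3)
      by (simp add: tmap_vec)
    moreover obtain V where "open V" "y \<in> V" "smooth_on V ?f" using s unfolding smooth_at_vec_iff by auto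
    then have "(?f has_derivative frechet_derivative ?f (at y)) (at y)" using smooth_on_has_derivative by blast
    ultimately show ?thesis by (metis (no_types, lifting) ext)
  qed
  have "\<exists>k. \<forall>y\<in>ball (snd d g) r. ?f y = k"
    by (rule has_derivative_zero_constant[OF convex_ball]) (use D r in \<open>blast intro: has_derivative_at_withinI\<close>)
  then obtain k where k: "\<And>y. y \<in> ball (snd d g) r \<Longrightarrow> ?f y = k" by blast
  have "?f (snd d g) = k" by (rule k) (use r in simp)
  then have "k = Ad K g c" using chart_inj[OF cK d(1)] d(2) by simp
  then show ?thesis using d r k by (intro exI[of _ d] exI[of _ "ball (snd d g) r"]) auto
qed

text \<open>By local constancy, every condition on \<open>Ad K h c\<close> defines an open set of
  \<open>h\<close>. Applied to the singleton of \<open>c\<close> and to its complement, this makes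
  the stabiliser open and closed, and it contains the unit.\<close>

lemma Ad_central:
  assumes c: "central K c" and con: "connected_space (mtop K)" and h: "h \<in> pts K" shows "Ad K h c = c"
proof -
  have o: "openin (mtop K) {h \<in> pts K. Ad K h c \<in> S}" for S
  proof (rule openin_mtopI[OF cK])
    fix g assume g: "g \<in> {h \<in> pts K. Ad K h c \<in> S}"
    then obtain d V where d: "d \<in> atlas K" "g \<in> fst d" "open V" "snd d g \<in> V" "V \<subseteq> snd d ` fst d" "\<And>y. y \<in> V \<Longrightarrow> Ad K (cinv d y) c = Ad K g c"
      using Ad_locally_constant[OF c, of g] by blast
    have "cinv d ` V \<subseteq> {h \<in> pts K. Ad K h c \<in> S}"
      using g d(5,6) cinv_in[of _ d] chart_sub[OF cK d(1)] by fastforce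
    then show "\<exists>d V. d \<in> atlas K \<and> g \<in> fst d \<and> open V \<and> snd d g \<in> V \<and> V \<subseteq> snd d ` fst d \<and> cinv d ` V \<subseteq> {h \<in> pts K. Ad K h c \<in> S}"
      using d(1-5) by (intro exI[of _ d] exI[of _ V]) simp
  qed
  have t: "topspace (mtop K) = pts K" by (rule topspace_mtop[OF cK])
  let ?S = "{h \<in> pts K. Ad K h c \<in> {c}}"
  have "pts K - ?S = {h \<in> pts K. Ad K h c \<in> - {c}}" by auto
  then have "closedin (mtop K) ?S" using o[of "- {c}"] by (auto simp: closedin_def t)
  then have "?S = {} \<or> ?S = pts K" using con o[of "{c}"] unfolding connected_space_clopen_in t by blast
  moreover have "gone K \<in> ?S" by (simp add: one_in Ad_one)
  ultimately show ?thesis using h by blast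
qed

end

section \<open>Connections and curvature\<close>

locale conn = principal K X E for K :: "('k, 'l::real_normed_vector) lie"
    and X :: "('x, 'v::real_normed_vector) kaehler" and E :: "('k, 'x, 'e, 'b::real_normed_vector) pbundle" +
  fixes A :: "'e \<Rightarrow> 'b list \<Rightarrow> 'l"
  assumes con: "connection K E A"
begin

abbreviation P where "P e \<equiv> tmap E X (proj E) e"
abbreviation V where "V e \<equiv> tmap K E (ract E e) (gone K)"
abbreviation R where "R h e \<equiv> tmap E E (\<lambda>e. ract E e h) e"

lemma A_alt: "e \<in> pts E \<Longrightarrow> alt_form 1 (A e)" and A_smooth: "smooth_tensor E 1 A"
  and A_vert: "e \<in> pts E \<Longrightarrow> A e [V e s] = s"
  and A_equiv: "e \<in> pts E \<Longrightarrow> h \<in> pts K \<Longrightarrow> A (ract E e h) [R h e w] = Ad K (ginv K h) (A e [w])"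
  using con unfolding connection_def diff_form_def by auto

lemma A_linear: "e \<in> pts E \<Longrightarrow> linear (\<lambda>w. A e [w])" by (rule alt_form_1_linear[OF A_alt])

text \<open>By the tangent decomposition a vector killed by the projection is vertical, and the
  connection form recovers a vertical vector.\<close>

lemma horizontal_unique:
  assumes e: "e \<in> pts E" and w: "A e [w] = A e [w']" "P e w = P e w'" shows "w = w'"
proof -
  obtain S T where ST: "\<And>w. w = S (P e w) + V e (T w)" using tangent_decomposition[OF e] by blast
  have 1: "P e (w - w') = 0" using w(2) by (simp add: linear_diff[OF proj_linear[OF e]])
  have 2: "A e [w - w'] = 0" using linear_diff[OF A_linear[OF e], of w w'] w(1) by simp
  \<comment> \<open>The decomposition does not provide linearity of \<open>S\<close> and
    \<open>T\<close>; its instance at 0 is used to express \<open>S 0\<close> as a vertical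
    vector.\<close>
  have z: "0 = S 0 + V e (T 0)" using ST[of 0] by (simp add: linear_0[OF proj_linear[OF e]])
  have "w - w' = S 0 + V e (T (w - w'))" using ST[of "w - w'"] 1 by simp
  also have "\<dots> = V e (T (w - w') - T 0)" using z by (simp add: linear_diff[OF vertical_linear[OF e]] eq_neg_iff_add_eq_0)
  finally have k: "w - w' = V e (T (w - w') - T 0)" .
  have "T (w - w') - T 0 = 0" using A_vert[OF e, of "T (w - w') - T 0"] 2 unfolding k[symmetric] by simp
  then have "w - w' = 0" using k linear_0[OF vertical_linear[OF e]] by simp
  then show ?thesis by simp
qed

text \<open>Any lift becomes horizontal after subtracting the vertical vector on which the
  connection form takes the same value.\<close>

lemma hlift_props: assumes e: "e \<in> pts E"
  shows "A e [hlift X E A e u] = 0" "P e (hlift X E A e u) = u"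
proof -
  obtain S T where S: "\<And>u. P e (S u) = u" using tangent_decomposition[OF e] by blast
  let ?w = "S u - V e (A e [S u])"
  have w: "A e [?w] = 0 \<and> P e ?w = u"
    using linear_diff[OF A_linear[OF e], of "S u" "V e (A e [S u])"]
    by (simp add: A_vert[OF e] linear_diff[OF proj_linear[OF e]] S proj_vertical[OF e])
  have "A e [hlift X E A e u] = 0 \<and> P e (hlift X E A e u) = u"
    unfolding hlift_def by (rule theI[of _ ?w]) (use w horizontal_unique[OF e] in metis)+
  then show "A e [hlift X E A e u] = 0" "P e (hlift X E A e u) = u" by auto
qed

lemma hlift_eqI: "e \<in> pts E \<Longrightarrow> A e [w] = 0 \<Longrightarrow> P e w = u \<Longrightarrow> hlift X E A e u = w"
  using horizontal_unique[of e] hlift_props[of e u] by simp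

lemma hlift_linear: assumes e: "e \<in> pts E" shows "linear (hlift X E A e)"
proof (rule linearI)
  note A = A_linear[OF e] and p = proj_linear[OF e] and h = hlift_props[OF e]
  show "hlift X E A e (u + v) = hlift X E A e u + hlift X E A e v" for u v
    by (rule hlift_eqI[OF e]) (use linear_add[OF A] linear_add[OF p] h in auto)
  show "hlift X E A e (r *\<^sub>R u) = r *\<^sub>R hlift X E A e u" for r u
    by (rule hlift_eqI[OF e]) (use linear_scale[OF A] linear_scale[OF p] h in auto)
qed

lemma hlift_of_proj: assumes e: "e \<in> pts E" shows "hlift X E A e (P e w) = w - V e (A e [w])"
  by (rule hlift_eqI[OF e])
     (use linear_diff[OF A_linear[OF e], of w "V e (A e [w])"] in
       \<open>simp_all add: A_vert[OF e] linear_diff[OF proj_linear[OF e]] proj_vertical[OF e]\<close>)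

lemma R_proj: assumes e: "e \<in> pts E" and h: "h \<in> pts K" shows "P (ract E e h) (R h e w) = P e w"
proof -
  have "tmap E X (proj E) e = tmap E X (\<lambda>e. proj E (ract E e h)) e"
    by (rule tmap_cong[OF cE cX openin_pts[OF cE] e _ smooth_proj e proj_in[OF e]]) (simp add: proj_ract h)
  moreover have "tmap E X (\<lambda>e. proj E (ract E e h)) e w = P (ract E e h) (R h e w)"
    by (rule tmap_comp[where f = "\<lambda>e. ract E e h" and g = "proj E", OF cE cE cX smooth_ract1[OF e h] smooth_proj e ract_in[OF e h] proj_in[OF ract_in[OF e h]]])
  ultimately show ?thesis by simp
qed

lemma hlift_ract: assumes e: "e \<in> pts E" and h: "h \<in> pts K"
  shows "hlift X E A (ract E e h) u = R h e (hlift X E A e u)"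
  by (rule hlift_eqI[OF ract_in[OF e h]])
     (use A_equiv[OF e h] R_proj[OF e h] hlift_props[OF e] linear_0[OF Ad_linear[OF inv_in[OF h]]] in auto)

text \<open>Right translation pulls the connection form back to its image under a fixed linear map.
  Naturality of \<open>ext_d\<close> treats the pullback, linearity treats the image, and horizontal
  lifts are carried to horizontal lifts.\<close>

lemma curv_ract: assumes e: "e \<in> pts E" and h: "h \<in> pts K"
  shows "curv X E A (ract E e h) [u, v] = Ad K (ginv K h) (curv X E A e [u, v])"
proof -
  obtain L :: "'l set" where L: "is_basis L" using charted_basis[OF cK] .
  let ?a = "Ad K (ginv K h)"
  have bl: "bounded_linear ?a" by (rule linear_imp_bounded_linear[OF L Ad_linear[OF inv_in[OF h]]])
  let ?c = "chart_at E e"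
  note c = chart_at_props[OF cE e]
  have D: "frechet_derivative (\<lambda>y. loc E ?c (\<lambda>q vs. ?a (A q vs)) y [w]) (at (snd ?c e)) z =
      ?a (frechet_derivative (\<lambda>y. loc E ?c A y [w]) (at (snd ?c e)) z)" for w z
  proof -
    have "((\<lambda>y. loc E ?c A y [w]) has_derivative frechet_derivative (\<lambda>y. loc E ?c A y [w]) (at (snd ?c e))) (at (snd ?c e))"
      by (rule smooth_on_has_derivative[of "snd ?c ` fst ?c"]) (use A_smooth c in \<open>auto simp: smooth_tensor_def\<close>)
    from frechet_derivative_eqI[OF bounded_linear.has_derivative[OF bl this]] show ?thesis by (simp add: loc_def)
  qed
  have 1: "ext_d E 1 (\<lambda>q vs. ?a (A q vs)) e [w, z] = ?a (ext_d E 1 A e [w, z])" for w z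
    unfolding ext_d_one_form D by (simp add: linear_diff[OF Ad_linear[OF inv_in[OF h]]])
  have 2: "ext_d E 1 (\<lambda>q vs. ?a (A q vs)) e [w, z] = ext_d E 1 A (ract E e h) [R h e w, R h e z]" for w z
    by (rule ext_d_natural[where f = "\<lambda>e. ract E e h", OF cE cE openin_pts[OF cE] e _ _ A_alt A_smooth])
       (use h in \<open>auto simp: A_equiv intro: smooth_ract1 ract_in\<close>)
  show ?thesis unfolding curv_def list.map hlift_ract[OF e h] 2[symmetric] 1 ..
qed

lemma curv_alt: assumes e: "e \<in> pts E" shows "alt_form 2 (curv X E A e)"
proof (rule alt_form_2I)
  note b = ext_d_alternating[OF cE A_alt A_smooth e] and l = hlift_linear[OF e]
  show "curv X E A e vs = 0" if "length vs \<noteq> 2" for vs using that by (simp add: curv_def ext_d_length)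
  show "bilinear (\<lambda>u v. curv X E A e [u, v])"
    using b(1) unfolding bilinear_def curv_def
    by (auto intro: linear_compose[OF l, unfolded comp_def])
  show "curv X E A e [u, u] = 0" for u using b(2) by (simp add: curv_def)
qed

end

section \<open>The associated bundle\<close>

lemma open_smooth_localI:
  assumes "\<And>z. z \<in> S \<Longrightarrow> \<exists>V. open V \<and> z \<in> V \<and> V \<subseteq> S \<and> smooth_on V h"
  shows "open S \<and> smooth_on S h"
proof
  show "open S" by (subst open_subopen) (use assms in blast)
  show "smooth_on S h" by (rule smooth_on_local) (use assms in blast)
qed

locale assoc_bundle = principal K X E for K :: "('k, 'l::real_normed_vector) lie"
    and X :: "('x, 'v::real_normed_vector) kaehler" and E :: "('k, 'x, 'e, 'b::real_normed_vector) pbundle" +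
  fixes F :: "('k, 'l, 'f, 'w::real_normed_vector) hspace"
  assumes Fm: "is_manifold F" and Fact: "smooth_left_action K F"
begin

abbreviation AB where "AB \<equiv> assoc K F X E"
abbreviation orbit where "orbit \<equiv> orb K F E"

lemma cF: "charted F" by (rule is_manifold_charted[OF Fm])

lemma act_in: "h \<in> pts K \<Longrightarrow> f \<in> pts F \<Longrightarrow> act F h f \<in> pts F"
  using Fact unfolding smooth_left_action_def smooth_map_def by (fastforce simp: pts_mprod)

lemma act_one: "f \<in> pts F \<Longrightarrow> act F (gone K) f = f"
  and act_mul: "g \<in> pts K \<Longrightarrow> h \<in> pts K \<Longrightarrow> f \<in> pts F \<Longrightarrow> act F (gmul K g h) f = act F g (act F h f)"
  using Fact unfolding smooth_left_action_def by auto

lemma act_inv: "h \<in> pts K \<Longrightarrow> f \<in> pts F \<Longrightarrow> act F (ginv K h) (act F h f) = f"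
  "h \<in> pts K \<Longrightarrow> f \<in> pts F \<Longrightarrow> act F h (act F (ginv K h) f) = f"
  using act_mul[of "ginv K h" h f] act_mul[of h "ginv K h" f] by (simp_all add: inv_in inv_mul mul_inv act_one)

lemma smooth_act: "smooth_at (mprod K F) F (\<lambda>(h, f). act F h f) (h, f)"
  using Fact unfolding smooth_left_action_def by (auto intro!: smooth_map_smooth_at intro: chart_inj[OF charted_mprod[OF cK cF]])

lemma smooth_act2: "h \<in> pts K \<Longrightarrow> f \<in> pts F \<Longrightarrow> smooth_at F F (act F h) f"
  using smooth_at_two[where F = "\<lambda>h f. act F h f" and f = "\<lambda>_. h" and g = "\<lambda>f. f", OF cF cK cF smooth_act smooth_at_const[OF cF] _ smooth_at_id[OF cF]] by simp

lemma smooth_act1: "h \<in> pts K \<Longrightarrow> f \<in> pts F \<Longrightarrow> smooth_at K F (\<lambda>h. act F h f) h"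
  using smooth_at_two[where F = "\<lambda>h f. act F h f" and f = "\<lambda>h. h" and g = "\<lambda>_. f", OF cK cK cF smooth_act smooth_at_id[OF cK] _ smooth_at_const[OF cK]] by simp

abbreviation TA where "TA h f \<equiv> tmap F F (act F h) f"

lemma TA_inv:
  assumes h: "h \<in> pts K" and f: "f \<in> pts F"
  shows "TA h (act F (ginv K h) f) (TA (ginv K h) f a) = a"
proof -
  have "tmap F F (\<lambda>f. f) f = tmap F F (\<lambda>f. act F h (act F (ginv K h) f)) f"
    by (rule tmap_cong[OF cF cF openin_pts[OF cF] f _ smooth_at_id[OF cF f] f f]) (simp add: act_inv h)
  moreover have "tmap F F (\<lambda>f. act F h (act F (ginv K h) f)) f a = TA h (act F (ginv K h) f) (TA (ginv K h) f a)"
    by (rule tmap_comp[where f = "act F (ginv K h)" and g = "act F h", OF cF cF cF])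
       (use h f in \<open>auto simp: inv_in act_in act_inv intro: smooth_act2\<close>)
  ultimately show ?thesis using tmap_id[OF cF f] by metis
qed

lemma TA_inj: "h \<in> pts K \<Longrightarrow> f \<in> pts F \<Longrightarrow> TA h f a = TA h f b \<Longrightarrow> a = b"
  using TA_inv[of "ginv K h" f] by (metis inv_in inv_inv)

lemma orbit_self: "e \<in> pts E \<Longrightarrow> f \<in> pts F \<Longrightarrow> (e, f) \<in> orbit e f"
  unfolding orb_def using one_in inv_mul[OF one_in] mul_one[OF inv_in[OF one_in]]
  by (auto intro!: exI[of _ "gone K"] simp: ract_one act_one)

lemma orbit_mem: "z \<in> orbit e f \<longleftrightarrow> (\<exists>h\<in>pts K. z = (ract E e h, act F (ginv K h) f))"
  unfolding orb_def by auto

lemma orbit_ract: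
  assumes e: "e \<in> pts E" and h: "h \<in> pts K" and f: "f \<in> pts F"
  shows "orbit (ract E e h) f = orbit e (act F h f)"
proof (intro equalityI subsetI)
  fix z assume "z \<in> orbit (ract E e h) f"
  then obtain k where k: "k \<in> pts K" "z = (ract E (ract E e h) k, act F (ginv K k) f)" unfolding orbit_mem by blast
  have "act F (ginv K (gmul K h k)) (act F h f) = act F (ginv K k) f"
    using k h f by (simp add: inv_mul_group act_mul inv_in act_in act_inv)
  then have "z = (ract E e (gmul K h k), act F (ginv K (gmul K h k)) (act F h f))" using k e h by (simp add: ract_mul)
  then show "z \<in> orbit e (act F h f)" unfolding orbit_mem using mul_in[OF h k(1)] by blast
next
  fix z assume "z \<in> orbit e (act F h f)"
  then obtain k where k: "k \<in> pts K" "z = (ract E e k, act F (ginv K k) (act F h f))" unfolding orbit_mem by blast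
  let ?k = "gmul K (ginv K h) k"
  have kk: "?k \<in> pts K" using k h by (simp add: mul_in inv_in)
  have "act F (ginv K ?k) f = act F (ginv K k) (act F h f)"
    using k h f by (simp add: inv_mul_group inv_in inv_inv act_mul)
  moreover have "ract E (ract E e h) ?k = ract E e k"
    using k h e kk by (simp add: ract_mul[symmetric] mul_inv_cancel)
  ultimately have "z = (ract E (ract E e h) ?k, act F (ginv K ?k) f)" using k by simp
  then show "z \<in> orbit (ract E e h) f" unfolding orbit_mem using kk by blast
qed

lemma aproj_orbit: assumes "e \<in> pts E" shows "aproj E (orbit e f) = proj E e"
proof -
  have "(\<lambda>(e, f). proj E e) ` orbit e f = {proj E e}"
  proof (intro equalityI subsetI)
    fix x assume "x \<in> (\<lambda>(e, f). proj E e) ` orbit e f"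
    then obtain z where "z \<in> orbit e f" "x = proj E (fst z)" by (auto simp: case_prod_beta)
    then show "x \<in> {proj E e}" using assms unfolding orbit_mem by (auto simp: proj_ract)
  next
    fix x assume "x \<in> {proj E e}"
    then show "x \<in> (\<lambda>(e, f). proj E e) ` orbit e f"
    proof (intro image_eqI)
      show "(ract E e (gone K), act F (ginv K (gone K)) f) \<in> orbit e f" unfolding orbit_mem using one_in by blast
    qed (use assms in \<open>simp add: ract_one\<close>)
  qed
  then show ?thesis by (simp add: aproj_def)
qed

lemma fcomp_orbit: assumes e: "e \<in> pts E" and f: "f \<in> pts F" and h: "h \<in> pts K"
  shows "fcomp (orbit e f) (ract E e h) = act F (ginv K h) f"
  unfolding fcomp_def
proof (rule the_equality)
  show "(ract E e h, act F (ginv K h) f) \<in> orbit e f" unfolding orbit_mem using h by blast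
  fix f' assume "(ract E e h, f') \<in> orbit e f"
  then obtain k where "k \<in> pts K" "ract E e h = ract E e k" "f' = act F (ginv K k) f" unfolding orbit_mem by blast
  then show "f' = act F (ginv K h) f" using ract_free[OF e h, of k] by simp
qed

lemma fcomp_orbit_self: "e \<in> pts E \<Longrightarrow> f \<in> pts F \<Longrightarrow> fcomp (orbit e f) e = f"
  using fcomp_orbit[of e f "gone K"] one_in inv_mul[OF one_in] mul_one[OF inv_in[OF one_in]]
  by (simp add: ract_one act_one)

lemma orbit_in: "e \<in> pts E \<Longrightarrow> f \<in> pts F \<Longrightarrow> orbit e f \<in> pts AB"
  unfolding assoc_def by auto

lemma AB_cases: assumes "y \<in> pts AB" obtains e f where "e \<in> pts E" "f \<in> pts F" "y = orbit e f"
  using assms unfolding assoc_def by auto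

definition achart where
  "achart U \<tau> c d = ({orbit (\<tau> (x, gone K)) f | x f. x \<in> U \<inter> fst c \<and> f \<in> fst d},
               \<lambda>y. (snd c (aproj E y), snd d (fcomp y (\<tau> (aproj E y, gone K)))))"

lemma atlas_AB: "a \<in> atlas AB \<longleftrightarrow> (\<exists>U \<tau> c d. local_triv K X E U \<tau> \<and> c \<in> atlas X \<and> d \<in> atlas F \<and> a = achart U \<tau> c d)"
  unfolding assoc_def achart_def mfd.select_convs mem_Collect_eq by blast

context
  fixes U \<tau> assumes triv: "local_triv K X E U \<tau>"
begin

lemma section_in: "x \<in> U \<Longrightarrow> \<tau> (x, gone K) \<in> pts E" by (rule triv_in[OF triv _ one_in])
lemma section_proj: "x \<in> U \<Longrightarrow> proj E (\<tau> (x, gone K)) = x" by (rule triv_proj[OF triv _ one_in])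

lemma section_ract: "e \<in> pts E \<Longrightarrow> proj E e \<in> U \<Longrightarrow> ract E (\<tau> (proj E e, gone K)) (triv_comp U \<tau> e) = e"
  using triv_mul[OF triv _ one_in, of "proj E e" "triv_comp U \<tau> e"] triv_comp[OF triv, of e] by (simp add: one_mul)

lemma orbit_section:
  "e \<in> pts E \<Longrightarrow> f \<in> pts F \<Longrightarrow> proj E e \<in> U \<Longrightarrow> orbit e f = orbit (\<tau> (proj E e, gone K)) (act F (triv_comp U \<tau> e) f)"
  using orbit_ract[OF section_in, of "proj E e" "triv_comp U \<tau> e" f] section_ract[of e] triv_comp(1)[OF triv, of e] by simp

lemma achart_apply: "x \<in> U \<Longrightarrow> f \<in> pts F \<Longrightarrow> snd (achart U \<tau> c d) (orbit (\<tau> (x, gone K)) f) = (snd c x, snd d f)"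
  using section_in[of x] section_proj[of x] by (simp add: achart_def aproj_orbit fcomp_orbit_self)

lemma achart_dom: "x \<in> U \<Longrightarrow> x \<in> fst c \<Longrightarrow> f \<in> fst d \<Longrightarrow> orbit (\<tau> (x, gone K)) f \<in> fst (achart U \<tau> c d)"
  by (auto simp: achart_def)

lemma achart_domE:
  assumes "y \<in> fst (achart U \<tau> c d)"
  obtains x f where "x \<in> U" "x \<in> fst c" "f \<in> fst d" "y = orbit (\<tau> (x, gone K)) f"
  using assms by (auto simp: achart_def)

lemma orbit_section_inj:
  assumes "x \<in> U" "x' \<in> U" "f \<in> pts F" "f' \<in> pts F" "orbit (\<tau> (x, gone K)) f = orbit (\<tau> (x', gone K)) f'"
  shows "x = x' \<and> f = f'"
proof -
  have x: "x' = x" using arg_cong[OF assms(5), of "aproj E"]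
    unfolding aproj_orbit[OF section_in[OF assms(1)]] aproj_orbit[OF section_in[OF assms(2)]] section_proj[OF assms(1)] section_proj[OF assms(2)] by (rule sym)
  have "f = f'" using arg_cong[OF assms(5)[unfolded x], of "\<lambda>y. Defs.fcomp y (\<tau> (x, gone K))"]
    unfolding fcomp_orbit_self[OF section_in[OF assms(1)] assms(3)] fcomp_orbit_self[OF section_in[OF assms(1)] assms(4)] .
  then show ?thesis using x by simp
qed

lemma achart_inj: assumes c: "c \<in> atlas X" and d: "d \<in> atlas F" shows "inj_on (snd (achart U \<tau> c d)) (fst (achart U \<tau> c d))"
proof (rule inj_onI)
  fix y y' assume y: "y \<in> fst (achart U \<tau> c d)" "y' \<in> fst (achart U \<tau> c d)" "snd (achart U \<tau> c d) y = snd (achart U \<tau> c d) y'"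
  obtain x f where x: "x \<in> U" "x \<in> fst c" "f \<in> fst d" "y = orbit (\<tau> (x, gone K)) f" using achart_domE[OF y(1)] .
  obtain x' f' where x': "x' \<in> U" "x' \<in> fst c" "f' \<in> fst d" "y' = orbit (\<tau> (x', gone K)) f'" using achart_domE[OF y(2)] .
  have F: "f \<in> pts F" "f' \<in> pts F" using x(3) x'(3) chart_sub[OF cF d] by auto
  have "(snd c x, snd d f) = (snd c x', snd d f')"
    using y(3) unfolding x(4) x'(4) achart_apply[OF x(1) F(1)] achart_apply[OF x'(1) F(2)] .
  then have e: "snd c x = snd c x'" "snd d f = snd d f'" by (simp_all only: prod.inject)
  have "x = x'" "f = f'"
    by (rule inj_onD[OF chart_inj[OF cX c] e(1) x(2) x'(2)], rule inj_onD[OF chart_inj[OF cF d] e(2) x(3) x'(3)])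
  then show "y = y'" unfolding x(4) x'(4) by (simp only:)
qed

lemma achart_image: assumes d: "d \<in> atlas F" shows "snd (achart U \<tau> c d) ` fst (achart U \<tau> c d) = snd c ` (U \<inter> fst c) \<times> snd d ` fst d"
proof (intro equalityI subsetI)
  fix z assume "z \<in> snd (achart U \<tau> c d) ` fst (achart U \<tau> c d)"
  then obtain y where y: "y \<in> fst (achart U \<tau> c d)" "z = snd (achart U \<tau> c d) y" by blast
  obtain x f where x: "x \<in> U" "x \<in> fst c" "f \<in> fst d" "y = orbit (\<tau> (x, gone K)) f" using achart_domE[OF y(1)] .
  have "f \<in> pts F" using chart_sub[OF cF d] x by auto
  then show "z \<in> snd c ` (U \<inter> fst c) \<times> snd d ` fst d" using x y by (auto simp: achart_apply)
next
  fix z assume "z \<in> snd c ` (U \<inter> fst c) \<times> snd d ` fst d"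
  then obtain x f where x: "x \<in> U" "x \<in> fst c" "f \<in> fst d" "z = (snd c x, snd d f)" by auto
  have "f \<in> pts F" using chart_sub[OF cF d] x by auto
  then show "z \<in> snd (achart U \<tau> c d) ` fst (achart U \<tau> c d)"
    using x by (intro image_eqI[of _ _ "orbit (\<tau> (x, gone K)) f"]) (auto simp: achart_apply achart_dom)
qed

lemma achart_image_open: assumes c: "c \<in> atlas X" and d: "d \<in> atlas F" shows "open (snd (achart U \<tau> c d) ` fst (achart U \<tau> c d))"
  unfolding achart_image[OF d]
  using triv_open[OF triv] c chart_image_open[OF cF d] openin_mtop[OF cX] by (intro open_Times) auto

lemma cinv_achart:
  assumes c: "c \<in> atlas X" and d: "d \<in> atlas F" and x: "x \<in> U" "x \<in> fst c" "f \<in> fst d"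
  shows "cinv (achart U \<tau> c d) (snd c x, snd d f) = orbit (\<tau> (x, gone K)) f"
proof -
  have "f \<in> pts F" using chart_sub[OF cF d] x by auto
  from achart_apply[OF x(1) this, of c d] show ?thesis using cinv_snd[OF achart_inj[OF c d] achart_dom[OF x]] by simp
qed

end

text \<open>In product coordinates the transition is \<open>\<Psi>\<close>: it fixes the base point
  and acts on the fibre by \<gamma>, the group-valued transition function between the two local
  sections.\<close>

lemma achart_transition:
  assumes t: "local_triv K X E U \<tau>" "c \<in> atlas X" "d \<in> atlas F"
    and t': "local_triv K X E U' \<tau>'" "c' \<in> atlas X" "d' \<in> atlas F"
  shows "open (snd (achart U \<tau> c d) ` (fst (achart U \<tau> c d) \<inter> fst (achart U' \<tau>' c' d'))) \<and>
     smooth_on (snd (achart U \<tau> c d) ` (fst (achart U \<tau> c d) \<inter> fst (achart U' \<tau>' c' d'))) (snd (achart U' \<tau>' c' d') \<circ> cinv (achart U \<tau> c d))"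
proof (rule open_smooth_localI)
  let ?a = "achart U \<tau> c d" and ?b = "achart U' \<tau>' c' d'"
  note sin = section_in[OF t(1)] and sproj = section_proj[OF t(1)]
  define \<gamma> where "\<gamma> = (\<lambda>x. triv_comp U' \<tau>' (\<tau> (x, gone K)))"
  define \<Psi> where "\<Psi> = (\<lambda>p. (fst p, act F (\<gamma> (fst p)) (snd p)))"
  have g: "\<gamma> x \<in> pts K" if "x \<in> U" "x \<in> U'" for x unfolding \<gamma>_def using triv_comp(1)[OF t'(1) sin] sproj that by simp
  have o: "orbit (\<tau> (x, gone K)) f = orbit (\<tau>' (x, gone K)) (act F (\<gamma> x) f)" if "x \<in> U" "x \<in> U'" "f \<in> pts F" for x f
    using orbit_section[OF t'(1) sin that(3)] sproj that unfolding \<gamma>_def by simp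
  fix z assume "z \<in> snd ?a ` (fst ?a \<inter> fst ?b)"
  then obtain y where y: "y \<in> fst ?a" "y \<in> fst ?b" "z = snd ?a y" by blast
  obtain x f where x: "x \<in> U" "x \<in> fst c" "f \<in> fst d" "y = orbit (\<tau> (x, gone K)) f" using achart_domE[OF t(1) y(1)] .
  obtain x' f' where x': "x' \<in> U'" "x' \<in> fst c'" "f' \<in> fst d'" "y = orbit (\<tau>' (x', gone K)) f'" using achart_domE[OF t'(1) y(2)] .
  have fF: "f \<in> pts F" "f' \<in> pts F" using chart_sub[OF cF t(3)] chart_sub[OF cF t'(3)] x x' by auto
  have xx: "x' = x" using aproj_orbit[OF sin[OF x(1)], of f] aproj_orbit[OF section_in[OF t'(1) x'(1)], of f'] x x'
    by (simp add: sproj section_proj[OF t'(1)])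
  have f': "f' = act F (\<gamma> x) f"
    using orbit_section_inj[OF t'(1) x'(1) x'(1) fF(2), of "act F (\<gamma> x) f"] o[OF x(1) _ fF(1)] x x' xx act_in[OF g fF(1)] by simp
  have xX: "x \<in> pts X" using chart_sub[OF cX t(2)] x by auto
  note cXF = charted_mprod[OF cX cF]
  have sf: "smooth_at (mprod X F) X fst (x, f)" and ss: "smooth_at (mprod X F) F snd (x, f)"
    by (rule smooth_at_fst[OF cX cF xX fF(1)], rule smooth_at_snd[OF cX cF xX fF(1)])
  have s\<gamma>: "smooth_at X K \<gamma> x" unfolding \<gamma>_def
    by (rule smooth_at_comp[OF cX cE smooth_triv_section[OF t(1) x(1) one_in] smooth_triv_comp[OF t'(1)]])
       (use sin sproj x x' xx in auto)
  have s\<gamma>': "smooth_at (mprod X F) K (\<lambda>p. \<gamma> (fst p)) (x, f)"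
    by (rule smooth_at_comp[OF cXF cX sf]) (use s\<gamma> xX in auto)
  have "smooth_at (mprod X F) F (\<lambda>p. act F (\<gamma> (fst p)) (snd p)) (x, f)"
    by (rule smooth_at_two[where F = "\<lambda>h f. act F h f", OF cXF cK cF smooth_act s\<gamma>' _ ss]) (use g x x' xx fF in auto)
  then have s\<Psi>: "smooth_at (mprod X F) (mprod X F) \<Psi> (x, f)" unfolding \<Psi>_def by (rule smooth_at_pair[OF sf])
  have cd: "pch c d \<in> atlas (mprod X F)" "pch c' d' \<in> atlas (mprod X F)" unfolding atlas_mprod using t t' by blast+
  have "\<exists>V. open V \<and> snd (pch c d) (x, f) \<in> V \<and> V \<subseteq> snd (pch c d) ` fst (pch c d) \<and> (\<forall>y\<in>V. \<Psi> (cinv (pch c d) y) \<in> fst (pch c' d')) \<and>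
        smooth_on V (\<lambda>y. snd (pch c' d') (\<Psi> (cinv (pch c d) y)))"
    by (rule smooth_atD[OF s\<Psi> cd]) (use x x' xx f' in \<open>auto simp: \<Psi>_def\<close>)
  then obtain V where V: "open V" "(snd c x, snd d f) \<in> V" "V \<subseteq> snd c ` fst c \<times> snd d ` fst d"
    "\<And>y. y \<in> V \<Longrightarrow> \<Psi> (cinv (pch c d) y) \<in> fst c' \<times> fst d'" "smooth_on V (\<lambda>y. snd (pch c' d') (\<Psi> (cinv (pch c d) y)))"
    unfolding pch_simps pch_image by blast
  \<comment> \<open>The set \<open>V\<close> controls only the coordinates of \<open>\<Psi>\<close>;
    intersecting with the coordinates of \<open>U \<inter> U'\<close> ensures that the base points
    lie where \<gamma> has its meaning.\<close>
  define V' where "V' = V \<inter> (snd c ` ((U \<inter> U') \<inter> fst c) \<times> UNIV)"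
  have "openin (mtop X) (U \<inter> U')" using triv_open[OF t(1)] triv_open[OF t'(1)] by blast
  then have "open (snd c ` ((U \<inter> U') \<inter> fst c))" using openin_mtop[OF cX] t(2) by blast
  then have oV': "open V'" unfolding V'_def using V(1) by (intro open_Int open_Times) auto
  have key: "w \<in> snd ?a ` (fst ?a \<inter> fst ?b) \<and> snd (pch c' d') (\<Psi> (cinv (pch c d) w)) = (snd ?b \<circ> cinv ?a) w" if w: "w \<in> V'" for w
  proof -
    from w obtain q where q: "q \<in> U" "q \<in> U'" "q \<in> fst c" "fst w = snd c q" unfolding V'_def by auto
    from w obtain k where k: "k \<in> fst d" "snd w = snd d k" using V(3) unfolding V'_def by auto
    have w': "w = (snd c q, snd d k)" using q k by (simp add: prod_eq_iff)
    have kF: "k \<in> pts F" using chart_sub[OF cF t(3)] k by auto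
    have ci: "cinv (pch c d) w = (q, k)"
      unfolding w' using cinv_pch[OF chart_inj[OF cX t(2)] chart_inj[OF cF t(3)]] q k chart_inj[OF cX t(2)] chart_inj[OF cF t(3)] by simp
    have w2: "q \<in> fst c'" "act F (\<gamma> q) k \<in> fst d'" using V(4)[of w] w unfolding ci by (auto simp: \<Psi>_def V'_def)
    have ca: "cinv ?a w = orbit (\<tau> (q, gone K)) k" unfolding w' by (rule cinv_achart[OF t(1-3) q(1,3) k(1)])
    have b: "orbit (\<tau> (q, gone K)) k \<in> fst ?b" unfolding o[OF q(1,2) kF] by (rule achart_dom[OF t'(1) q(2) w2])
    have a: "orbit (\<tau> (q, gone K)) k \<in> fst ?a" by (rule achart_dom[OF t(1) q(1,3) k(1)])
    have "snd ?a (orbit (\<tau> (q, gone K)) k) = w" unfolding w' by (rule achart_apply[OF t(1) q(1) kF])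
    moreover have "snd ?b (orbit (\<tau> (q, gone K)) k) = (snd c' q, snd d' (act F (\<gamma> q) k))"
      unfolding o[OF q(1,2) kF] by (rule achart_apply[OF t'(1) q(2) act_in[OF g[OF q(1,2)] kF]])
    ultimately show ?thesis using a b unfolding comp_def ca ci by (auto simp: \<Psi>_def intro!: image_eqI[of w "snd ?a"])
  qed
  have "z = (snd c x, snd d f)" unfolding y(3) x(4) by (rule achart_apply[OF t(1) x(1) fF(1)])
  then have zV: "z \<in> V'" using V(2) x x' xx by (auto simp: V'_def)
  have "smooth_on V' (snd ?b \<circ> cinv ?a)"
    by (rule smooth_on_cong[OF oV' _ smooth_on_mono[OF V(5)]]) (use key in \<open>auto simp: V'_def\<close>)
  then show "\<exists>V. open V \<and> z \<in> V \<and> V \<subseteq> snd ?a ` (fst ?a \<inter> fst ?b) \<and> smooth_on V (snd ?b \<circ> cinv ?a)"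
    using oV' zV key by blast
qed

lemma AB_charted: "charted AB"
  unfolding charted_def
proof (intro conjI ballI)
  obtain B :: "'v set" where B: "is_basis B" using charted_basis[OF cX] .
  obtain C :: "'w set" where C: "is_basis C" using charted_basis[OF cF] .
  show "\<exists>B :: ('v \<times> 'w) set. is_basis B" by (rule is_basis_Times[OF B C])
next
  fix a assume "a \<in> atlas AB"
  then obtain U \<tau> c d where t: "local_triv K X E U \<tau>" "c \<in> atlas X" "d \<in> atlas F" "a = achart U \<tau> c d" unfolding atlas_AB by blast
  show "inj_on (snd a) (fst a)" "open (snd a ` fst a)" unfolding t(4) by (rule achart_inj[OF t(1-3)], rule achart_image_open[OF t(1-3)])
  show "fst a \<subseteq> pts AB"
  proof
    fix y assume "y \<in> fst a"
    then obtain x f where x: "x \<in> U" "x \<in> fst c" "f \<in> fst d" "y = orbit (\<tau> (x, gone K)) f" unfolding t(4) using achart_domE[OF t(1)] by metis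
    then show "y \<in> pts AB" using orbit_in[OF section_in[OF t(1)]] chart_sub[OF cF t(3)] by blast
  qed
  fix b assume "b \<in> atlas AB"
  then obtain U' \<tau>' c' d' where t': "local_triv K X E U' \<tau>'" "c' \<in> atlas X" "d' \<in> atlas F" "b = achart U' \<tau>' c' d'" unfolding atlas_AB by blast
  show "open (snd a ` (fst a \<inter> fst b))" "smooth_on (snd a ` (fst a \<inter> fst b)) (snd b \<circ> cinv a)"
    using achart_transition[OF t(1-3) t'(1-3)] unfolding t(4) t'(4) by auto
next
  show "pts AB = (\<Union>a\<in>atlas AB. fst a)"
  proof (intro equalityI subsetI)
    fix y assume "y \<in> pts AB"
    then obtain e f where ef: "e \<in> pts E" "f \<in> pts F" "y = orbit e f" by (rule AB_cases)
    obtain U \<tau> where U: "proj E e \<in> U" "local_triv K X E U \<tau>" using triv_exists[OF proj_in[OF ef(1)]] by blast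
    let ?f = "act F (triv_comp U \<tau> e) f"
    have f: "?f \<in> pts F" by (rule act_in[OF triv_comp(1)[OF U(2) ef(1) U(1)] ef(2)])
    note c = chart_at_props[OF cX proj_in[OF ef(1)]] and d = chart_at_props[OF cF f]
    have "y \<in> fst (achart U \<tau> (chart_at X (proj E e)) (chart_at F ?f))"
      unfolding ef(3) orbit_section[OF U(2) ef(1,2) U(1)] by (rule achart_dom[OF U(2) U(1) c(2) d(2)])
    moreover have "achart U \<tau> (chart_at X (proj E e)) (chart_at F ?f) \<in> atlas AB" unfolding atlas_AB using U c d by blast
    ultimately show "y \<in> (\<Union>a\<in>atlas AB. fst a)" by blast
  next
    fix y assume "y \<in> (\<Union>a\<in>atlas AB. fst a)"
    then obtain a where a: "a \<in> atlas AB" "y \<in> fst a" by blast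
    from a(1) obtain U \<tau> c d where "local_triv K X E U \<tau>" "c \<in> atlas X" "d \<in> atlas F" "a = achart U \<tau> c d"
      unfolding atlas_AB by blast
    with a(2) have t: "local_triv K X E U \<tau>" "c \<in> atlas X" "d \<in> atlas F" "y \<in> fst (achart U \<tau> c d)" by simp_all
    then obtain x f where x: "x \<in> U" "x \<in> fst c" "f \<in> fst d" "y = orbit (\<tau> (x, gone K)) f" using achart_domE[OF t(1,4)] by metis
    then show "y \<in> pts AB" using orbit_in[OF section_in[OF t(1)]] chart_sub[OF cF t(3)] by blast
  qed
qed

end

section \<open>Orbit maps into the associated bundle and their differentials\<close>

context assoc_bundle
begin

context
  fixes U \<tau> assumes triv: "local_triv K X E U \<tau>"
begin

lemma achart_coordinates:
  assumes c: "c \<in> atlas X" and d: "d \<in> atlas F" and z: "z \<in> snd c ` (U \<inter> fst c) \<times> snd d ` fst d"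
  shows "\<exists>x f. x \<in> U \<and> x \<in> fst c \<and> f \<in> fst d \<and> f \<in> pts F \<and> z = (snd c x, snd d f) \<and> cinv (pch c d) z = (x, f) \<and>
     cinv (achart U \<tau> c d) z = orbit (\<tau> (x, gone K)) f"
proof -
  obtain x f where xf: "x \<in> U" "x \<in> fst c" "f \<in> fst d" "z = (snd c x, snd d f)" using z by auto
  have "cinv (pch c d) z = (x, f)"
    unfolding xf(4) using cinv_pch[OF chart_inj[OF cX c] chart_inj[OF cF d]] xf chart_inj[OF cX c] chart_inj[OF cF d] by simp
  moreover have "cinv (achart U \<tau> c d) z = orbit (\<tau> (x, gone K)) f" unfolding xf(4) by (rule cinv_achart[OF triv c d xf(1-3)])
  moreover have "f \<in> pts F" using chart_sub[OF cF d] xf by auto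
  ultimately show ?thesis using xf by blast
qed

lemma coordinates_open: "c \<in> atlas X \<Longrightarrow> d \<in> atlas F \<Longrightarrow> open (snd c ` (U \<inter> fst c) \<times> snd d ` fst d)"
  using triv_open[OF triv] chart_image_open[OF cF, of d] openin_mtop[OF cX] by (intro open_Times) auto

lemma achart_in: "c \<in> atlas X \<Longrightarrow> d \<in> atlas F \<Longrightarrow> achart U \<tau> c d \<in> atlas AB"
  unfolding atlas_AB using triv by blast

text \<open>In the charts of the associated bundle built from the same trivialisation, this map has
  the identity as coordinate expression.\<close>

lemma smooth_section_orbit:
  assumes x: "x \<in> U" and f: "f \<in> pts F"
  shows "smooth_at (mprod X F) AB (\<lambda>p. orbit (\<tau> (fst p, gone K)) (snd p)) (x, f)"
proof -
  define c d where "c = chart_at X x" and "d = chart_at F f"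
  have c: "c \<in> atlas X" "x \<in> fst c" using chart_at_props[OF cX] x triv_sub[OF triv] by (auto simp: c_def)
  have d: "d \<in> atlas F" "f \<in> fst d" using chart_at_props[OF cF f] by (auto simp: d_def)
  let ?V = "snd c ` (U \<inter> fst c) \<times> snd d ` fst d"
  note o = coordinates_open[OF c(1) d(1)]
  have co: "orbit (\<tau> (fst (cinv (pch c d) z), gone K)) (snd (cinv (pch c d) z)) \<in> fst (achart U \<tau> c d) \<and>
     snd (achart U \<tau> c d) (orbit (\<tau> (fst (cinv (pch c d) z), gone K)) (snd (cinv (pch c d) z))) = z" if z: "z \<in> ?V" for z
  proof -
    obtain q k where q: "q \<in> U" "q \<in> fst c" "k \<in> fst d" "k \<in> pts F" "z = (snd c q, snd d k)" "cinv (pch c d) z = (q, k)"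
      using achart_coordinates[OF c(1) d(1) z] by blast
    show ?thesis unfolding q(6) fst_conv snd_conv using achart_dom[OF triv q(1-3)] achart_apply[OF triv q(1,4), of c d] q(5) by simp
  qed
  show ?thesis
  proof (rule smooth_atI_charts[OF charted_mprod[OF cX cF] AB_charted _ _ achart_in[OF c(1) d(1)] o])
    show "pch c d \<in> atlas (mprod X F)" unfolding atlas_mprod using c d by blast
    show "(x, f) \<in> fst (pch c d)" "snd (pch c d) (x, f) \<in> ?V" "?V \<subseteq> snd (pch c d) ` fst (pch c d)" using c d x by (auto simp: pch_image)
    show "orbit (\<tau> (fst (cinv (pch c d) z), gone K)) (snd (cinv (pch c d) z)) \<in> fst (achart U \<tau> c d)" if "z \<in> ?V" for z using co[OF that] by blast
    show "smooth_on ?V (\<lambda>z. snd (achart U \<tau> c d) (orbit (\<tau> (fst (cinv (pch c d) z), gone K)) (snd (cinv (pch c d) z))))"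
      by (rule smooth_on_cong[OF o _ smooth_on_id[OF o]]) (use co in simp)
  qed
qed

lemma smooth_fibre_component:
  assumes x: "x \<in> U" and f: "f \<in> pts F"
  shows "smooth_at AB X (aproj E) (orbit (\<tau> (x, gone K)) f)"
    and "smooth_at AB F (\<lambda>y. Defs.fcomp y (\<tau> (aproj E y, gone K))) (orbit (\<tau> (x, gone K)) f)"
proof -
  define c d where "c = chart_at X x" and "d = chart_at F f"
  have c: "c \<in> atlas X" "x \<in> fst c" using chart_at_props[OF cX] x triv_sub[OF triv] by (auto simp: c_def)
  have d: "d \<in> atlas F" "f \<in> fst d" using chart_at_props[OF cF f] by (auto simp: d_def)
  let ?V = "snd c ` (U \<inter> fst c) \<times> snd d ` fst d" and ?a = "achart U \<tau> c d"
  note o = coordinates_open[OF c(1) d(1)]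
  have co: "aproj E (cinv ?a z) \<in> fst c \<and> snd c (aproj E (cinv ?a z)) = fst z \<and>
      Defs.fcomp (cinv ?a z) (\<tau> (aproj E (cinv ?a z), gone K)) \<in> fst d \<and>
      snd d (Defs.fcomp (cinv ?a z) (\<tau> (aproj E (cinv ?a z), gone K))) = snd z" if z: "z \<in> ?V" for z
  proof -
    obtain q k where q: "q \<in> U" "q \<in> fst c" "k \<in> fst d" "k \<in> pts F" "z = (snd c q, snd d k)" "cinv ?a z = orbit (\<tau> (q, gone K)) k"
      using achart_coordinates[OF c(1) d(1) z] by blast
    have a: "aproj E (orbit (\<tau> (q, gone K)) k) = q" using aproj_orbit[OF section_in[OF triv q(1)]] section_proj[OF triv q(1)] by simp
    show ?thesis unfolding q(6) a fcomp_orbit_self[OF section_in[OF triv q(1)] q(4)] using q by simp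
  qed
  have "?V \<subseteq> snd ?a ` fst ?a" unfolding achart_image[OF triv d(1)] ..
  moreover have "snd ?a (orbit (\<tau> (x, gone K)) f) \<in> ?V" "orbit (\<tau> (x, gone K)) f \<in> fst ?a"
    using achart_apply[OF triv x f, of c d] achart_dom[OF triv x c(2) d(2)] c d x by auto
  ultimately have V: "?V \<subseteq> snd ?a ` fst ?a" "snd ?a (orbit (\<tau> (x, gone K)) f) \<in> ?V" "orbit (\<tau> (x, gone K)) f \<in> fst ?a" by auto
  show "smooth_at AB X (aproj E) (orbit (\<tau> (x, gone K)) f)"
  proof (rule smooth_atI_charts[OF AB_charted cX achart_in[OF c(1) d(1)] V(3) c(1) o V(2,1)])
    show "smooth_on ?V (\<lambda>z. snd c (aproj E (cinv ?a z)))"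
      by (rule smooth_on_cong[OF o _ smooth_on_fst[OF o smooth_on_id[OF o]]]) (use co in simp)
  qed (use co in blast)
  show "smooth_at AB F (\<lambda>y. Defs.fcomp y (\<tau> (aproj E y, gone K))) (orbit (\<tau> (x, gone K)) f)"
  proof (rule smooth_atI_charts[OF AB_charted cF achart_in[OF c(1) d(1)] V(3) d(1) o V(2,1)])
    show "smooth_on ?V (\<lambda>z. snd d (Defs.fcomp (cinv ?a z) (\<tau> (aproj E (cinv ?a z), gone K))))"
      by (rule smooth_on_cong[OF o _ smooth_on_snd[OF o smooth_on_id[OF o]]]) (use co in simp)
  qed (use co in blast)
qed

end

text \<open>In a trivialisation the group component of \<open>e\<close> can be shifted onto
  \<open>f\<close>; this factors the orbit map through the local section, where
  \<open>smooth_section_orbit\<close> applies.\<close>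

lemma smooth_orbit:
  assumes e: "e \<in> pts E" and f: "f \<in> pts F"
  shows "smooth_at (mprod E F) AB (\<lambda>(e, f). orbit e f) (e, f)"
proof -
  obtain U \<tau> where U: "proj E e \<in> U" "local_triv K X E U \<tau>" using triv_exists[OF proj_in[OF e]] by blast
  note cEF = charted_mprod[OF cE cF] and cXF = charted_mprod[OF cX cF]
  note sf = smooth_at_fst[OF cE cF e f] and ss = smooth_at_snd[OF cE cF e f]
  let ?\<kappa> = "triv_comp U \<tau>"
  have sp: "smooth_at (mprod E F) X (\<lambda>p. proj E (fst p)) (e, f)"
    by (rule smooth_at_comp[OF cEF cE sf]) (use smooth_proj e in auto)
  have s\<kappa>: "smooth_at (mprod E F) K (\<lambda>p. ?\<kappa> (fst p)) (e, f)"
    by (rule smooth_at_comp[OF cEF cE sf]) (use smooth_triv_comp[OF U(2) e U(1)] e in auto)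
  have \<kappa>: "?\<kappa> e \<in> pts K" by (rule triv_comp(1)[OF U(2) e U(1)])
  have sa: "smooth_at (mprod E F) F (\<lambda>p. act F (?\<kappa> (fst p)) (snd p)) (e, f)"
    by (rule smooth_at_two[where F = "\<lambda>h f. act F h f", OF cEF cK cF smooth_act s\<kappa> _ ss]) (use \<kappa> f in auto)
  have "smooth_at (mprod E F) AB (\<lambda>p. orbit (\<tau> (fst (proj E (fst p), act F (?\<kappa> (fst p)) (snd p)), gone K)) (snd (proj E (fst p), act F (?\<kappa> (fst p)) (snd p)))) (e, f)"
    by (rule smooth_at_comp[where g = "\<lambda>p. orbit (\<tau> (fst p, gone K)) (snd p)", OF cEF cXF smooth_at_pair[OF sp sa]])
       (use smooth_section_orbit[OF U(2,1) act_in[OF \<kappa> f]] proj_in[OF e] act_in[OF \<kappa> f] in \<open>auto simp: pts_mprod\<close>)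
  then have 1: "smooth_at (mprod E F) AB (\<lambda>p. orbit (\<tau> (proj E (fst p), gone K)) (act F (?\<kappa> (fst p)) (snd p))) (e, f)" by simp
  let ?W = "{p \<in> pts (mprod E F). proj E (fst p) \<in> U}"
  have oW: "openin (mtop (mprod E F)) ?W"
  proof (rule openin_smooth_preimage[OF cEF cX triv_open[OF U(2)]])
    fix p assume "p \<in> pts (mprod E F)"
    then obtain a b where p: "p = (a, b)" "a \<in> pts E" "b \<in> pts F" by (auto simp: pts_mprod)
    show "smooth_at (mprod E F) X (\<lambda>p. proj E (fst p)) p" unfolding p(1)
      by (rule smooth_at_comp[OF cEF cE smooth_at_fst[OF cE cF p(2,3)]]) (use smooth_proj p in auto)
  qed (use proj_in in \<open>auto simp: pts_mprod\<close>)
  show ?thesis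
  proof (rule smooth_at_cong[OF cEF oW _ _ 1])
    show "(e, f) \<in> ?W" using e f U by (auto simp: pts_mprod)
    show "orbit (\<tau> (proj E (fst p), gone K)) (act F (?\<kappa> (fst p)) (snd p)) = (case p of (e, f) \<Rightarrow> orbit e f)" if "p \<in> ?W" for p
      using orbit_section[OF U(2), of "fst p" "snd p"] that by (auto simp: pts_mprod)
  qed
qed

lemma smooth_aproj:
  assumes e: "e \<in> pts E" and f: "f \<in> pts F" shows "smooth_at AB X (aproj E) (orbit e f)"
proof -
  obtain U \<tau> where U: "proj E e \<in> U" "local_triv K X E U \<tau>" using triv_exists[OF proj_in[OF e]] by blast
  show ?thesis unfolding orbit_section[OF U(2) e f U(1)]
    by (rule smooth_fibre_component(1)[OF U(2,1) act_in[OF triv_comp(1)[OF U(2) e U(1)] f]])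
qed

lemma smooth_orbit1: "e \<in> pts E \<Longrightarrow> f \<in> pts F \<Longrightarrow> smooth_at E AB (\<lambda>e. orbit e f) e"
  using smooth_at_two[where F = "\<lambda>e f. orbit e f" and f = "\<lambda>e. e" and g = "\<lambda>_. f", OF cE cE cF smooth_orbit smooth_at_id[OF cE] _ smooth_at_const[OF cE]] by simp

lemma smooth_orbit2: "e \<in> pts E \<Longrightarrow> f \<in> pts F \<Longrightarrow> smooth_at F AB (orbit e) f"
  using smooth_at_two[where F = "\<lambda>e f. orbit e f" and f = "\<lambda>_. e" and g = "\<lambda>f. f", OF cF cE cF smooth_orbit smooth_at_const[OF cF] _ smooth_at_id[OF cF]] by simp

abbreviation TF where "TF e f \<equiv> tmap F AB (orbit e) f"
abbreviation TE where "TE e f \<equiv> tmap E AB (\<lambda>e. orbit e f) e"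
abbreviation TP where "TP y \<equiv> tmap AB X (aproj E) y"
text \<open>The infinitesimal action of the Lie algebra at a point of the fibre, as the differential
  of the orbit map of that point.\<close>

abbreviation TL where "TL f \<equiv> tmap K F (\<lambda>h. act F h f) (gone K)"

lemma TF_linear: "e \<in> pts E \<Longrightarrow> f \<in> pts F \<Longrightarrow> linear (TF e f)"
  by (rule tmap_linear[OF cF AB_charted smooth_orbit2 _ orbit_in])

lemma TE_linear: "e \<in> pts E \<Longrightarrow> f \<in> pts F \<Longrightarrow> linear (TE e f)"
  by (rule tmap_linear[OF cE AB_charted smooth_orbit1 _ orbit_in])

lemma TL_linear: "f \<in> pts F \<Longrightarrow> linear (TL f)"
  by (rule tmap_linear[OF cK cF smooth_act1[OF one_in] one_in]) (auto simp: act_one)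

lemma TP_linear: "e \<in> pts E \<Longrightarrow> f \<in> pts F \<Longrightarrow> linear (TP (orbit e f))"
  by (rule tmap_linear[OF AB_charted cX smooth_aproj orbit_in]) (auto simp: aproj_orbit proj_in)

text \<open>Differentiation of \<open>orbit (ract E e k) f = orbit e (act F k f)\<close> in
  \<open>k\<close> at the unit. This is how the connection form comes to act on the fibre.\<close>

lemma TE_vertical:
  assumes e: "e \<in> pts E" and f: "f \<in> pts F"
  shows "TE e f (tmap K E (ract E e) (gone K) s) = TF e f (TL f s)"
proof -
  have 1: "tmap K AB (\<lambda>k. orbit (ract E e k) f) (gone K) s = TE e f (tmap K E (ract E e) (gone K) s)"
    using tmap_comp[where f = "ract E e" and g = "\<lambda>e. orbit e f", OF cK cE AB_charted smooth_ract2[OF e one_in], of s] smooth_orbit1[OF e f] e f orbit_in[OF e f]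
    by (simp add: ract_one one_in)
  have 2: "tmap K AB (\<lambda>k. orbit e (act F k f)) (gone K) s = TF e f (TL f s)"
    using tmap_comp[where f = "\<lambda>k. act F k f" and g = "orbit e", OF cK cF AB_charted smooth_act1[OF one_in f], of s] smooth_orbit2[OF e f] e f orbit_in[OF e f]
    by (simp add: act_one one_in)
  have "tmap K AB (\<lambda>k. orbit (ract E e k) f) (gone K) = tmap K AB (\<lambda>k. orbit e (act F k f)) (gone K)"
  proof (rule tmap_cong[OF cK AB_charted openin_pts[OF cK] one_in])
    show "orbit (ract E e k) f = orbit e (act F k f)" if "k \<in> pts K" for k by (rule orbit_ract[OF e that f])
    show "smooth_at K AB (\<lambda>k. orbit (ract E e k) f) (gone K)"
      by (rule smooth_at_comp[where g = "\<lambda>e. orbit e f", OF cK cE smooth_ract2[OF e one_in]]) (use smooth_orbit1[OF e f] e in \<open>auto simp: ract_one\<close>)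
  qed (use one_in e f orbit_in in \<open>auto simp: ract_one\<close>)
  then show ?thesis using 1 2 by simp
qed

lemma TP_TE:
  assumes e: "e \<in> pts E" and f: "f \<in> pts F"
  shows "TP (orbit e f) (TE e f w) = tmap E X (proj E) e w"
proof -
  have "tmap E X (\<lambda>e. aproj E (orbit e f)) e w = TP (orbit e f) (TE e f w)"
    by (rule tmap_comp[where f = "\<lambda>e. orbit e f" and g = "aproj E", OF cE AB_charted cX smooth_orbit1[OF e f] smooth_aproj[OF e f] e orbit_in[OF e f]])
       (use e in \<open>simp add: aproj_orbit proj_in\<close>)
  moreover have "tmap E X (proj E) e = tmap E X (\<lambda>e. aproj E (orbit e f)) e"
    by (rule tmap_cong[OF cE cX openin_pts[OF cE] e _ smooth_proj e proj_in[OF e]]) (simp add: aproj_orbit)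
  ultimately show ?thesis by simp
qed

lemma TF_ract:
  assumes e: "e \<in> pts E" and h: "h \<in> pts K" and f: "f \<in> pts F"
  shows "TF (ract E e h) f a = TF e (act F h f) (TA h f a)"
proof -
  have "tmap F AB (orbit (ract E e h)) f = tmap F AB (\<lambda>f. orbit e (act F h f)) f"
    by (rule tmap_cong[OF cF AB_charted openin_pts[OF cF] f _ smooth_orbit2[OF ract_in[OF e h] f] f orbit_in[OF ract_in[OF e h] f]])
       (rule orbit_ract[OF e h])
  moreover have "tmap F AB (\<lambda>f. orbit e (act F h f)) f a = TF e (act F h f) (TA h f a)"
    by (rule tmap_comp[where f = "act F h" and g = "orbit e", OF cF cF AB_charted smooth_act2[OF h f] smooth_orbit2[OF e act_in[OF h f]] f act_in[OF h f] orbit_in[OF e act_in[OF h f]]])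
  ultimately show ?thesis by simp
qed

lemma TE_ract:
  assumes e: "e \<in> pts E" and h: "h \<in> pts K" and f: "f \<in> pts F"
  shows "TE (ract E e h) f (tmap E E (\<lambda>e. ract E e h) e w) = TE e (act F h f) w"
proof -
  have "tmap E AB (\<lambda>e. orbit e (act F h f)) e = tmap E AB (\<lambda>e. orbit (ract E e h) f) e"
    by (rule tmap_cong[OF cE AB_charted openin_pts[OF cE] e _ smooth_orbit1[OF e act_in[OF h f]] e orbit_in[OF e act_in[OF h f]]])
       (rule orbit_ract[symmetric, OF _ h f])
  moreover have "tmap E AB (\<lambda>e. orbit (ract E e h) f) e w = TE (ract E e h) f (tmap E E (\<lambda>e. ract E e h) e w)"
    by (rule tmap_comp[where f = "\<lambda>e. ract E e h" and g = "\<lambda>e. orbit e f", OF cE cE AB_charted smooth_ract1[OF e h] smooth_orbit1[OF ract_in[OF e h] f] e ract_in[OF e h] orbit_in[OF ract_in[OF e h] f]])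
  ultimately show ?thesis by simp
qed

text \<open>Followed by the fibre component of a trivialisation, \<open>orbit e\<close> becomes the
  action of one group element, and the differential of that action is injective.\<close>

lemma TF_inj:
  assumes e: "e \<in> pts E" and f: "f \<in> pts F" and eq: "TF e f a = TF e f b"
  shows "a = b"
proof -
  obtain U \<tau> where U: "proj E e \<in> U" "local_triv K X E U \<tau>" using triv_exists[OF proj_in[OF e]] by blast
  let ?k = "triv_comp U \<tau> e" and ?\<eta> = "\<lambda>y. Defs.fcomp y (\<tau> (aproj E y, gone K))"
  have k: "?k \<in> pts K" by (rule triv_comp(1)[OF U(2) e U(1)])
  have \<eta>: "?\<eta> (orbit e f) = act F ?k f" if "f \<in> pts F" for f
    unfolding orbit_section[OF U(2) e that U(1)] aproj_orbit[OF section_in[OF U(2,1)]] section_proj[OF U(2,1)]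
    by (rule fcomp_orbit_self[OF section_in[OF U(2,1)] act_in[OF k that]])
  have s\<eta>: "smooth_at AB F ?\<eta> (orbit e f)"
    unfolding orbit_section[OF U(2) e f U(1)] by (rule smooth_fibre_component(2)[OF U(2,1) act_in[OF k f]])
  have "tmap F F (\<lambda>f. ?\<eta> (orbit e f)) f a = tmap AB F ?\<eta> (orbit e f) (TF e f a)" for a
    by (rule tmap_comp[where f = "orbit e" and g = ?\<eta>, OF cF AB_charted cF smooth_orbit2[OF e f] s\<eta> f orbit_in[OF e f]])
       (use \<eta>[OF f] act_in[OF k f] in simp)
  moreover have "tmap F F (act F ?k) f = tmap F F (\<lambda>f. ?\<eta> (orbit e f)) f"
    by (rule tmap_cong[OF cF cF openin_pts[OF cF] f _ smooth_act2[OF k f] f act_in[OF k f]]) (simp add: \<eta>)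
  ultimately have "TA ?k f a = TA ?k f b" using eq by simp
  then show ?thesis by (rule TA_inj[OF k f])
qed

end

section \<open>Covariant derivative and Chern-Weil form of a section\<close>

locale gauge = conn K X E A + assoc_bundle K X E F
  for K :: "('k, 'l::real_normed_vector) lie" and X :: "('x, 'v::real_normed_vector) kaehler"
    and E :: "('k, 'x, 'e, 'b::real_normed_vector) pbundle" and A :: "'e \<Rightarrow> 'b list \<Rightarrow> 'l"
    and F :: "('k, 'l, 'f, 'w::real_normed_vector) hspace" +
  fixes \<Phi> :: "'x \<Rightarrow> ('e \<times> 'f) set"
  assumes ham: "hamiltonian_space K F" and sec: "smooth_section K F X E \<Phi>" and inner: "Ad_invariant_inner K"
begin

lemma ip_inner: "inner_product (ip K)" and ip_Ad: "h \<in> pts K \<Longrightarrow> ip K (Ad K h s) (Ad K h t) = ip K s t"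
  using inner unfolding Ad_invariant_inner_def by auto

lemma ip_bil: "bilinear (ip K)" by (rule inner_product_bilinear[OF ip_inner])

lemma ip_eqI: assumes "\<And>w. ip K a w = ip K b w" shows "a = b"
proof (rule ccontr)
  assume "a \<noteq> b"
  then have "ip K (a - b) (a - b) > 0" using inner_product_pos[OF ip_inner] by simp
  then show False using assms[of "a - b"] by (simp add: bilinear_lsub[OF ip_bil])
qed

lemma symp_alt: "f \<in> pts F \<Longrightarrow> alt_form 2 (symp F f)" and symp_smooth: "smooth_tensor F 2 (symp F)"
  and symp_inv: "h \<in> pts K \<Longrightarrow> f \<in> pts F \<Longrightarrow> pullback F F (act F h) (symp F) f vs = symp F f vs"
  and acs_equiv: "h \<in> pts K \<Longrightarrow> f \<in> pts F \<Longrightarrow> TA h f (acs F f u) = acs F (act F h f) (TA h f u)"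
  and acs_linear: "f \<in> pts F \<Longrightarrow> linear (acs F f)" and acs_square: "f \<in> pts F \<Longrightarrow> acs F f (acs F f u) = - u"
  and metric_inner: "f \<in> pts F \<Longrightarrow> inner_product (\<lambda>u v. symp F f [u, acs F f v])"
  and metric_smooth: "smooth_tensor F 2 (assoc_metric (symp F) (acs F))"
  and mom_smooth: "smooth_map F vec_mfd (mom F)"
  and mom_ip: "h \<in> pts K \<Longrightarrow> f \<in> pts F \<Longrightarrow> ip K (mom F (act F h f)) (Ad K h v) = ip K (mom F f) v"
  using ham unfolding hamiltonian_space_def symplectic_form_def diff_form_def almost_complex_def riemannian_def moment_map_def assoc_metric_def
  by auto

text \<open>The defining equivariance is a pairing identity; invariance and nondegeneracy of the
  inner product turn it into an equation in the Lie algebra.\<close>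

lemma mom_equiv: assumes h: "h \<in> pts K" and f: "f \<in> pts F" shows "mom F (act F h f) = Ad K h (mom F f)"
proof (rule ip_eqI)
  fix w
  have "ip K (mom F (act F h f)) (Ad K h (Ad K (ginv K h) w)) = ip K (mom F f) (Ad K (ginv K h) w)" by (rule mom_ip[OF h f])
  also have "\<dots> = ip K (Ad K h (mom F f)) (Ad K h (Ad K (ginv K h) w))" by (rule ip_Ad[OF h, symmetric])
  finally show "ip K (mom F (act F h f)) w = ip K (Ad K h (mom F f)) w" by (simp only: Ad_inv[OF h])
qed

lemma symp_TA: "h \<in> pts K \<Longrightarrow> f \<in> pts F \<Longrightarrow> symp F (act F h f) [TA h f a, TA h f b] = symp F f [a, b]"
  using symp_inv[of h f "[a, b]"] by (simp add: pullback_def)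

subsection \<open>Vertical structures in an arbitrary frame\<close>

text \<open>The horizontal space collects vectors from all representatives of the orbit. Since right
  translation preserves horizontal lifts, the single frame \<open>e\<close> already yields all of
  them.\<close>

lemma hor_orbit:
  assumes e: "e \<in> pts E" and f: "f \<in> pts F"
  shows "hor K F X E A (orbit e f) = range (\<lambda>v. TE e f (hlift X E A e v))"
proof (intro equalityI subsetI)
  fix u assume "u \<in> hor K F X E A (orbit e f)"
  then obtain e' f' w where w: "(e', f') \<in> orbit e f" "A e' [w] = 0" "u = TE e' f' w" unfolding hor_def by blast
  obtain h where h: "h \<in> pts K" "e' = ract E e h" "f' = act F (ginv K h) f" using w(1) unfolding orbit_mem by blast
  have e': "e' \<in> pts E" using ract_in[OF e h(1)] h by simp
  have "w = hlift X E A e' (P e' w)" by (rule hlift_eqI[OF e' w(2) refl, symmetric])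
  then have "w = R h e (hlift X E A e (P e' w))" using hlift_ract[OF e h(1), of "P e' w"] h(2) by simp
  then have "u = TE (ract E e h) f' (R h e (hlift X E A e (P e' w)))" using w(3) h(2) by simp
  also have "\<dots> = TE e (act F h f') (hlift X E A e (P e' w))" by (rule TE_ract[OF e h(1)]) (simp add: h act_in inv_in f)
  also have "act F h f' = f" unfolding h(3) by (rule act_inv(2)[OF h(1) f])
  finally show "u \<in> range (\<lambda>v. TE e f (hlift X E A e v))" by blast
next
  fix u assume "u \<in> range (\<lambda>v. TE e f (hlift X E A e v))"
  then show "u \<in> hor K F X E A (orbit e f)"
    unfolding hor_def using orbit_self[OF e f] hlift_props(1)[OF e] by blast
qed

text \<open>Subtracting the horizontal vector over the projection of \<open>u\<close> leaves a
  vertical one. Uniqueness follows because the projection annihilates the vertical part and thereby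
  determines the horizontal part.\<close>

lemma valpha_orbit:
  assumes e: "e \<in> pts E" and f: "f \<in> pts F"
  shows "valpha K F X E A (orbit e f) u = u - TE e f (hlift X E A e (TP (orbit e f) u))"
  unfolding valpha_def
proof (rule the_equality)
  note lin = TP_linear[OF e f]
  have TPh: "TP (orbit e f) (TE e f (hlift X E A e v)) = v" for v using TP_TE[OF e f] hlift_props(2)[OF e] by simp
  show "u - TE e f (hlift X E A e (TP (orbit e f) u)) \<in> vert K F X E (orbit e f) \<and>
      u - (u - TE e f (hlift X E A e (TP (orbit e f) u))) \<in> hor K F X E A (orbit e f)"
    unfolding hor_orbit[OF e f] vert_def by (auto simp: linear_diff[OF lin] TPh)
  fix u' assume u': "u' \<in> vert K F X E (orbit e f) \<and> u - u' \<in> hor K F X E A (orbit e f)"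
  then obtain v where v: "u - u' = TE e f (hlift X E A e v)" unfolding hor_orbit[OF e f] by blast
  have "TP (orbit e f) u' = 0" using u' by (simp add: vert_def)
  then have "TP (orbit e f) u = v" using arg_cong[OF v, of "TP (orbit e f)"] unfolding TPh by (simp add: linear_diff[OF lin])
  then show "u' = u - TE e f (hlift X E A e (TP (orbit e f) u))" using v by (simp add: algebra_simps)
qed

lemma rep_orbit:
  assumes e: "e \<in> pts E" and f: "f \<in> pts F"
  shows "\<exists>h\<in>pts K. rep (orbit e f) = (ract E e h, act F (ginv K h) f)"
proof -
  have "rep (orbit e f) \<in> orbit e f" unfolding rep_def by (rule someI) (rule orbit_self[OF e f])
  then show ?thesis unfolding orbit_mem .
qed

context
  fixes e f h assumes e: "e \<in> pts E" and f: "f \<in> pts F" and h: "h \<in> pts K"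
    and rep: "rep (orbit e f) = (ract E e h, act F (ginv K h) f)"
begin

lemma fibre_iso_orbit: "fibre_iso K F X E (orbit e f) b = TF e f (TA h (act F (ginv K h) f) b)"
  unfolding fibre_iso_def rep fst_conv snd_conv
  using TF_ract[OF e h act_in[OF inv_in[OF h] f]] act_inv(2)[OF h f] by simp

lemma TF_fibre_iso: "TF e f a = fibre_iso K F X E (orbit e f) (TA (ginv K h) f a)"
  unfolding fibre_iso_orbit TA_inv[OF h f] ..

lemma fibre_iso_inv_TF: "fibre_iso_inv K F X E (orbit e f) (TF e f a) = TA (ginv K h) f a"
  unfolding fibre_iso_inv_def
proof (rule the_equality)
  show "fibre_iso K F X E (orbit e f) (TA (ginv K h) f a) = TF e f a" by (rule TF_fibre_iso[symmetric])
  fix b assume "fibre_iso K F X E (orbit e f) b = TF e f a"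
  then have "fibre_iso K F X E (orbit e f) b = fibre_iso K F X E (orbit e f) (TA (ginv K h) f a)" unfolding TF_fibre_iso .
  then have "TA h (act F (ginv K h) f) b = TA h (act F (ginv K h) f) (TA (ginv K h) f a)"
    unfolding fibre_iso_orbit by (rule TF_inj[OF e f])
  then show "b = TA (ginv K h) f a" by (rule TA_inj[OF h act_in[OF inv_in[OF h] f]])
qed

end

text \<open>The structures are defined through the representative chosen by \<open>rep\<close>. It
  differs from \<open>(e, f)\<close> by a group element, which changes all fibre vectors by the
  differential of its action; this preserves the symplectic and the complex structure.\<close>

lemma vertical_structures:
  assumes e: "e \<in> pts E" and f: "f \<in> pts F"
  shows "vert_metric K F X E (orbit e f) (TF e f a) (TF e f b) = symp F f [a, acs F f b]"
    and "vert_symp K F X E (orbit e f) [TF e f a, TF e f b] = symp F f [a, b]"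
    and "vert_acs K F X E (orbit e f) (TF e f a) = TF e f (acs F f a)"
proof -
  obtain h where h: "h \<in> pts K" "rep (orbit e f) = (ract E e h, act F (ginv K h) f)" using rep_orbit[OF e f] by blast
  note i = inv_in[OF h(1)]
  show "vert_metric K F X E (orbit e f) (TF e f a) (TF e f b) = symp F f [a, acs F f b]"
    unfolding vert_metric_def fibre_iso_inv_TF[OF e f h] h(2) snd_conv assoc_metric_def
    using symp_TA[OF i f, of a "acs F f b"] by (simp add: acs_equiv[OF i f])
  show "vert_symp K F X E (orbit e f) [TF e f a, TF e f b] = symp F f [a, b]"
    unfolding vert_symp_def list.map fibre_iso_inv_TF[OF e f h] h(2) snd_conv by (rule symp_TA[OF i f])
  show "vert_acs K F X E (orbit e f) (TF e f a) = TF e f (acs F f a)"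
    unfolding vert_acs_def fibre_iso_inv_TF[OF e f h] unfolding h(2) snd_conv acs_equiv[OF i f, symmetric] TF_fibre_iso[OF e f h, symmetric] ..
qed

text \<open>A change of representative applies the same \<open>Ad\<close> to the curvature and to
  the moment map, which the invariant inner product does not see.\<close>

lemma curvature_moment_pairing:
  assumes e: "e \<in> pts E" and f: "f \<in> pts F"
  shows "ip K (curv X E A (fst (rep (orbit e f))) [u, v]) (mom F (snd (rep (orbit e f)))) = ip K (curv X E A e [u, v]) (mom F f)"
proof -
  obtain h where h: "h \<in> pts K" "rep (orbit e f) = (ract E e h, act F (ginv K h) f)" using rep_orbit[OF e f] by blast
  show ?thesis unfolding h(2) fst_conv snd_conv curv_ract[OF e h(1)] mom_equiv[OF inv_in[OF h(1)] f] by (rule ip_Ad[OF inv_in[OF h(1)]])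
qed

subsection \<open>The section in a local frame\<close>

lemma section_props: assumes x: "x \<in> pts X" shows "\<Phi> x \<in> pts AB" "aproj E (\<Phi> x) = x" "smooth_at X AB \<Phi> x"
proof -
  have "smooth_map X AB \<Phi>" using sec unfolding smooth_section_def by blast
  then show "\<Phi> x \<in> pts AB" "smooth_at X AB \<Phi> x" using x chart_inj[OF cX] unfolding smooth_map_def[of X AB]
    by (auto intro!: smooth_map_smooth_at simp: \<open>smooth_map X AB \<Phi>\<close>)
  show "aproj E (\<Phi> x) = x" using sec x unfolding smooth_section_def by blast
qed

lemma section_orbit:
  assumes e: "e \<in> pts E"
  shows "Defs.fcomp (\<Phi> (proj E e)) e \<in> pts F" "\<Phi> (proj E e) = orbit e (Defs.fcomp (\<Phi> (proj E e)) e)"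
proof -
  note s = section_props[OF proj_in[OF e]]
  obtain e' f' where ef: "e' \<in> pts E" "f' \<in> pts F" "\<Phi> (proj E e) = orbit e' f'" using AB_cases[OF s(1)] .
  have "proj E e' = proj E e" using s(2) unfolding ef(3) aproj_orbit[OF ef(1)] .
  then obtain h where h: "h \<in> pts K" "e' = ract E e h" using fibre_transitive[OF e ef(1)] by metis
  have o: "\<Phi> (proj E e) = orbit e (act F h f')" unfolding ef(3) h(2) by (rule orbit_ract[OF e h(1) ef(2)])
  have a: "act F h f' \<in> pts F" by (rule act_in[OF h(1) ef(2)])
  have "Defs.fcomp (\<Phi> (proj E e)) e = act F h f'" unfolding o by (rule fcomp_orbit_self[OF e a])
  then show "Defs.fcomp (\<Phi> (proj E e)) e \<in> pts F" "\<Phi> (proj E e) = orbit e (Defs.fcomp (\<Phi> (proj E e)) e)" using a o by auto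
qed

context
  fixes U \<tau> assumes triv: "local_triv K X E U \<tau>"
begin

definition sect where "sect x = \<tau> (x, gone K)"
definition phi where "phi x = Defs.fcomp (\<Phi> x) (sect x)"
text \<open>The gauge potential: the pullback of the connection form by the local section.\<close>

definition lconn where "lconn x v = A (sect x) [tmap X E sect x v]"
text \<open>The covariant derivative in a trivialisation: the derivative of the fibre component plus
  the infinitesimal action of the gauge potential on it.\<close>

definition ldiff where "ldiff x v = tmap X F phi x v + TL (phi x) (lconn x v)"

lemma sect_in: "x \<in> U \<Longrightarrow> sect x \<in> pts E" and sect_proj: "x \<in> U \<Longrightarrow> proj E (sect x) = x"
  and sect_smooth: "x \<in> U \<Longrightarrow> smooth_at X E sect x" and Usub: "x \<in> U \<Longrightarrow> x \<in> pts X"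
  using section_in[OF triv] section_proj[OF triv] smooth_triv_section[OF triv _ one_in] triv_sub[OF triv]
  by (auto simp: sect_def[abs_def])

lemma phi_in: "x \<in> U \<Longrightarrow> phi x \<in> pts F" and phi_orbit: "x \<in> U \<Longrightarrow> \<Phi> x = orbit (sect x) (phi x)"
  using section_orbit[OF sect_in, of x] sect_proj[of x] by (auto simp: phi_def)

text \<open>In the charts of the associated bundle coming from \<tau>, the fibre coordinate of the
  section is the coordinate of \<open>phi\<close>.\<close>

lemma phi_smooth: assumes x: "x \<in> U" shows "smooth_at X F phi x"
  unfolding smooth_at_def
proof (intro ballI impI)
  fix c d assume c: "c \<in> atlas X" and d: "d \<in> atlas F" and xc: "x \<in> fst c" "phi x \<in> fst d"
  let ?a = "achart U \<tau> c d"
  have "\<Phi> x \<in> fst ?a" unfolding phi_orbit[OF x] sect_def by (rule achart_dom[OF triv x xc])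
  from smooth_atD[OF section_props(3)[OF Usub[OF x]] c achart_in[OF triv c d] xc(1) this]
  obtain V where V: "open V" "snd c x \<in> V" "V \<subseteq> snd c ` fst c" "\<And>y. y \<in> V \<Longrightarrow> \<Phi> (cinv c y) \<in> fst ?a" "smooth_on V (\<lambda>y. snd ?a (\<Phi> (cinv c y)))"
    by blast
  have k: "phi (cinv c y) \<in> fst d \<and> snd (snd ?a (\<Phi> (cinv c y))) = snd d (phi (cinv c y))" if y: "y \<in> V" for y
  proof -
    let ?q = "cinv c y"
    have q: "?q \<in> pts X" using chart_sub[OF cX c] cinv_in[of y c] V(3) y by blast
    obtain x' f' where x': "x' \<in> U" "x' \<in> fst c" "f' \<in> fst d" "\<Phi> ?q = orbit (\<tau> (x', gone K)) f'" using achart_domE[OF triv V(4)[OF y]] .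
    have f': "f' \<in> pts F" using chart_sub[OF cF d] x'(3) by blast
    have "?q = x'" using section_props(2)[OF q] unfolding x'(4) aproj_orbit[OF section_in[OF triv x'(1)]] section_proj[OF triv x'(1)] by (rule sym)
    then have "phi ?q = f'" unfolding phi_def sect_def x'(4) using fcomp_orbit_self[OF section_in[OF triv x'(1)] f'] by simp
    moreover have "snd (snd ?a (\<Phi> ?q)) = snd d f'" unfolding x'(4) achart_apply[OF triv x'(1) f'] by simp
    ultimately show ?thesis using x' by simp
  qed
  have "smooth_on V (\<lambda>y. snd d (phi (cinv c y)))"
    by (rule smooth_on_cong[OF V(1) _ smooth_on_snd[OF V(1) V(5)]]) (use k in blast)
  then show "\<exists>V. open V \<and> snd c x \<in> V \<and> V \<subseteq> snd c ` fst c \<and> (\<forall>y\<in>V. phi (cinv c y) \<in> fst d) \<and> smooth_on V (\<lambda>y. snd d (phi (cinv c y)))"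
    using V(1-3) k by blast
qed

lemma lconn_linear: "x \<in> U \<Longrightarrow> linear (lconn x)"
  unfolding lconn_def[abs_def]
  by (rule linear_compose[OF tmap_linear[OF cX cE sect_smooth Usub sect_in] A_linear[OF sect_in], unfolded comp_def])

lemma ldiff_linear: "x \<in> U \<Longrightarrow> linear (ldiff x)"
  unfolding ldiff_def[abs_def]
  by (rule linear_compose_add[OF tmap_linear[OF cX cF phi_smooth Usub phi_in] linear_compose[OF lconn_linear TL_linear[OF phi_in], unfolded comp_def]])

lemma hlift_sect:
  assumes x: "x \<in> U" shows "hlift X E A (sect x) v = tmap X E sect x v - V (sect x) (lconn x v)"
proof -
  have "tmap X X (\<lambda>x. x) x = tmap X X (\<lambda>x. proj E (sect x)) x"
    by (rule tmap_cong[OF cX cX triv_open[OF triv] x _ smooth_at_id[OF cX Usub[OF x]] Usub[OF x] Usub[OF x]]) (simp add: sect_proj)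
  moreover have "tmap X X (\<lambda>x. proj E (sect x)) x v = P (sect x) (tmap X E sect x v)"
    by (rule tmap_comp[where f = sect and g = "proj E", OF cX cE cX sect_smooth[OF x] smooth_proj Usub[OF x] sect_in[OF x] proj_in[OF sect_in[OF x]]])
  ultimately have "P (sect x) (tmap X E sect x v) = v" using tmap_id[OF cX Usub[OF x], of v] by simp
  then show ?thesis using hlift_of_proj[OF sect_in[OF x], of "tmap X E sect x v"] by (simp add: lconn_def)
qed

lemma tmap_section:
  assumes x: "x \<in> U"
  shows "tmap X AB \<Phi> x v = TE (sect x) (phi x) (tmap X E sect x v) + TF (sect x) (phi x) (tmap X F phi x v)"
proof -
  have "tmap X AB \<Phi> x = tmap X AB (\<lambda>x. orbit (sect x) (phi x)) x"
    by (rule tmap_cong[OF cX AB_charted triv_open[OF triv] x _ section_props(3)[OF Usub[OF x]] Usub[OF x] section_props(1)[OF Usub[OF x]]])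
       (rule phi_orbit)
  moreover have "tmap X AB (\<lambda>x. orbit (sect x) (phi x)) x v = TE (sect x) (phi x) (tmap X E sect x v) + TF (sect x) (phi x) (tmap X F phi x v)"
    by (rule tmap_two[where F = "\<lambda>e f. orbit e f", OF cX cE cF AB_charted smooth_orbit[OF sect_in[OF x] phi_in[OF x]]
          sect_smooth[OF x] sect_in[OF x] phi_smooth[OF x] phi_in[OF x] Usub[OF x] orbit_in[OF sect_in[OF x] phi_in[OF x]]])
  ultimately show ?thesis by simp
qed

lemma TP_section: assumes x: "x \<in> U" shows "TP (\<Phi> x) (tmap X AB \<Phi> x v) = v"
proof -
  note px = Usub[OF x]
  have "tmap X X (\<lambda>x. x) x = tmap X X (\<lambda>x. aproj E (\<Phi> x)) x"
    by (rule tmap_cong[OF cX cX openin_pts[OF cX] px _ smooth_at_id[OF cX px] px px]) (simp add: section_props)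
  moreover have "tmap X X (\<lambda>x. aproj E (\<Phi> x)) x v = TP (\<Phi> x) (tmap X AB \<Phi> x v)"
    by (rule tmap_comp[where f = \<Phi> and g = "aproj E", OF cX AB_charted cX section_props(3)[OF px] _ px section_props(1)[OF px]])
       (use smooth_aproj[OF sect_in[OF x] phi_in[OF x]] phi_orbit[OF x] section_props(2)[OF px] px in auto)
  ultimately show ?thesis using tmap_id[OF cX px, of v] by simp
qed

text \<open>The horizontal lift differs from the derivative of the local section by the vertical
  vector of the gauge potential. Removing the lift leaves the derivative of \<open>phi\<close> and
  that vertical vector, which \<open>TE_vertical\<close> moves to the fibre.\<close>

lemma valpha_section: assumes x: "x \<in> U" shows "valpha K F X E A (\<Phi> x) (tmap X AB \<Phi> x v) = TF (sect x) (phi x) (ldiff x v)"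
proof -
  note s = sect_in[OF x] and f = phi_in[OF x]
  have "valpha K F X E A (\<Phi> x) (tmap X AB \<Phi> x v) = tmap X AB \<Phi> x v - TE (sect x) (phi x) (hlift X E A (sect x) v)"
    using valpha_orbit[OF s f, of "tmap X AB \<Phi> x v"] TP_section[OF x, of v] unfolding phi_orbit[OF x, symmetric] by simp
  also have "\<dots> = TF (sect x) (phi x) (tmap X F phi x v) + TE (sect x) (phi x) (V (sect x) (lconn x v))"
    unfolding tmap_section[OF x] hlift_sect[OF x] by (simp add: linear_diff[OF TE_linear[OF s f]])
  also have "\<dots> = TF (sect x) (phi x) (ldiff x v)"
    unfolding TE_vertical[OF s f] ldiff_def by (simp add: linear_add[OF TF_linear[OF s f]])
  finally show ?thesis .
qed

lemma cov_d_section: "x \<in> U \<Longrightarrow> cov_d K F X E A \<Phi> x [v] = TF (sect x) (phi x) (ldiff x v)"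
  using valpha_section[of x v] by (simp add: cov_d_def)

lemma dbar_section:
  assumes x: "x \<in> U"
  shows "dbar K F X E A \<Phi> x [v] = TF (sect x) (phi x) ((1 / 2) *\<^sub>R (ldiff x v + acs F (phi x) (ldiff x (cstr X v))))"
proof -
  note s = sect_in[OF x] and f = phi_in[OF x]
  have 1: "vert_acs K F X E (\<Phi> x) (TF (sect x) (phi x) a) = TF (sect x) (phi x) (acs F (phi x) a)" for a
    unfolding phi_orbit[OF x] by (rule vertical_structures(3)[OF s f])
  show ?thesis unfolding dbar_def part01_def list.map cov_d_section[OF x] 1
    by (simp add: linear_add[OF TF_linear[OF s f]] linear_scale[OF TF_linear[OF s f]])
qed

lemma metric_cov_d:
  assumes x: "x \<in> U"
  shows "vert_metric K F X E (\<Phi> x) (cov_d K F X E A \<Phi> x [u]) (cov_d K F X E A \<Phi> x [v]) = symp F (phi x) [ldiff x u, acs F (phi x) (ldiff x v)]"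
  unfolding cov_d_section[OF x] using vertical_structures(1)[OF sect_in[OF x] phi_in[OF x]] phi_orbit[OF x] by simp

lemma metric_dbar:
  assumes x: "x \<in> U"
  shows "vert_metric K F X E (\<Phi> x) (dbar K F X E A \<Phi> x [u]) (dbar K F X E A \<Phi> x [u]) =
    symp F (phi x) [(1 / 2) *\<^sub>R (ldiff x u + acs F (phi x) (ldiff x (cstr X u))),
       acs F (phi x) ((1 / 2) *\<^sub>R (ldiff x u + acs F (phi x) (ldiff x (cstr X u))))]"
  unfolding dbar_section[OF x] using vertical_structures(1)[OF sect_in[OF x] phi_in[OF x]] phi_orbit[OF x] by simp

lemma pullback_chern_weil:
  assumes x: "x \<in> U"
  shows "pullback X AB \<Phi> (chern_weil_form K F X E A) x [u, v] =
     symp F (phi x) [ldiff x u, ldiff x v] - ip K (curv X E A (sect x) [u, v]) (mom F (phi x))"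
proof -
  note s = sect_in[OF x] and f = phi_in[OF x]
  have 1: "vert_symp K F X E (\<Phi> x) [TF (sect x) (phi x) a, TF (sect x) (phi x) b] = symp F (phi x) [a, b]" for a b
    unfolding phi_orbit[OF x] by (rule vertical_structures(2)[OF s f])
  have 2: "ip K (curv X E A (fst (rep (\<Phi> x))) [u, v]) (mom F (snd (rep (\<Phi> x)))) = ip K (curv X E A (sect x) [u, v]) (mom F (phi x))"
    unfolding phi_orbit[OF x] by (rule curvature_moment_pairing[OF s f])
  show ?thesis unfolding pullback_def chern_weil_form_def list.map valpha_section[OF x] TP_section[OF x] 1 2 ..
qed

text \<open>The frame over \<open>x\<close> is an arbitrary choice, unrelated to frames at nearby
  points. A single group element relates both the curvature and the moment map to their values in
  the smooth section.\<close>

lemma curvature_section: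
  assumes x: "x \<in> U"
  shows "\<exists>h\<in>pts K. (\<forall>u v. curvature X E A x [u, v] = Ad K h (curv X E A (sect x) [u, v])) \<and> mom_section F E \<Phi> x = Ad K h (mom F (phi x))"
proof -
  note s = sect_in[OF x] and f = phi_in[OF x] and fr = frame_props[OF Usub[OF x]]
  obtain h where h: "h \<in> pts K" "frame E x = ract E (sect x) h" using fibre_transitive[OF s, of "frame E x"] fr sect_proj[OF x] by metis
  have "curvature X E A x [u, v] = Ad K (ginv K h) (curv X E A (sect x) [u, v])" for u v
    unfolding curvature_def h(2) by (rule curv_ract[OF s h(1)])
  moreover have "mom_section F E \<Phi> x = Ad K (ginv K h) (mom F (phi x))"
    unfolding mom_section_def h(2) unfolding phi_orbit[OF x] fcomp_orbit[OF s f h(1)] by (rule mom_equiv[OF inv_in[OF h(1)] f])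
  ultimately show ?thesis using inv_in[OF h(1)] by blast
qed

end

end

section \<open>Continuity in local coordinates\<close>

lemma continuous_on_local:
  fixes S :: "'a::real_normed_vector set" and f :: "'a \<Rightarrow> 'b::real_normed_vector"
  shows "(\<And>x. x \<in> S \<Longrightarrow> \<exists>U. open U \<and> x \<in> U \<and> continuous_on U f) \<Longrightarrow> continuous_on S f"
  using Ck_on_local[of S 0 f] by simp

lemma continuous_on_bilinear_apply:
  fixes L :: "'a::topological_space \<Rightarrow> 'v::real_normed_vector \<Rightarrow> 'v \<Rightarrow> 'w::real_normed_vector"
  assumes B: "is_basis (B :: 'v set)" and L: "\<And>y. y \<in> S \<Longrightarrow> bilinear (L y)"
    and c: "\<And>u v. continuous_on S (\<lambda>y. L y u v)" and a: "continuous_on S a" and b: "continuous_on S b"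
  shows "continuous_on S (\<lambda>y. L y (a y) (b y))"
proof -
  have 1: "continuous_on S (\<lambda>y. L y (a y) v)" for v
  proof (rule continuous_on_linear_apply[OF B, where L = "\<lambda>y u. L y u v" and w = a])
    show "linear (\<lambda>u. L y u v)" if "y \<in> S" for y using L[OF that] by (simp add: bilinear_def)
  qed (rule c a)+
  show ?thesis
  proof (rule continuous_on_linear_apply[OF B, where L = "\<lambda>y. L y (a y)" and w = b])
    show "linear (L y (a y))" if "y \<in> S" for y using L[OF that] by (simp add: bilinear_def)
  qed (rule 1 b)+
qed

lemma from_chart_self: "charted M \<Longrightarrow> p \<in> pts M \<Longrightarrow> from_chart M (chart_at M p) p u = u"
  using tmap_id[of M p u] by (simp add: tmap_def from_chart_def comp_def)

lemma bilinear_from_chart: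
  assumes M: "charted M" and c: "c \<in> atlas M" "p \<in> fst c" and h: "bilinear h"
  shows "bilinear (\<lambda>u v. h (from_chart M c p u) (from_chart M c p v))"
  using h from_chart_linear[OF M c] unfolding bilinear_def by (auto intro: linear_compose[unfolded comp_def])

text \<open>The partial differential at a fixed \<open>q\<close>, written in a fixed chart of the
  target, is read off from a jointly smooth coordinate expression and so depends continuously on the
  first variable. It is applied to both actions of the group, at the unit.\<close>

lemma partial_derivative_continuous:
  fixes M :: "('a, 'v::real_normed_vector, 'y) mfd_scheme" and N :: "('b, 'w::real_normed_vector, 'z) mfd_scheme"
    and Q :: "('d, 'u::real_normed_vector, 't) mfd_scheme"
  assumes M: "charted M" and N: "charted N" and Q: "charted Q" and q: "q \<in> pts N"
    and G: "\<And>p. p \<in> pts M \<Longrightarrow> smooth_at (mprod M N) Q (\<lambda>(p, q). G p q) (p, q)" "\<And>p. p \<in> pts M \<Longrightarrow> G p q \<in> pts Q"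
    and c: "c \<in> atlas M" "p \<in> fst c" and e: "e \<in> atlas Q" "G p q \<in> fst e"
  shows "\<exists>V D. open V \<and> snd c p \<in> V \<and> V \<subseteq> snd c ` fst c \<and> (\<forall>s. continuous_on V (\<lambda>y. D y s)) \<and>
     (\<forall>y\<in>V. linear (D y) \<and> (\<forall>s. tmap N Q (G (cinv c y)) q s = from_chart Q e (G (cinv c y) q) (D y s)))"
proof -
  define d where "d = chart_at N q"
  have d: "d \<in> atlas N" "q \<in> fst d" using chart_at_props[OF N q] by (auto simp: d_def)
  obtain B :: "'v set" where B: "is_basis B" using charted_basis[OF M] .
  obtain C :: "'w set" where C: "is_basis C" using charted_basis[OF N] .
  have pM: "p \<in> pts M" using chart_sub[OF M c(1)] c(2) by auto
  have cd: "pch c d \<in> atlas (mprod M N)" unfolding atlas_mprod using c d by blast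
  let ?G = "\<lambda>w. snd e (case cinv (pch c d) w of (p, q) \<Rightarrow> G p q)"
  have "\<exists>V. open V \<and> snd (pch c d) (p, q) \<in> V \<and> V \<subseteq> snd (pch c d) ` fst (pch c d) \<and>
      (\<forall>y\<in>V. (case cinv (pch c d) y of (p, q) \<Rightarrow> G p q) \<in> fst e) \<and> smooth_on V ?G"
    by (rule smooth_atD[OF G(1)[OF pM] cd e(1)]) (use c d e in auto)
  then obtain V0 where V0: "open V0" "(snd c p, snd d q) \<in> V0" "V0 \<subseteq> snd c ` fst c \<times> snd d ` fst d"
      "\<And>y. y \<in> V0 \<Longrightarrow> (case cinv (pch c d) y of (p, q) \<Rightarrow> G p q) \<in> fst e" "smooth_on V0 ?G"
    unfolding pch_simps pch_image by blast
  let ?z = "snd d q"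
  define V where "V = (\<lambda>y. (y, ?z)) -` V0"
  have oV: "open V" unfolding V_def by (rule open_vimage[OF V0(1)]) (intro continuous_intros)
  have Vc: "V \<subseteq> snd c ` fst c" unfolding V_def using V0(3) by auto
  define D where "D = (\<lambda>y s. frechet_derivative ?G (at (y, ?z)) (0, s))"
  have "continuous_on V (\<lambda>y. D y s)" for s
    unfolding D_def
    by (rule continuous_on_compose2[OF smooth_on_continuous[OF smooth_on_derivative[OF V0(5)]]])
       (auto simp: V_def intro!: continuous_intros)
  moreover have "linear (D y) \<and> (\<forall>s. tmap N Q (G (cinv c y)) q s = from_chart Q e (G (cinv c y) q) (D y s))" if y: "y \<in> V" for y
  proof -
    have yc: "y \<in> snd c ` fst c" using Vc y by auto
    let ?p = "cinv c y"
    have p: "?p \<in> pts M" using cinv_in[OF yc] chart_sub[OF M c(1)] by auto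
    have ci: "cinv (pch c d) (y, z) = (?p, cinv d z)" if "z \<in> snd d ` fst d" for z
      by (rule cinv_pch[OF chart_inj[OF M c(1)] chart_inj[OF N d(1)] yc that])
    have cz: "cinv d ?z = q" using chart_inj[OF N d(1)] d(2) by simp
    have zd: "?z \<in> snd d ` fst d" using d by simp
    have Ge: "G ?p q \<in> fst e" using V0(4)[of "(y, ?z)"] y ci[OF zd] cz by (simp add: V_def)
    have DG: "(?G has_derivative frechet_derivative ?G (at (y, ?z))) (at (y, ?z))"
      by (rule smooth_on_has_derivative[OF V0(5)]) (use y in \<open>simp add: V_def\<close>)
    have D1: "((\<lambda>z. ?G (y, z)) has_derivative D y) (at ?z)" unfolding D_def
      by (rule has_derivative_compose[where f = "\<lambda>z. (y, z)" and g = ?G, OF _ DG]) (auto intro!: derivative_eq_intros)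
    have D2: "((\<lambda>z. snd e (G ?p (cinv d z))) has_derivative D y) (at ?z)"
      by (rule has_derivative_transform_within_open[OF D1 chart_image_open[OF N d(1)] zd]) (simp add: ci)
    have sG: "smooth_at N Q (G ?p) q"
      using smooth_at_two[where F = G and f = "\<lambda>_. ?p" and g = "\<lambda>q. q", OF N M N G(1)[OF p] smooth_at_const[OF N] p smooth_at_id[OF N q] q] by simp
    have "tmap N Q (G ?p) q s = tmap vec_mfd Q (\<lambda>z. G ?p (cinv d z)) ?z s" for s
      using tmap_from_chart[OF N Q sG d G(2)[OF p], of s] from_chart_self[OF N q, of s] unfolding d_def by simp
    also have "\<dots> s = from_chart Q e (G ?p (cinv d ?z)) (frechet_derivative (\<lambda>z. snd e (G ?p (cinv d z))) (at ?z) s)" for s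
    proof (rule tmap_vec_chart[where s = "\<lambda>z. G ?p (cinv d z)", OF Q C _ e(1)])
      show "smooth_at vec_mfd Q (\<lambda>z. G ?p (cinv d z)) ?z"
        by (rule smooth_at_comp[where g = "G ?p", OF charted_vec[OF C] N smooth_at_cinv[OF N d(1) zd]]) (use sG q cz in auto)
    qed (use Ge cz in simp)
    finally show ?thesis using frechet_derivative_eqI[OF D2] has_derivative_linear[OF D2] cz by simp
  qed
  moreover have "snd c p \<in> V" using V0(2) by (simp add: V_def)
  ultimately show ?thesis using oV Vc by blast
qed

context gauge
begin

lemma smooth_act_swap:
  assumes "h \<in> pts K" "f \<in> pts F"
  shows "smooth_at (mprod F K) F (\<lambda>(f, h). act F h f) (f, h)"
proof -
  have "smooth_at (mprod F K) F (\<lambda>z. act F (snd z) (fst z)) (f, h)"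
    by (rule smooth_at_two[where F = "\<lambda>h f. act F h f" and f = snd and g = fst,
        OF charted_mprod[OF cF cK] cK cF _ smooth_at_snd[OF cF cK] _ smooth_at_fst[OF cF cK]])
       (use assms smooth_act in simp_all)
  then show ?thesis by (simp add: case_prod_unfold)
qed

context
  fixes U \<tau> c assumes triv: "local_triv K X E U \<tau>" and c: "c \<in> atlas X"
begin

abbreviation "Y \<equiv> snd c ` (U \<inter> fst c)"
abbreviation "q y \<equiv> cinv c y"
abbreviation "sc \<equiv> sect \<tau>"
abbreviation "ph \<equiv> phi \<tau>"
abbreviation "fc y \<equiv> from_chart X c (q y)"

lemma Y_point: assumes "y \<in> Y" shows "q y \<in> U" "q y \<in> fst c" "snd c (q y) = y"
  using assms chart_inj[OF cX c] by auto

lemma Y_open: "open Y" using triv_open[OF triv] c openin_mtop[OF cX] by blast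

text \<open>With respect to the charts \<open>cE\<close> of the total space and \<open>d\<close> of the fibre, \<open>sh\<close>, \<open>p\<close>, \<open>a\<close>, \<open>hh\<close>
  and \<open>Dh\<close> are the coordinate expressions of the local section, the fibre component of \<open>\<Phi>\<close>, the
  connection form, the horizontal lift and the covariant derivative.\<close>

lemma local_coordinates:
  assumes y0: "y0 \<in> Y"
  shows "\<exists>W cE d sh p a hh Dh. open W \<and> y0 \<in> W \<and> W \<subseteq> Y \<and> cE \<in> atlas E \<and> d \<in> atlas F \<and>
     continuous_on W sh \<and> continuous_on W p \<and>
     (\<forall>y\<in>W. sc (q y) \<in> fst cE \<and> sh y = snd cE (sc (q y)) \<and> ph (q y) \<in> fst d \<and> p y = snd d (ph (q y))) \<and>
     (\<forall>u. continuous_on W (\<lambda>y. hh y u)) \<and> (\<forall>u. continuous_on W (\<lambda>y. Dh y u)) \<and>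
     (\<forall>y\<in>W. \<forall>u. lconn \<tau> (q y) (fc y u) = a y u) \<and>
     (\<forall>y\<in>W. \<forall>u. hlift X E A (sc (q y)) (fc y u) = from_chart E cE (sc (q y)) (hh y u)) \<and>
     (\<forall>y\<in>W. \<forall>u. ldiff \<tau> (q y) (fc y u) = from_chart F d (ph (q y)) (Dh y u))"
proof -
  note [simp] = Y_point
  let ?x0 = "q y0"
  obtain B :: "'v set" where B: "is_basis B" using charted_basis[OF cX] .
  obtain BE :: "'b set" where BE: "is_basis BE" using charted_basis[OF cE] .
  obtain BK :: "'l set" where BK: "is_basis BK" using charted_basis[OF cK] .
  note vB = charted_vec[OF B]
  have x0: "?x0 \<in> U" "?x0 \<in> fst c" "snd c ?x0 = y0" using Y_point[OF y0] .
  define cE' d where "cE' = chart_at E (sc ?x0)" and "d = chart_at F (ph ?x0)"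
  have e: "cE' \<in> atlas E" "sc ?x0 \<in> fst cE'" using chart_at_props[OF cE sect_in[OF triv x0(1)]] by (auto simp: cE'_def)
  have d: "d \<in> atlas F" "ph ?x0 \<in> fst d" using chart_at_props[OF cF phi_in[OF triv x0(1)]] by (auto simp: d_def)
  obtain V1 where V1: "open V1" "y0 \<in> V1" "\<And>y. y \<in> V1 \<Longrightarrow> sc (q y) \<in> fst cE'" "smooth_on V1 (\<lambda>y. snd cE' (sc (q y)))"
    using smooth_atD[OF sect_smooth[OF triv x0(1)] c e(1) x0(2) e(2)] unfolding x0(3) by blast
  obtain V2 where V2: "open V2" "y0 \<in> V2" "\<And>y. y \<in> V2 \<Longrightarrow> ph (q y) \<in> fst d" "smooth_on V2 (\<lambda>y. snd d (ph (q y)))"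
    using smooth_atD[OF phi_smooth[OF triv x0(1)] c d(1) x0(2) d(2)] unfolding x0(3) by blast
  define sh p where "sh = (\<lambda>y. snd cE' (sc (q y)))" and "p = (\<lambda>y. snd d (ph (q y)))"
  \<comment> \<open>\<open>Vh\<close>, and \<open>Lh\<close> in the next step, are the coordinate
    expressions of the infinitesimal actions on \<open>E\<close> and on \<open>F\<close>.\<close>
  obtain V3 Vh where V3: "open V3" "snd cE' (sc ?x0) \<in> V3" "V3 \<subseteq> snd cE' ` fst cE'" "\<And>s. continuous_on V3 (\<lambda>z. Vh z s)"
    "\<And>z. z \<in> V3 \<Longrightarrow> linear (Vh z)"
    "\<And>z s. z \<in> V3 \<Longrightarrow> tmap K E (ract E (cinv cE' z)) (gone K) s = from_chart E cE' (ract E (cinv cE' z) (gone K)) (Vh z s)"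
    using partial_derivative_continuous[where G = "ract E", OF cE cK cE one_in smooth_ract _ e e(1)]
      ract_in[OF _ one_in] e ract_one[OF sect_in[OF triv x0(1)]]
    by simp (elim exE conjE, rule that, assumption+, simp_all)
  obtain V4 Lh where V4: "open V4" "snd d (ph ?x0) \<in> V4" "V4 \<subseteq> snd d ` fst d" "\<And>s. continuous_on V4 (\<lambda>z. Lh z s)"
    "\<And>z. z \<in> V4 \<Longrightarrow> linear (Lh z)"
    "\<And>z s. z \<in> V4 \<Longrightarrow> tmap K F (\<lambda>h. act F h (cinv d z)) (gone K) s = from_chart F d (act F (gone K) (cinv d z)) (Lh z s)"
    using partial_derivative_continuous[where G = "\<lambda>f h. act F h f", OF cF cK cF one_in smooth_act_swap[OF one_in] _ d d(1)]
      act_in[OF one_in] d act_one[OF phi_in[OF triv x0(1)]]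
    by simp (elim exE conjE, rule that, assumption+, simp_all)
  define V12 where "V12 = V1 \<inter> V2 \<inter> Y"
  have o12: "open V12" unfolding V12_def using V1 V2 Y_open by auto
  have ssh: "smooth_on V12 sh" and sp: "smooth_on V12 p"
    unfolding sh_def p_def V12_def by (rule smooth_on_mono[OF V1(4)], blast, rule smooth_on_mono[OF V2(4)], blast)
  define W where "W = (V12 \<inter> sh -` V3) \<inter> (V12 \<inter> p -` V4)"
  have oW: "open W" unfolding W_def
    using continuous_open_preimage[OF smooth_on_continuous[OF ssh] o12 V3(1)]
      continuous_open_preimage[OF smooth_on_continuous[OF sp] o12 V4(1)] by blast
  have yW: "y0 \<in> W" using V1(2) V2(2) V3(2) V4(2) y0 by (simp add: W_def V12_def sh_def p_def)
  have WY: "W \<subseteq> Y" and WV: "W \<subseteq> V12" by (auto simp: W_def V12_def)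
  have csh: "continuous_on W sh" and cp: "continuous_on W p"
    using continuous_on_subset[OF smooth_on_continuous[OF ssh] WV] continuous_on_subset[OF smooth_on_continuous[OF sp] WV] .
  define Ds Dp where "Ds = (\<lambda>y. frechet_derivative sh (at y))" and "Dp = (\<lambda>y. frechet_derivative p (at y))"
  have cDs: "continuous_on W (\<lambda>y. Ds y u)" and cDp: "continuous_on W (\<lambda>y. Dp y u)" for u
    unfolding Ds_def Dp_def
    using continuous_on_subset[OF smooth_on_continuous[OF smooth_on_derivative[OF ssh]] WV]
      continuous_on_subset[OF smooth_on_continuous[OF smooth_on_derivative[OF sp]] WV] .
  have pt: "q y \<in> U" "q y \<in> fst c" "snd c (q y) = y" "sc (q y) \<in> fst cE'" "ph (q y) \<in> fst d" "sh y \<in> V3" "p y \<in> V4"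
    "cinv cE' (sh y) = sc (q y)" "cinv d (p y) = ph (q y)" "y \<in> snd c ` fst c" "sc (q y) \<in> pts E" "ph (q y) \<in> pts F"
    if y: "y \<in> W" for y
  proof -
    have y': "y \<in> V1" "y \<in> V2" "y \<in> Y" using y by (auto simp: W_def V12_def)
    show a: "q y \<in> U" "q y \<in> fst c" "snd c (q y) = y" using Y_point[OF y'(3)] .
    show b: "sc (q y) \<in> fst cE'" "ph (q y) \<in> fst d" using V1(3)[OF y'(1)] V2(3)[OF y'(2)] .
    show "sh y \<in> V3" "p y \<in> V4" using y by (auto simp: W_def)
    show "cinv cE' (sh y) = sc (q y)" "cinv d (p y) = ph (q y)"
      unfolding sh_def p_def using cinv_snd[OF chart_inj[OF cE e(1)] b(1)] cinv_snd[OF chart_inj[OF cF d(1)] b(2)] .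
    show "y \<in> snd c ` fst c" using a by (metis imageI)
    show "sc (q y) \<in> pts E" "ph (q y) \<in> pts F" using sect_in[OF triv a(1)] phi_in[OF triv a(1)] .
  qed
  have ts: "tmap X E sc (q y) (fc y u) = from_chart E cE' (sc (q y)) (Ds y u)" if y: "y \<in> W" for y u
  proof -
    note pt = pt[OF y]
    have "smooth_at vec_mfd E (\<lambda>y. sc (q y)) y"
      by (rule smooth_at_comp[where g = sc, OF vB cX smooth_at_cinv[OF cX c pt(10)] sect_smooth[OF triv pt(1)] Usub[OF triv pt(1)]])
    from tmap_vec_chart[OF cE B this e(1) pt(4), of u]
    show ?thesis using tmap_from_chart[OF cX cE sect_smooth[OF triv pt(1)] c pt(2,11), of u] unfolding pt(3) Ds_def sh_def by simp
  qed
  have tp: "tmap X F ph (q y) (fc y u) = from_chart F d (ph (q y)) (Dp y u)" if y: "y \<in> W" for y u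
  proof -
    note pt = pt[OF y]
    have "smooth_at vec_mfd F (\<lambda>y. ph (q y)) y"
      by (rule smooth_at_comp[where g = ph, OF vB cX smooth_at_cinv[OF cX c pt(10)] phi_smooth[OF triv pt(1)] Usub[OF triv pt(1)]])
    from tmap_vec_chart[OF cF B this d(1) pt(5), of u]
    show ?thesis using tmap_from_chart[OF cX cF phi_smooth[OF triv pt(1)] c pt(2,12), of u] unfolding pt(3) Dp_def p_def by simp
  qed
  define a where "a = (\<lambda>y u. loc E cE' A (sh y) [Ds y u])"
  have ca: "continuous_on W (\<lambda>y. a y u)" for u
    unfolding a_def
  proof (rule continuous_on_linear_apply[OF BE, where L = "\<lambda>y w. loc E cE' A (sh y) [w]" and w = "\<lambda>y. Ds y u"])
    show "linear (\<lambda>w. loc E cE' A (sh y) [w])" if "y \<in> W" for y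
      by (rule loc_one_form_linear[OF cE A_alt e(1)]) (use pt(6)[OF that] V3(3) in auto)
    show "continuous_on W (\<lambda>y. loc E cE' A (sh y) [v])" for v
      by (rule continuous_on_compose2[OF smooth_on_continuous[of "snd cE' ` fst cE'"] csh])
         (use A_smooth e(1) pt(6) V3(3) in \<open>auto simp: smooth_tensor_def\<close>)
  qed (rule cDs)
  have la: "lconn \<tau> (q y) (fc y u) = a y u" if y: "y \<in> W" for y u
    unfolding lconn_def[OF triv] a_def loc_def ts[OF y] by (simp add: pt(8)[OF y])
  define hh where "hh = (\<lambda>y u. Ds y u - Vh (sh y) (a y u))"
  define Dh where "Dh = (\<lambda>y u. Dp y u + Lh (p y) (a y u))"
  have "continuous_on W (\<lambda>y. Vh (sh y) (a y u))" for u
  proof (rule continuous_on_linear_apply[OF BK, where L = "\<lambda>y. Vh (sh y)" and w = "\<lambda>y. a y u"])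
    show "continuous_on W (\<lambda>y. Vh (sh y) v)" for v
      by (rule continuous_on_compose2[OF V3(4) csh]) (use pt(6) in auto)
  qed (use V3(5) pt(6) ca in auto)
  then have chh: "continuous_on W (\<lambda>y. hh y u)" for u unfolding hh_def by (intro continuous_on_diff cDs)
  have "continuous_on W (\<lambda>y. Lh (p y) (a y u))" for u
  proof (rule continuous_on_linear_apply[OF BK, where L = "\<lambda>y. Lh (p y)" and w = "\<lambda>y. a y u"])
    show "continuous_on W (\<lambda>y. Lh (p y) v)" for v
      by (rule continuous_on_compose2[OF V4(4) cp]) (use pt(7) in auto)
  qed (use V4(5) pt(7) ca in auto)
  then have cDh: "continuous_on W (\<lambda>y. Dh y u)" for u unfolding Dh_def by (intro continuous_on_add cDp)
  have lh: "hlift X E A (sc (q y)) (fc y u) = from_chart E cE' (sc (q y)) (hh y u)" if y: "y \<in> W" for y u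
    using V3(6)[OF pt(6)[OF y], of "a y u"] linear_diff[OF from_chart_linear[OF cE e(1) pt(4)[OF y]]]
    unfolding hlift_sect[OF triv pt(1)[OF y]] ts[OF y] la[OF y] hh_def pt(8)[OF y] ract_one[OF pt(11)[OF y]] by simp
  have lD: "ldiff \<tau> (q y) (fc y u) = from_chart F d (ph (q y)) (Dh y u)" if y: "y \<in> W" for y u
    using V4(6)[OF pt(7)[OF y], of "a y u"] linear_add[OF from_chart_linear[OF cF d(1) pt(5)[OF y]]]
    unfolding ldiff_def[OF triv] tp[OF y] la[OF y] Dh_def pt(9)[OF y] act_one[OF pt(12)[OF y]] by simp
  show ?thesis
    by (intro exI[of _ W] exI[of _ cE'] exI[of _ d] exI[of _ sh] exI[of _ p] exI[of _ a] exI[of _ hh] exI[of _ Dh])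
       (use oW yW WY e(1) d(1) csh cp chh cDh la lh lD pt(4,5) in \<open>simp add: sh_def p_def\<close>)
qed

lemma continuous_mom: "continuous_on Y (\<lambda>y. mom F (ph (q y)))"
proof (rule continuous_on_local)
  fix y0 assume "y0 \<in> Y"
  from local_coordinates[OF this] obtain W d p where W: "open W" "y0 \<in> W" "d \<in> atlas F" "continuous_on W p"
    "\<And>y. y \<in> W \<Longrightarrow> ph (q y) \<in> fst d \<and> p y = snd d (ph (q y))"
    by (elim exE conjE) (rule that, assumption+, simp)
  have "continuous_on (snd d ` fst d) (\<lambda>z. mom F (cinv d z))"
    using mom_smooth W(3) unfolding smooth_map_def by (intro smooth_on_continuous) (simp add: comp_def)
  then have "continuous_on W (\<lambda>y. mom F (cinv d (p y)))"
    by (rule continuous_on_compose2[OF _ W(4)]) (use W(5) in auto)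
  then have "continuous_on W (\<lambda>y. mom F (ph (q y)))"
    by (rule continuous_on_eq) (use W(5) chart_inj[OF cF W(3)] in auto)
  then show "\<exists>W. open W \<and> y0 \<in> W \<and> continuous_on W (\<lambda>y. mom F (ph (q y)))" using W by blast
qed

text \<open>The tensor \<theta> is kept general because both the symplectic form and the associated
  metric are needed. In the chart \<open>d\<close> the claim becomes continuity of a bilinear form
  on the varying vectors \<open>Dh\<close>.\<close>

lemma continuous_fibre_tensor:
  assumes \<theta>: "smooth_tensor F 2 \<theta>" "\<And>f. f \<in> pts F \<Longrightarrow> bilinear (\<lambda>a b. \<theta> f [a, b])"
  shows "continuous_on Y (\<lambda>y. \<theta> (ph (q y)) [ldiff \<tau> (q y) (fc y u), ldiff \<tau> (q y) (fc y v)] :: real)"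
proof (rule continuous_on_local)
  fix y0 assume "y0 \<in> Y"
  from local_coordinates[OF this] obtain W d p Dh where W: "open W" "y0 \<in> W" "W \<subseteq> Y" "d \<in> atlas F" "continuous_on W p"
    "\<And>y. y \<in> W \<Longrightarrow> ph (q y) \<in> fst d \<and> p y = snd d (ph (q y))" "\<And>u. continuous_on W (\<lambda>y. Dh y u)"
    "\<And>y u. y \<in> W \<Longrightarrow> ldiff \<tau> (q y) (fc y u) = from_chart F d (ph (q y)) (Dh y u)"
    by (elim exE conjE) (rule that, assumption+, simp_all)
  obtain C :: "'w set" where C: "is_basis C" using charted_basis[OF cF] .
  have k: "cinv d (p y) = ph (q y)" if "y \<in> W" for y using W(6)[OF that] chart_inj[OF cF W(4)] by simp
  have "continuous_on W (\<lambda>y. loc F d \<theta> (p y) [Dh y u, Dh y v])"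
  proof (rule continuous_on_bilinear_apply[OF C, where L = "\<lambda>y a b. loc F d \<theta> (p y) [a, b]" and a = "\<lambda>y. Dh y u" and b = "\<lambda>y. Dh y v"])
    show "bilinear (\<lambda>a b. loc F d \<theta> (p y) [a, b])" if y: "y \<in> W" for y
      unfolding loc_def list.map k[OF y]
      using bilinear_from_chart[OF cF W(4) _ \<theta>(2)] W(6)[OF y] chart_sub[OF cF W(4)] by blast
    show "continuous_on W (\<lambda>y. loc F d \<theta> (p y) [a, b])" for a b
      by (rule continuous_on_compose2[OF smooth_on_continuous[of "snd d ` fst d"] W(5)])
         (use \<theta>(1) W(4,6) in \<open>auto simp: smooth_tensor_def\<close>)
  qed (rule W(7))+
  then have "continuous_on W (\<lambda>y. \<theta> (ph (q y)) [ldiff \<tau> (q y) (fc y u), ldiff \<tau> (q y) (fc y v)])"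
    by (rule continuous_on_eq) (simp add: W(8) loc_def k)
  then show "\<exists>W. open W \<and> y0 \<in> W \<and> continuous_on W (\<lambda>y. \<theta> (ph (q y)) [ldiff \<tau> (q y) (fc y u), ldiff \<tau> (q y) (fc y v)])" using W by blast
qed

text \<open>By \<open>ext_d_chart\<close> the exterior derivative is computed in one chart of the
  total space while the point moves; its coefficients and the coordinates of the horizontal lifts
  are then continuous.\<close>

lemma continuous_curv: "continuous_on Y (\<lambda>y. curv X E A (sc (q y)) [fc y u, fc y v])"
proof (rule continuous_on_local)
  fix y0 assume "y0 \<in> Y"
  from local_coordinates[OF this] obtain W cE' sh hh where W: "open W" "y0 \<in> W" "W \<subseteq> Y" "cE' \<in> atlas E" "continuous_on W sh"
    "\<And>y. y \<in> W \<Longrightarrow> sc (q y) \<in> fst cE' \<and> sh y = snd cE' (sc (q y))" "\<And>u. continuous_on W (\<lambda>y. hh y u)"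
    "\<And>y u. y \<in> W \<Longrightarrow> hlift X E A (sc (q y)) (fc y u) = from_chart E cE' (sc (q y)) (hh y u)"
    by (elim exE conjE) (rule that, assumption+, simp_all)
  obtain C :: "'b set" where C: "is_basis C" using charted_basis[OF cE] .
  have "continuous_on W (\<lambda>y. ext_d E 1 A (sc (q y)) [from_chart E cE' (sc (q y)) (hh y u), from_chart E cE' (sc (q y)) (hh y v)])"
  proof (rule continuous_on_bilinear_apply[OF C, where a = "\<lambda>y. hh y u" and b = "\<lambda>y. hh y v"
        and L = "\<lambda>y a b. ext_d E 1 A (sc (q y)) [from_chart E cE' (sc (q y)) a, from_chart E cE' (sc (q y)) b]"])
    show "bilinear (\<lambda>a b. ext_d E 1 A (sc (q y)) [from_chart E cE' (sc (q y)) a, from_chart E cE' (sc (q y)) b])" if y: "y \<in> W" for y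
      by (rule bilinear_from_chart[OF cE W(4) _ ext_d_alternating(1)[OF cE A_alt A_smooth]])
         (use W(6)[OF y] chart_sub[OF cE W(4)] in blast)+
    show "continuous_on W (\<lambda>y. ext_d E 1 A (sc (q y)) [from_chart E cE' (sc (q y)) a, from_chart E cE' (sc (q y)) b])" for a b
    proof (rule continuous_on_eq)
      have s: "smooth_on (snd cE' ` fst cE') (\<lambda>z. loc E cE' A z [w])" for w using A_smooth W(4) by (simp add: smooth_tensor_def)
      have cc: "continuous_on W (\<lambda>y. frechet_derivative (\<lambda>z. loc E cE' A z [w]) (at (sh y)) w')" for w w'
        by (rule continuous_on_compose2[OF smooth_on_continuous[OF smooth_on_derivative[OF s]] W(5)]) (use W(6) in auto)
      show "continuous_on W (\<lambda>y. frechet_derivative (\<lambda>z. loc E cE' A z [b]) (at (sh y)) a - frechet_derivative (\<lambda>z. loc E cE' A z [a]) (at (sh y)) b)"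
        by (intro continuous_on_diff cc)
      show "frechet_derivative (\<lambda>z. loc E cE' A z [b]) (at (sh y)) a - frechet_derivative (\<lambda>z. loc E cE' A z [a]) (at (sh y)) b =
        ext_d E 1 A (sc (q y)) [from_chart E cE' (sc (q y)) a, from_chart E cE' (sc (q y)) b]" if y: "y \<in> W" for y
        using ext_d_chart[OF cE A_alt A_smooth W(4), of "sc (q y)" a b] W(6)[OF y] by simp
    qed
  qed (rule W(7))+
  then have "continuous_on W (\<lambda>y. curv X E A (sc (q y)) [fc y u, fc y v])"
    by (rule continuous_on_eq) (simp add: W(8) curv_def)
  then show "\<exists>W. open W \<and> y0 \<in> W \<and> continuous_on W (\<lambda>y. curv X E A (sc (q y)) [fc y u, fc y v])" using W by blast
qed

end

end

section \<open>Pointwise identities\<close>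

lemma bilinear_compose: "bilinear m \<Longrightarrow> linear A \<Longrightarrow> linear B \<Longrightarrow> bilinear (\<lambda>a b. m (A a) (B b))"
  unfolding bilinear_def by (auto intro: linear_compose[unfolded comp_def])

lemma mlin_pair:
  assumes "mlin \<alpha>" shows "linear (\<lambda>u. \<alpha> [u, v])" "linear (\<lambda>u. \<alpha> [v, u])"
  using bilinear_pair[OF assms] by (auto simp: bilinear_def)

text \<open>Keeping four arguments apart makes the expression bilinear in each repeated pair, so the
  two basis indices can be changed one after the other.\<close>

lemma (in onb_space) trace_invariant2:
  fixes Q :: "'v \<Rightarrow> 'v \<Rightarrow> 'v \<Rightarrow> 'v \<Rightarrow> 'w::real_vector"
  assumes Q1: "\<And>v v'. bilinear (\<lambda>u u'. Q u u' v v')" and Q2: "\<And>u u'. bilinear (\<lambda>v v'. Q u u' v v')"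
    and e: "orthonormal g N e" and f: "orthonormal g N f"
  shows "(\<Sum>i<N. \<Sum>j<N. Q (f i) (f i) (f j) (f j)) = (\<Sum>i<N. \<Sum>j<N. Q (e i) (e i) (e j) (e j))"
proof -
  have "(\<Sum>i<N. \<Sum>j<N. Q (f i) (f i) (f j) (f j)) = (\<Sum>i<N. \<Sum>j<N. Q (f i) (f i) (e j) (e j))"
    by (rule sum.cong[OF refl], rule trace_invariant[OF Q2 e f])
  also have "\<dots> = (\<Sum>j<N. \<Sum>i<N. Q (f i) (f i) (e j) (e j))" by (rule sum.swap)
  also have "\<dots> = (\<Sum>j<N. \<Sum>i<N. Q (e i) (e i) (e j) (e j))"
    by (rule sum.cong[OF refl], rule trace_invariant[OF Q1 e f])
  also have "\<dots> = (\<Sum>i<N. \<Sum>j<N. Q (e i) (e i) (e j) (e j))" by (rule sum.swap)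
  finally show ?thesis .
qed

text \<open>\<open>form_inner\<close> sums over increasing indices; half the sum over all ordered
  pairs is the form to which trace arguments apply.\<close>

lemma sum_increasing_pairs:
  fixes f :: "nat \<Rightarrow> nat \<Rightarrow> real"
  assumes f: "\<And>i j. f i j = f j i" "\<And>i. f i i = 0"
  shows "(\<Sum>is | length is = 2 \<and> sorted_wrt (<) is \<and> set is \<subseteq> {..<N}. f (is ! 0) (is ! 1)) = (1 / 2) * (\<Sum>i<N. \<Sum>j<N. f i j)"
proof -
  let ?h = "\<lambda>i j. if i < j then f i j else 0"
  have "(\<Sum>is | length is = 2 \<and> sorted_wrt (<) is \<and> set is \<subseteq> {..<N}. f (is ! 0) (is ! 1)) = (\<Sum>(i, j) | i < j \<and> j < N. f i j)"
    by (rule sum.reindex_bij_witness[where i = "\<lambda>(i, j). [i, j]" and j = "\<lambda>is. (is ! 0, is ! 1)"])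
       (auto simp: numeral_2_eq_2 length_Suc_conv)
  also have "\<dots> = (\<Sum>(i, j)\<in>{..<N} \<times> {..<N}. ?h i j)"
    by (rule sum.mono_neutral_cong_left) (auto split: if_splits)
  also have "\<dots> = (\<Sum>i<N. \<Sum>j<N. ?h i j)" by (simp add: sum.cartesian_product)
  finally have 1: "(\<Sum>is | length is = 2 \<and> sorted_wrt (<) is \<and> set is \<subseteq> {..<N}. f (is ! 0) (is ! 1)) = (\<Sum>i<N. \<Sum>j<N. ?h i j)" .
  have f_split: "f i j = ?h i j + ?h j i" for i j
    using f(2)[of i] f(1)[of i j] by (cases i j rule: linorder_cases) auto
  have "(\<Sum>i<N. \<Sum>j<N. f i j) = (\<Sum>i<N. \<Sum>j<N. ?h i j) + (\<Sum>i<N. \<Sum>j<N. ?h j i)"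
    unfolding sum.distrib[symmetric] by (intro sum.cong refl f_split)
  also have "(\<Sum>i<N. \<Sum>j<N. ?h j i) = (\<Sum>i<N. \<Sum>j<N. ?h i j)" by (rule sum.swap)
  finally show ?thesis unfolding 1 by simp
qed

lemma form_inner_0: "form_inner X x m 0 \<eta> \<zeta> = m (\<eta> []) (\<zeta> [])"
proof -
  have "{is. length is = 0 \<and> sorted_wrt (<) is \<and> set is \<subseteq> {..<length (onb X x)}} = {[] :: nat list}" by auto
  then show ?thesis unfolding form_inner_def by simp
qed

lemma form_inner_1: "form_inner X x m 1 \<eta> \<zeta> = (\<Sum>i<length (onb X x). m (\<eta> [onb X x ! i]) (\<zeta> [onb X x ! i]))"
  unfolding form_inner_def
  by (rule sum.reindex_bij_witness[where i = "\<lambda>i. [i]" and j = "\<lambda>is. is ! 0"]) (auto simp: length_Suc_conv)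

lemma form_inner_2:
  fixes m :: "'w::real_vector \<Rightarrow> 'w \<Rightarrow> real"
  assumes m: "bilinear m" and \<eta>: "\<And>u v. \<eta> [u, v] = - \<eta> [v, u]" and \<zeta>: "\<And>u v. \<zeta> [u, v] = - \<zeta> [v, u]"
  shows "form_inner X x m 2 \<eta> \<zeta> =
    (1 / 2) * (\<Sum>i<length (onb X x). \<Sum>j<length (onb X x). m (\<eta> [onb X x ! i, onb X x ! j]) (\<zeta> [onb X x ! i, onb X x ! j]))"
proof -
  let ?e = "(!) (onb X x)"
  have s: "m (\<eta> [u, v]) (\<zeta> [u, v]) = m (\<eta> [v, u]) (\<zeta> [v, u])" for u v
    unfolding \<eta>[of u v] \<zeta>[of u v] using bilinear_lneg[OF m] bilinear_rneg[OF m] by simp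
  have z: "\<eta> [u, u] = 0" for u using \<eta>[of u u] by (simp add: eq_neg_iff_add_eq_0 flip: scaleR_2)
  have "form_inner X x m 2 \<eta> \<zeta> = (\<Sum>is | length is = 2 \<and> sorted_wrt (<) is \<and> set is \<subseteq> {..<length (onb X x)}.
      m (\<eta> [?e (is ! 0), ?e (is ! 1)]) (\<zeta> [?e (is ! 0), ?e (is ! 1)]))"
    unfolding form_inner_def by (rule sum.cong[OF refl]) (auto simp: numeral_2_eq_2 length_Suc_conv)
  also have "\<dots> = (1 / 2) * (\<Sum>i<length (onb X x). \<Sum>j<length (onb X x). m (\<eta> [?e i, ?e j]) (\<zeta> [?e i, ?e j]))"
    by (rule sum_increasing_pairs) (rule s, simp add: z bilinear_lzero[OF m])
  finally show ?thesis .
qed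

text \<open>The contraction \<Lambda> for vector-valued 2-forms; \<open>lam\<close> is its
  real-valued case.\<close>

definition contraction :: "('v list \<Rightarrow> real) \<Rightarrow> nat \<Rightarrow> (nat \<Rightarrow> 'v) \<Rightarrow> ('v list \<Rightarrow> 'w::real_vector) \<Rightarrow> 'w" where
  "contraction \<omega> N e R = (1 / 2) *\<^sub>R (\<Sum>i<N. \<Sum>j<N. \<omega> [e i, e j] *\<^sub>R R [e i, e j])"

text \<open>For \<open>L\<close> the identity this is the squared norm of a 2-form, for
  \<open>L\<close> the complex structure the quantity that remains from the wedge square.\<close>

definition pairing :: "nat \<Rightarrow> ('w \<Rightarrow> 'w \<Rightarrow> real) \<Rightarrow> ('v \<Rightarrow> 'v) \<Rightarrow> (nat \<Rightarrow> 'v) \<Rightarrow> ('v list \<Rightarrow> 'w) \<Rightarrow> real" where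
  "pairing N m L e R = (1 / 2) * (\<Sum>i<N. \<Sum>j<N. m (R [e i, e j]) (R [L (e i), L (e j)]))"

context hermitian
begin

abbreviation vlam :: "(nat \<Rightarrow> 'v) \<Rightarrow> ('v list \<Rightarrow> 'w::real_vector) \<Rightarrow> 'w" where
  "vlam \<equiv> contraction \<omega> (2 * n)"

abbreviation pair_sum :: "('w \<Rightarrow> 'w \<Rightarrow> real) \<Rightarrow> ('v \<Rightarrow> 'v) \<Rightarrow> (nat \<Rightarrow> 'v) \<Rightarrow> ('v list \<Rightarrow> 'w) \<Rightarrow> real" where
  "pair_sum \<equiv> pairing (2 * n)"

lemma lam_vlam: "lam e \<eta> = vlam e \<eta>"
  by (simp add: lam_def contraction_def mult.commute)

lemma linear_vlam: "linear A \<Longrightarrow> A (vlam e R) = vlam e (\<lambda>vs. A (R vs))"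
  unfolding contraction_def by (simp add: linear_scale linear_sum)

lemma vlam_invariant:
  assumes R: "mlin R" and e: "orthonormal g (2 * n) e" and f: "orthonormal g (2 * n) f"
  shows "vlam f R = vlam e R"
  unfolding contraction_def
  by (subst trace_invariant2[where Q = "\<lambda>u u' v v'. \<omega> [u, v] *\<^sub>R R [u', v']", OF _ _ e f])
     (intro bilinear_compose[OF bilinear_scaleR] mlin_pair R \<omega>_mlin refl)+

lemma pair_sum_invariant:
  assumes m: "bilinear m" and R: "mlin R" and L: "linear L" and e: "orthonormal g (2 * n) e" and f: "orthonormal g (2 * n) f"
  shows "pair_sum m L f R = pair_sum m L e R"
  unfolding pairing_def
  by (subst trace_invariant2[where Q = "\<lambda>u u' v v'. m (R [u, v]) (R [L u', L v'])", OF _ _ e f])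
     (intro bilinear_compose[OF m] mlin_pair R linear_compose[OF L, unfolded comp_def] refl)+

text \<open>The expanded square consists of four norms and two cross terms. Rotating either index by
  \<open>J\<close> turns each norm into that of \<open>R\<close>; the second cross term becomes
  minus the first because \<open>J\<close> squares to -1.\<close>

lemma part02_norm:
  assumes m: "bilinear m" "\<And>a b. m a b = m b a" and R: "mlin R" and e: "orthonormal g (2 * n) e"
  shows "(1 / 2) * (\<Sum>i<2 * n. \<Sum>j<2 * n. cplx_inner m (part02 J R [e i, e j]) (part02 J R [e i, e j])) =
     (1 / 4) * (pair_sum m (\<lambda>u. u) e R - pair_sum m J e R)"
proof -
  note Je = orthonormal_J[OF e]
  note ms = bilinear_ladd[OF m(1)] bilinear_radd[OF m(1)] bilinear_lsub[OF m(1)] bilinear_rsub[OF m(1)]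
    bilinear_lmul[OF m(1)] bilinear_rmul[OF m(1)] bilinear_lneg[OF m(1)] bilinear_rneg[OF m(1)]
  note l1 = linear_scale[OF mlin_pair(1)[OF R]] linear_scale[OF mlin_pair(2)[OF R]]
  let ?S = "\<lambda>h. \<Sum>i<2 * n. \<Sum>j<2 * n. (h (e i) (e j) :: real)"
  let ?r = "\<lambda>u v u' v'. m (R [u, v]) (R [u', v'])"
  have b1: "bilinear (\<lambda>v v'. ?r u (A v) u' (B v'))" if "linear A" "linear B" for A B u u'
    by (rule bilinear_compose[OF m(1)]) (intro linear_compose[OF that(1), unfolded comp_def] linear_compose[OF that(2), unfolded comp_def] mlin_pair R)+
  have b2: "bilinear (\<lambda>u u'. ?r (A u) v (B u') v')" if "linear A" "linear B" for A B v v'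
    by (rule bilinear_compose[OF m(1)]) (intro linear_compose[OF that(1), unfolded comp_def] linear_compose[OF that(2), unfolded comp_def] mlin_pair R)+
  have rot2: "?S (\<lambda>u v. ?r (a u) (A (J v)) (b u) (B (J v))) = ?S (\<lambda>u v. ?r (a u) (A v) (b u) (B v))"
    if "linear A" "linear B" for a b A B
    by (rule sum.cong[OF refl], rule trace_invariant[OF b1[OF that] e Je])
  have rot1: "?S (\<lambda>u v. ?r (A (J u)) (a v) (B (J u)) (b v)) = ?S (\<lambda>u v. ?r (A u) (a v) (B u) (b v))"
    if "linear A" "linear B" for a b A B
    apply (subst sum.swap, subst (2) sum.swap)
    by (rule sum.cong[OF refl], rule trace_invariant[OF b2[OF that] e Je])
  have id: "linear (\<lambda>u::'v. u)" by (simp add: linear_id[unfolded id_def])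
  let ?N = "?S (\<lambda>u v. ?r u v u v)" and ?C = "?S (\<lambda>u v. ?r u v (J u) (J v))"
  have s1: "?S (\<lambda>u v. ?r u (J v) u (J v)) = ?N" using rot2[OF id id, of "\<lambda>u. u" "\<lambda>u. u"] .
  have s2: "?S (\<lambda>u v. ?r (J u) v (J u) v) = ?N" using rot1[OF id id, of "\<lambda>u. u" "\<lambda>u. u"] .
  have s3: "?S (\<lambda>u v. ?r (J u) (J v) (J u) (J v)) = ?N" using rot1[OF id id, of J J] s1 by simp
  \<comment> \<open>Rotation of the second index of a cross term; \<open>J (J v) = - v\<close> then
    supplies the sign in \<open>s4\<close>.\<close>
  have "?S (\<lambda>u v. ?r u (J v) (J u) (J (J v))) = ?S (\<lambda>u v. ?r u v (J u) (J v))"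
    using rot2[OF id J(1), of "\<lambda>u. u" J] .
  moreover have "?r u (J v) (J u) (J (J v)) = - ?r u (J v) (J u) v" for u v
    using linear_neg[OF mlin_pair(2)[OF R], of "J u" v] by (simp add: J(2) ms)
  ultimately have s4: "?S (\<lambda>u v. ?r u (J v) (J u) v) = - ?C" by (simp add: sum_negf)
  \<comment> \<open>Each of the two projections carries a factor one half, and the product is
    squared.\<close>
  have "16 * cplx_inner m (part02 J R [u, v]) (part02 J R [u, v]) =
      ?r u v u v + ?r (J u) (J v) (J u) (J v) + ?r u (J v) u (J v) + ?r (J u) v (J u) v
      - 2 * ?r u v (J u) (J v) + 2 * ?r u (J v) (J u) v" for u v
    using m(2)[of "R [J u, J v]" "R [u, v]"] m(2)[of "R [J u, v]" "R [u, J v]"]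
    by (simp add: cplx_inner_def part02_def cplx_ext2_def proj01_def l1 ms algebra_simps)
  then have "16 * ?S (\<lambda>u v. cplx_inner m (part02 J R [u, v]) (part02 J R [u, v])) =
      ?N + ?S (\<lambda>u v. ?r (J u) (J v) (J u) (J v)) + ?S (\<lambda>u v. ?r u (J v) u (J v)) + ?S (\<lambda>u v. ?r (J u) v (J u) v)
      - 2 * ?C + 2 * ?S (\<lambda>u v. ?r u (J v) (J u) v)"
    by (simp add: sum_distrib_left sum.distrib sum_subtractf)
  also have "\<dots> = 4 * ?N - 4 * ?C" unfolding s1 s2 s3 s4 by simp
  finally show ?thesis unfolding pairing_def by simp
qed

text \<open>The values of \<omega> on \<open>e i\<close> and \<open>e j\<close> are the coordinates
  of \<open>J (e i)\<close>, so the sum over \<open>j\<close> reassembles that vector.\<close>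

lemma vlam_contract:
  assumes h: "bilinear h" and e: "orthonormal g (2 * n) e"
  shows "(\<Sum>i<2 * n. \<Sum>j<2 * n. \<omega> [e i, e j] *\<^sub>R h (e i) (e j)) = (\<Sum>i<2 * n. h (e i) (J (e i)))"
proof (rule sum.cong[OF refl])
  fix i
  have c: "\<omega> [e i, e j] = g (J (e i)) (e j)" for j by (rule \<omega>_J[symmetric])
  have "(\<Sum>j<2 * n. \<omega> [e i, e j] *\<^sub>R h (e i) (e j)) = h (e i) (\<Sum>j<2 * n. g (J (e i)) (e j) *\<^sub>R e j)"
    unfolding bilinear_sum_right[OF h] bilinear_rmul[OF h] c ..
  also have "\<dots> = h (e i) (J (e i))" unfolding expand[OF e] ..
  finally show "(\<Sum>j<2 * n. \<omega> [e i, e j] *\<^sub>R h (e i) (e j)) = h (e i) (J (e i))" .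
qed

text \<open>In the expanded square the norms of \<open>D u\<close> and \<open>D (J u)\<close> have
  equal traces. The cross term pairs \<open>D u\<close> with \<open>D (J u)\<close> by \<sigma>, and
  \<open>vlam_contract\<close> identifies its trace with the contraction of the pulled back form;
  the double sum is twice \<Lambda>.\<close>

lemma dbar_norm:
  fixes \<sigma> :: "'w::real_vector list \<Rightarrow> real" and D :: "'v \<Rightarrow> 'w"
  assumes \<sigma>: "alt_form 2 \<sigma>" and I: "linear I" "\<And>a. I (I a) = - a" and G: "inner_product (\<lambda>a b. \<sigma> [a, I b])"
    and D: "linear D" and e: "orthonormal g (2 * n) e"
  defines "B \<equiv> \<lambda>u. (1 / 2) *\<^sub>R (D u + I (D (J u)))"
  shows "2 * (\<Sum>i<2 * n. \<sigma> [B (e i), I (B (e i))]) =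
    (\<Sum>i<2 * n. \<sigma> [D (e i), I (D (e i))]) - (\<Sum>i<2 * n. \<Sum>j<2 * n. \<omega> [e i, e j] * \<sigma> [D (e i), D (e j)])"
proof -
  note b = bilinear_pair[OF alt_form_mlin[OF \<sigma>]] and bG = inner_product_bilinear[OF G]
  note as = asym_pair[OF alt_form_asym[OF \<sigma>]]
  note sm = bilinear_ladd[OF bG] bilinear_radd[OF bG] bilinear_lmul[OF bG] bilinear_rmul[OF bG]
  have neg: "\<sigma> [a, - b'] = - \<sigma> [a, b']" for a b' using bilinear_rneg[OF b] .
  have GI: "\<sigma> [I a, I (I b')] = \<sigma> [a, I b']" for a b'
    using as[of "I a" b'] inner_product_sym[OF G, of a b'] by (simp add: I(2) neg)
  have GD: "\<sigma> [a, I (I b')] = - \<sigma> [a, b']" for a b' by (simp add: I(2) neg)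
  have q: "4 * \<sigma> [B u, I (B u)] = \<sigma> [D u, I (D u)] + \<sigma> [D (J u), I (D (J u))] - 2 * \<sigma> [D u, D (J u)]" for u
    using GI[of "D (J u)" "D (J u)"] GD[of "D u" "D (J u)"] inner_product_sym[OF G, of "I (D (J u))" "D u"]
    unfolding B_def sm by (simp add: algebra_simps)
  have t: "(\<Sum>i<2 * n. \<sigma> [D (J (e i)), I (D (J (e i)))]) = (\<Sum>i<2 * n. \<sigma> [D (e i), I (D (e i))])"
    by (rule trace_invariant[OF bilinear_compose[OF bG D D] e orthonormal_J[OF e]])
  have w: "(\<Sum>i<2 * n. \<Sum>j<2 * n. \<omega> [e i, e j] * \<sigma> [D (e i), D (e j)]) = (\<Sum>i<2 * n. \<sigma> [D (e i), D (J (e i))])"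
    using vlam_contract[OF bilinear_compose[OF b D D] e] by simp
  have "4 * (\<Sum>i<2 * n. \<sigma> [B (e i), I (B (e i))]) =
      (\<Sum>i<2 * n. \<sigma> [D (e i), I (D (e i))]) + (\<Sum>i<2 * n. \<sigma> [D (J (e i)), I (D (J (e i)))]) - 2 * (\<Sum>i<2 * n. \<sigma> [D (e i), D (J (e i))])"
    unfolding sum_distrib_left q sum.distrib sum_subtractf ..
  then show ?thesis unfolding t w by simp
qed

lemma wedge_top_2form:
  assumes \<eta>: "alt_form 2 \<eta>" and e: "orthonormal g (2 * n) e"
  shows "wedge (*) 2 (nat (2 * (int n - 1))) \<eta> (ipow \<omega> (int n - 1)) x = vlam e \<eta> * ipow \<omega> (int n) x"
  unfolding wedge_eq_shuf[OF bilinear_times alt_form_asym[OF \<eta>] alt_form_deg[OF \<eta>] ipow_props(2,1)[OF \<omega>]]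
    wedge_lam[OF alt_form_deg[OF \<eta>] alt_form_asym[OF \<eta>] alt_form_mlin[OF \<eta>] e] lam_vlam ..

text \<open>The components of \<open>R\<close> in an orthonormal basis of the values are real
  2-forms, each squared by \<open>wedge_wedge\<close>; Parseval puts the components together
  again.\<close>

lemma wedge_top_square:
  fixes R :: "'v list \<Rightarrow> 'l::real_normed_vector"
  assumes m: "inner_product m" and B: "\<exists>B :: 'l set. is_basis B"
    and R: "alt_form 2 R" and e: "orthonormal g (2 * n) e"
  shows "wedge (*) 4 (nat (2 * (int n - 2))) (wedge m 2 2 R R) (ipow \<omega> (int n - 2)) x =
     (m (vlam e R) (vlam e R) - pair_sum m J e R) * ipow \<omega> (int n) x"
proof -
  interpret L: onb_space m "dim (UNIV :: 'l set)" using m B by unfold_locales auto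
  let ?N = "dim (UNIV :: 'l set)"
  obtain C :: "'l set" where C: "is_basis C" using B by blast
  \<comment> \<open>Gram-Schmidt over a one-point parameter set provides the orthonormal basis of
    the space of values.\<close>
  have "\<exists>b. (\<forall>i. continuous_on {0::real} (\<lambda>y. b y i)) \<and> (\<forall>y\<in>{0::real}. orthonormal m (card C) (b y))"
    by (rule continuous_gram_schmidt[OF C]) (use m in auto)
  then obtain b where b: "orthonormal m ?N b" using L.basis_card[OF C] by auto
  define c where "c = (\<lambda>k vs. m (R vs) (b k))"
  have lin: "linear (\<lambda>v. m v (b k))" for k using L.bil by (simp add: bilinear_def)
  note Ra = alt_form_asym[OF R] and Rm = alt_form_mlin[OF R] and Rd = alt_form_deg[OF R]
  have c: "deg 2 (c k)" "asym_form (c k)" "mlin (c k)" for k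
  proof -
    show "deg 2 (c k)" using Rd bilinear_lzero[OF L.bil] unfolding deg_def c_def by simp
    show "asym_form (c k)" unfolding asym_form_def c_def
    proof (intro allI)
      fix xs u v ys show "m (R (xs @ u # v # ys)) (b k) = - m (R (xs @ v # u # ys)) (b k)"
        unfolding asymD[OF Ra, of xs u v ys] by (rule bilinear_lneg[OF L.bil])
    qed
    show "mlin (c k)" unfolding mlin_def c_def
      by (intro allI linear_compose[OF mlinD[OF Rm] lin, unfolded comp_def])
  qed
  have mc: "m (R vs) (R ws) = (\<Sum>k<?N. c k vs * c k ws)" for vs ws
    unfolding c_def by (rule L.parseval[OF b, symmetric])
  have w: "wedge m 2 2 R R = (\<lambda>vs. \<Sum>k<?N. wedge (*) 2 2 (c k) (c k) vs)"
    unfolding wedge_def mc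
    by (rule ext) (auto simp: sum_distrib_left scaleR_sum_right intro: sum.swap)
  have ws: "wedge m 2 2 R R = (\<lambda>vs. \<Sum>k<?N. rsh (c k) (c k) vs)"
    unfolding w wedge_eq_shuf[OF bilinear_times c(2,1) c(2,1)] ..
  have d4: "deg 4 (rsh (c k) (c k))" and a4: "asym_form (rsh (c k) (c k))" for k
    using deg_shuf[OF bilinear_times c(1) c(1), of k k] asym_shuf[OF bilinear_times c(2) c(2), of k k] by auto
  have w4: "deg 4 (wedge m 2 2 R R)" using d4 unfolding ws deg_def by simp
  have w4a: "asym_form (wedge m 2 2 R R)" unfolding ws asym_form_def
  proof (intro allI)
    fix xs u v ys
    show "(\<Sum>k<?N. rsh (c k) (c k) (xs @ u # v # ys)) = - (\<Sum>k<?N. rsh (c k) (c k) (xs @ v # u # ys))"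
      unfolding sum_negf[symmetric] by (rule sum.cong[OF refl], rule asymD[OF a4])
  qed
  have "wedge (*) 4 (nat (2 * (int n - 2))) (wedge m 2 2 R R) (ipow \<omega> (int n - 2)) x = rsh (wedge m 2 2 R R) (ipow \<omega> (int n - 2)) x"
    unfolding wedge_eq_shuf[OF bilinear_times w4a w4 ipow_props(2,1)[OF \<omega>]] ..
  also have "\<dots> = (\<Sum>k<?N. rsh (rsh (c k) (c k)) (ipow \<omega> (int n - 2)) x)"
    unfolding ws by (rule shuf_sum_left[OF bilinear_times])
  also have "\<dots> = (\<Sum>k<?N. lam e (c k) * lam e (c k) - (1 / 2) * (\<Sum>i<2 * n. \<Sum>j<2 * n. c k [e i, e j] * c k [J (e i), J (e j)])) * ipow \<omega> (int n) x"
    unfolding wedge_wedge[OF c c e] sum_distrib_right ..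
  also have "(\<Sum>k<?N. lam e (c k) * lam e (c k) - (1 / 2) * (\<Sum>i<2 * n. \<Sum>j<2 * n. c k [e i, e j] * c k [J (e i), J (e j)])) =
      (\<Sum>k<?N. m (vlam e R) (b k) * m (vlam e R) (b k)) - (1 / 2) * (\<Sum>k<?N. \<Sum>i<2 * n. \<Sum>j<2 * n. c k [e i, e j] * c k [J (e i), J (e j)])"
    unfolding lam_vlam c_def linear_vlam[OF lin] sum_subtractf sum_distrib_left ..
  also have "(\<Sum>k<?N. \<Sum>i<2 * n. \<Sum>j<2 * n. c k [e i, e j] * c k [J (e i), J (e j)]) = (\<Sum>i<2 * n. \<Sum>j<2 * n. m (R [e i, e j]) (R [J (e i), J (e j)]))"
    unfolding mc by (subst sum.swap) (rule sum.cong[OF refl], rule sum.swap)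
  finally show ?thesis unfolding L.parseval[OF b] pairing_def .
qed

end

section \<open>The identity of the integrands\<close>

lemma continuous_on_frame_change:
  fixes T :: "'y::topological_space \<Rightarrow> 'v::real_normed_vector \<Rightarrow> 'v \<Rightarrow> 'r::real_normed_vector"
    and L :: "'y \<Rightarrow> 'v \<Rightarrow> 'v"
  assumes B: "is_basis (B :: 'v set)" and T: "\<And>y. y \<in> S \<Longrightarrow> bilinear (T y)" and L: "\<And>y. y \<in> S \<Longrightarrow> linear (L y)"
    and c: "\<And>u v. continuous_on S (\<lambda>y. T y (L y u) (L y v))" and ab: "continuous_on S a" "continuous_on S b"
  shows "continuous_on S (\<lambda>y. T y (L y (a y)) (L y (b y)))"
proof (rule continuous_on_bilinear_apply[OF B, where L = "\<lambda>y u v. T y (L y u) (L y v)" and a = a and b = b])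
  show "bilinear (\<lambda>u v. T y (L y u) (L y v))" if "y \<in> S" for y by (rule bilinear_compose[OF T[OF that] L[OF that] L[OF that]])
qed (rule c ab)+

locale kaehler_gauge = gauge K X E A F \<Phi>
  for K :: "('k, 'l::real_normed_vector) lie" and X :: "('x, 'v::{real_normed_vector, second_countable_topology}) kaehler"
    and E :: "('k, 'x, 'e, 'b::real_normed_vector) pbundle" and A :: "'e \<Rightarrow> 'b list \<Rightarrow> 'l"
    and F :: "('k, 'l, 'f, 'w::real_normed_vector) hspace" and \<Phi> :: "'x \<Rightarrow> ('e \<times> 'f) set" +
  fixes n :: nat and c0 :: 'l
  assumes kaehler: "kaehler_manifold n X" and cpt: "compact_space (mtop X)"
    and central: "central K c0" and K_connected: "connected_space (mtop K)"
begin

abbreviation kmet where "kmet x u v \<equiv> kform X x [u, cstr X v]"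
abbreviation ob where "ob x \<equiv> (!) (onb X x)"

lemma cstr_linear: "linear (cstr X)" and kform_alt: "x \<in> pts X \<Longrightarrow> alt_form 2 (kform X x)"
  and kmet_inner: "x \<in> pts X \<Longrightarrow> inner_product (kmet x)"
  and cstr_chart: "d \<in> atlas X \<Longrightarrow> x \<in> fst d \<Longrightarrow> from_chart X d x (cstr X v) = cstr X (from_chart X d x v)"
proof -
  have X: "complex_manifold n X" "diff_form X 2 (kform X)" "riemannian X (assoc_metric (kform X) (\<lambda>_. cstr X))"
    using kaehler by (auto simp: kaehler_manifold_def)
  show "linear (cstr X)" using X(1) by (simp add: complex_manifold_def)
  show "alt_form 2 (kform X x)" if "x \<in> pts X" using X(2) that by (simp add: diff_form_def)
  show "inner_product (kmet x)" if "x \<in> pts X" using X(3) that by (simp add: riemannian_def assoc_metric_def)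
  show "from_chart X d x (cstr X v) = cstr X (from_chart X d x v)" if d: "d \<in> atlas X" "x \<in> fst d"
  proof -
    have "x \<in> pts X" using chart_sub[OF cX d(1)] d(2) by auto
    from chart_at_props[OF cX this] show ?thesis
      using X(1) d unfolding complex_manifold_def from_chart_def by blast
  qed
qed

lemma hermitian_point: assumes x: "x \<in> pts X" shows "hermitian (kform X x) (cstr X) n"
proof (rule hermitian.intro)
  show "alt_form 2 (kform X x)" by (rule kform_alt[OF x])
  show "linear (cstr X)" by (rule cstr_linear)
  show "inner_product (kmet x)" by (rule kmet_inner[OF x])
  show "cstr X (cstr X v) = - v" for v using kaehler by (simp add: kaehler_manifold_def complex_manifold_def)
  show "dim (UNIV :: 'v set) = 2 * n" using kaehler by (simp add: kaehler_manifold_def complex_manifold_def)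
  show "\<exists>B :: 'v set. is_basis B" using charted_basis[OF cX] by blast
qed

text \<open>The basis \<open>onb\<close> is an arbitrary choice; Gram-Schmidt at a single point
  shows that its specification can be met.\<close>

lemma onb_props:
  assumes x: "x \<in> pts X" shows "length (onb X x) = 2 * n" "orthonormal (kmet x) (2 * n) (ob x)"
proof -
  interpret H: hermitian "kform X x" "cstr X" n by (rule hermitian_point[OF x])
  obtain B :: "'v set" where B: "is_basis B" using charted_basis[OF cX] .
  have "\<exists>b. (\<forall>i. continuous_on {0::real} (\<lambda>y. b y i)) \<and> (\<forall>y\<in>{0::real}. orthonormal (kmet x) (card B) (b y))"
    by (rule continuous_gram_schmidt[OF B]) (use kmet_inner[OF x] in auto)
  then obtain b where "orthonormal (kmet x) (2 * n) b" using H.basis_card[OF B] by auto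
  then have "\<exists>bs. length bs = dim (UNIV :: 'v set) \<and>
     (\<forall>i<length bs. \<forall>j<length bs. kmetric X x (bs ! i) (bs ! j) = (if i = j then 1 else 0))"
    by (intro exI[of _ "map b [0..<2 * n]"]) (simp add: H.dim2n orthonormal_def kmetric_def assoc_metric_def)
  from someI_ex[OF this] show "length (onb X x) = 2 * n" "orthonormal (kmet x) (2 * n) (ob x)"
    unfolding onb_def[symmetric] by (simp_all add: H.dim2n orthonormal_def kmetric_def assoc_metric_def)
qed

text \<open>A 0-form is determined by its value on the empty list, so adjointness is tested on
  constants; their wedge product with the Kaehler form is a scalar multiple of it. Nondegeneracy of
  the inner product gives uniqueness.\<close>

lemma Lambda_contraction:
  assumes x: "x \<in> pts X" and \<eta>: "alt_form 2 \<eta>"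
  shows "Lambda X (ip K) 0 x \<eta> = (\<lambda>vs. if vs = [] then contraction (kform X x) (2 * n) (ob x) \<eta> else 0)"
proof -
  let ?\<xi> = "\<lambda>vs :: 'v list. if vs = [] then contraction (kform X x) (2 * n) (ob x) \<eta> else 0"
  have w: "wedge (*\<^sub>R) 2 0 (kform X x) \<zeta> = (\<lambda>vs. kform X x vs *\<^sub>R \<zeta> [])" if \<zeta>: "alt_form 0 \<zeta>" for \<zeta> :: "'v list \<Rightarrow> 'l"
    unfolding wedge_eq_shuf[OF bilinear_scaleR alt_form_asym alt_form_deg alt_form_asym alt_form_deg, OF kform_alt kform_alt \<zeta> \<zeta>, OF x x]
    by (rule ext, rule shuf_deg0_right[OF bilinear_scaleR]) (use \<zeta> in \<open>simp add: alt_form_def\<close>)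
  have rhs: "form_inner X x (ip K) (0 + 2) \<eta> (wedge (*\<^sub>R) 2 0 (kform X x) \<zeta>) = ip K (?\<xi> []) (\<zeta> [])" if \<zeta>: "alt_form 0 \<zeta>" for \<zeta>
  proof -
    have s: "kform X x [u, v] *\<^sub>R \<zeta> [] = - (kform X x [v, u] *\<^sub>R \<zeta> [])" for u v
      using asym_pair[OF alt_form_asym[OF kform_alt[OF x]], of u v] by simp
    show ?thesis
      unfolding w[OF \<zeta>] add_0 form_inner_2[where \<eta> = \<eta> and \<zeta> = "\<lambda>vs. kform X x vs *\<^sub>R \<zeta> []", OF ip_bil asym_pair[OF alt_form_asym[OF \<eta>]] s] onb_props(1)[OF x] contraction_def
      by (simp add: bilinear_lmul[OF ip_bil] bilinear_rmul[OF ip_bil] bilinear_sum_left[OF ip_bil] mult.commute)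
  qed
  show ?thesis unfolding Lambda_def
  proof (rule the_equality)
    show "alt_form 0 ?\<xi> \<and> (\<forall>\<zeta>. alt_form 0 \<zeta> \<longrightarrow>
        form_inner X x (ip K) 0 ?\<xi> \<zeta> = form_inner X x (ip K) (0 + 2) \<eta> (wedge (*\<^sub>R) 2 0 (kform X x) \<zeta>))"
      using rhs by (auto simp: alt_form_def form_inner_0)
    fix \<xi> assume \<xi>: "alt_form 0 \<xi> \<and> (\<forall>\<zeta>. alt_form 0 \<zeta> \<longrightarrow>
        form_inner X x (ip K) 0 \<xi> \<zeta> = form_inner X x (ip K) (0 + 2) \<eta> (wedge (*\<^sub>R) 2 0 (kform X x) \<zeta>))"
    have "\<xi> [] = ?\<xi> []"
    proof (rule ip_eqI)
      fix w :: 'l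
      have a: "alt_form 0 (\<lambda>vs :: 'v list. if vs = [] then w else 0)" by (simp add: alt_form_def)
      show "ip K (\<xi> []) w = ip K (?\<xi> []) w"
        using \<xi>[THEN conjunct2, rule_format, OF a] unfolding rhs[OF a] form_inner_0 by simp
    qed
    then show "\<xi> = ?\<xi>" using \<xi> by (auto simp: alt_form_def fun_eq_iff)
  qed
qed

lemma curvature_alt: "x \<in> pts X \<Longrightarrow> alt_form 2 (curvature X E A x)"
  unfolding curvature_def using curv_alt frame_props by blast

abbreviation FA where "FA x \<equiv> curvature X E A x"
abbreviation LF where "LF x \<equiv> contraction (kform X x) (2 * n) (ob x) (FA x)"
abbreviation CW where "CW x \<equiv> pullback X AB \<Phi> (chern_weil_form K F X E A) x"
abbreviation mo where "mo x \<equiv> mom_section F E \<Phi> x"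
abbreviation covsq where "covsq x \<equiv> form_inner X x (vert_metric K F X E (\<Phi> x)) 1 (cov_d K F X E A \<Phi> x) (cov_d K F X E A \<Phi> x)"
abbreviation curvsq where "curvsq L x \<equiv> pairing (2 * n) (ip K) L (ob x) (FA x)"

context
  fixes U \<tau> x assumes triv: "local_triv K X E U \<tau>" and x: "x \<in> U"
begin

abbreviation Rs where "Rs \<equiv> curv X E A (sect \<tau> x)"
abbreviation D where "D \<equiv> ldiff \<tau> x"
abbreviation f where "f \<equiv> phi \<tau> x"
abbreviation pulled where "pulled \<equiv> (\<lambda>vs. symp F f (map D vs) - ip K (Rs vs) (mom F f))"

lemma xX: "x \<in> pts X" using Usub[OF triv x] .
lemma fF: "f \<in> pts F" using phi_in[OF triv x] .

lemma Rs_alt: "alt_form 2 Rs" by (rule curv_alt[OF sect_in[OF triv x]])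

lemma symp_D_alt: "alt_form 2 (\<lambda>vs. symp F f (map D vs))"
proof (rule alt_form_2I)
  have a: "alt_form 2 (symp F f)" by (rule symp_alt[OF fF])
  show "symp F f (map D vs) = 0" if "length vs \<noteq> 2" for vs using alt_form_deg[OF a] that by (simp add: deg_def)
  show "bilinear (\<lambda>u v. symp F f (map D [u, v]))"
    using bilinear_compose[OF bilinear_pair[OF alt_form_mlin[OF a]] ldiff_linear[OF triv x] ldiff_linear[OF triv x]] by simp
  show "symp F f (map D [u, u]) = 0" for u using asym_pair[OF alt_form_asym[OF a], of "D u" "D u"] by simp
qed

lemma pairing_alt: "alt_form 2 (\<lambda>vs. ip K (Rs vs) b)"
proof (rule alt_form_2I)
  have l: "linear (\<lambda>a. ip K a b)" using ip_bil by (simp add: bilinear_def)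
  show "ip K (Rs vs) b = 0" if "length vs \<noteq> 2" for vs
    using alt_form_deg[OF Rs_alt] that by (simp add: deg_def linear_0[OF l])
  show "bilinear (\<lambda>u v. ip K (Rs [u, v]) b)"
    using bilinear_pair[OF alt_form_mlin[OF Rs_alt]] unfolding bilinear_def
    by (auto intro: linear_compose[OF _ l, unfolded comp_def])
  show "ip K (Rs [u, u]) b = 0" for u
    using asym_pair[OF alt_form_asym[OF Rs_alt], of u u] by (simp add: linear_0[OF l] eq_neg_iff_add_eq_0 flip: scaleR_2)
qed

text \<open>\<open>pullback_chern_weil\<close> speaks of two arguments only. For equality as
  functions on lists, both sides must also vanish on the other lengths, which on the left is checked
  at the chosen representative.\<close>

lemma CW_eq: "CW x = pulled"
proof (rule deg2_eqI)
  show "CW x [u, v] = pulled [u, v]" for u v using pullback_chern_weil[OF triv x] by simp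
  show "deg 2 pulled" using alt_form_deg[OF symp_D_alt] alt_form_deg[OF pairing_alt] by (simp add: deg_def)
  obtain h where h: "h \<in> pts K" "rep (\<Phi> x) = (ract E (sect \<tau> x) h, act F (ginv K h) f)"
    using rep_orbit[OF sect_in[OF triv x] fF] phi_orbit[OF triv x] by auto
  have r: "fst (rep (\<Phi> x)) \<in> pts E" "snd (rep (\<Phi> x)) \<in> pts F"
    unfolding h(2) using ract_in[OF sect_in[OF triv x] h(1)] act_in[OF inv_in[OF h(1)] fF] by auto
  show "deg 2 (CW x)"
    using alt_form_deg[OF symp_alt[OF r(2)]] alt_form_deg[OF curv_alt[OF r(1)]] bilinear_lzero[OF ip_bil]
    unfolding deg_def pullback_def chern_weil_form_def vert_symp_def by simp
qed

lemma pulled_alt: "alt_form 2 pulled"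
proof (rule alt_form_2I)
  note a = bilinear_pair[OF alt_form_mlin[OF symp_D_alt]] bilinear_pair[OF alt_form_mlin[OF pairing_alt]]
  show "pulled vs = 0" if "length vs \<noteq> 2" for vs
    using alt_form_deg[OF symp_D_alt] alt_form_deg[OF pairing_alt] that by (simp add: deg_def)
  show "bilinear (\<lambda>u v. pulled [u, v])" using a unfolding bilinear_def by (auto intro: linear_compose_sub)
  show "pulled [u, u] = 0" for u
    using asym_pair[OF alt_form_asym[OF symp_D_alt], of u u] asym_pair[OF alt_form_asym[OF pairing_alt], of u u] by simp
qed

text \<open>One group element moves the curvature and the moment map together, and it fixes
  \<open>c0\<close>; inner products among the three can therefore be computed in the local
  section.\<close>

lemma local_gauge:
  "\<exists>h\<in>pts K. FA x = (\<lambda>vs. Ad K h (Rs vs)) \<and> mo x = Ad K h (mom F f) \<and> linear (Ad K h) \<and> Ad K h c0 = c0"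
proof -
  obtain h where h: "h \<in> pts K" "\<And>u v. FA x [u, v] = Ad K h (Rs [u, v])" "mo x = Ad K h (mom F f)"
    using curvature_section[OF triv x] by blast
  have "FA x = (\<lambda>vs. Ad K h (Rs vs))"
    by (rule deg2_eqI[OF alt_form_deg[OF curvature_alt[OF xX]] _ h(2)])
       (use alt_form_deg[OF Rs_alt] linear_0[OF Ad_linear[OF h(1)]] in \<open>simp add: deg_def\<close>)
  then show ?thesis using h Ad_linear[OF h(1)] Ad_central[OF central K_connected h(1)] by blast
qed

text \<open>On the left stand the chosen frame and the chosen orthonormal basis, on the right the
  local section and any orthonormal basis \<open>e\<close>. The freedom in \<open>e\<close> is what
  permits a continuous one.\<close>

lemma local_values:
  assumes e: "orthonormal (kmet x) (2 * n) e"
  defines "l \<equiv> contraction (kform X x) (2 * n) e Rs"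
  shows "linear L \<Longrightarrow> curvsq L x = pairing (2 * n) (ip K) L e Rs"
    and "ip K (LF x) (LF x) = ip K l l" "ip K (LF x) c0 = ip K l c0" "ip K (LF x) (mo x) = ip K l (mom F f)"
    and "ip K (mo x - c0) (mo x - c0) = ip K (mom F f - c0) (mom F f - c0)"
    and "covsq x = (\<Sum>i<2 * n. symp F f [D (e i), acs F f (D (e i))])"
    and "contraction (kform X x) (2 * n) (ob x) (CW x) = contraction (kform X x) (2 * n) e pulled"
proof -
  interpret H: hermitian "kform X x" "cstr X" n by (rule hermitian_point[OF xX])
  note ob = onb_props[OF xX]
  obtain h where h: "h \<in> pts K" "FA x = (\<lambda>vs. Ad K h (Rs vs))" "mo x = Ad K h (mom F f)" "linear (Ad K h)" "Ad K h c0 = c0"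
    using local_gauge by blast
  note Rm = alt_form_mlin[OF Rs_alt]
  show "curvsq L x = pairing (2 * n) (ip K) L e Rs" if L: "linear L"
    unfolding H.pair_sum_invariant[OF ip_bil Rm L ob(2) e] by (simp add: h(2) pairing_def ip_Ad[OF h(1)])
  have LF: "LF x = Ad K h l"
    unfolding l_def h(2) H.linear_vlam[OF h(4), symmetric] H.vlam_invariant[OF Rm ob(2) e] ..
  show "ip K (LF x) (LF x) = ip K l l" "ip K (LF x) (mo x) = ip K l (mom F f)" unfolding LF h(3) ip_Ad[OF h(1)] by rule+
  have "ip K (LF x) (Ad K h c0) = ip K l c0" unfolding LF ip_Ad[OF h(1)] ..
  then show "ip K (LF x) c0 = ip K l c0" unfolding h(5) .
  have "mo x - c0 = Ad K h (mom F f - c0)" unfolding linear_diff[OF h(4)] h(3,5) ..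
  then show "ip K (mo x - c0) (mo x - c0) = ip K (mom F f - c0) (mom F f - c0)" unfolding ip_Ad[OF h(1)] by (simp add: ip_Ad[OF h(1)])
  note Dl = ldiff_linear[OF triv x]
  show "covsq x = (\<Sum>i<2 * n. symp F f [D (e i), acs F f (D (e i))])"
    unfolding form_inner_1 ob(1) metric_cov_d[OF triv x]
    by (rule H.trace_invariant[OF bilinear_compose[OF inner_product_bilinear[OF metric_inner[OF fF]] Dl Dl] e ob(2)])
  show "contraction (kform X x) (2 * n) (ob x) (CW x) = contraction (kform X x) (2 * n) e pulled"
    unfolding CW_eq by (rule H.vlam_invariant[OF alt_form_mlin[OF pulled_alt] e ob(2)])
qed

end

lemma ip_sym: "ip K a b = ip K b a" by (rule inner_product_sym[OF ip_inner])

context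
  fixes x assumes x: "x \<in> pts X"
begin

lemma curvature_norm: "form_inner X x (ip K) 2 (FA x) (FA x) = curvsq (\<lambda>u. u) x"
  unfolding form_inner_2[where \<eta> = "FA x" and \<zeta> = "FA x", OF ip_bil asym_pair[OF alt_form_asym[OF curvature_alt[OF x]]] asym_pair[OF alt_form_asym[OF curvature_alt[OF x]]]]
    onb_props(1)[OF x] pairing_def ..

lemma curvature02_norm:
  "4 * form_inner X x (cplx_inner (ip K)) 2 (part02 (cstr X) (FA x)) (part02 (cstr X) (FA x)) = curvsq (\<lambda>u. u) x - curvsq (cstr X) x"
proof -
  interpret H: hermitian "kform X x" "cstr X" n by (rule hermitian_point[OF x])
  note b = bilinear_ladd[OF ip_bil] bilinear_radd[OF ip_bil] bilinear_lmul[OF ip_bil] bilinear_rmul[OF ip_bil]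
  have c: "bilinear (cplx_inner (ip K))"
    unfolding bilinear_def cplx_inner_def by (auto intro!: linearI simp: b algebra_simps)
  have as: "FA x [u, v] = - FA x [v, u]" for u v by (rule asym_pair[OF alt_form_asym[OF curvature_alt[OF x]]])
  have l: "FA x [u, r *\<^sub>R v] = r *\<^sub>R FA x [u, v]" "FA x [r *\<^sub>R u, v] = r *\<^sub>R FA x [u, v]" for u v r
    using linear_scale[OF mlin_pair(1)] linear_scale[OF mlin_pair(2)] alt_form_mlin[OF curvature_alt[OF x]] by blast+
  have p: "part02 (cstr X) (FA x) [u, v] = - part02 (cstr X) (FA x) [v, u]" for u v
    unfolding part02_def cplx_ext2_def proj01_def using as[of u v] as[of "cstr X u" "cstr X v"] as[of "cstr X u" v] as[of u "cstr X v"]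
    by (simp add: l)
  show ?thesis
    unfolding form_inner_2[where \<eta> = "part02 (cstr X) (FA x)" and \<zeta> = "part02 (cstr X) (FA x)", OF c p p] onb_props(1)[OF x] H.part02_norm[OF ip_bil ip_sym alt_form_mlin[OF curvature_alt[OF x]] onb_props(2)[OF x]]
    by simp
qed

text \<open>The Chern-Weil form is the pulled back symplectic form minus the pairing of curvature
  and moment map. Adding that pairing back after contraction isolates the term required by
  \<open>dbar_norm\<close>.\<close>

lemma dbar_norm_section:
  "2 * form_inner X x (vert_metric K F X E (\<Phi> x)) 1 (dbar K F X E A \<Phi> x) (dbar K F X E A \<Phi> x) =
     covsq x - 2 * (contraction (kform X x) (2 * n) (ob x) (CW x) + ip K (LF x) (mo x))"
proof -
  interpret H: hermitian "kform X x" "cstr X" n by (rule hermitian_point[OF x])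
  obtain U \<tau> where U: "x \<in> U" "local_triv K X E U \<tau>" using triv_exists[OF x] by blast
  note ob = onb_props[OF x] and t = U(2,1)
  let ?l = "contraction (kform X x) (2 * n) (ob x) (curv X E A (sect \<tau> x))"
  note fF = phi_in[OF t]
  have l: "linear (\<lambda>a. ip K a (mom F (phi \<tau> x)))" using ip_bil by (simp add: bilinear_def)
  have "2 * contraction (kform X x) (2 * n) (ob x) (CW x) =
      (\<Sum>i<2 * n. \<Sum>j<2 * n. kform X x [ob x i, ob x j] * symp F (phi \<tau> x) [ldiff \<tau> x (ob x i), ldiff \<tau> x (ob x j)]) - 2 * ip K ?l (mom F (phi \<tau> x))"
    unfolding CW_eq[OF t] H.linear_vlam[OF l] unfolding contraction_def
    by (simp add: right_diff_distrib sum_subtractf)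
  moreover have "2 * (\<Sum>i<2 * n. symp F (phi \<tau> x) [(1 / 2) *\<^sub>R (ldiff \<tau> x (ob x i) + acs F (phi \<tau> x) (ldiff \<tau> x (cstr X (ob x i)))),
         acs F (phi \<tau> x) ((1 / 2) *\<^sub>R (ldiff \<tau> x (ob x i) + acs F (phi \<tau> x) (ldiff \<tau> x (cstr X (ob x i)))))]) =
      covsq x - (\<Sum>i<2 * n. \<Sum>j<2 * n. kform X x [ob x i, ob x j] * symp F (phi \<tau> x) [ldiff \<tau> x (ob x i), ldiff \<tau> x (ob x j)])"
    unfolding local_values(6)[OF t ob(2)]
    by (rule H.dbar_norm[OF symp_alt[OF fF] acs_linear[OF fF] acs_square[OF fF] metric_inner[OF fF] ldiff_linear[OF t] ob(2)])
  \<comment> \<open>The remaining arithmetic, with the sums replaced by real variables.\<close>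
  moreover have "b = v - 2 * (a + d)" if "2 * a = s - 2 * d" "b = v - s" for a b d s v :: real
    using that by simp
  ultimately show ?thesis
    unfolding local_values(4)[OF t ob(2)] form_inner_1[of _ _ _ "dbar K F X E A \<Phi> x"] ob(1) metric_dbar[OF t] by blast
qed

lemma Lambda_norm:
  "form_inner X x (ip K) 0 (\<lambda>vs. Lambda X (ip K) 0 x (FA x) vs + mo x - c0) (\<lambda>vs. Lambda X (ip K) 0 x (FA x) vs + mo x - c0) =
     ip K (LF x) (LF x) + 2 * ip K (LF x) (mo x) - 2 * ip K (LF x) c0 + ip K (mo x - c0) (mo x - c0)"
  unfolding form_inner_0 Lambda_contraction[OF x curvature_alt[OF x]]
  using ip_sym[of "mo x" "LF x"] ip_sym[of c0 "LF x"]
  by (simp add: bilinear_ladd[OF ip_bil] bilinear_radd[OF ip_bil] bilinear_lsub[OF ip_bil] bilinear_rsub[OF ip_bil])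

lemma curvature_square_wedge:
  "wedge (*) 4 (nat (2 * (int n - 2))) (wedge (ip K) 2 2 (FA x) (FA x)) (kpow X (int n - 2) x) vs =
     (ip K (LF x) (LF x) - curvsq (cstr X) x) * kpow X (int n) x vs"
proof -
  interpret H: hermitian "kform X x" "cstr X" n by (rule hermitian_point[OF x])
  have B: "\<exists>B :: 'l set. is_basis B" using charted_basis[OF cK] by blast
  show ?thesis unfolding kpow_ipow by (rule H.wedge_top_square[OF ip_inner B curvature_alt[OF x] onb_props(2)[OF x]])
qed

lemma chern_weil_wedge:
  "wedge (*) 2 (nat (2 * (int n - 1))) (CW x) (kpow X (int n - 1) x) vs =
     contraction (kform X x) (2 * n) (ob x) (CW x) * kpow X (int n) x vs"
proof -
  interpret H: hermitian "kform X x" "cstr X" n by (rule hermitian_point[OF x])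
  obtain U \<tau> where U: "x \<in> U" "local_triv K X E U \<tau>" using triv_exists[OF x] by blast
  show ?thesis unfolding kpow_ipow
    by (rule H.wedge_top_2form[OF _ onb_props(2)[OF x]]) (use pulled_alt[OF U(2,1)] CW_eq[OF U(2,1)] in simp)
qed

end

end

subsection \<open>Continuity of the integrands\<close>

context kaehler_gauge
begin

context
  fixes U \<tau> d assumes triv: "local_triv K X E U \<tau>" and d: "d \<in> atlas X"
begin

text \<open>The chosen orthonormal basis need not be continuous in the point. Gram-Schmidt is
  applied to the metric in chart coordinates, and the resulting vectors are carried back by
  \<open>from_chart\<close>.\<close>

lemma local_frame:
  "\<exists>e. (\<forall>y\<in>snd d ` (U \<inter> fst d). orthonormal (kmet (cinv d y)) (2 * n) (e y)) \<and>
     (\<forall>i j. continuous_on (snd d ` (U \<inter> fst d)) (\<lambda>y. kform X (cinv d y) [e y i, e y j]) \<and>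
        continuous_on (snd d ` (U \<inter> fst d)) (\<lambda>y. curv X E A (sect \<tau> (cinv d y)) [e y i, e y j]) \<and>
        continuous_on (snd d ` (U \<inter> fst d)) (\<lambda>y. curv X E A (sect \<tau> (cinv d y)) [cstr X (e y i), cstr X (e y j)]) \<and>
        continuous_on (snd d ` (U \<inter> fst d)) (\<lambda>y. symp F (phi \<tau> (cinv d y)) [ldiff \<tau> (cinv d y) (e y i), ldiff \<tau> (cinv d y) (e y j)]) \<and>
        continuous_on (snd d ` (U \<inter> fst d)) (\<lambda>y. symp F (phi \<tau> (cinv d y))
          [ldiff \<tau> (cinv d y) (e y i), acs F (phi \<tau> (cinv d y)) (ldiff \<tau> (cinv d y) (e y j))]))"
proof -
  let ?Y = "snd d ` (U \<inter> fst d)"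
  let ?x = "cinv d" and ?L = "\<lambda>y. from_chart X d (cinv d y)"
  obtain B :: "'v set" where B: "is_basis B" using charted_basis[OF cX] .
  have pt: "?x y \<in> U" "?x y \<in> fst d" "?x y \<in> pts X" if "y \<in> ?Y" for y
    using Y_point[OF triv d that] Usub[OF triv] by auto
  have L: "linear (?L y)" if "y \<in> ?Y" for y by (rule from_chart_linear[OF cX d pt(2)[OF that]])
  have inj: "?L y u = 0 \<Longrightarrow> u = 0" if "y \<in> ?Y" for y u
    using to_from_chart[OF cX d pt(2)[OF that]] linear_0[OF L[OF that]] by metis
  \<comment> \<open>The charts are holomorphic, so the complex structure in coordinates is
    \<open>cstr X\<close> itself; the metric and the rotated frame vectors stay expressible in the
    chart.\<close>
  have LJ: "?L y (cstr X u) = cstr X (?L y u)" if "y \<in> ?Y" for y u by (rule cstr_chart[OF d pt(2)[OF that]])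
  have ck: "continuous_on ?Y (\<lambda>y. kform X (?x y) [?L y u, ?L y v])" for u v
  proof -
    have "smooth_on (snd d ` fst d) (\<lambda>y. loc X d (kform X) y [u, v])"
      using X_kform[OF kaehler cpt] d by (simp add: smooth_tensor_def)
    from continuous_on_subset[OF smooth_on_continuous[OF this]] show ?thesis by (simp add: loc_def image_mono)
  qed
  define g where "g = (\<lambda>y u v. kmet (?x y) (?L y u) (?L y v))"
  have "\<exists>b. (\<forall>i. continuous_on ?Y (\<lambda>y. b y i)) \<and> (\<forall>y\<in>?Y. orthonormal (g y) (card B) (b y))"
  proof (rule continuous_gram_schmidt[OF B])
    fix y assume y: "y \<in> ?Y"
    note i = kmet_inner[OF pt(3)[OF y]]
    show "inner_product (g y)"
      unfolding inner_product_def
    proof (intro conjI allI impI)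
      show "bilinear (g y)" unfolding g_def by (rule bilinear_compose[OF inner_product_bilinear[OF i] L[OF y] L[OF y]])
      show "g y u v = g y v u" for u v unfolding g_def by (rule inner_product_sym[OF i])
      show "0 < g y u u" if "u \<noteq> 0" for u unfolding g_def by (rule inner_product_pos[OF i]) (use inj[OF y] that in blast)
    qed
  next
    show "continuous_on ?Y (\<lambda>y. g y u v)" for u v
      by (rule continuous_on_eq[OF ck[of u "cstr X v"]]) (simp add: g_def LJ)
  qed
  then obtain b where b: "\<And>i. continuous_on ?Y (\<lambda>y. b y i)" "\<And>y. y \<in> ?Y \<Longrightarrow> orthonormal (g y) (card B) (b y)" by blast
  define e where "e = (\<lambda>y i. ?L y (b y i))"
  have cJ: "continuous_on ?Y (\<lambda>y. cstr X (b y i))" for i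
    by (rule continuous_on_linear_apply[OF B, where L = "\<lambda>_. cstr X" and w = "\<lambda>y. b y i"]) (rule cstr_linear continuous_on_const b(1))+
  have o: "orthonormal (kmet (?x y)) (2 * n) (e y)" if y: "y \<in> ?Y" for y
  proof -
    interpret H: hermitian "kform X (?x y)" "cstr X" n by (rule hermitian_point[OF pt(3)[OF y]])
    show ?thesis using b(2)[OF y] unfolding H.basis_card[OF B] orthonormal_def g_def e_def .
  qed
  have c1: "continuous_on ?Y (\<lambda>y. kform X (?x y) [e y i, e y j])" for i j
    unfolding e_def
    by (rule continuous_on_frame_change[where T = "\<lambda>y u v. kform X (?x y) [u, v]", OF B bilinear_pair[OF alt_form_mlin[OF kform_alt[OF pt(3)]]] L ck b(1) b(1)])
  have bR: "bilinear (\<lambda>u v. curv X E A (sect \<tau> (?x y)) [u, v])" if "y \<in> ?Y" for y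
    by (rule bilinear_pair[OF alt_form_mlin[OF Rs_alt[OF triv pt(1)[OF that]]]])
  have c2: "continuous_on ?Y (\<lambda>y. curv X E A (sect \<tau> (?x y)) [e y i, e y j])" for i j
    unfolding e_def
    by (rule continuous_on_frame_change[where T = "\<lambda>y u v. curv X E A (sect \<tau> (?x y)) [u, v]", OF B bR L continuous_curv[OF triv d] b(1) b(1)])
  have c3: "continuous_on ?Y (\<lambda>y. curv X E A (sect \<tau> (?x y)) [?L y (cstr X (b y i)), ?L y (cstr X (b y j))])" for i j
    by (rule continuous_on_frame_change[where T = "\<lambda>y u v. curv X E A (sect \<tau> (?x y)) [u, v]", OF B bR L continuous_curv[OF triv d] cJ cJ])
  have c3': "continuous_on ?Y (\<lambda>y. curv X E A (sect \<tau> (?x y)) [cstr X (e y i), cstr X (e y j)])" for i j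
    by (rule continuous_on_eq[OF c3]) (simp add: e_def LJ)
  have ft: "continuous_on ?Y (\<lambda>y. \<theta> (phi \<tau> (?x y)) [ldiff \<tau> (?x y) (e y i), ldiff \<tau> (?x y) (e y j)])"
    if \<theta>: "smooth_tensor F 2 \<theta>" "\<And>f. f \<in> pts F \<Longrightarrow> bilinear (\<lambda>a b. \<theta> f [a, b])" for \<theta> :: "'f \<Rightarrow> 'w list \<Rightarrow> real" and i j
    unfolding e_def
  proof (rule continuous_on_frame_change[where T = "\<lambda>y u v. \<theta> (phi \<tau> (?x y)) [ldiff \<tau> (?x y) u, ldiff \<tau> (?x y) v]",
        OF B _ L continuous_fibre_tensor[OF triv d \<theta>] b(1) b(1)])
    fix y assume y: "y \<in> ?Y"
    note l = ldiff_linear[OF triv pt(1)[OF y]]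
    show "bilinear (\<lambda>u v. \<theta> (phi \<tau> (?x y)) [ldiff \<tau> (?x y) u, ldiff \<tau> (?x y) v])"
      by (rule bilinear_compose[OF \<theta>(2)[OF phi_in[OF triv pt(1)[OF y]]] l l])
  qed
  have c4: "continuous_on ?Y (\<lambda>y. symp F (phi \<tau> (?x y)) [ldiff \<tau> (?x y) (e y i), ldiff \<tau> (?x y) (e y j)])" for i j
    by (rule ft[OF symp_smooth]) (rule bilinear_pair[OF alt_form_mlin[OF symp_alt]])
  have c5: "continuous_on ?Y (\<lambda>y. symp F (phi \<tau> (?x y)) [ldiff \<tau> (?x y) (e y i), acs F (phi \<tau> (?x y)) (ldiff \<tau> (?x y) (e y j))])" for i j
    using ft[OF metric_smooth, of i j] inner_product_bilinear[OF metric_inner] by (simp add: assoc_metric_def)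
  show ?thesis by (intro exI[of _ e] conjI ballI allI) (rule o c1 c2 c3' c4 c5 | assumption)+
qed

text \<open>By \<open>local_values\<close> all quantities are computed in the local section; where a
  basis enters, it is the continuous one of \<open>local_frame\<close>, so only finite sums and
  inner products of continuous functions remain.\<close>

lemma local_continuity:
  "continuous_on (snd d ` (U \<inter> fst d)) (\<lambda>y. curvsq (\<lambda>u. u) (cinv d y))" (is ?th1)
  "continuous_on (snd d ` (U \<inter> fst d)) (\<lambda>y. curvsq (cstr X) (cinv d y))" (is ?th2)
  "continuous_on (snd d ` (U \<inter> fst d)) (\<lambda>y. ip K (LF (cinv d y)) (LF (cinv d y)))" (is ?th3)
  "continuous_on (snd d ` (U \<inter> fst d)) (\<lambda>y. ip K (LF (cinv d y)) c0)" (is ?th4)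
  "continuous_on (snd d ` (U \<inter> fst d)) (\<lambda>y. ip K (LF (cinv d y)) (mo (cinv d y)))" (is ?th5)
  "continuous_on (snd d ` (U \<inter> fst d)) (\<lambda>y. ip K (mo (cinv d y) - c0) (mo (cinv d y) - c0))" (is ?th6)
  "continuous_on (snd d ` (U \<inter> fst d)) (\<lambda>y. covsq (cinv d y))" (is ?th7)
  "continuous_on (snd d ` (U \<inter> fst d)) (\<lambda>y. contraction (kform X (cinv d y)) (2 * n) (ob (cinv d y)) (CW (cinv d y)))" (is ?th8)
proof -
  let ?Y = "snd d ` (U \<inter> fst d)" and ?x = "cinv d"
  let ?R = "\<lambda>y. curv X E A (sect \<tau> (?x y))" and ?m = "\<lambda>y. mom F (phi \<tau> (?x y))"
  obtain e where e: "\<And>y. y \<in> ?Y \<Longrightarrow> orthonormal (kmet (?x y)) (2 * n) (e y)"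
    and ce: "\<And>i j. continuous_on ?Y (\<lambda>y. kform X (?x y) [e y i, e y j])" "\<And>i j. continuous_on ?Y (\<lambda>y. ?R y [e y i, e y j])"
      "\<And>i j. continuous_on ?Y (\<lambda>y. ?R y [cstr X (e y i), cstr X (e y j)])"
      "\<And>i j. continuous_on ?Y (\<lambda>y. symp F (phi \<tau> (?x y)) [ldiff \<tau> (?x y) (e y i), ldiff \<tau> (?x y) (e y j)])"
      "\<And>i j. continuous_on ?Y (\<lambda>y. symp F (phi \<tau> (?x y)) [ldiff \<tau> (?x y) (e y i), acs F (phi \<tau> (?x y)) (ldiff \<tau> (?x y) (e y j))])"
    using local_frame
    apply (elim exE conjE)
    apply (rule that)
         apply (erule bspec, assumption)
        apply ((drule spec)+, elim conjE, assumption)+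
    done
  have pt: "?x y \<in> U" if "y \<in> ?Y" for y using Y_point(1)[OF triv d that] .
  note v = local_values[OF triv pt e]
  obtain BK :: "'l set" where BK: "is_basis BK" using charted_basis[OF cK] .
  have cip: "continuous_on ?Y (\<lambda>y. ip K (a y) (b y))" if "continuous_on ?Y a" "continuous_on ?Y b" for a b
  proof (rule continuous_on_bilinear_apply[OF BK, where L = "\<lambda>_. ip K"])
    show "bilinear (ip K)" by (rule ip_bil)
  qed (rule continuous_on_const that)+
  note cm = continuous_mom[OF triv d]
  have cl: "continuous_on ?Y (\<lambda>y. contraction (kform X (?x y)) (2 * n) (e y) (?R y))"
    unfolding contraction_def by (intro continuous_intros ce)
  have id: "linear (\<lambda>u :: 'v. u)" by (simp add: linear_id[unfolded id_def])
  have "continuous_on ?Y (\<lambda>y. pairing (2 * n) (ip K) (\<lambda>u. u) (e y) (?R y))"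
    "continuous_on ?Y (\<lambda>y. pairing (2 * n) (ip K) (cstr X) (e y) (?R y))"
    unfolding pairing_def by (intro continuous_intros cip ce)+
  then show ?th1 ?th2 using v(1)[OF _ _ id] v(1)[OF _ _ cstr_linear] by (simp_all cong: continuous_on_cong)
  show ?th3 by (rule continuous_on_eq[OF cip[OF cl cl] v(2)[symmetric]])
  show ?th4 by (rule continuous_on_eq[OF cip[OF cl continuous_on_const] v(3)[symmetric]])
  show ?th5 by (rule continuous_on_eq[OF cip[OF cl cm] v(4)[symmetric]])
  have cc: "continuous_on ?Y (\<lambda>y. ?m y - c0)" by (intro continuous_intros cm)
  show ?th6 by (rule continuous_on_eq[OF cip[OF cc cc] v(5)[symmetric]])
  have "continuous_on ?Y (\<lambda>y. \<Sum>i<2 * n. symp F (phi \<tau> (?x y)) [ldiff \<tau> (?x y) (e y i), acs F (phi \<tau> (?x y)) (ldiff \<tau> (?x y) (e y i))])"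
    by (intro continuous_intros ce)
  then show ?th7 by (rule continuous_on_eq) (rule v(6)[symmetric])
  have "continuous_on ?Y (\<lambda>y. contraction (kform X (?x y)) (2 * n) (e y)
      (\<lambda>vs. symp F (phi \<tau> (?x y)) (map (ldiff \<tau> (?x y)) vs) - ip K (?R y vs) (?m y)))"
    unfolding contraction_def list.map by (intro continuous_intros cip ce cm)
  then show ?th8 by (rule continuous_on_eq) (rule v(7)[symmetric])
qed

end

lemma chart_continuousI:
  assumes "\<And>U \<tau> d. local_triv K X E U \<tau> \<Longrightarrow> d \<in> atlas X \<Longrightarrow> continuous_on (snd d ` (U \<inter> fst d)) (\<lambda>y. s (cinv d y) :: real)"
  shows "chart_continuous X s"
  unfolding chart_continuous_def
proof (intro ballI continuous_on_local)
  fix d y assume d: "d \<in> atlas X" and y: "y \<in> snd d ` fst d"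
  have q: "cinv d y \<in> fst d" "snd d (cinv d y) = y" using y chart_inj[OF cX d] by auto
  then obtain U \<tau> where U: "cinv d y \<in> U" "local_triv K X E U \<tau>" using triv_exists chart_sub[OF cX d] by blast
  have "y \<in> snd d ` (U \<inter> fst d)" using q U(1) by (metis IntI imageI)
  then show "\<exists>V. open V \<and> y \<in> V \<and> continuous_on V (\<lambda>y. s (cinv d y))"
    using assms[OF U(2) d] Y_open[OF U(2) d] by blast
qed

lemma base_continuous:
  "chart_continuous X (curvsq (\<lambda>u. u))" "chart_continuous X (curvsq (cstr X))"
  "chart_continuous X (\<lambda>x. ip K (LF x) (LF x))" "chart_continuous X (\<lambda>x. ip K (LF x) c0)"
  "chart_continuous X (\<lambda>x. ip K (LF x) (mo x))" "chart_continuous X (\<lambda>x. ip K (mo x - c0) (mo x - c0))"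
  "chart_continuous X covsq" "chart_continuous X (\<lambda>x. contraction (kform X x) (2 * n) (ob x) (CW x))"
  by (rule chart_continuousI, erule (1) local_continuity)+

text \<open>All terms are combinations of the integrals of the eight functions \<open>?b1\<close> to
  \<open>?b8\<close>. \<open>?b4\<close> cancels between the expanded square and the (0,1)-term,
  \<open>?b6\<close> between that square and the pairing with \<open>c0\<close>, \<open>?b7\<close>
  between the (0,1)-term and the Chern-Weil integral; \<open>?b5\<close> and \<open>?b8\<close> are
  absorbed by the wedge square. What is left are \<open>?b1\<close>, \<open>?b2\<close> and
  \<open>?b3\<close>.\<close>

lemma YMH_identity:
  "YMH K c0 F X E A \<Phi> =
      L2sq X (\<lambda>_. ip K) 0 (\<lambda>x vs. Lambda X (ip K) 0 x (curvature X E A x) vs + mom_section F E \<Phi> x - c0)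
    + 2 * L2sq X (\<lambda>x. vert_metric K F X E (\<Phi> x)) 1 (dbar K F X E A \<Phi>)
    + 4 * L2sq X (\<lambda>_. cplx_inner (ip K)) 2 (\<lambda>x. part02 (cstr X) (curvature X E A x))
    + 2 * fun_integral X (\<lambda>x. ip K (Lambda X (ip K) 0 x (curvature X E A x) []) c0)
    - top_integral X (\<lambda>x. wedge (*) 4 (nat (2 * (int n - 2)))
        (wedge (ip K) 2 2 (curvature X E A x) (curvature X E A x)) (kpow X (int n - 2) x))
    + 2 * top_integral X (\<lambda>x. wedge (*) 2 (nat (2 * (int n - 1)))
        (pullback X AB \<Phi> (chern_weil_form K F X E A) x) (kpow X (int n - 1) x))"
proof -
  note fI = fun_integral_add[OF kaehler cpt] fun_integral_scale[OF kaehler cpt]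
  note cong = fun_integral_cong[OF kaehler cpt] and top = top_integral_eq_fun_integral[OF kaehler cpt]
  let ?I = "fun_integral X"
  let ?b1 = "curvsq (\<lambda>u. u)" and ?b2 = covsq and ?b3 = "\<lambda>x. ip K (mo x - c0) (mo x - c0)"
    and ?b4 = "\<lambda>x. ip K (LF x) (mo x)" and ?b5 = "\<lambda>x. ip K (LF x) (LF x)" and ?b6 = "\<lambda>x. ip K (LF x) c0"
    and ?b7 = "\<lambda>x. contraction (kform X x) (2 * n) (ob x) (CW x)" and ?b8 = "curvsq (cstr X)"
  have L1: "L2sq X (\<lambda>_. ip K) 2 (curvature X E A) = ?I ?b1" unfolding L2sq_def by (rule cong[OF curvature_norm])
  have L2: "L2sq X (\<lambda>x. vert_metric K F X E (\<Phi> x)) 1 (cov_d K F X E A \<Phi>) = ?I ?b2" unfolding L2sq_def ..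
  have L3: "L2sq X (\<lambda>_. ip K) 0 (\<lambda>x _. c0 - mom_section F E \<Phi> x) = ?I ?b3"
    unfolding L2sq_def by (rule cong) (simp add: form_inner_0 bilinear_lsub[OF ip_bil] bilinear_rsub[OF ip_bil])
  have cs: "chart_continuous X (\<lambda>x. a * f x)" if "chart_continuous X f" for a f
    by (rule chart_continuous_intros(3)[OF chart_continuous_intros(4)[OF that that] that])
  have lin: "?I (\<lambda>x. a * f x + g x) = a * ?I f + ?I g" if "chart_continuous X f" "chart_continuous X g" for a f g
    unfolding fI(1)[OF cs[OF that(1)] that(2)] fI(2) ..
  note ca = chart_continuous_intros(1)[OF cs]
  note b = base_continuous
  have R1: "L2sq X (\<lambda>_. ip K) 0 (\<lambda>x vs. Lambda X (ip K) 0 x (FA x) vs + mo x - c0) = ?I ?b5 + (2 * ?I ?b4 + ((- 2) * ?I ?b6 + ?I ?b3))"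
  proof -
    have "L2sq X (\<lambda>_. ip K) 0 (\<lambda>x vs. Lambda X (ip K) 0 x (FA x) vs + mo x - c0) =
        ?I (\<lambda>x. 1 * ?b5 x + (2 * ?b4 x + ((- 2) * ?b6 x + ?b3 x)))"
      unfolding L2sq_def by (rule cong) (simp add: Lambda_norm)
    also have "\<dots> = 1 * ?I ?b5 + (2 * ?I ?b4 + ((- 2) * ?I ?b6 + ?I ?b3))"
      unfolding lin[OF b(3) ca[OF b(5) ca[OF b(4) b(6)]]] lin[OF b(5) ca[OF b(4) b(6)]] lin[OF b(4) b(6)] ..
    finally show ?thesis by simp
  qed
  have R2: "L2sq X (\<lambda>x. vert_metric K F X E (\<Phi> x)) 1 (dbar K F X E A \<Phi>) = (1 / 2) * ?I ?b2 + ((- 1) * ?I ?b7 + (- 1) * ?I ?b4)"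
  proof -
    have "L2sq X (\<lambda>x. vert_metric K F X E (\<Phi> x)) 1 (dbar K F X E A \<Phi>) = ?I (\<lambda>x. (1 / 2) * ?b2 x + ((- 1) * ?b7 x + (- 1) * ?b4 x))"
      unfolding L2sq_def
    proof (rule cong)
      fix x assume x: "x \<in> pts X"
      have "p = (1 / 2) * u + ((- 1) * v + (- 1) * w)" if "2 * p = u - 2 * (v + w)" for p u v w :: real using that by simp
      from this[OF dbar_norm_section[OF x]]
      show "form_inner X x (vert_metric K F X E (\<Phi> x)) 1 (dbar K F X E A \<Phi> x) (dbar K F X E A \<Phi> x) =
        (1 / 2) * ?b2 x + ((- 1) * ?b7 x + (- 1) * ?b4 x)" .
    qed
    also have "\<dots> = (1 / 2) * ?I ?b2 + ((- 1) * ?I ?b7 + (- 1) * ?I ?b4)"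
      unfolding lin[OF b(7) ca[OF b(8) cs[OF b(5)]]] lin[OF b(8) cs[OF b(5)]] fI(2) ..
    finally show ?thesis .
  qed
  have R3: "L2sq X (\<lambda>_. cplx_inner (ip K)) 2 (\<lambda>x. part02 (cstr X) (FA x)) = (1 / 4) * ?I ?b1 + (- 1 / 4) * ?I ?b8"
  proof -
    have "L2sq X (\<lambda>_. cplx_inner (ip K)) 2 (\<lambda>x. part02 (cstr X) (FA x)) = ?I (\<lambda>x. (1 / 4) * ?b1 x + (- 1 / 4) * ?b8 x)"
      unfolding L2sq_def by (rule cong) (use curvature02_norm in fastforce)
    also have "\<dots> = (1 / 4) * ?I ?b1 + (- 1 / 4) * ?I ?b8" unfolding lin[OF b(1) cs[OF b(2)]] fI(2) ..
    finally show ?thesis .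
  qed
  have R4: "?I (\<lambda>x. ip K (Lambda X (ip K) 0 x (FA x) []) c0) = ?I ?b6"
    by (rule cong) (simp add: Lambda_contraction curvature_alt)
  have R5: "top_integral X (\<lambda>x. wedge (*) 4 (nat (2 * (int n - 2))) (wedge (ip K) 2 2 (FA x) (FA x)) (kpow X (int n - 2) x)) = ?I ?b5 + (- 1) * ?I ?b8"
  proof -
    have "top_integral X (\<lambda>x. wedge (*) 4 (nat (2 * (int n - 2))) (wedge (ip K) 2 2 (FA x) (FA x)) (kpow X (int n - 2) x)) = ?I (\<lambda>x. 1 * ?b5 x + (- 1) * ?b8 x)"
    proof (rule top)
      fix x vs assume x: "x \<in> pts X"
      show "wedge (*) 4 (nat (2 * (int n - 2))) (wedge (ip K) 2 2 (FA x) (FA x)) (kpow X (int n - 2) x) vs = (1 * ?b5 x + (- 1) * ?b8 x) * kpow X (int n) x vs"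
        unfolding curvature_square_wedge[OF x] by simp
    qed
    also have "\<dots> = 1 * ?I ?b5 + (- 1) * ?I ?b8" unfolding lin[OF b(3) cs[OF b(2)]] fI(2) ..
    finally show ?thesis by simp
  qed
  have R6: "top_integral X (\<lambda>x. wedge (*) 2 (nat (2 * (int n - 1))) (CW x) (kpow X (int n - 1) x)) = ?I ?b7"
    by (rule top) (rule chern_weil_wedge)
  show ?thesis unfolding YMH_def L1 L2 L3 R1 R2 R3 R4 R5 R6 by (simp add: algebra_simps)
qed

end

theorem lemma1p2p16:
  fixes K :: "('k, 'l::real_normed_vector) lie"
    and c :: 'l
    and F :: "('k, 'l, 'f, 'w::real_normed_vector) hspace"
    and X :: "('x, 'v::{real_normed_vector, second_countable_topology}) kaehler"
    and E :: "('k, 'x, 'e, 'b::real_normed_vector) pbundle"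
    and A :: "'e \<Rightarrow> 'b list \<Rightarrow> 'l"
    and \<Phi> :: "'x \<Rightarrow> ('e \<times> 'f) set"
    and n :: nat
  assumes "lie_group K" "compact_space (mtop K)" "connected_space (mtop K)"
    and "Ad_invariant_inner K" "central K c"
    and "hamiltonian_space K F"
    and "kaehler_manifold n X" "compact_space (mtop X)" "connected_space (mtop X)"
    and "principal_bundle K X E"
    and "smooth_section K F X E \<Phi>" "connection K E A"
  shows "YMH K c F X E A \<Phi> =
      L2sq X (\<lambda>_. ip K) 0
        (\<lambda>x vs. Lambda X (ip K) 0 x (curvature X E A x) vs + mom_section F E \<Phi> x - c)
    + 2 * L2sq X (\<lambda>x. vert_metric K F X E (\<Phi> x)) 1 (dbar K F X E A \<Phi>)
    + 4 * L2sq X (\<lambda>_. cplx_inner (ip K)) 2 (\<lambda>x. part02 (cstr X) (curvature X E A x))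
    + 2 * fun_integral X (\<lambda>x. ip K (Lambda X (ip K) 0 x (curvature X E A x) []) c)
    - top_integral X (\<lambda>x. wedge (*) 4 (nat (2 * (int n - 2)))
        (wedge (ip K) 2 2 (curvature X E A x) (curvature X E A x)) (kpow X (int n - 2) x))
    + 2 * top_integral X (\<lambda>x. wedge (*) 2 (nat (2 * (int n - 1)))
        (pullback X (assoc K F X E) \<Phi> (chern_weil_form K F X E A) x) (kpow X (int n - 1) x))"
proof -
  interpret G: kaehler_gauge K X E A F \<Phi> n c
    using assms by unfold_locales (auto simp: hamiltonian_space_def kaehler_manifold_def complex_manifold_def)
  show ?thesis by (rule G.YMH_identity)
qed

end
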